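(* Let $d\ge1$ and let $F_n=(F_{n,1},\dots,F_{n,d})\in(\mathbb D^{3,\infty})^d$, $n\in\mathbb N$, be a sequence of Wiener functionals such that $$\text{i)}\ \ \sup_n\|F_n\|_{3,p}<\infty\quad\forall p\ge1,\qquad\text{ii)}\ \ \limsup_{\varepsilon\to0}\ \limsup_{n\to\infty}\ \mathbb P(\det\sigma_{F_n}<\varepsilon)=0 .$$ Suppose also that $F$ is a random vector in $\mathbb R^d$ with $\lim_nF_n=F$ in distribution and $\lim_n\mathbb E(F_n)=\mathbb E(F)$. Then $$\lim_nd_{TV}(F,F_n)=0 .$$ In particular, if the laws of $F$ and $F_n$ are absolutely continuous with densities $p_F$ and $p_{F_n}$, then $\lim_n\int_{\mathbb R^d}|p_F(x)-p_{F_n}(x)|\,dx=0$.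
   Context: $d_{TV}(F,G)=\sup\{|\mathbb E(f(F))-\mathbb E(f(G))|:\|f\|_\infty\le1\}$. $W=(W^1,\dots,W^N)$ is a Brownian motion on $[0,1]$ on a probability space; $\mathbb D^{m,p}$ is the usual Malliavin–Sobolev space of functionals of $W$, $\mathbb D^{m,\infty}=\bigcap_{p\ge1}\mathbb D^{m,p}$, with norm $\|F\|_{m,p}^p=\mathbb E(|F|_m^p)$, $|F|_m^2=|F|^2+\sum_{k=1}^m|D^{(k)}F|^2$, $|D^{(k)}F|^2=\sum_{\alpha\in\{1,\dots,N\}^k}\int_{[0,1)^k}|D^\alpha_{s_1,\dots,s_k}F|^2ds_1\cdots ds_k$ (summed over components for vectors). The Malliavin covariance matrix is $\sigma_F^{i,j}=\sum_{k=1}^N\int_0^1D^k_sF^i\,D^k_sF^j\,ds$. *)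

theory Defs
  imports "HOL-Probability.Probability"
begin

section \<open>Brownian motion on the unit interval\<close>

text \<open>
  The number of components of the Brownian motion and the dimension of the random vectors are
  arbitrary and are represented by finite index types \<open>'N\<close> and \<open>'d\<close>.  The third condition below
  asks the increments to be jointly independent over both the components and the time intervals,
  i.e. the components are independent Brownian motions.
\<close>

definition brownian_motion :: "'w measure \<Rightarrow> ('N::finite \<Rightarrow> real \<Rightarrow> 'w \<Rightarrow> real) \<Rightarrow> bool" where
  "brownian_motion M W \<longleftrightarrow>
     prob_space M \<and>
     (\<forall>i. \<forall>t\<in>{0..1}. W i t \<in> borel_measurable M) \<and>
     (\<forall>n. \<forall>t :: nat \<Rightarrow> real. strict_mono_on {..n} t \<and> t ` {..n} \<subseteq> {0..1} \<longrightarrow>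
        prob_space.indep_vars M (\<lambda>_. borel) (\<lambda>(i, j) \<omega>. W i (t (Suc j)) \<omega> - W i (t j) \<omega>)
          ((UNIV :: 'N set) \<times> {..<n})) \<and>
     (\<forall>i s t. 0 \<le> s \<and> s < t \<and> t \<le> 1 \<longrightarrow>
        distributed M lborel (\<lambda>\<omega>. W i t \<omega> - W i s \<omega>)
          (\<lambda>x. ennreal (normal_density 0 (sqrt (t - s)) x))) \<and>
     (\<forall>i. AE \<omega> in M. W i 0 \<omega> = 0) \<and>
     (\<forall>i. AE \<omega> in M. continuous_on {0..1} (\<lambda>t. W i t \<omega>))"


section \<open>Smooth cylindrical functionals\<close>

text \<open>
  The functionals are \<open>\<phi>(W\<^sub>t\<^sub>1, \<dots>, W\<^sub>t\<^sub>n)\<close>.  As \<open>n\<close> varies, \<open>\<phi>\<close> is taken as a function of families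
  \<open>x (j, i)\<close> (\<open>j\<close> the number of the time point, \<open>i\<close> the component of \<open>W\<close>) that only depends on the
  entries with \<open>j < n\<close>.  For such a function continuity in the product topology is continuity on
  the finite-dimensional space, and being smooth means that all iterated partial derivatives
  exist and are continuous.
\<close>

definition partial :: "'c \<Rightarrow> (('c \<Rightarrow> real) \<Rightarrow> real) \<Rightarrow> ('c \<Rightarrow> real) \<Rightarrow> real" where
  "partial c \<phi> x = deriv (\<lambda>t. \<phi> (x(c := t))) (x c)"

fun iter_partial :: "'c list \<Rightarrow> (('c \<Rightarrow> real) \<Rightarrow> real) \<Rightarrow> ('c \<Rightarrow> real) \<Rightarrow> real" where
  "iter_partial [] \<phi> = \<phi>"
| "iter_partial (c # cs) \<phi> = partial c (iter_partial cs \<phi>)"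

text \<open>The class \<open>C\<^sub>p\<^sup>\<infinity>\<close>: smooth, with all derivatives of polynomial growth.\<close>

definition smooth_poly_growth :: "nat \<Rightarrow> ((nat \<times> 'N::finite \<Rightarrow> real) \<Rightarrow> real) \<Rightarrow> bool" where
  "smooth_poly_growth n \<phi> \<longleftrightarrow>
     (\<forall>x y. (\<forall>j<n. \<forall>i. x (j, i) = y (j, i)) \<longrightarrow> \<phi> x = \<phi> y) \<and>
     (\<forall>cs. continuous_on UNIV (iter_partial cs \<phi>) \<and>
        (\<forall>c x. (\<lambda>t. iter_partial cs \<phi> (x(c := t))) differentiable at (x c)) \<and>
        (\<exists>C q. \<forall>x. \<bar>iter_partial cs \<phi> x\<bar> \<le> C * (1 + (\<Sum>j<n. \<Sum>i\<in>UNIV. \<bar>x (j, i)\<bar>)) ^ q))"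

definition cyl_point :: "('N \<Rightarrow> real \<Rightarrow> 'w \<Rightarrow> real) \<Rightarrow> real list \<Rightarrow> 'w \<Rightarrow> nat \<times> 'N \<Rightarrow> real" where
  "cyl_point W ts \<omega> = (\<lambda>(j, i). W i (ts ! j) \<omega>)"

definition cyl_val ::
  "('N \<Rightarrow> real \<Rightarrow> 'w \<Rightarrow> real) \<Rightarrow> real list \<Rightarrow> ((nat \<times> 'N \<Rightarrow> real) \<Rightarrow> real) \<Rightarrow> 'w \<Rightarrow> real" where
  "cyl_val W ts \<phi> \<omega> = \<phi> (cyl_point W ts \<omega>)"

text \<open>
  A \<open>k\<close>-th order derivative \<open>D\<^sup>\<alpha>\<^bsub>s\<^sub>1,\<dots>,s\<^sub>k\<^esub>F(\<omega>)\<close> is written \<open>U k \<alpha> s \<omega>\<close>, where \<open>\<alpha>\<close> and \<open>s\<close> are functions on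
  \<open>{..<k}\<close>.  Iterating \<open>D\<^sup>i\<^sub>s \<phi>(W\<^sub>t\<^sub>1, \<dots>, W\<^sub>t\<^sub>n) = (\<Sum>j. \<partial>\<^bsub>(j,i)\<^esub>\<phi>(W\<^sub>t\<^sub>1, \<dots>, W\<^sub>t\<^sub>n) 1\<^bsub>s < t\<^sub>j\<^esub>)\<close> gives the following sum.
\<close>

type_synonym ('N, 'w) jet = "nat \<Rightarrow> (nat \<Rightarrow> 'N) \<Rightarrow> (nat \<Rightarrow> real) \<Rightarrow> 'w \<Rightarrow> real"

definition cyl_deriv ::
  "('N \<Rightarrow> real \<Rightarrow> 'w \<Rightarrow> real) \<Rightarrow> real list \<Rightarrow> ((nat \<times> 'N \<Rightarrow> real) \<Rightarrow> real) \<Rightarrow> ('N, 'w) jet" where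
  "cyl_deriv W ts \<phi> k \<alpha> s \<omega> =
     (\<Sum>J\<in>{..<k} \<rightarrow>\<^sub>E {..<length ts}.
        iter_partial (map (\<lambda>l. (J l, \<alpha> l)) [0..<k]) \<phi> (cyl_point W ts \<omega>) *
        (\<Prod>l<k. indicator {0..<ts ! J l} (s l)))"


section \<open>Malliavin--Sobolev norms and spaces\<close>

text \<open>Power of an extended nonnegative number, for a positive exponent.\<close>

definition epowr :: "ennreal \<Rightarrow> real \<Rightarrow> ennreal" where
  "epowr x p = (if x = \<infinity> then \<infinity> else ennreal (enn2real x powr p))"

text \<open>Lebesgue measure on \<open>[0,1)\<^sup>k\<close>.\<close>

definition unit_cube :: "nat \<Rightarrow> (nat \<Rightarrow> real) measure" where
  "unit_cube k = Pi\<^sub>M {..<k} (\<lambda>_. restrict_space lborel {0..<1})"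

definition deriv_sq ::
  "nat \<Rightarrow> ((nat \<Rightarrow> 'N::finite) \<Rightarrow> (nat \<Rightarrow> real) \<Rightarrow> 'w \<Rightarrow> real) \<Rightarrow> 'w \<Rightarrow> ennreal" where
  "deriv_sq k V \<omega> =
     (\<Sum>\<alpha>\<in>{..<k} \<rightarrow>\<^sub>E (UNIV :: 'N set). \<integral>\<^sup>+ s. ennreal ((V \<alpha> s \<omega>)\<^sup>2) \<partial>unit_cube k)"

text \<open>\<open>|F|\<^sub>m\<^sup>2\<close>, where the derivatives of \<open>F\<close> are given by \<open>U\<close>.\<close>

definition jet_sq :: "nat \<Rightarrow> ('w \<Rightarrow> real) \<Rightarrow> ('N::finite, 'w) jet \<Rightarrow> 'w \<Rightarrow> ennreal" where
  "jet_sq m F U \<omega> = ennreal ((F \<omega>)\<^sup>2) + (\<Sum>k=1..m. deriv_sq k (U k) \<omega>)"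

text \<open>\<open>(E (h\<^bsup>p/2\<^esup>))\<^bsup>1/p\<^esup>\<close>, to be used with \<open>h = |F|\<^sub>m\<^sup>2\<close>.\<close>

definition Lp_norm_of_sq :: "'w measure \<Rightarrow> real \<Rightarrow> ('w \<Rightarrow> ennreal) \<Rightarrow> ennreal" where
  "Lp_norm_of_sq M p h = epowr (\<integral>\<^sup>+ \<omega>. epowr (h \<omega>) (p / 2) \<partial>M) (1 / p)"

text \<open>
  The space \<open>\<D>\<^bsup>m,p\<^esup>\<close> is the completion of the cylindrical functionals in the norm \<open>\<parallel>\<sqdot>\<parallel>\<^bsub>m,p\<^esub>\<close>:
  \<open>in_closure M W m p F U\<close> says that \<open>F\<close> and its derivatives \<open>U\<close> up to order \<open>m\<close> are the limit
  of cylindrical functionals and their derivatives.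
\<close>

definition in_closure ::
  "'w measure \<Rightarrow> ('N::finite \<Rightarrow> real \<Rightarrow> 'w \<Rightarrow> real) \<Rightarrow> nat \<Rightarrow> real \<Rightarrow> ('w \<Rightarrow> real) \<Rightarrow> ('N, 'w) jet \<Rightarrow> bool"
  where
  "in_closure M W m p F U \<longleftrightarrow>
     F \<in> borel_measurable M \<and>
     (\<forall>k\<in>{1..m}. \<forall>\<alpha>\<in>{..<k} \<rightarrow>\<^sub>E UNIV.
        (\<lambda>(s, \<omega>). U k \<alpha> s \<omega>) \<in> borel_measurable (unit_cube k \<Otimes>\<^sub>M M)) \<and>
     (\<exists>ts \<phi>. (\<forall>n. set (ts n) \<subseteq> {0..1} \<and> smooth_poly_growth (length (ts n)) (\<phi> n)) \<and>
        (\<lambda>n. Lp_norm_of_sq M p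
               (jet_sq m (\<lambda>\<omega>. F \<omega> - cyl_val W (ts n) (\<phi> n) \<omega>)
                         (\<lambda>k \<alpha> s \<omega>. U k \<alpha> s \<omega> - cyl_deriv W (ts n) (\<phi> n) k \<alpha> s \<omega>)))
          \<longlonglongrightarrow> 0)"

definition malliavin_sobolev ::
  "'w measure \<Rightarrow> ('N::finite \<Rightarrow> real \<Rightarrow> 'w \<Rightarrow> real) \<Rightarrow> nat \<Rightarrow> real \<Rightarrow> ('w \<Rightarrow> real) set" where
  "malliavin_sobolev M W m p = {F. \<exists>U. in_closure M W m p F U}"

definition malliavin_sobolev_inf ::
  "'w measure \<Rightarrow> ('N::finite \<Rightarrow> real \<Rightarrow> 'w \<Rightarrow> real) \<Rightarrow> nat \<Rightarrow> ('w \<Rightarrow> real) set" where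
  "malliavin_sobolev_inf M W m = (\<Inter>p\<in>{1..}. malliavin_sobolev M W m p)"

text \<open>
  The operator \<open>D\<^bsup>(k)\<^esup>\<close>, as closure of its restriction to cylindrical functionals.  Since that
  restriction is closable, a jointly measurable version is determined up to null sets; since
  \<open>\<D>\<^bsup>m,p\<^esup> \<subseteq> \<D>\<^bsup>k,1\<^esup>\<close> for \<open>k \<le> m\<close> and \<open>p \<ge> 1\<close>, the closure in \<open>\<D>\<^bsup>k,1\<^esup>\<close> serves for all \<open>m\<close> and \<open>p\<close>.
\<close>

definition malliavin_deriv ::
  "'w measure \<Rightarrow> ('N::finite \<Rightarrow> real \<Rightarrow> 'w \<Rightarrow> real) \<Rightarrow> ('w \<Rightarrow> real) \<Rightarrow> ('N, 'w) jet" where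
  "malliavin_deriv M W F k = (SOME U. in_closure M W k 1 F U) k"

text \<open>\<open>\<parallel>F\<parallel>\<^bsub>m,p\<^esub>\<close> for a random vector \<open>F\<close>.\<close>

definition sobolev_norm ::
  "'w measure \<Rightarrow> ('N::finite \<Rightarrow> real \<Rightarrow> 'w \<Rightarrow> real) \<Rightarrow> nat \<Rightarrow> real \<Rightarrow> ('w \<Rightarrow> real ^ 'd) \<Rightarrow> ennreal" where
  "sobolev_norm M W m p F =
     Lp_norm_of_sq M p
       (\<lambda>\<omega>. \<Sum>i\<in>UNIV. jet_sq m (\<lambda>\<omega>. F \<omega> $ i) (malliavin_deriv M W (\<lambda>\<omega>. F \<omega> $ i)) \<omega>)"

definition malliavin_deriv1 ::
  "'w measure \<Rightarrow> ('N::finite \<Rightarrow> real \<Rightarrow> 'w \<Rightarrow> real) \<Rightarrow> ('w \<Rightarrow> real) \<Rightarrow> 'N \<Rightarrow> real \<Rightarrow> 'w \<Rightarrow> real" where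
  "malliavin_deriv1 M W F k s = malliavin_deriv M W F 1 (\<lambda>_\<in>{..<1}. k) (\<lambda>_\<in>{..<1}. s)"

definition malliavin_cov ::
  "'w measure \<Rightarrow> ('N::finite \<Rightarrow> real \<Rightarrow> 'w \<Rightarrow> real) \<Rightarrow> ('w \<Rightarrow> real ^ 'd) \<Rightarrow> 'w \<Rightarrow> real ^ 'd ^ 'd" where
  "malliavin_cov M W F \<omega> =
     (\<chi> i j. \<Sum>k\<in>UNIV. LINT s|restrict_space lborel {0..<1}.
        malliavin_deriv1 M W (\<lambda>\<omega>. F \<omega> $ i) k s \<omega> * malliavin_deriv1 M W (\<lambda>\<omega>. F \<omega> $ j) k s \<omega>)"


section \<open>Laws of random vectors\<close>

text \<open>The two random variables may live on different probability spaces.\<close>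

definition tv_dist ::
  "'v measure \<Rightarrow> ('v \<Rightarrow> 'a::topological_space) \<Rightarrow> 'w measure \<Rightarrow> ('w \<Rightarrow> 'a) \<Rightarrow> real" where
  "tv_dist M F M' G =
     (SUP f\<in>{f. f \<in> borel_measurable borel \<and> (\<forall>x. \<bar>f x\<bar> \<le> 1)}.
        \<bar>(LINT \<omega>|M. (f (F \<omega>) :: real)) - (LINT \<omega>|M'. f (G \<omega>))\<bar>)"

definition tendsto_in_distribution ::
  "'w measure \<Rightarrow> (nat \<Rightarrow> 'w \<Rightarrow> 'a::topological_space) \<Rightarrow> 'v measure \<Rightarrow> ('v \<Rightarrow> 'a) \<Rightarrow> bool" where
  "tendsto_in_distribution M Fs M' F \<longleftrightarrow>
     (\<forall>f :: 'a \<Rightarrow> real. continuous_on UNIV f \<and> bounded (range f) \<longrightarrow>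
        (\<lambda>n. LINT \<omega>|M. f (Fs n \<omega>)) \<longlonglongrightarrow> (LINT \<omega>|M'. f (F \<omega>)))"

definition has_density :: "'w measure \<Rightarrow> ('w \<Rightarrow> 'a::euclidean_space) \<Rightarrow> ('a \<Rightarrow> real) \<Rightarrow> bool" where
  "has_density M F f \<longleftrightarrow>
     f \<in> borel_measurable borel \<and> (\<forall>x. 0 \<le> f x) \<and> distributed M lborel F (\<lambda>x. ennreal (f x))"

end

theory Submission
  imports Defs
begin

text \<open>
  The total variation distance is controlled by the smoothness of the laws of the \<open>F\<^sub>n\<close>: if for every
  \<open>\<eta> > 0\<close> there is \<open>C\<close> with \<open>\<bar>E(f(F\<^sub>n + h) - f(F\<^sub>n))\<bar> \<le> \<eta> + C \<bar>h\<bar>\<close> for large \<open>n\<close> and all smooth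
  \<open>0 \<le> f \<le> 1\<close>, then mollifying the laws with a kernel of small support costs at most about \<open>\<eta>\<close>, and the mollified
  densities converge pointwise, hence in \<open>L\<^sup>1\<close> by Scheffe's lemma.

  The smoothness estimate is Malliavin's integration by parts, localised by a cut-off \<open>m(\<sigma>)\<close> of the
  covariance matrix to \<open>{det \<sigma> \<ge> \<epsilon>, \<bar>\<sigma>\<bar> \<le> K}\<close>.  With \<open>T(\<sigma>) = m(\<sigma>) \<sigma>\<^sup>-\<^sup>1\<close> it reads
  \<open>E(m(\<sigma>) \<nabla>f(F) \<bullet> h) = E(f(F) \<delta>(h \<bullet> T(\<sigma>) DF))\<close>, and as \<open>f\<close> is bounded, first and second
  derivatives in \<open>L\<^sup>2\<close> suffice for the right-hand side.  Non-degeneracy makes \<open>E(1 - m(\<sigma>))\<close> small.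

  For a cylindrical functional everything is a statement about a finite family of independent Gaussian
  increments.  The passage to the limit needs closability: the \<open>L\<^sup>2\<close> limits of the derivatives of
  approximating cylindrical functionals are the derivatives defined as a closure in \<open>\<D>\<^bsup>k,1\<^esup>\<close>.
\<close>

section \<open>Smooth functions of polynomial growth\<close>

text \<open>Three obstacles shape the proof. Each approximant comes with its own grid of increments,
  so no constant may depend on the number of slots; every bound is therefore in terms of the Hilbert
  norms \<open>Dsq\<close>, and the divergence is controlled by the exact identity
  \<open>dvg_square\<close>. Differentiating the inverse covariance produces a term of size |DF|^2
  |D^2 F|, for which second moments are not enough; since |DF|^2 is at most of the size of the
  covariance itself, the cut-off absorbs that factor. Finally \<open>malliavin_deriv\<close> is
  chosen order by order among limits in L^1, so it must be shown that two such limits agree. For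
  this the difference of two approximating sequences is taken at two indices: at a late one it is a
  small functional \<theta>, at a fixed one it is a functional \<xi> with finite second derivatives,
  and D\<theta> is close to D\<xi> because both sequences of derivatives converge. The usual duality
  argument with fixed test functionals becomes an inequality in which the normalised D\<xi> is
  itself the test field.\<close>

definition tempered :: "'c set \<Rightarrow> (('c \<Rightarrow> real) \<Rightarrow> real) \<Rightarrow> bool" where
  "tempered C g \<longleftrightarrow> continuous_on UNIV g \<and> (\<exists>K q. \<forall>x. \<bar>g x\<bar> \<le> K * (1 + (\<Sum>c\<in>C. \<bar>x c\<bar>)) ^ q)"

lemma temperedI: "continuous_on UNIV g \<Longrightarrow> (\<And>x. \<bar>g x\<bar> \<le> K * (1 + (\<Sum>c\<in>C. \<bar>x c\<bar>)) ^ q) \<Longrightarrow> tempered C g"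
  unfolding tempered_def by blast

lemma tempered_cont: "tempered C g \<Longrightarrow> continuous_on UNIV g"
  unfolding tempered_def by blast

lemma temperedE:
  assumes "tempered C g"
  obtains K q where "0 \<le> K" "\<And>x. \<bar>g x\<bar> \<le> K * (1 + (\<Sum>c\<in>C. \<bar>x c\<bar>)) ^ q"
proof -
  obtain K q where K: "\<And>x. \<bar>g x\<bar> \<le> K * (1 + (\<Sum>c\<in>C. \<bar>x c\<bar>)) ^ q"
    using assms unfolding tempered_def by blast
  have "0 \<le> K" using order_trans[OF abs_ge_zero K[of "\<lambda>_. 0"]] by simp
  then show ?thesis using K that by blast
qed

lemma tempered_bounded:
  assumes "continuous_on UNIV g" "\<And>x. \<bar>g x\<bar> \<le> B" shows "tempered C g"
  using assms(2) by (intro temperedI[OF assms(1), of B _ 0]) auto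

lemma tempered_const [intro]: "tempered C (\<lambda>_. k)"
  by (rule tempered_bounded[where B="\<bar>k\<bar>"]) auto

lemma tempered_coord [intro]:
  assumes "finite C" "c \<in> C" shows "tempered C (\<lambda>x. x c)"
proof (rule temperedI[where K=1 and q=1])
  show "continuous_on UNIV (\<lambda>x::'a \<Rightarrow> real. x c)" by (rule continuous_on_product_coordinates)
  fix x :: "'a \<Rightarrow> real"
  have "\<bar>x c\<bar> \<le> (\<Sum>c\<in>C. \<bar>x c\<bar>)" using assms by (intro member_le_sum) auto
  then show "\<bar>x c\<bar> \<le> 1 * (1 + (\<Sum>c\<in>C. \<bar>x c\<bar>)) ^ 1" by simp
qed

lemma tempered_add [intro]:
  assumes "tempered C f" "tempered C g" shows "tempered C (\<lambda>x. f x + g x)"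
proof -
  obtain K q where 1: "0 \<le> K" "\<And>x. \<bar>f x\<bar> \<le> K * (1 + (\<Sum>c\<in>C. \<bar>x c\<bar>)) ^ q" using temperedE[OF assms(1)] by blast
  obtain L r where 2: "0 \<le> L" "\<And>x. \<bar>g x\<bar> \<le> L * (1 + (\<Sum>c\<in>C. \<bar>x c\<bar>)) ^ r" using temperedE[OF assms(2)] by blast
  show ?thesis
  proof (rule temperedI[where K="K+L" and q="max q r"])
    show "continuous_on UNIV (\<lambda>x. f x + g x)" using assms by (intro continuous_intros tempered_cont)
    fix x :: "'a \<Rightarrow> real"
    let ?s = "1 + (\<Sum>c\<in>C. \<bar>x c\<bar>)"
    have s: "1 \<le> ?s" by (simp add: sum_nonneg)
    have "\<bar>f x + g x\<bar> \<le> K * ?s ^ q + L * ?s ^ r" using 1(2)[of x] 2(2)[of x] by linarith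
    also have "\<dots> \<le> K * ?s ^ max q r + L * ?s ^ max q r"
      using s 1(1) 2(1) by (intro add_mono mult_left_mono power_increasing) auto
    finally show "\<bar>f x + g x\<bar> \<le> (K + L) * ?s ^ max q r" by (simp add: algebra_simps)
  qed
qed

lemma tempered_mult [intro]:
  assumes "tempered C f" "tempered C g" shows "tempered C (\<lambda>x. f x * g x)"
proof -
  obtain K q where 1: "0 \<le> K" "\<And>x. \<bar>f x\<bar> \<le> K * (1 + (\<Sum>c\<in>C. \<bar>x c\<bar>)) ^ q" using temperedE[OF assms(1)] by blast
  obtain L r where 2: "0 \<le> L" "\<And>x. \<bar>g x\<bar> \<le> L * (1 + (\<Sum>c\<in>C. \<bar>x c\<bar>)) ^ r" using temperedE[OF assms(2)] by blast
  show ?thesis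
  proof (rule temperedI[where K="K*L" and q="q+r"])
    show "continuous_on UNIV (\<lambda>x. f x * g x)" using assms by (intro continuous_intros tempered_cont)
    fix x :: "'a \<Rightarrow> real"
    let ?s = "1 + (\<Sum>c\<in>C. \<bar>x c\<bar>)"
    have s: "1 \<le> ?s" by (simp add: sum_nonneg)
    have "\<bar>f x * g x\<bar> \<le> (K * ?s ^ q) * (L * ?s ^ r)"
      unfolding abs_mult using 1 2 s by (intro mult_mono) auto
    then show "\<bar>f x * g x\<bar> \<le> (K * L) * ?s ^ (q+r)" by (simp add: algebra_simps power_add)
  qed
qed

lemma tempered_uminus [intro]: "tempered C f \<Longrightarrow> tempered C (\<lambda>x. - f x)"
  using tempered_mult[OF tempered_const[of C "-1"]] by simp

lemma tempered_diff [intro]: "tempered C f \<Longrightarrow> tempered C g \<Longrightarrow> tempered C (\<lambda>x. f x - g x)"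
  using tempered_add[OF _ tempered_uminus] by simp

lemma tempered_sum [intro]: "(\<And>i. i \<in> I \<Longrightarrow> tempered C (f i)) \<Longrightarrow> tempered C (\<lambda>x. \<Sum>i\<in>I. f i x)"
  by (induction I rule: infinite_finite_induct) auto

lemma tempered_power [intro]: "tempered C f \<Longrightarrow> tempered C (\<lambda>x. f x ^ n)"
  by (induction n) auto

section \<open>Partial derivatives with growth bounds\<close>

lemma continuous_on_fun_upd:
  "continuous_on UNIV (\<lambda>t::real. (x :: 'c \<Rightarrow> real)(c := t))"
proof (rule continuous_on_coordinatewise_then_product)
  show "continuous_on UNIV (\<lambda>t. (x(c := t)) i)" for i by (cases "i = c") auto
qed

text \<open>A relation instead of the function \<open>partial\<close>, carrying the growth of both
  functions: the calculus rules then deliver a derivative together with its integrability. It also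
  covers the cut-offs, which are merely continuously differentiable.\<close>

definition pder :: "'c set \<Rightarrow> 'c \<Rightarrow> (('c \<Rightarrow> real) \<Rightarrow> real) \<Rightarrow> (('c \<Rightarrow> real) \<Rightarrow> real) \<Rightarrow> bool" where
  "pder C c g g' \<longleftrightarrow> tempered C g \<and> tempered C g' \<and>
     (\<forall>x. ((\<lambda>t. g (x(c := t))) has_real_derivative g' x) (at (x c)))"

lemma pderD:
  assumes "pder C c g g'"
  shows "tempered C g" "tempered C g'" "((\<lambda>t. g (x(c := t))) has_real_derivative g' x) (at (x c))"
    "((\<lambda>t. g (x(c := t))) has_real_derivative g' (x(c := s))) (at s)"
proof -
  have *: "\<And>x. ((\<lambda>t. g (x(c := t))) has_real_derivative g' x) (at (x c))"
    using assms unfolding pder_def by blast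
  show "tempered C g" "tempered C g'" "((\<lambda>t. g (x(c := t))) has_real_derivative g' x) (at (x c))"
    using assms unfolding pder_def by blast+
  show "((\<lambda>t. g (x(c := t))) has_real_derivative g' (x(c := s))) (at s)"
    using *[of "x(c := s)"] by simp
qed

lemma pder_const: "pder C c (\<lambda>_. k) (\<lambda>_. 0)"
  unfolding pder_def by auto

lemma pder_coord: "finite C \<Longrightarrow> d \<in> C \<Longrightarrow> pder C c (\<lambda>x. x d) (\<lambda>_. if c = d then 1 else 0)"
  unfolding pder_def by (auto intro!: derivative_eq_intros)

lemma pder_add: "pder C c f f' \<Longrightarrow> pder C c g g' \<Longrightarrow> pder C c (\<lambda>x. f x + g x) (\<lambda>x. f' x + g' x)"
  unfolding pder_def by (auto intro!: derivative_intros)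

lemma pder_mult:
  "pder C c f f' \<Longrightarrow> pder C c g g' \<Longrightarrow> pder C c (\<lambda>x. f x * g x) (\<lambda>x. f' x * g x + f x * g' x)"
  unfolding pder_def by (auto intro!: derivative_eq_intros)

lemma pder_cmult: "pder C c g g' \<Longrightarrow> pder C c (\<lambda>x. k * g x) (\<lambda>x. k * g' x)"
  using pder_mult[OF pder_const[of C c k]] by simp

lemma pder_diff: "pder C c f f' \<Longrightarrow> pder C c g g' \<Longrightarrow> pder C c (\<lambda>x. f x - g x) (\<lambda>x. f' x - g' x)"
  unfolding pder_def by (auto intro!: derivative_intros)

lemma pder_sum:
  "(\<And>i. i \<in> I \<Longrightarrow> pder C c (f i) (f' i)) \<Longrightarrow> pder C c (\<lambda>x. \<Sum>i\<in>I. f i x) (\<lambda>x. \<Sum>i\<in>I. f' i x)"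
  by (induction I rule: infinite_finite_induct) (auto intro: pder_const pder_add)

text \<open>The bounds on \<open>h\<close> and \<open>h'\<close> are asked on \<open>S\<close>,
  which contains the range of \<open>g\<close>; the case in mind is an inverse square root on the
  half line.\<close>

lemma pder_compose:
  assumes g: "pder C c g g'" and S: "\<And>x. g x \<in> S"
    and h: "\<And>y. y \<in> S \<Longrightarrow> (h has_real_derivative h' y) (at y)"
    and h': "continuous_on S h'" and B: "\<And>y. y \<in> S \<Longrightarrow> \<bar>h y\<bar> \<le> B" "\<And>y. y \<in> S \<Longrightarrow> \<bar>h' y\<bar> \<le> B'"
  shows "pder C c (\<lambda>x. h (g x)) (\<lambda>x. h' (g x) * g' x)"
  unfolding pder_def
proof (intro conjI allI)
  have hc: "continuous_on S h"
    using h by (meson DERIV_continuous continuous_at_imp_continuous_on)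
  show "tempered C (\<lambda>x. h (g x))"
    by (rule tempered_bounded[OF continuous_on_compose2[OF hc tempered_cont[OF pderD(1)[OF g]]]]) (use S B in auto)
  have "tempered C (\<lambda>x. h' (g x))"
    by (rule tempered_bounded[OF continuous_on_compose2[OF h' tempered_cont[OF pderD(1)[OF g]]]]) (use S B in auto)
  then show "tempered C (\<lambda>x. h' (g x) * g' x)" using pderD(2)[OF g] by auto
  fix x
  show "((\<lambda>t. h (g (x(c := t)))) has_real_derivative h' (g x) * g' x) (at (x c))"
    using DERIV_chain2[of h "h' (g x)" "\<lambda>t. g (x(c := t))" "x c"] h[OF S[of x]] pderD(3)[OF g, of x]
    by simp
qed

lemma pder_compose_gradient:
  fixes F F' :: "('c \<Rightarrow> real) \<Rightarrow> 'a::euclidean_space"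
  assumes F: "\<And>b. b \<in> Basis \<Longrightarrow> pder C c (\<lambda>x. F x \<bullet> b) (\<lambda>x. F' x \<bullet> b)"
    and f: "\<And>y. (f has_derivative (\<lambda>v. G y \<bullet> v)) (at y)"
    and G: "continuous_on UNIV G" and B: "\<And>y. \<bar>f y\<bar> \<le> B" "\<And>y. norm (G y) \<le> B'"
  shows "pder C c (\<lambda>x. f (F x)) (\<lambda>x. G (F x) \<bullet> F' x)"
  unfolding pder_def
proof (intro conjI allI)
  have Fc: "continuous_on UNIV F"
  proof -
    have "continuous_on UNIV (\<lambda>x. \<Sum>b\<in>Basis. (F x \<bullet> b) *\<^sub>R b)"
      by (intro continuous_on_sum continuous_on_scaleR continuous_on_const tempered_cont[OF pderD(1)[OF F]])
    then show ?thesis by (simp add: euclidean_representation)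
  qed
  have fc: "continuous_on UNIV f"
    using f by (meson has_derivative_continuous continuous_at_imp_continuous_on)
  show "tempered C (\<lambda>x. f (F x))"
    by (rule tempered_bounded[OF continuous_on_compose2[OF fc Fc]]) (use B in auto)
  have "tempered C (\<lambda>x. G (F x) \<bullet> b)" if "b \<in> Basis" for b
  proof (rule tempered_bounded)
    show "continuous_on UNIV (\<lambda>x. G (F x) \<bullet> b)"
      by (intro continuous_intros continuous_on_compose2[OF G Fc]) auto
    fix x show "\<bar>G (F x) \<bullet> b\<bar> \<le> B'"
      using Basis_le_norm[OF that, of "G (F x)"] B(2)[of "F x"] by linarith
  qed
  then have "tempered C (\<lambda>x. \<Sum>b\<in>Basis. (G (F x) \<bullet> b) * (F' x \<bullet> b))"
    using pderD(2)[OF F] by (intro tempered_sum tempered_mult) auto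
  then show "tempered C (\<lambda>x. G (F x) \<bullet> F' x)" by (subst euclidean_inner) auto
  fix x
  \<comment> \<open>A curve in one real variable is differentiable as soon as its components are, so
    partial derivatives of the components are enough for the chain rule with the gradient of
    \<open>f\<close>.\<close>
  have "((\<lambda>t. F (x(c := t))) has_derivative (\<lambda>h. h *\<^sub>R F' x)) (at (x c))"
    unfolding has_derivative_componentwise_within[of "\<lambda>t. F (x(c := t))"]
  proof
    fix b :: 'a assume b: "b \<in> Basis"
    have "((\<lambda>t. F (x(c := t)) \<bullet> b) has_derivative (*) (F' x \<bullet> b)) (at (x c))"
      using pderD(3)[OF F[OF b], of x] unfolding has_field_derivative_def .
    then show "((\<lambda>t. F (x(c := t)) \<bullet> b) has_derivative (\<lambda>h. h *\<^sub>R F' x \<bullet> b)) (at (x c))"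
      by (rule has_derivative_eq_rhs) (auto simp: fun_eq_iff)
  qed
  from has_derivative_compose[OF this, of f "\<lambda>v. G (F x) \<bullet> v"] f[of "F x"]
  show "((\<lambda>t. f (F (x(c := t)))) has_real_derivative G (F x) \<bullet> F' x) (at (x c))"
    unfolding has_field_derivative_def
    by (simp add: fun_upd_triv) (erule has_derivative_eq_rhs, auto simp: fun_eq_iff)
qed

section \<open>Infinitely differentiable functions and the order of differentiation\<close>

definition smooth :: "'c set \<Rightarrow> (('c \<Rightarrow> real) \<Rightarrow> real) \<Rightarrow> bool" where
  "smooth C g \<longleftrightarrow> (\<forall>cs. tempered C (iter_partial cs g) \<and>
     (\<forall>c x. (\<lambda>t. iter_partial cs g (x(c := t))) differentiable at (x c)))"

lemma iter_partial_append: "iter_partial (cs @ ds) g = iter_partial cs (iter_partial ds g)"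
  by (induction cs) auto

lemma smooth_iter: "smooth C g \<Longrightarrow> smooth C (iter_partial cs g)"
  unfolding smooth_def by (simp flip: iter_partial_append)

lemma smooth_partial: "smooth C g \<Longrightarrow> smooth C (partial c g)"
  using smooth_iter[of C g "[c]"] by simp

lemma smooth_pder: assumes "smooth C g" shows "pder C c g (partial c g)"
proof -
  have s: "tempered C g" "tempered C (partial c g)" "\<And>x. (\<lambda>t. g (x(c := t))) differentiable at (x c)"
    using assms[unfolded smooth_def, rule_format, of "[]"] assms[unfolded smooth_def, rule_format, of "[c]"]
    by auto
  show ?thesis unfolding pder_def
  proof (intro conjI s allI)
    fix x show "((\<lambda>t. g (x(c := t))) has_real_derivative partial c g x) (at (x c))"
      using s(3)[of x] unfolding partial_def by (simp add: DERIV_deriv_iff_real_differentiable)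
  qed
qed

lemma smooth_tempered: "smooth C g \<Longrightarrow> tempered C g"
  by (rule pderD(1)[OF smooth_pder])

lemma pder_partial: "pder C c g g' \<Longrightarrow> partial c g = g'"
  unfolding partial_def by (intro ext DERIV_imp_deriv) (rule pderD(3))

text \<open>Coinduction: partial derivatives of members never leave \<open>S\<close>, so all
  iterated ones are tempered. This spares a formula for \<open>iter_partial\<close> of a composite
  function.\<close>

lemma smooth_coinduct_set:
  assumes "\<And>g c. g \<in> S \<Longrightarrow> \<exists>g'\<in>S. pder C c g g'" and "g \<in> S"
    shows "smooth C g"
proof -
  have *: "iter_partial cs g \<in> S" for cs
  proof (induction cs)
    case (Cons c cs)
    then obtain g' where "g' \<in> S" "pder C c (iter_partial cs g) g'" using assms(1) by blast
    then show ?case using pder_partial by fastforce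
  qed (use assms in auto)
  show ?thesis unfolding smooth_def
  proof (intro allI conjI)
    fix cs c x
    obtain g' where g': "pder C c (iter_partial cs g) g'" using assms(1)[OF *] by blast
    show "tempered C (iter_partial cs g)" using pderD(1)[OF g'] .
    show "(\<lambda>t. iter_partial cs g (x(c := t))) differentiable at (x c)"
      using pderD(3)[OF g', of x] real_differentiable_def by blast
  qed
qed

lemma smooth_diff: assumes "smooth C f" "smooth C g" shows "smooth C (\<lambda>x. f x - g x)"
proof (rule smooth_coinduct_set[where S="{\<lambda>x. f x - g x |f g. smooth C f \<and> smooth C g}"])
  fix h c assume "h \<in> {\<lambda>x. f x - g x |f g. smooth C f \<and> smooth C g}"
  then obtain f g where h: "h = (\<lambda>x. f x - g x)" "smooth C f" "smooth C g" by blast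
  then show "\<exists>g'\<in>{\<lambda>x. f x - g x |f g. smooth C f \<and> smooth C g}. pder C c h g'"
    by (intro bexI[of _ "\<lambda>x. partial c f x - partial c g x"])
       (auto intro: pder_diff smooth_pder smooth_partial)
qed (use assms in auto)

lemma partial_diff:
  assumes "smooth C f" "smooth C g"
  shows "partial c (\<lambda>x. f x - g x) = (\<lambda>x. partial c f x - partial c g x)"
  by (rule pder_partial[OF pder_diff[OF smooth_pder[OF assms(1)] smooth_pder[OF assms(2)]]])

lemma iter_partial_diff:
  assumes "smooth C f" "smooth C g"
  shows "iter_partial cs (\<lambda>x. f x - g x) = (\<lambda>x. iter_partial cs f x - iter_partial cs g x)"
proof (induction cs)
  case (Cons c cs)
  show ?case unfolding iter_partial.simps Cons
    by (rule partial_diff[OF smooth_iter smooth_iter]) (use assms in auto)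
qed simp

text \<open>Schwarz's theorem. The second difference over a square of side \<open>h n\<close> is, by
  two uses of the mean value theorem in either order, the area times a mixed derivative at an
  interior point; continuity then lets the square shrink.\<close>

lemma mixed_second_derivatives_eq:
  fixes u us ut ust uts :: "real \<Rightarrow> real \<Rightarrow> real"
  assumes us: "\<And>s t. ((\<lambda>s. u s t) has_real_derivative us s t) (at s)"
    and ut: "\<And>s t. ((\<lambda>t. u s t) has_real_derivative ut s t) (at t)"
    and ust: "\<And>s t. ((\<lambda>t. us s t) has_real_derivative ust s t) (at t)"
    and uts: "\<And>s t. ((\<lambda>s. ut s t) has_real_derivative uts s t) (at s)"
    and c: "continuous_on UNIV (\<lambda>(s, t). ust s t)" "continuous_on UNIV (\<lambda>(s, t). uts s t)"
  shows "ust s t = uts s t"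
proof -
  define h where "h n = inverse (real (Suc n))" for n
  have h: "h n > 0" for n unfolding h_def by simp
  have hl: "h \<longlonglongrightarrow> 0" unfolding h_def by (rule LIMSEQ_inverse_real_of_nat)
  have "\<exists>a b a' b'. s < a \<and> a < s + h n \<and> t < b \<and> b < t + h n \<and> s < a' \<and> a' < s + h n \<and> t < b' \<and> b' < t + h n
      \<and> ust a b = uts a' b'" for n
  proof -
    obtain a where a: "s < a" "a < s + h n"
      "(u (s + h n) (t + h n) - u (s + h n) t) - (u s (t + h n) - u s t) = h n * (us a (t + h n) - us a t)"
      using MVT2[of s "s + h n" "\<lambda>s. u s (t + h n) - u s t" "\<lambda>s. us s (t + h n) - us s t"] h[of n]
      using DERIV_diff[OF us us] by auto
    obtain b where b: "t < b" "b < t + h n" "us a (t + h n) - us a t = h n * ust a b"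
      using MVT2[of t "t + h n" "\<lambda>t. us a t" "\<lambda>t. ust a t"] h[of n] ust by auto
    obtain b' where b': "t < b'" "b' < t + h n"
      "(u (s + h n) (t + h n) - u s (t + h n)) - (u (s + h n) t - u s t) = h n * (ut (s + h n) b' - ut s b')"
      using MVT2[of t "t + h n" "\<lambda>t. u (s + h n) t - u s t" "\<lambda>t. ut (s + h n) t - ut s t"] h[of n]
      using DERIV_diff[OF ut ut] by auto
    obtain a' where a': "s < a'" "a' < s + h n" "ut (s + h n) b' - ut s b' = h n * uts a' b'"
      using MVT2[of s "s + h n" "\<lambda>s. ut s b'" "\<lambda>s. uts s b'"] h[of n] uts by auto
    have "h n * (h n * ust a b) = h n * (h n * uts a' b')"
      using a(3) b(3) b'(3) a'(3) by algebra
    then have "ust a b = uts a' b'" using h[of n] by simp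
    then show ?thesis using a b a' b' by blast
  qed
  then obtain a b a' b' where ab: "\<And>n. s < a n \<and> a n < s + h n \<and> t < b n \<and> b n < t + h n
     \<and> s < a' n \<and> a' n < s + h n \<and> t < b' n \<and> b' n < t + h n \<and> ust (a n) (b n) = uts (a' n) (b' n)"
    by metis
  have lim: "x \<longlonglongrightarrow> y" if "\<And>n. y < x n" "\<And>n. x n < y + h n" for x y
  proof (rule tendsto_sandwich[of "\<lambda>_. y" _ _ "\<lambda>n. y + h n"])
    show "(\<lambda>n. y + h n) \<longlonglongrightarrow> y" using tendsto_add[OF tendsto_const hl, of y] by simp
  qed (use that in \<open>auto intro!: always_eventually less_imp_le\<close>)
  have l: "a \<longlonglongrightarrow> s" "b \<longlonglongrightarrow> t" "a' \<longlonglongrightarrow> s" "b' \<longlonglongrightarrow> t" using ab by (auto intro!: lim)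
  have "(\<lambda>n. ust (a n) (b n)) \<longlonglongrightarrow> ust s t"
    using continuous_on_tendsto_compose[OF c(1) tendsto_Pair[OF l(1,2)]] by simp
  moreover have "(\<lambda>n. uts (a' n) (b' n)) \<longlonglongrightarrow> uts s t"
    using continuous_on_tendsto_compose[OF c(2) tendsto_Pair[OF l(3,4)]] by simp
  ultimately show ?thesis using ab LIMSEQ_unique by simp
qed

lemma partial_commute:
  assumes g: "smooth C g" shows "partial c (partial d g) = partial d (partial c g)"
proof (cases "c = d")
  case False
  have "partial c (partial d g) x = partial d (partial c g) x" for x
  proof -
    let ?u = "\<lambda>f s t. f (x(c := s, d := t))"
    have cont: "continuous_on UNIV (\<lambda>(s, t). x(c := s, d := t))"
    proof (rule continuous_on_coordinatewise_then_product)
      fix i show "continuous_on UNIV (\<lambda>p. (case p of (s, t) \<Rightarrow> x(c := s, d := t)) i)"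
        by (cases "i = d"; cases "i = c") (auto simp: case_prod_beta intro!: continuous_intros)
    qed
    have c2: "continuous_on UNIV (\<lambda>(s, t). ?u f s t)" if "tempered C f" for f
      using continuous_on_compose2[OF tempered_cont[OF that] cont] by (simp add: case_prod_beta)
    have 1: "((\<lambda>s. ?u f s t) has_real_derivative ?u f' s t) (at s)" if "pder C c f f'" for f f' s t
      using pderD(4)[OF that, of "x(d := t)" s] False by (simp add: fun_upd_twist)
    have 2: "((\<lambda>t. ?u f s t) has_real_derivative ?u f' s t) (at t)" if "pder C d f f'" for f f' s t
      using pderD(4)[OF that, of "x(c := s)" t] .
    note P = smooth_pder[OF g] smooth_pder[OF smooth_partial[OF g]]
    have "?u (partial d (partial c g)) (x c) (x d) = ?u (partial c (partial d g)) (x c) (x d)"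
      by (rule mixed_second_derivatives_eq[where us="?u (partial c g)" and ut="?u (partial d g)" and u="?u g"])
         (rule 1 2 P c2 smooth_tempered smooth_partial g)+
    then show ?thesis by simp
  qed
  then show ?thesis by blast
qed simp

text \<open>The function space carries no norm, so no total derivative is at hand. The coordinates
  in \<open>S\<close> are moved one after the other, each increment being evaluated by the mean
  value theorem, and continuity of the partial derivatives removes the intermediate points.\<close>

lemma directional_derivative:
  fixes \<phi> :: "('c \<Rightarrow> real) \<Rightarrow> real"
  assumes "finite S" and \<phi>: "\<And>c. c \<in> S \<Longrightarrow> pder C c \<phi> (\<phi>' c)"
  shows "((\<lambda>t. \<phi> (\<lambda>c. x c + (if c \<in> S then t * v c else 0))) has_real_derivative (\<Sum>c\<in>S. v c * \<phi>' c x)) (at 0)"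
  using assms
proof (induction S)
  case (insert c S)
  define y where "y t = (\<lambda>d. x d + (if d \<in> S then t * v d else 0))" for t
  have yc: "y t c = x c" for t using insert(2) by (simp add: y_def)
  have eq: "(\<lambda>d. x d + (if d \<in> insert c S then t * v d else 0)) = (y t)(c := x c + t * v c)" for t
    using insert(2) by (auto simp: y_def fun_eq_iff)
  have P: "pder C c \<phi> (\<phi>' c)" using insert(4) by simp
  \<comment> \<open>Mean value theorem in coordinate \<open>c\<close>, with the intermediate point
    written as an offset from \<open>x c\<close>. The case split is on the order of the end points,
    which coincide when the increment vanishes.\<close>
  have "\<exists>z. \<bar>z\<bar> \<le> \<bar>t * v c\<bar> \<and>
     \<phi> ((y t)(c := x c + t * v c)) - \<phi> (y t) = (t * v c) * \<phi>' c ((y t)(c := x c + z))" for t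
  proof -
    consider "t * v c = 0" | "t * v c > 0" | "t * v c < 0" by linarith
    then show ?thesis
    proof cases
      case 1 then show ?thesis using yc[of t] by (intro exI[of _ 0]) (auto simp: fun_upd_idem)
    next
      case 2
      obtain z where "x c < z" "z < x c + t * v c"
        "\<phi> ((y t)(c := x c + t * v c)) - \<phi> ((y t)(c := x c)) = (t * v c) * \<phi>' c ((y t)(c := z))"
        using MVT2[of "x c" "x c + t * v c" "\<lambda>s. \<phi> ((y t)(c := s))" "\<lambda>s. \<phi>' c ((y t)(c := s))"] 2 pderD(4)[OF P]
        by auto
      then show ?thesis using yc[of t] by (intro exI[of _ "z - x c"]) (auto simp: fun_upd_idem)
    next
      case 3
      obtain z where "z < x c" "x c + t * v c < z"
        "\<phi> ((y t)(c := x c)) - \<phi> ((y t)(c := x c + t * v c)) = (- (t * v c)) * \<phi>' c ((y t)(c := z))"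
        using MVT2[of "x c + t * v c" "x c" "\<lambda>s. \<phi> ((y t)(c := s))" "\<lambda>s. \<phi>' c ((y t)(c := s))"] 3 pderD(4)[OF P]
        by auto
      then show ?thesis using yc[of t] by (intro exI[of _ "z - x c"]) (auto simp: fun_upd_idem algebra_simps)
    qed
  qed
  then obtain z where z: "\<And>t. \<bar>z t\<bar> \<le> \<bar>t * v c\<bar>"
     "\<And>t. \<phi> ((y t)(c := x c + t * v c)) - \<phi> (y t) = (t * v c) * \<phi>' c ((y t)(c := x c + z t))" by metis
  have z0: "(z \<longlongrightarrow> 0) (at 0)"
  proof (rule Lim_null_comparison)
    show "\<forall>\<^sub>F t in at 0. norm (z t) \<le> \<bar>t * v c\<bar>" using z(1) by simp
    show "((\<lambda>t. \<bar>t * v c\<bar>) \<longlongrightarrow> 0) (at 0)" by (auto intro!: tendsto_eq_intros)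
  qed
  have w: "((\<lambda>t. (y t)(c := x c + z t)) \<longlongrightarrow> x) (at 0)"
  proof -
    have "((\<lambda>t. ((y t)(c := x c + z t)) d) \<longlongrightarrow> x d) (at 0)" for d
      using z0 insert(2)
      by (cases "d = c"; cases "d \<in> S") (auto simp: y_def intro!: tendsto_eq_intros)
    then have "limitin (product_topology (\<lambda>_. euclidean) UNIV) (\<lambda>t. (y t)(c := x c + z t)) x (at 0)"
      by (simp add: limitin_componentwise)
    then show ?thesis by (simp add: euclidean_product_topology)
  qed
  \<comment> \<open>The intermediate points tend to \<open>x\<close> in the product topology, so the
    continuous partial derivative evaluated there tends to its value at \<open>x\<close>.\<close>
  have "((\<lambda>t. v c * \<phi>' c ((y t)(c := x c + z t))) \<longlongrightarrow> v c * \<phi>' c x) (at 0)"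
    using continuous_on_tendsto_compose[OF tempered_cont[OF pderD(2)[OF P]] w] by (intro tendsto_intros) auto
  then have "((\<lambda>t. \<phi> ((y t)(c := x c + t * v c)) - \<phi> (y t)) has_real_derivative v c * \<phi>' c x) (at 0)"
    unfolding has_field_derivative_iff using yc
    by (rule_tac Lim_transform_eventually[rotated])
       (auto simp: eventually_at_filter z(2) fun_upd_idem)
  moreover have "((\<lambda>t. \<phi> (y t)) has_real_derivative (\<Sum>c\<in>S. v c * \<phi>' c x)) (at 0)"
    using insert unfolding y_def by auto
  ultimately have "((\<lambda>t. (\<phi> ((y t)(c := x c + t * v c)) - \<phi> (y t)) + \<phi> (y t)) has_real_derivative
      v c * \<phi>' c x + (\<Sum>c\<in>S. v c * \<phi>' c x)) (at 0)" by (rule DERIV_add)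
  then show ?case unfolding eq using insert by simp
qed simp

section \<open>Gaussian integration by parts\<close>

text \<open>Completing the square trades the Gaussian exponent for -|t| plus a constant, and an
  exponential beats every power. The filter is left open so that both ends of the line are
  covered.\<close>

lemma normal_density_poly_limit:
  fixes \<sigma> :: real
  assumes s: "\<sigma> > 0" and F: "filterlim (\<lambda>t. \<bar>t\<bar>) at_top F"
  shows "((\<lambda>t. normal_density 0 \<sigma> t * (1 + \<bar>t\<bar>) ^ q) \<longlongrightarrow> 0) F"
proof (rule Lim_null_comparison)
  define k where "k = 1 / sqrt (2 * pi * \<sigma>\<^sup>2) * exp (\<sigma>\<^sup>2 / 2 + 1)"
  show "\<forall>\<^sub>F t in F. norm (normal_density 0 \<sigma> t * (1 + \<bar>t\<bar>) ^ q) \<le> k * ((1 + \<bar>t\<bar>) ^ q / exp (1 + \<bar>t\<bar>))"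
  proof (rule always_eventually, rule allI)
    fix t :: real
    have "0 \<le> (\<bar>t\<bar> / \<sigma> - \<sigma>)\<^sup>2" by simp
    then have "2 * \<bar>t\<bar> \<le> t\<^sup>2 / \<sigma>\<^sup>2 + \<sigma>\<^sup>2" using s by (simp add: power2_eq_square field_simps)
    then have "- t\<^sup>2 / (2 * \<sigma>\<^sup>2) \<le> (\<sigma>\<^sup>2 / 2 + 1) - (1 + \<bar>t\<bar>)" by (simp add: field_simps)
    then have "exp (- t\<^sup>2 / (2 * \<sigma>\<^sup>2)) \<le> exp (\<sigma>\<^sup>2 / 2 + 1) / exp (1 + \<bar>t\<bar>)" by (simp flip: exp_diff)
    then have "normal_density 0 \<sigma> t \<le> k / exp (1 + \<bar>t\<bar>)"
      using divide_right_mono[of _ _ "sqrt (2 * pi * \<sigma>\<^sup>2)"] unfolding normal_density_def k_def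
      by (fastforce simp: mult.commute)
    then have "normal_density 0 \<sigma> t * (1 + \<bar>t\<bar>) ^ q \<le> k / exp (1 + \<bar>t\<bar>) * (1 + \<bar>t\<bar>) ^ q"
      by (intro mult_right_mono) auto
    then show "norm (normal_density 0 \<sigma> t * (1 + \<bar>t\<bar>) ^ q) \<le> k * ((1 + \<bar>t\<bar>) ^ q / exp (1 + \<bar>t\<bar>))"
      using s by simp
  qed
  have "filterlim (\<lambda>t::real. 1 + \<bar>t\<bar>) at_top F"
    by (rule filterlim_at_top_mono[OF F]) auto
  from filterlim_compose[OF tendsto_power_div_exp_0 this]
  show "((\<lambda>t. k * ((1 + \<bar>t\<bar>) ^ q / exp (1 + \<bar>t\<bar>))) \<longlongrightarrow> 0) F"
    by (rule tendsto_mult_right_zero)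
qed

lemma integrable_normal_poly:
  fixes \<sigma> :: real and g :: "real \<Rightarrow> real"
  assumes s: "\<sigma> > 0" and g: "g \<in> borel_measurable borel" and B: "\<And>t. \<bar>g t\<bar> \<le> K * (1 + \<bar>t\<bar>) ^ q"
  shows "integrable lborel (\<lambda>t. normal_density 0 \<sigma> t * g t)"
proof (rule Bochner_Integration.integrable_bound)
  have "integrable lborel (\<lambda>t. K * 2 ^ q * (normal_density 0 \<sigma> t * \<bar>t - 0\<bar>^0 + normal_density 0 \<sigma> t * \<bar>t - 0\<bar>^q))"
    using s by (intro integrable_mult_right Bochner_Integration.integrable_add integrable_normal_moment_abs)
  then show "integrable lborel (\<lambda>t. K * 2 ^ q * (normal_density 0 \<sigma> t * (1 + \<bar>t\<bar> ^ q)))"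
    by (simp add: distrib_left)
  show "AE t in lborel. norm (normal_density 0 \<sigma> t * g t) \<le> norm (K * 2 ^ q * (normal_density 0 \<sigma> t * (1 + \<bar>t\<bar> ^ q)))"
  proof (rule AE_I2)
    fix t :: real
    have K: "0 \<le> K" using order_trans[OF abs_ge_zero B[of 0]] by simp
    have "(1 + \<bar>t\<bar>) ^ q \<le> (2 * max 1 \<bar>t\<bar>) ^ q" by (intro power_mono) auto
    also have "\<dots> = 2 ^ q * (max 1 \<bar>t\<bar>) ^ q" by (simp add: power_mult_distrib)
    also have "\<dots> \<le> 2 ^ q * (1 + \<bar>t\<bar> ^ q)" by (intro mult_left_mono) (auto simp: max_def)
    finally have "\<bar>g t\<bar> \<le> K * (2 ^ q * (1 + \<bar>t\<bar> ^ q))"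
      using B[of t] K by (meson mult_left_mono order_trans)
    then have "normal_density 0 \<sigma> t * \<bar>g t\<bar> \<le> normal_density 0 \<sigma> t * (K * (2 ^ q * (1 + \<bar>t\<bar> ^ q)))"
      by (intro mult_left_mono) auto
    then show "norm (normal_density 0 \<sigma> t * g t) \<le> norm (K * 2 ^ q * (normal_density 0 \<sigma> t * (1 + \<bar>t\<bar> ^ q)))"
      using K by (simp add: abs_mult mult_ac)
  qed
qed (use g in simp)

lemma Stein_one_dimensional:
  fixes \<sigma> :: real and g g' :: "real \<Rightarrow> real"
  assumes s: "\<sigma> > 0" and d: "\<And>t. (g has_real_derivative g' t) (at t)" and c: "continuous_on UNIV g'"
    and B: "\<And>t. \<bar>g t\<bar> \<le> K * (1 + \<bar>t\<bar>) ^ q" "\<And>t. \<bar>g' t\<bar> \<le> K' * (1 + \<bar>t\<bar>) ^ q'"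
  shows "\<sigma>\<^sup>2 * (\<integral>t. normal_density 0 \<sigma> t * g' t \<partial>lborel) = (\<integral>t. normal_density 0 \<sigma> t * (t * g t) \<partial>lborel)"
proof -
  let ?\<phi> = "normal_density 0 \<sigma>"
  have cg: "continuous_on UNIV g"
    using d by (meson DERIV_continuous continuous_at_imp_continuous_on)
  have K: "0 \<le> K" using order_trans[OF abs_ge_zero B(1)[of 0]] by simp
  have i1: "integrable lborel (\<lambda>t. ?\<phi> t * g' t)"
    by (rule integrable_normal_poly[OF s _ B(2)]) (intro borel_measurable_continuous_onI c)
  have "\<bar>t * g t\<bar> \<le> K * (1 + \<bar>t\<bar>) ^ (Suc q)" for t
  proof -
    have "\<bar>t\<bar> * \<bar>g t\<bar> \<le> (1 + \<bar>t\<bar>) * (K * (1 + \<bar>t\<bar>) ^ q)" using B(1)[of t] by (intro mult_mono) auto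
    then show ?thesis by (simp add: abs_mult mult_ac)
  qed
  then have i2: "integrable lborel (\<lambda>t. ?\<phi> t * (t * g t))"
    by (intro integrable_normal_poly[OF s, where K=K and q="Suc q"])
       (auto intro!: borel_measurable_continuous_onI continuous_intros cg simp del: power_Suc)
  \<comment> \<open>The derivative of the density is -t/\<sigma>^2 times itself, so \<open>f\<close>
    is the derivative of density times \<open>g\<close>; its integral over the line is a difference
    of two limits that are both 0.\<close>
  define f where "f t = ?\<phi> t * g' t - ?\<phi> t * (t * g t) / \<sigma>\<^sup>2" for t
  have i3: "integrable lborel f" unfolding f_def using i1 i2 by auto
  have dphi: "(?\<phi> has_real_derivative (- t / \<sigma>\<^sup>2 * ?\<phi> t)) (at t)" for t
    unfolding normal_density_def using s
    by (auto intro!: derivative_eq_intros simp: power2_eq_square field_simps)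
  have dF: "((\<lambda>t. ?\<phi> t * g t) has_real_derivative f t) (at t)" for t
    using DERIV_mult[OF dphi d, of t] by (rule DERIV_cong) (simp add: f_def algebra_simps)
  have contphi: "continuous_on UNIV ?\<phi>"
    using dphi by (meson DERIV_continuous continuous_at_imp_continuous_on)
  have cf: "continuous_on UNIV f" unfolding f_def using s
    by (intro continuous_intros c cg contphi) auto
  have lim: "((\<lambda>t. ?\<phi> t * g t) \<longlongrightarrow> 0) F" if "filterlim (\<lambda>t. \<bar>t\<bar>) at_top F" for F
  proof (rule Lim_null_comparison)
    have "\<bar>?\<phi> t * g t\<bar> \<le> K * (?\<phi> t * (1 + \<bar>t\<bar>) ^ q)" for t
      using mult_left_mono[OF B(1)[of t], of "?\<phi> t"] by (simp add: abs_mult mult_ac)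
    then show "\<forall>\<^sub>F t in F. norm (?\<phi> t * g t) \<le> K * (?\<phi> t * (1 + \<bar>t\<bar>) ^ q)" by simp
    show "((\<lambda>t. K * (?\<phi> t * (1 + \<bar>t\<bar>) ^ q)) \<longlongrightarrow> 0) F"
      by (rule tendsto_mult_right_zero[OF normal_density_poly_limit[OF s that]])
  qed
  have "(LBINT x=-\<infinity>..\<infinity>. f x) = 0 - 0"
  proof (rule interval_integral_FTC_integrable[where F="\<lambda>t. ?\<phi> t * g t"])
    show "((\<lambda>t. ?\<phi> t * g t) has_vector_derivative f x) (at x)" for x
      using dF by (simp add: has_real_derivative_iff_has_vector_derivative)
    show "isCont f x" for x using cf by (simp add: continuous_on_eq_continuous_at)
    show "set_integrable lborel (einterval (- \<infinity>) \<infinity>) f" using i3 by (simp add: set_integrable_def)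
    show "(((\<lambda>t. ?\<phi> t * g t) \<circ> real_of_ereal) \<longlongrightarrow> 0) (at_right (- \<infinity>))"
      unfolding at_right_MInf tendsto_compose_filtermap[symmetric] filterlim_filtermap o_def real_of_ereal.simps
      by (rule lim) (rule filterlim_abs_real[THEN filterlim_compose, OF filterlim_uminus_at_top_at_bot, simplified])
    show "(((\<lambda>t. ?\<phi> t * g t) \<circ> real_of_ereal) \<longlongrightarrow> 0) (at_left \<infinity>)"
      unfolding at_left_PInf tendsto_compose_filtermap[symmetric] filterlim_filtermap o_def real_of_ereal.simps
      by (rule lim) (rule filterlim_abs_real)
  qed simp
  then have "(\<integral>t. f t \<partial>lborel) = 0"
    by (simp add: interval_lebesgue_integral_def einterval_def set_lebesgue_integral_def)
  then have "(\<integral>t. ?\<phi> t * g' t \<partial>lborel) - (\<integral>t. ?\<phi> t * (t * g t) \<partial>lborel) / \<sigma>\<^sup>2 = 0"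
    unfolding f_def using i1 i2 by simp
  then show ?thesis using s by (simp add: field_simps)
qed

text \<open>Reduces polynomial growth in many variables to moments of the single ones: the sum is at
  most the number of terms times the largest.\<close>

lemma power_one_plus_sum_le:
  fixes a :: "'c \<Rightarrow> real"
  assumes "finite C" "\<And>c. c \<in> C \<Longrightarrow> 0 \<le> a c"
  shows "(1 + (\<Sum>c\<in>C. a c)) ^ q \<le> (1 + real (card C)) ^ q * (1 + (\<Sum>c\<in>C. a c ^ q))"
proof -
  define m where "m = Max (insert 1 (a ` C))"
  have m: "1 \<le> m" "\<And>c. c \<in> C \<Longrightarrow> a c \<le> m" "m \<in> insert 1 (a ` C)"
    unfolding m_def using assms(1) Max_in[of "insert 1 (a ` C)"] by (auto intro: Max_ge)
  have "(\<Sum>c\<in>C. a c) \<le> real (card C) * m" using sum_bounded_above[of C a m] m(2) by simp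
  then have "1 + (\<Sum>c\<in>C. a c) \<le> (1 + real (card C)) * m" using m(1) by (simp add: algebra_simps)
  then have "(1 + (\<Sum>c\<in>C. a c)) ^ q \<le> ((1 + real (card C)) * m) ^ q"
    using assms(2) by (intro power_mono) (auto simp: sum_nonneg add_nonneg_nonneg)
  also have "\<dots> = (1 + real (card C)) ^ q * m ^ q" by (simp add: power_mult_distrib)
  also have "m ^ q \<le> 1 + (\<Sum>c\<in>C. a c ^ q)"
  proof (cases "m = 1")
    case True then show ?thesis using assms(2) by (simp add: sum_nonneg)
  next
    case False
    then obtain c where "c \<in> C" "m = a c" using m(3) by auto
    then have "m ^ q \<le> (\<Sum>c\<in>C. a c ^ q)" using assms by (auto intro!: member_le_sum)
    then show ?thesis by simp
  qed
  finally show ?thesis by (auto intro: mult_left_mono)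
qed

text \<open>The variances will be lengths of time intervals. A sum over slots with weights
  \<open>v\<close> is then the time integral of a step function, which is why \<open>v\<close> and
  not 1 weights the derivatives below.\<close>

locale gaussian_slots = prob_space M for M :: "'w measure" +
  fixes C :: "'c::countable set" and v :: "'c \<Rightarrow> real" and X :: "'c \<Rightarrow> 'w \<Rightarrow> real"
  assumes fin: "finite C" and v_pos: "\<And>c. c \<in> C \<Longrightarrow> v c > 0"
    and indep: "indep_vars (\<lambda>_. borel) X C"
    and normal: "\<And>c. c \<in> C \<Longrightarrow> distributed M lborel (X c) (\<lambda>x. ennreal (normal_density 0 (sqrt (v c)) x))"
begin

text \<open>Coordinates off \<open>C\<close> are frozen at 0. The predicate \<open>tempered\<close>
  bounds growth in terms of \<open>C\<close> but does not forbid dependence on other coordinates;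
  with this default the value of such a function is still determined by the slots.\<close>

definition pt :: "'w \<Rightarrow> 'c \<Rightarrow> real" where "pt \<omega> = (\<lambda>c. if c \<in> C then X c \<omega> else 0)"

abbreviation ev :: "(('c \<Rightarrow> real) \<Rightarrow> real) \<Rightarrow> real" where "ev g \<equiv> expectation (\<lambda>\<omega>. g (pt \<omega>))"

lemma X_measurable [measurable]: "c \<in> C \<Longrightarrow> X c \<in> borel_measurable M"
  using indep unfolding indep_vars_def by auto

lemma embed_measurable:
  assumes "D \<subseteq> C"
  shows "(\<lambda>(y :: 'c \<Rightarrow> real, t :: real) d. if d = c then t else if d \<in> D then y d else 0)
    \<in> PiM D (\<lambda>_. borel) \<Otimes>\<^sub>M borel \<rightarrow>\<^sub>M borel"
proof -
  have "(\<lambda>p d. if d = c then snd p else if d \<in> D then fst p d else 0)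
    \<in> PiM D (\<lambda>_. borel :: real measure) \<Otimes>\<^sub>M (borel :: real measure) \<rightarrow>\<^sub>M PiM UNIV (\<lambda>_. borel)"
  proof (rule measurable_PiM_single')
    fix i :: 'c
    show "(\<lambda>p. if i = c then snd p else if i \<in> D then fst p i else 0)
      \<in> PiM D (\<lambda>_. borel :: real measure) \<Otimes>\<^sub>M (borel :: real measure) \<rightarrow>\<^sub>M borel"
      by (cases "i = c"; cases "i \<in> D") (auto simp: measurable_split_conv)
  qed auto
  then show ?thesis
    by (subst (asm) measurable_cong_sets[OF refl sets_PiM_equal_borel]) (simp add: case_prod_beta)
qed

lemma pt_measurable [measurable]: "pt \<in> M \<rightarrow>\<^sub>M borel"
proof -
  have "pt \<in> M \<rightarrow>\<^sub>M PiM UNIV (\<lambda>_. borel)"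
  proof (rule measurable_PiM_single')
    show "(\<lambda>\<omega>. pt \<omega> c) \<in> borel_measurable M" for c
      by (cases "c \<in> C") (auto simp: pt_def)
  qed auto
  then show ?thesis
    by (subst (asm) measurable_cong_sets[OF refl sets_PiM_equal_borel])
qed

lemma tempered_measurable: "tempered C g \<Longrightarrow> (\<lambda>\<omega>. g (pt \<omega>)) \<in> borel_measurable M"
  by (rule measurable_compose[OF pt_measurable borel_measurable_continuous_onI[OF tempered_cont]])

lemma tempered_integrable: assumes "tempered C g" shows "integrable M (\<lambda>\<omega>. g (pt \<omega>))"
proof -
  obtain K q where K: "0 \<le> K" "\<And>x. \<bar>g x\<bar> \<le> K * (1 + (\<Sum>c\<in>C. \<bar>x c\<bar>)) ^ q" using temperedE[OF assms] by blast
  let ?h = "\<lambda>\<omega>. K * ((1 + real (card C)) ^ q * (1 + (\<Sum>c\<in>C. \<bar>X c \<omega>\<bar> ^ q)))"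
  have "integrable M (\<lambda>\<omega>. \<bar>X c \<omega>\<bar> ^ q)" if c: "c \<in> C" for c
  proof -
    have "integrable lborel (\<lambda>x. normal_density 0 (sqrt (v c)) x * \<bar>x\<bar>^q)"
      using integrable_normal_moment_abs[of "sqrt (v c)" 0 q] v_pos[OF c] by simp
    then show ?thesis by (subst (asm) distributed_integrable[OF normal[OF c]]) auto
  qed
  then have "integrable M ?h"
    by (intro integrable_mult_right Bochner_Integration.integrable_add Bochner_Integration.integrable_sum) auto
  then show ?thesis
  proof (rule Bochner_Integration.integrable_bound)
    show "AE \<omega> in M. norm (g (pt \<omega>)) \<le> norm (?h \<omega>)"
    proof (rule AE_I2)
      fix \<omega>
      have "\<bar>g (pt \<omega>)\<bar> \<le> K * (1 + (\<Sum>c\<in>C. \<bar>X c \<omega>\<bar>)) ^ q" using K(2)[of "pt \<omega>"] by (simp add: pt_def)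
      also have "\<dots> \<le> ?h \<omega>" by (intro mult_left_mono K power_one_plus_sum_le fin) auto
      finally show "norm (g (pt \<omega>)) \<le> norm (?h \<omega>)" by simp
    qed
  qed (rule tempered_measurable[OF assms])
qed

text \<open>Independence makes the joint law a product of the law of slot \<open>c\<close> and that
  of the remaining slots. Fubini's theorem freezes the latter, and Stein's identity applies in the
  one variable that is left.\<close>

lemma integration_by_parts:
  assumes c: "c \<in> C" and g: "pder C c g g'"
  shows "v c * ev g' = ev (\<lambda>x. x c * g x)"
proof -
  define D where "D = C - {c}"
  define Y where "Y \<omega> = restrict (\<lambda>i. X i \<omega>) D" for \<omega>
  define e where "e = (\<lambda>(y :: 'c \<Rightarrow> real, t :: real) d. if d = c then t else if d \<in> D then y d else 0)"
  let ?s = "sqrt (v c)"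
  have s: "?s > 0" "?s\<^sup>2 = v c" using v_pos[OF c] by auto
  have "indep_var (PiM D (\<lambda>_. borel)) Y (PiM {c} (\<lambda>_. borel)) (\<lambda>\<omega>. restrict (\<lambda>i. X i \<omega>) {c})"
    unfolding Y_def by (rule indep_var_restrict[OF indep]) (auto simp: D_def c)
  then have iv: "indep_var (PiM D (\<lambda>_. borel)) Y (PiM {c} (\<lambda>_. borel)) (\<lambda>\<omega>. restrict (\<lambda>i. X i \<omega>) {c})" .
  define P where "P = distr M (PiM D (\<lambda>_. borel)) Y"
  define Q where "Q = distr M (PiM {c} (\<lambda>_. borel)) (\<lambda>\<omega>. restrict (\<lambda>i. X i \<omega>) {c})"
  have Ym [measurable]: "Y \<in> M \<rightarrow>\<^sub>M PiM D (\<lambda>_. borel)" using indep_var_rv1[OF iv] .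
  have Xm [measurable]: "X c \<in> borel_measurable M" using c by simp
  have Zm [measurable]: "(\<lambda>\<omega>. restrict (\<lambda>i. X i \<omega>) {c}) \<in> M \<rightarrow>\<^sub>M PiM {c} (\<lambda>_. borel)"
    using indep_var_rv2[OF iv] .
  interpret P: prob_space P unfolding P_def by (rule prob_space_distr[OF Ym])
  interpret Q: prob_space Q unfolding Q_def by (rule prob_space_distr[OF Zm])
  interpret PQ: pair_sigma_finite P Q ..
  have PQ: "P \<Otimes>\<^sub>M Q = distr M (PiM D (\<lambda>_. borel) \<Otimes>\<^sub>M PiM {c} (\<lambda>_. borel)) (\<lambda>\<omega>. (Y \<omega>, restrict (\<lambda>i. X i \<omega>) {c}))"
    using iv unfolding indep_var_distribution_eq P_def Q_def by blast
  have em [measurable]: "e \<in> PiM D (\<lambda>_. borel) \<Otimes>\<^sub>M borel \<rightarrow>\<^sub>M borel"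
    unfolding e_def by (rule embed_measurable) (auto simp: D_def)
  have pt: "pt \<omega> = e (Y \<omega>, X c \<omega>)" for \<omega>
    using c by (auto simp: pt_def e_def D_def Y_def fun_eq_iff)
  have Fub: "ev h = (\<integral>y. (\<integral>t. normal_density 0 ?s t * h (e (y, t)) \<partial>lborel) \<partial>P)" if h: "tempered C h" for h
  proof -
    have hm [measurable]: "h \<in> borel_measurable borel" by (rule borel_measurable_continuous_onI[OF tempered_cont[OF h]])
    have m: "(\<lambda>p. h (e p)) \<in> borel_measurable (PiM D (\<lambda>_. borel) \<Otimes>\<^sub>M borel)" by measurable
    have m': "(\<lambda>p. h (e (fst p, snd p c))) \<in> borel_measurable (PiM D (\<lambda>_. borel) \<Otimes>\<^sub>M PiM {c} (\<lambda>_. borel))"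
      by measurable
    have i: "integrable (P \<Otimes>\<^sub>M Q) (\<lambda>p. h (e (fst p, snd p c)))"
      unfolding PQ using tempered_integrable[OF h] m' by (subst integrable_distr_eq) (auto simp: pt)
    have "ev h = (\<integral>p. h (e (fst p, snd p c)) \<partial>(P \<Otimes>\<^sub>M Q))"
      unfolding PQ using m' by (subst integral_distr) (auto simp: pt)
    also have "\<dots> = (\<integral>y. (\<integral>f. h (e (y, f c)) \<partial>Q) \<partial>P)" using PQ.integral_fst'[OF i] by simp
    also have "\<dots> = (\<integral>y. (\<integral>t. normal_density 0 ?s t * h (e (y, t)) \<partial>lborel) \<partial>P)"
    proof (rule Bochner_Integration.integral_cong[OF refl])
      fix y assume "y \<in> space P"
      then have m2 [measurable]: "(\<lambda>t. h (e (y, t))) \<in> borel_measurable borel"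
        using measurable_compose[OF measurable_Pair1' m] by (simp add: P_def)
      have "(\<integral>f. h (e (y, f c)) \<partial>Q) = (\<integral>\<omega>. h (e (y, X c \<omega>)) \<partial>M)"
        unfolding Q_def by (subst integral_distr) auto
      also have "\<dots> = (\<integral>t. normal_density 0 ?s t * h (e (y, t)) \<partial>lborel)"
        by (rule distributed_integral[OF normal[OF c], symmetric]) auto
      finally show "(\<integral>f. h (e (y, f c)) \<partial>Q) = (\<integral>t. normal_density 0 ?s t * h (e (y, t)) \<partial>lborel)" .
    qed
    finally show ?thesis .
  qed
  have xg: "tempered C (\<lambda>x. x c * g x)" using tempered_mult[OF tempered_coord[OF fin c] pderD(1)[OF g]] .
  have "v c * (\<integral>t. normal_density 0 ?s t * g' (e (y, t)) \<partial>lborel)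
     = (\<integral>t. normal_density 0 ?s t * (e (y, t) c * g (e (y, t))) \<partial>lborel)" for y
  proof -
    have e: "e (y, t) = (e (y, 0))(c := t)" for t by (auto simp: e_def)
    have ec: "e (y, t) c = t" for t by (simp add: e_def)
    have bnd: "\<exists>K q. \<forall>t. \<bar>h (e (y, t))\<bar> \<le> K * (1 + \<bar>t\<bar>) ^ q" if h: "tempered C h" for h
    proof -
      obtain K q where K: "0 \<le> K" "\<And>x. \<bar>h x\<bar> \<le> K * (1 + (\<Sum>c\<in>C. \<bar>x c\<bar>)) ^ q" using temperedE[OF h] by blast
      let ?S = "\<Sum>d\<in>D. \<bar>y d\<bar>"
      have "\<bar>h (e (y, t))\<bar> \<le> K * (1 + ?S) ^ q * (1 + \<bar>t\<bar>) ^ q" for t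
      proof -
        have "(\<Sum>d\<in>C. \<bar>e (y, t) d\<bar>) = \<bar>t\<bar> + ?S"
          using sum.remove[OF fin c, of "\<lambda>d. \<bar>e (y, t) d\<bar>"] by (simp add: e_def D_def)
        then have "\<bar>h (e (y, t))\<bar> \<le> K * (1 + (\<bar>t\<bar> + ?S)) ^ q" using K(2)[of "e (y, t)"] by simp
        also have "\<dots> \<le> K * ((1 + ?S) * (1 + \<bar>t\<bar>)) ^ q"
          by (intro mult_left_mono power_mono K) (auto simp: algebra_simps sum_nonneg add_nonneg_nonneg)
        finally show ?thesis by (simp add: power_mult_distrib mult_ac)
      qed
      then show ?thesis by blast
    qed
    obtain K q where 1: "\<And>t. \<bar>g (e (y, t))\<bar> \<le> K * (1 + \<bar>t\<bar>) ^ q" using bnd[OF pderD(1)[OF g]] by blast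
    obtain L r where 2: "\<And>t. \<bar>g' (e (y, t))\<bar> \<le> L * (1 + \<bar>t\<bar>) ^ r" using bnd[OF pderD(2)[OF g]] by blast
    have "continuous_on UNIV (\<lambda>t. (e (y, 0))(c := t))" by (rule continuous_on_fun_upd)
    from continuous_on_compose2[OF tempered_cont[OF pderD(2)[OF g]] this]
    have "continuous_on UNIV (\<lambda>t. g' (e (y, t)))" by (simp flip: e)
    moreover have "((\<lambda>t. g (e (y, t))) has_real_derivative g' (e (y, t))) (at t)" for t
      using pderD(4)[OF g, of "e (y, 0)" t] by (simp flip: e)
    ultimately show ?thesis
      using Stein_one_dimensional[OF s(1) _ _ 1 2] s(2) unfolding ec by auto
  qed
  then show ?thesis
    unfolding Fub[OF pderD(2)[OF g]] Fub[OF xg] by (simp flip: integral_mult_right_zero)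
qed

end

section \<open>Weighted Euclidean inequalities\<close>

lemma weighted_Cauchy_Schwarz:
  fixes p a b :: "'i \<Rightarrow> real"
  assumes "\<And>i. i \<in> I \<Longrightarrow> 0 \<le> p i"
  shows "\<bar>\<Sum>i\<in>I. p i * (a i * b i)\<bar> \<le> sqrt (\<Sum>i\<in>I. p i * (a i)\<^sup>2) * sqrt (\<Sum>i\<in>I. p i * (b i)\<^sup>2)"
proof -
  have "(\<Sum>i\<in>I. (sqrt (p i) * a i) * (sqrt (p i) * b i))\<^sup>2
      \<le> (\<Sum>i\<in>I. (sqrt (p i) * a i)\<^sup>2) * (\<Sum>i\<in>I. (sqrt (p i) * b i)\<^sup>2)"
    by (rule Cauchy_Schwarz_ineq_sum)
  also have "(\<Sum>i\<in>I. (sqrt (p i) * a i)\<^sup>2) = (\<Sum>i\<in>I. p i * (a i)\<^sup>2)"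
    using assms by (intro sum.cong) (auto simp: power_mult_distrib)
  also have "(\<Sum>i\<in>I. (sqrt (p i) * b i)\<^sup>2) = (\<Sum>i\<in>I. p i * (b i)\<^sup>2)"
    using assms by (intro sum.cong) (auto simp: power_mult_distrib)
  also have "(\<Sum>i\<in>I. (sqrt (p i) * a i) * (sqrt (p i) * b i)) = (\<Sum>i\<in>I. p i * (a i * b i))"
  proof (intro sum.cong refl)
    fix i assume "i \<in> I"
    then have "sqrt (p i) * sqrt (p i) = p i" using assms by simp
    then show "(sqrt (p i) * a i) * (sqrt (p i) * b i) = p i * (a i * b i)"
      by (metis mult.assoc mult.left_commute)
  qed
  finally show ?thesis by (metis real_sqrt_abs real_sqrt_le_iff real_sqrt_mult)
qed

lemma weighted_triangle:
  fixes p a b :: "'i \<Rightarrow> real"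
  assumes "\<And>i. i \<in> I \<Longrightarrow> 0 \<le> p i"
  shows "sqrt (\<Sum>i\<in>I. p i * (a i + b i)\<^sup>2) \<le> sqrt (\<Sum>i\<in>I. p i * (a i)\<^sup>2) + sqrt (\<Sum>i\<in>I. p i * (b i)\<^sup>2)"
proof (rule real_le_lsqrt)
  let ?A = "\<Sum>i\<in>I. p i * (a i)\<^sup>2" and ?B = "\<Sum>i\<in>I. p i * (b i)\<^sup>2"
  have nn: "0 \<le> ?A" "0 \<le> ?B" using assms by (auto intro!: sum_nonneg)
  then show "0 \<le> sqrt ?A + sqrt ?B" by simp
  have "(\<Sum>i\<in>I. p i * (a i + b i)\<^sup>2) = ?A + 2 * (\<Sum>i\<in>I. p i * (a i * b i)) + ?B"
    by (simp add: power2_sum sum.distrib sum_distrib_left algebra_simps)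
  also have "\<dots> \<le> ?A + 2 * (sqrt ?A * sqrt ?B) + ?B"
    using weighted_Cauchy_Schwarz[of I p a b] assms by (auto simp: abs_le_iff)
  also have "\<dots> = (sqrt ?A + sqrt ?B)\<^sup>2" using nn by (simp add: power2_sum)
  finally show "(\<Sum>i\<in>I. p i * (a i + b i)\<^sup>2) \<le> (sqrt ?A + sqrt ?B)\<^sup>2" .
qed

lemma sqrt_le_1_plus: "0 \<le> x \<Longrightarrow> sqrt x \<le> 1 + x"
  by (rule real_le_lsqrt) (auto simp: power2_eq_square algebra_simps)

lemma tempered_sqrt: assumes "tempered C f" "\<And>x. 0 \<le> f x" shows "tempered C (\<lambda>x. sqrt (f x))"
proof -
  obtain K q where K: "0 \<le> K" "\<And>x. \<bar>1 + f x\<bar> \<le> K * (1 + (\<Sum>c\<in>C. \<bar>x c\<bar>)) ^ q"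
    using temperedE[OF tempered_add[OF tempered_const[of C 1] assms(1)]] by blast
  show ?thesis
  proof (rule temperedI)
    show "continuous_on UNIV (\<lambda>x. sqrt (f x))" using assms by (intro continuous_intros tempered_cont)
    show "\<bar>sqrt (f x)\<bar> \<le> K * (1 + (\<Sum>c\<in>C. \<bar>x c\<bar>)) ^ q" for x
      using K(2)[of x] sqrt_le_1_plus[OF assms(2)[of x]] assms(2)[of x] by simp
  qed
qed

text \<open>Normalising factors: the summand a > 0 keeps the root away from 0, so the factor and its
  derivative as a function of \<open>g\<close> are bounded even where \<open>g\<close>
  vanishes.\<close>

lemma pder_inverse_sqrt:
  assumes g: "pder C c g g'" and "\<And>x. 0 \<le> g x" and a: "a > 0"
  shows "pder C c (\<lambda>x. 1 / sqrt (a + g x)) (\<lambda>x. - ((1 / sqrt (a + g x)) ^ 3) / 2 * g' x)"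
proof (rule pder_compose[OF g, where S="{0..}" and h="\<lambda>y. 1 / sqrt (a + y)" and h'="\<lambda>y. - ((1 / sqrt (a + y)) ^ 3) / 2"
      and B="1 / sqrt a" and B'="(1 / sqrt a)^3 / 2"])
  fix y :: real assume y: "y \<in> {0..}"
  then have p: "a + y > 0" using a by auto
  have "sqrt (a + y) * sqrt (a + y) = a + y" using p by simp
  then show "((\<lambda>y. 1 / sqrt (a + y)) has_real_derivative - ((1 / sqrt (a + y)) ^ 3) / 2) (at y)"
    using p by (auto intro!: derivative_eq_intros simp: power3_eq_cube field_simps)
  have le: "1 / sqrt (a + y) \<le> 1 / sqrt a" using y a by (simp add: frac_le)
  then show "\<bar>1 / sqrt (a + y)\<bar> \<le> 1 / sqrt a" using p by simp
  show "abs (- ((1 / sqrt (a + y)) ^ 3) / 2) \<le> (1 / sqrt a) ^ 3 / 2"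
    using p power_mono[OF le, of 3] by (simp add: power_abs)
next
  show "continuous_on {0..} (\<lambda>y. - ((1 / sqrt (a + y)) ^ 3) / 2)"
    using a by (intro continuous_intros) (auto simp: add_nonneg_eq_0_iff)
qed (use assms in auto)

text \<open>The pointwise half of the closability estimate, with \<open>t\<close>, \<open>T\<close>,
  \<open>H\<close> in the roles of \<theta>, D\<theta> and D\<xi>. The first factor is the
  derivative of l \<theta>, that is of \<theta> pulled into the unit ball, and r H is almost the
  unit vector along H, so their inner product is almost |H|. The losses are \<eta> for the
  regularised norm, \<open>d\<close> for replacing D\<theta> by D\<xi>, and 1 - l^2 for the
  truncation.\<close>

lemma truncated_inner_lower_bound:
  fixes w :: "'b \<Rightarrow> real" and v :: "'c \<Rightarrow> real" and t :: "'b \<Rightarrow> real" and T H :: "'b \<Rightarrow> 'c \<Rightarrow> real"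
  assumes w: "\<And>b. b \<in> B \<Longrightarrow> 0 \<le> w b" and v: "\<And>c. c \<in> C \<Longrightarrow> 0 \<le> v c" and \<eta>: "\<eta> > 0"
  defines "l \<equiv> 1 / sqrt (1 + (\<Sum>b\<in>B. w b * (t b)\<^sup>2))"
    and "h \<equiv> sqrt (\<Sum>b\<in>B. \<Sum>c\<in>C. w b * v c * (H b c)\<^sup>2)"
    and "d \<equiv> sqrt (\<Sum>b\<in>B. \<Sum>c\<in>C. w b * v c * (T b c - H b c)\<^sup>2)"
    and "r \<equiv> 1 / sqrt (\<eta>\<^sup>2 + (\<Sum>b\<in>B. \<Sum>c\<in>C. w b * v c * (H b c)\<^sup>2))"
  shows "h - \<eta> - 2 * d - 2 * (1 - l\<^sup>2) * h \<le>
    (\<Sum>b\<in>B. \<Sum>c\<in>C. w b * v c * ((- (l ^ 3) * (\<Sum>e\<in>B. w e * (t e * T e c)) * t b + l * T b c) * (r * H b c)))"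
proof -
  define s where "s = sqrt (\<Sum>b\<in>B. w b * (t b)\<^sup>2)"
  define p where "p = (\<lambda>(b, c). w b * v c)"
  define h2 where "h2 = (\<Sum>b\<in>B. \<Sum>c\<in>C. w b * v c * (H b c)\<^sup>2)"
  have p: "\<And>i. i \<in> B \<times> C \<Longrightarrow> 0 \<le> p i" using w v by (auto simp: p_def)
  have S: "(\<Sum>b\<in>B. \<Sum>c\<in>C. w b * v c * f b c) = (\<Sum>i\<in>B \<times> C. p i * f (fst i) (snd i))" for f
    by (simp add: sum.cartesian_product p_def case_prod_beta)
  have h2: "0 \<le> h2" unfolding h2_def using w v by (intro sum_nonneg mult_nonneg_nonneg) auto
  have "h = sqrt h2" unfolding h_def h2_def ..
  then have hh: "h\<^sup>2 = h2" "0 \<le> h"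
    using real_sqrt_pow2[OF h2] real_sqrt_ge_zero[OF h2] by metis+
  have s2: "s\<^sup>2 = (\<Sum>b\<in>B. w b * (t b)\<^sup>2)" "0 \<le> s"
    unfolding s_def using w by (auto intro!: sum_nonneg)
  have d0: "0 \<le> d" unfolding d_def using w v by (intro real_sqrt_ge_zero sum_nonneg mult_nonneg_nonneg) auto
  have l: "l = 1 / sqrt (1 + s\<^sup>2)" unfolding l_def s2 ..
  have l2: "l\<^sup>2 = 1 / (1 + s\<^sup>2)" unfolding l by (simp add: power_divide add_nonneg_nonneg)
  have l01: "0 < l" "l \<le> 1" unfolding l by (auto simp: add_pos_nonneg)
  have ls: "l\<^sup>2 * s\<^sup>2 = 1 - l\<^sup>2" unfolding l2 by (simp add: field_simps add_nonneg_eq_0_iff)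
  have l21: "l\<^sup>2 \<le> l" "l\<^sup>2 \<le> 1" using l01 by (auto simp: power2_eq_square mult_le_one)
  have r: "r = 1 / sqrt (\<eta>\<^sup>2 + h2)" unfolding r_def h2_def ..
  have root: "h \<le> sqrt (\<eta>\<^sup>2 + h2)" "sqrt (\<eta>\<^sup>2 + h2) \<le> \<eta> + h"
  proof -
    show "h \<le> sqrt (\<eta>\<^sup>2 + h2)" by (rule real_le_rsqrt) (simp add: hh)
    show "sqrt (\<eta>\<^sup>2 + h2) \<le> \<eta> + h"
      using \<eta> hh by (intro real_le_lsqrt) (auto simp: power2_sum mult_nonneg_nonneg)
  qed
  have q0: "sqrt (\<eta>\<^sup>2 + h2) > 0" using \<eta> h2 by (simp add: add_pos_nonneg)
  have r0: "r > 0" using q0 by (simp add: r)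
  have rh: "r * h \<le> 1" using root q0 by (simp add: r)
  \<comment> \<open>The regularised norm is at most \<eta> + h, so dividing h^2 by it loses at most
    \<eta>; for h below \<eta> the left side is not positive.\<close>
  have rh2: "h - \<eta> \<le> r * h2"
  proof -
    have "(h - \<eta>) * sqrt (\<eta>\<^sup>2 + h2) \<le> h2"
    proof (cases "h \<le> \<eta>")
      case True
      then have "(h - \<eta>) * sqrt (\<eta>\<^sup>2 + h2) \<le> 0" using q0 by (intro mult_nonpos_nonneg) auto
      then show ?thesis using h2 by simp
    next
      case False
      then have "(h - \<eta>) * sqrt (\<eta>\<^sup>2 + h2) \<le> (h - \<eta>) * (\<eta> + h)" using root by (intro mult_left_mono) auto
      also have "\<dots> = h2 - \<eta>\<^sup>2" by (simp add: algebra_simps power2_eq_square flip: hh(1))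
      finally show ?thesis using zero_le_power2[of \<eta>] by linarith
    qed
    then show ?thesis using q0 by (simp add: r field_simps)
  qed
  define tn where "tn = sqrt (\<Sum>b\<in>B. \<Sum>c\<in>C. w b * v c * (T b c)\<^sup>2)"
  have tn: "tn \<le> h + d"
    using weighted_triangle[of "B \<times> C" p "\<lambda>(b, c). H b c" "\<lambda>(b, c). T b c - H b c"] p
    unfolding tn_def h_def d_def S by (simp add: case_prod_beta)
  have inner: "h2 - d * h \<le> (\<Sum>b\<in>B. \<Sum>c\<in>C. w b * v c * (T b c * H b c))"
  proof -
    have "\<bar>\<Sum>b\<in>B. \<Sum>c\<in>C. w b * v c * ((T b c - H b c) * H b c)\<bar> \<le> d * h"
      using weighted_Cauchy_Schwarz[of "B \<times> C" p "\<lambda>(b, c). T b c - H b c" "\<lambda>(b, c). H b c"] p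
      unfolding h_def d_def S by (simp add: case_prod_beta)
    moreover have "(\<Sum>b\<in>B. \<Sum>c\<in>C. w b * v c * (T b c * H b c)) =
        h2 + (\<Sum>b\<in>B. \<Sum>c\<in>C. w b * v c * ((T b c - H b c) * H b c))"
      unfolding h2_def by (simp add: algebra_simps power2_eq_square flip: sum.distrib)
    ultimately show ?thesis by linarith
  qed
  define a where "a c = (\<Sum>e\<in>B. w e * (t e * T e c))" for c
  define b' where "b' c = (\<Sum>e\<in>B. w e * (t e * H e c))" for c
  have ab: "\<bar>a c\<bar> \<le> s * sqrt (\<Sum>e\<in>B. w e * (T e c)\<^sup>2)" "\<bar>b' c\<bar> \<le> s * sqrt (\<Sum>e\<in>B. w e * (H e c)\<^sup>2)" for c
    unfolding a_def b'_def s_def using weighted_Cauchy_Schwarz[of B w t] w by auto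
  have cross: "\<bar>\<Sum>c\<in>C. v c * (a c * b' c)\<bar> \<le> s\<^sup>2 * (tn * h)"
  proof -
    have "\<bar>\<Sum>c\<in>C. v c * (a c * b' c)\<bar> \<le> sqrt (\<Sum>c\<in>C. v c * (a c)\<^sup>2) * sqrt (\<Sum>c\<in>C. v c * (b' c)\<^sup>2)"
      by (rule weighted_Cauchy_Schwarz[OF v])
    also have "\<dots> \<le> (s * tn) * (s * h)"
    proof -
      have *: "sqrt (\<Sum>c\<in>C. v c * (y c)\<^sup>2) \<le> s * sqrt (\<Sum>b\<in>B. \<Sum>c\<in>C. w b * v c * (Y b c)\<^sup>2)"
        if y: "\<And>c. \<bar>y c\<bar> \<le> s * sqrt (\<Sum>e\<in>B. w e * (Y e c)\<^sup>2)" for y Y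
      proof -
        have "(y c)\<^sup>2 \<le> s\<^sup>2 * (\<Sum>e\<in>B. w e * (Y e c)\<^sup>2)" for c
          using power_mono[OF y[of c], of 2] w by (simp add: power_mult_distrib sum_nonneg)
        then have "(\<Sum>c\<in>C. v c * (y c)\<^sup>2) \<le> (\<Sum>c\<in>C. v c * (s\<^sup>2 * (\<Sum>e\<in>B. w e * (Y e c)\<^sup>2)))"
          using v by (intro sum_mono mult_left_mono) auto
        also have "\<dots> = s\<^sup>2 * (\<Sum>b\<in>B. \<Sum>c\<in>C. w b * v c * (Y b c)\<^sup>2)"
          by (subst sum.swap) (simp add: sum_distrib_left mult_ac)
        finally have "sqrt (\<Sum>c\<in>C. v c * (y c)\<^sup>2) \<le> sqrt (s\<^sup>2 * (\<Sum>b\<in>B. \<Sum>c\<in>C. w b * v c * (Y b c)\<^sup>2))"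
          by simp
        then show ?thesis using s2(2) by (simp add: real_sqrt_mult)
      qed
      show ?thesis unfolding tn_def h_def
        using *[OF ab(1)] *[OF ab(2)] s2(2) v w
        by (intro mult_mono) (auto intro!: mult_nonneg_nonneg sum_nonneg)
    qed
    finally show ?thesis by (simp add: power2_eq_square mult_ac)
  qed
  have expand: "(\<Sum>b\<in>B. \<Sum>c\<in>C. w b * v c * ((- (l ^ 3) * (\<Sum>e\<in>B. w e * (t e * T e c)) * t b + l * T b c) * (r * H b c)))
     = - (l ^ 3 * r) * (\<Sum>c\<in>C. v c * (a c * b' c)) + l * r * (\<Sum>b\<in>B. \<Sum>c\<in>C. w b * v c * (T b c * H b c))"
  proof -
    have "(\<Sum>c\<in>C. v c * (a c * b' c)) = (\<Sum>b\<in>B. \<Sum>c\<in>C. w b * v c * (a c * (t b * H b c)))"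
      unfolding b'_def by (subst sum.swap) (simp add: sum_distrib_left mult_ac)
    then show ?thesis unfolding a_def[symmetric]
      by (simp add: sum_distrib_left algebra_simps sum.distrib sum_negf sum_subtractf)
  qed
  have 1: "l * r * (h2 - d * h) \<le> l * r * (\<Sum>b\<in>B. \<Sum>c\<in>C. w b * v c * (T b c * H b c))"
    using inner l01 r0 by (intro mult_left_mono) auto
  \<comment> \<open>The derivative of the truncation factor \<open>l\<close> costs l^3 s^2 |T| r h.
    Here l^2 s^2 = 1 - l^2, while l and r h are at most 1 and |T| is at most h + d.\<close>
  have "l ^ 3 * r * (\<Sum>c\<in>C. v c * (a c * b' c)) \<le> l ^ 3 * r * (s\<^sup>2 * (tn * h))"
    using cross l01 r0 by (intro mult_left_mono) auto
  also have "\<dots> = l * (l\<^sup>2 * s\<^sup>2) * tn * (r * h)" by (simp add: power3_eq_cube power2_eq_square)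
  also have "\<dots> \<le> 1 * (1 - l\<^sup>2) * tn * 1"
    unfolding ls using l01 l21 rh r0 hh(2)
    by (intro mult_mono) (auto simp: tn_def intro!: mult_nonneg_nonneg sum_nonneg w v)
  also have "\<dots> \<le> (1 - l\<^sup>2) * (h + d)" using tn l21 by (auto intro: mult_left_mono)
  finally have 2: "l ^ 3 * r * (\<Sum>c\<in>C. v c * (a c * b' c)) \<le> (1 - l\<^sup>2) * (h + d)" .
  have 3: "l * (r * h) * d \<le> d"
  proof -
    have "l * (r * h) \<le> 1 * 1" using l01 rh r0 hh by (intro mult_mono) auto
    then show ?thesis using mult_right_mono[OF _ d0, of "l * (r * h)" 1] by simp
  qed
  have 4: "l * (h - \<eta>) \<le> l * (r * h2)" using rh2 l01 by simp
  \<comment> \<open>Weakening l to l^2 gives this loss the same form (1 - l^2) h as the one from the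
    cross term; together they make up the factor 2 in the claim.\<close>
  have 5: "l * (h - \<eta>) \<ge> l\<^sup>2 * h - \<eta>"
  proof -
    have "l\<^sup>2 * h \<le> l * h" using l21 hh by (intro mult_right_mono) auto
    moreover have "l * \<eta> \<le> \<eta>" using l01 \<eta> by simp
    ultimately show ?thesis by (simp add: algebra_simps)
  qed
  have 6: "(1 - l\<^sup>2) * d \<le> d" using mult_right_mono[OF _ d0, of "1 - l\<^sup>2" 1] by simp
  show ?thesis unfolding expand
    using 1 2 3 4 5 6 by (simp add: algebra_simps)
qed

section \<open>Energies of the derivatives and the divergence on the slots\<close>

context gaussian_slots begin

text \<open>The squared Hilbert norm of the k-th Malliavin derivative in slot coordinates;
  \<open>Dsq_eq_deriv_sq\<close> makes the identification. Recursion through \<open>partial\<close>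
  avoids multi-indices.\<close>

primrec Dsq :: "nat \<Rightarrow> (('c \<Rightarrow> real) \<Rightarrow> real) \<Rightarrow> ('c \<Rightarrow> real) \<Rightarrow> real" where
  "Dsq 0 g x = (g x)\<^sup>2"
| "Dsq (Suc k) g x = (\<Sum>c\<in>C. v c * Dsq k (partial c g) x)"

lemma Dsq_nonneg: "0 \<le> Dsq k g x"
  by (induction k arbitrary: g) (auto intro!: sum_nonneg mult_nonneg_nonneg less_imp_le[OF v_pos])

lemma Dsq_1: "Dsq 1 g x = (\<Sum>c\<in>C. v c * (partial c g x)\<^sup>2)"
  and Dsq_2: "Dsq 2 g x = (\<Sum>c\<in>C. v c * (\<Sum>d\<in>C. v d * (partial d (partial c g) x)\<^sup>2))"
  by (simp_all add: numeral_2_eq_2)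

lemma tempered_Dsq: "smooth C g \<Longrightarrow> tempered C (Dsq k g)"
proof (induction k arbitrary: g)
  case 0
  have "Dsq 0 g = (\<lambda>x. (g x)\<^sup>2)" by (auto simp: fun_eq_iff)
  then show ?case using tempered_power[OF smooth_tempered[OF 0]] by simp
next
  case (Suc k)
  have "Dsq (Suc k) g = (\<lambda>x. \<Sum>c\<in>C. v c * Dsq k (partial c g) x)" by (auto simp: fun_eq_iff)
  then show ?case using Suc by (auto intro!: tempered_sum tempered_mult smooth_partial)
qed

lemma ev_add: "tempered C f \<Longrightarrow> tempered C g \<Longrightarrow> ev (\<lambda>x. f x + g x) = ev f + ev g"
  by (rule Bochner_Integration.integral_add) (auto intro: tempered_integrable)

lemma ev_diff: "tempered C f \<Longrightarrow> tempered C g \<Longrightarrow> ev (\<lambda>x. f x - g x) = ev f - ev g"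
  by (rule Bochner_Integration.integral_diff) (auto intro: tempered_integrable)

lemma ev_sum: "(\<And>i. i \<in> I \<Longrightarrow> tempered C (f i)) \<Longrightarrow> ev (\<lambda>x. \<Sum>i\<in>I. f i x) = (\<Sum>i\<in>I. ev (f i))"
  by (rule Bochner_Integration.integral_sum) (auto intro: tempered_integrable)

lemma ev_mono: "tempered C f \<Longrightarrow> tempered C g \<Longrightarrow> (\<And>x. f x \<le> g x) \<Longrightarrow> ev f \<le> ev g"
  by (rule integral_mono) (auto intro: tempered_integrable)

text \<open>The divergence of the gradient, i.e. the (negative) Ornstein--Uhlenbeck operator.\<close>

definition dvg :: "(('c \<Rightarrow> real) \<Rightarrow> real) \<Rightarrow> ('c \<Rightarrow> real) \<Rightarrow> real" where
  "dvg g x = (\<Sum>c\<in>C. x c * partial c g x - v c * partial c (partial c g) x)"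

lemma tempered_coord' [intro]: "c \<in> C \<Longrightarrow> tempered C (\<lambda>x. x c)" using fin by auto

lemma tempered_dvg: "smooth C g \<Longrightarrow> tempered C (dvg g)"
  unfolding dvg_def[abs_def]
  by (intro tempered_sum tempered_diff tempered_mult tempered_coord' tempered_const smooth_tempered smooth_partial)

text \<open>Derivative and divergence commute up to the identity: a derivative of the divergence is
  that derivative itself plus the divergence of its gradient. Two integrations by parts then
  evaluate the second moment exactly, with no constant depending on the number of slots.\<close>

lemma dvg_square:
  assumes g: "smooth C g"
  shows "ev (\<lambda>x. (dvg g x)\<^sup>2) = ev (Dsq 1 g) + ev (Dsq 2 g)"
proof -
  define S where "S c = partial c g" for c
  have sS: "smooth C (S c)" "smooth C (partial d (S c))" "smooth C (partial e (partial d (S c)))" for c d e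
    unfolding S_def by (intro smooth_partial g)+
  note P = smooth_pder[OF sS(1)] smooth_pder[OF sS(2)]
  note c' = smooth_tempered[OF sS(1)] smooth_tempered[OF sS(2)] smooth_tempered[OF sS(3)]
  \<comment> \<open>The partial derivative of \<open>dvg g\<close>. Its first summand arises when
    the derivative hits the factor \<open>x c\<close>; it is the commutator, and the source of the
    first-order energy.\<close>
  define W where "W c x = S c x + (\<Sum>d\<in>C. x d * partial c (S d) x - v d * partial d (partial c (S d)) x)" for c x
  have pd: "pder C c (dvg g) (W c)" if c: "c \<in> C" for c
  proof -
    have "pder C c (dvg g) (\<lambda>x. \<Sum>d\<in>C. ((if c = d then 1 else 0) * S d x + x d * partial c (S d) x)
         - v d * partial c (partial d (S d)) x)"
      unfolding dvg_def[abs_def] S_def[symmetric]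
      by (intro pder_sum pder_diff pder_mult pder_coord pder_cmult P fin)
    also have "(\<lambda>x. \<Sum>d\<in>C. ((if c = d then 1 else 0) * S d x + x d * partial c (S d) x)
         - v d * partial c (partial d (S d)) x) = W c"
      using c fin by (auto simp: fun_eq_iff W_def sum.distrib sum_subtractf partial_commute[OF sS(1)]
          if_distrib[of "\<lambda>z. z * _"] sum.delta cong: if_cong)
    finally show ?thesis .
  qed
  \<comment> \<open>The operator x c - v c D_c is the adjoint of v c D_c: it is taken off
    \<open>S c\<close> and the derivative moves to \<open>dvg g\<close>.\<close>
  have 1: "ev (\<lambda>x. x c * S c x * dvg g x - v c * partial c (S c) x * dvg g x) = v c * ev (\<lambda>x. S c x * W c x)"
    if c: "c \<in> C" for c
  proof -
    note p = pder_mult[OF P(1)[of c c] pd[OF c]]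
    have a: "tempered C (\<lambda>x. partial c (S c) x * dvg g x)" "tempered C (\<lambda>x. S c x * W c x)"
      using c' tempered_dvg[OF g] pderD(2)[OF pd[OF c]] by auto
    have "v c * (ev (\<lambda>x. partial c (S c) x * dvg g x) + ev (\<lambda>x. S c x * W c x)) = ev (\<lambda>x. x c * (S c x * dvg g x))"
      using integration_by_parts[OF c p] ev_add[OF a] by simp
    moreover have "ev (\<lambda>x. x c * S c x * dvg g x - v c * partial c (S c) x * dvg g x) =
       ev (\<lambda>x. x c * (S c x * dvg g x)) - v c * ev (\<lambda>x. partial c (S c) x * dvg g x)"
      using ev_diff[of "\<lambda>x. x c * (S c x * dvg g x)" "\<lambda>x. v c * (partial c (S c) x * dvg g x)"]
        tempered_mult[OF tempered_coord'[OF c] tempered_mult[OF c'(1) tempered_dvg[OF g]]] tempered_mult[OF tempered_const a(1)]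
      by (simp add: mult.assoc)
    ultimately show ?thesis by (simp add: algebra_simps)
  qed
  have 2: "ev (\<lambda>x. x d * partial c (S d) x * S c x - v d * partial d (partial c (S d)) x * S c x)
      = v d * ev (\<lambda>x. (partial d (S c) x)\<^sup>2)" if d: "d \<in> C" for c d
  proof -
    note p = pder_mult[OF P(2)[of d c d] P(1)[of d c]]
    have com: "partial d (S c) = partial c (S d)" unfolding S_def by (rule partial_commute[OF g])
    have a: "tempered C (\<lambda>x. partial d (partial c (S d)) x * S c x)" "tempered C (\<lambda>x. partial c (S d) x * partial d (S c) x)"
      by (intro tempered_mult c')+
    have "v d * (ev (\<lambda>x. partial d (partial c (S d)) x * S c x) + ev (\<lambda>x. partial c (S d) x * partial d (S c) x))
       = ev (\<lambda>x. x d * (partial c (S d) x * S c x))"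
      using integration_by_parts[OF d p] ev_add[OF a] by simp
    moreover have "ev (\<lambda>x. x d * partial c (S d) x * S c x - v d * partial d (partial c (S d)) x * S c x) =
       ev (\<lambda>x. x d * (partial c (S d) x * S c x)) - v d * ev (\<lambda>x. partial d (partial c (S d)) x * S c x)"
      using ev_diff[of "\<lambda>x. x d * (partial c (S d) x * S c x)" "\<lambda>x. v d * (partial d (partial c (S d)) x * S c x)"]
        tempered_mult[OF tempered_coord'[OF d] tempered_mult[OF c'(2,1)]] tempered_mult[OF tempered_const a(1)]
      by (simp add: mult.assoc)
    ultimately show ?thesis by (simp add: algebra_simps power2_eq_square com)
  qed
  have "ev (\<lambda>x. (dvg g x)\<^sup>2) = ev (\<lambda>x. \<Sum>c\<in>C. x c * S c x * dvg g x - v c * partial c (S c) x * dvg g x)"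
    by (rule arg_cong[where f=ev], rule ext)
       (simp add: power2_eq_square S_def[symmetric] dvg_def[of g] sum_distrib_right[symmetric] left_diff_distrib[symmetric])
  also have "\<dots> = (\<Sum>c\<in>C. v c * ev (\<lambda>x. S c x * W c x))"
    by (subst ev_sum) (auto intro!: tempered_mult tempered_coord' c' tempered_dvg g tempered_const tempered_diff simp: 1)
  also have "\<dots> = (\<Sum>c\<in>C. v c * (ev (\<lambda>x. (S c x)\<^sup>2) + (\<Sum>d\<in>C. v d * ev (\<lambda>x. (partial d (S c) x)\<^sup>2))))"
  proof (intro sum.cong refl arg_cong2[where f="(*)"])
    fix c
    have "ev (\<lambda>x. S c x * W c x) = ev (\<lambda>x. (S c x)\<^sup>2 +
        (\<Sum>d\<in>C. x d * partial c (S d) x * S c x - v d * partial d (partial c (S d)) x * S c x))"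
      by (rule arg_cong[where f=ev], rule ext)
         (simp add: W_def power2_eq_square distrib_left sum_distrib_left algebra_simps)
    also have "\<dots> = ev (\<lambda>x. (S c x)\<^sup>2) + (\<Sum>d\<in>C. v d * ev (\<lambda>x. (partial d (S c) x)\<^sup>2))"
      by (subst ev_add, (intro tempered_power tempered_sum tempered_diff tempered_mult tempered_coord' c' tempered_const; assumption)+,
          subst ev_sum) (auto intro!: tempered_mult tempered_coord' c' tempered_const tempered_diff simp: 2)
    finally show "ev (\<lambda>x. S c x * W c x) = ev (\<lambda>x. (S c x)\<^sup>2) + (\<Sum>d\<in>C. v d * ev (\<lambda>x. (partial d (S c) x)\<^sup>2))" .
  qed
  also have "\<dots> = ev (Dsq 1 g) + ev (Dsq 2 g)"
  proof -
    have "ev (Dsq 1 g) = (\<Sum>c\<in>C. v c * ev (\<lambda>x. (S c x)\<^sup>2))"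
      unfolding Dsq_1[abs_def] S_def[symmetric] by (subst ev_sum) (auto intro!: c' tempered_power tempered_mult)
    moreover have "ev (Dsq 2 g) = (\<Sum>c\<in>C. v c * (\<Sum>d\<in>C. v d * ev (\<lambda>x. (partial d (S c) x)\<^sup>2)))"
      unfolding Dsq_2[abs_def] S_def[symmetric]
      by (subst ev_sum, (intro c' tempered_power tempered_mult tempered_sum tempered_const; assumption)+)
         (simp, subst ev_sum, auto intro!: c' tempered_power tempered_mult)
    ultimately show ?thesis by (simp add: distrib_left sum.distrib)
  qed
  finally show ?thesis .
qed

end

section \<open>The L^1 closability estimate on the slots\<close>

context gaussian_slots begin

lemma ev_sum2:
  assumes "\<And>i j. i \<in> I \<Longrightarrow> j \<in> J \<Longrightarrow> tempered C (f i j)"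
  shows "ev (\<lambda>x. \<Sum>i\<in>I. \<Sum>j\<in>J. f i j x) = (\<Sum>i\<in>I. \<Sum>j\<in>J. ev (f i j))"
  using assms by (subst ev_sum) (auto intro!: tempered_sum sum.cong ev_sum)

text \<open>
  Integrate \<open>\<theta> / sqrt (1 + \<bar>\<theta>\<bar>\<^sup>2)\<close> by parts against the normalised field \<open>D\<xi> / sqrt (\<eta>\<^sup>2 + \<bar>D\<xi>\<bar>\<^sup>2)\<close>, with \<open>\<theta>\<close>
  close to \<open>\<xi>\<close> in the derivative: the bound is of order \<open>L\<^sup>1\<close> in \<open>\<theta>\<close> and \<open>D(\<theta> - \<xi>)\<close>, and the second
  derivatives of \<open>\<xi>\<close> only enter with the small factor \<open>\<kappa>\<close>.
\<close>

lemma closability_estimate: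
  fixes \<theta> \<xi> :: "'b \<Rightarrow> ('c \<Rightarrow> real) \<Rightarrow> real" and w :: "'b \<Rightarrow> real"
  assumes w: "\<And>b. b \<in> B \<Longrightarrow> 0 \<le> w b"
    and \<theta>: "\<And>b. b \<in> B \<Longrightarrow> smooth C (\<theta> b)" and \<xi>: "\<And>b. b \<in> B \<Longrightarrow> smooth C (\<xi> b)"
    and \<eta>: "\<eta> > 0" and \<kappa>: "\<kappa> > 0"
  shows "ev (\<lambda>x. sqrt (\<Sum>b\<in>B. w b * Dsq 1 (\<xi> b) x))
    \<le> \<eta> + 2 * ev (\<lambda>x. sqrt (\<Sum>b\<in>B. w b * Dsq 1 (\<lambda>x. \<theta> b x - \<xi> b x) x))
      + (1 + 1 / \<eta>) / \<kappa> * ev (\<lambda>x. sqrt (\<Sum>b\<in>B. w b * (\<theta> b x)\<^sup>2))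
      + 2 * \<kappa> * (1 + 1 / \<eta>) * (ev (\<lambda>x. \<Sum>b\<in>B. w b * Dsq 1 (\<xi> b) x) + ev (\<lambda>x. \<Sum>b\<in>B. w b * Dsq 2 (\<xi> b) x))"
proof -
  define nS where "nS x = (\<Sum>b\<in>B. w b * (\<theta> b x)\<^sup>2)" for x
  define nD where "nD x = (\<Sum>b\<in>B. w b * Dsq 1 (\<xi> b) x)" for x
  define nE where "nE x = (\<Sum>b\<in>B. w b * Dsq 1 (\<lambda>x. \<theta> b x - \<xi> b x) x)" for x
  define n2 where "n2 x = (\<Sum>b\<in>B. w b * Dsq 2 (\<xi> b) x)" for x
  define nV where "nV x = (\<Sum>b\<in>B. w b * (dvg (\<xi> b) x)\<^sup>2)" for x
  \<comment> \<open>The field l \<theta> is \<theta> pulled into the unit ball, which permits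
    pairing with quantities that have just second moments; r D\<xi> is D\<xi> divided by its
    regularised norm.\<close>
  define l where "l x = 1 / sqrt (1 + nS x)" for x
  define r where "r x = 1 / sqrt (\<eta>\<^sup>2 + nD x)" for x
  have nn: "0 \<le> nS x" "0 \<le> nD x" "0 \<le> nE x" "0 \<le> n2 x" "0 \<le> nV x" for x
    using w by (auto simp: nS_def nD_def nE_def n2_def nV_def intro!: sum_nonneg mult_nonneg_nonneg Dsq_nonneg less_imp_le[OF v_pos])
  have cn: "tempered C nS" "tempered C nD" "tempered C nE" "tempered C n2" "tempered C nV"
    unfolding nS_def[abs_def] nD_def[abs_def] nE_def[abs_def] n2_def[abs_def] nV_def[abs_def]
    by (intro tempered_sum tempered_mult tempered_const tempered_power smooth_tempered \<theta> \<xi> tempered_Dsq tempered_dvg smooth_diff; assumption)+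
  have nD_eq: "nD x = (\<Sum>b\<in>B. \<Sum>c\<in>C. w b * v c * (partial c (\<xi> b) x)\<^sup>2)" for x
    unfolding nD_def Dsq_1 by (simp add: sum_distrib_left mult_ac)
  have nE_eq: "nE x = (\<Sum>b\<in>B. \<Sum>c\<in>C. w b * v c * (partial c (\<theta> b) x - partial c (\<xi> b) x)\<^sup>2)" for x
    unfolding nE_def Dsq_1 using partial_diff[OF \<theta> \<xi>] by (simp add: sum_distrib_left mult_ac)
  have n2_eq: "n2 x = (\<Sum>c\<in>C. v c * (\<Sum>b\<in>B. \<Sum>e\<in>C. w b * v e * (partial c (partial e (\<xi> b)) x)\<^sup>2))" for x
  proof -
    have "n2 x = (\<Sum>b\<in>B. w b * (\<Sum>c\<in>C. v c * (\<Sum>e\<in>C. v e * (partial c (partial e (\<xi> b)) x)\<^sup>2)))"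
      unfolding n2_def Dsq_2 using partial_commute[OF \<xi>] by (auto intro!: sum.cong)
    also have "\<dots> = (\<Sum>b\<in>B. \<Sum>c\<in>C. v c * (\<Sum>e\<in>C. w b * v e * (partial c (partial e (\<xi> b)) x)\<^sup>2))"
      by (simp add: sum_distrib_left mult_ac)
    also have "\<dots> = (\<Sum>c\<in>C. v c * (\<Sum>b\<in>B. \<Sum>e\<in>C. w b * v e * (partial c (partial e (\<xi> b)) x)\<^sup>2))"
      by (subst sum.swap) (simp add: sum_distrib_left)
    finally show ?thesis .
  qed
  define l' where "l' c x = - (l x ^ 3) * (\<Sum>e\<in>B. w e * (\<theta> e x * partial c (\<theta> e) x))" for c x
  define r' where "r' c x = - (r x ^ 3) * (\<Sum>b\<in>B. \<Sum>e\<in>C. w b * v e * (partial e (\<xi> b) x * partial c (partial e (\<xi> b)) x))" for c x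
  have pl: "pder C c l (l' c)" for c
  proof -
    have "pder C c nS (\<lambda>x. \<Sum>b\<in>B. w b * (partial c (\<theta> b) x * \<theta> b x + \<theta> b x * partial c (\<theta> b) x))"
      unfolding nS_def[abs_def] power2_eq_square
      by (intro pder_sum pder_cmult pder_mult smooth_pder \<theta>)
    from pder_inverse_sqrt[OF this nn(1) zero_less_one] show ?thesis
      unfolding l_def[symmetric] l'_def[abs_def]
      by (rule back_subst[where P="\<lambda>z. pder C c _ z"]) (auto simp: fun_eq_iff sum_distrib_left l_def intro!: sum.cong)
  qed
  have pr: "pder C c r (r' c)" for c
  proof -
    have "pder C c nD (\<lambda>x. \<Sum>b\<in>B. \<Sum>e\<in>C. w b * v e *
        (partial c (partial e (\<xi> b)) x * partial e (\<xi> b) x + partial e (\<xi> b) x * partial c (partial e (\<xi> b)) x))"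
      unfolding nD_eq[abs_def] power2_eq_square
      by (intro pder_sum pder_cmult pder_mult smooth_pder smooth_partial \<xi>)
    from pder_inverse_sqrt[OF this nn(2), of "\<eta>\<^sup>2"] \<eta> show ?thesis
      unfolding r_def[symmetric] r'_def[abs_def]
      by (auto elim!: back_subst[where P="\<lambda>z. pder C c r z"] simp: fun_eq_iff sum_distrib_left r_def[abs_def] mult_ac)
  qed
  \<comment> \<open>\<open>I\<close> pairs D(l \<theta>) with the field r D\<xi>. \<open>R\<close>
    is what integration by parts makes of it: l \<theta> paired with the divergence of that field,
    that is r times the divergence of the gradient minus the derivative of r along D\<xi>.\<close>
  define I where "I x = (\<Sum>b\<in>B. \<Sum>c\<in>C. w b * v c *
     ((l' c x * \<theta> b x + l x * partial c (\<theta> b) x) * (r x * partial c (\<xi> b) x)))" for x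
  define R where "R x = (\<Sum>b\<in>B. w b * (l x * \<theta> b x *
      (r x * dvg (\<xi> b) x - (\<Sum>c\<in>C. v c * (r' c x * partial c (\<xi> b) x)))))" for x
  note base = pderD(1)[OF pl] pderD(1)[OF pr] pderD(2)[OF pl] pderD(2)[OF pr] smooth_tempered[OF \<theta>] smooth_tempered[OF \<xi>]
    smooth_tempered[OF smooth_partial[OF \<theta>]] smooth_tempered[OF smooth_partial[OF \<xi>]]
    smooth_tempered[OF smooth_partial[OF smooth_partial[OF \<xi>]]] tempered_dvg[OF \<xi>]
  have cI: "tempered C I" and cR: "tempered C R" unfolding I_def[abs_def] R_def[abs_def]
    by (intro tempered_sum tempered_mult tempered_add tempered_diff tempered_const base; assumption)+
  have "ev I = ev R"
  proof -
    define G where "G b c x = l x * \<theta> b x * (r x * partial c (\<xi> b) x)" for b c x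
    define G1 where "G1 b c x = (l' c x * \<theta> b x + l x * partial c (\<theta> b) x) * (r x * partial c (\<xi> b) x)" for b c x
    define G2 where "G2 b c x = l x * \<theta> b x * (r' c x * partial c (\<xi> b) x + r x * partial c (partial c (\<xi> b)) x)" for b c x
    have cG: "tempered C (G b c)" "tempered C (G1 b c)" "tempered C (G2 b c)" if "b \<in> B" for b c
      unfolding G_def[abs_def] G1_def[abs_def] G2_def[abs_def]
      using that by (intro tempered_sum tempered_mult tempered_add tempered_diff tempered_const base; assumption)+
    have step: "ev (\<lambda>x. w b * v c * G1 b c x) = ev (\<lambda>x. w b * (x c * G b c x - v c * G2 b c x))"
      if "b \<in> B" "c \<in> C" for b c
    proof -
      have "pder C c (G b c) (\<lambda>x. G1 b c x + G2 b c x)"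
        unfolding G_def[abs_def] G1_def G2_def
        by (rule pder_mult[OF pder_mult[OF pl smooth_pder[OF \<theta>]]
            pder_mult[OF pr smooth_pder[OF smooth_partial[OF \<xi>]]]]) (rule that)+
      from integration_by_parts[OF that(2) this]
      have "v c * (ev (G1 b c) + ev (G2 b c)) = ev (\<lambda>x. x c * G b c x)"
        using ev_add[OF cG(2,3)[OF that(1), of c]] by simp
      moreover have "ev (\<lambda>x. x c * G b c x - v c * G2 b c x) = ev (\<lambda>x. x c * G b c x) - v c * ev (G2 b c)"
        using ev_diff[OF tempered_mult[OF tempered_coord'[OF that(2)] cG(1)[OF that(1), of c]]
            tempered_mult[OF tempered_const[of C "v c"] cG(3)[OF that(1), of c]]] by simp
      ultimately have e: "v c * ev (G1 b c) = ev (\<lambda>x. x c * G b c x - v c * G2 b c x)"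
        by (simp add: algebra_simps)
      have "ev (\<lambda>x. w b * v c * G1 b c x) = w b * (v c * ev (G1 b c))" by simp
      then show ?thesis unfolding e by simp
    qed
    have "ev I = (\<Sum>b\<in>B. \<Sum>c\<in>C. ev (\<lambda>x. w b * v c * G1 b c x))"
      unfolding I_def[abs_def] G1_def[symmetric]
      by (rule ev_sum2) (intro tempered_mult tempered_const cG; assumption)
    also have "\<dots> = (\<Sum>b\<in>B. \<Sum>c\<in>C. ev (\<lambda>x. w b * (x c * G b c x - v c * G2 b c x)))"
      by (intro sum.cong refl step)
    also have "\<dots> = ev (\<lambda>x. \<Sum>b\<in>B. \<Sum>c\<in>C. w b * (x c * G b c x - v c * G2 b c x))"
      by (rule ev_sum2[symmetric]) (intro tempered_mult tempered_const tempered_diff tempered_coord' cG; assumption)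
    also have "(\<lambda>x. \<Sum>b\<in>B. \<Sum>c\<in>C. w b * (x c * G b c x - v c * G2 b c x)) = R"
      unfolding R_def[abs_def] dvg_def G_def G2_def
      by (intro ext sum.cong refl)
         (simp add: sum_distrib_left algebra_simps sum.distrib sum_subtractf)
    finally show ?thesis .
  qed
  have I_ge: "sqrt (nD x) - \<eta> - 2 * sqrt (nE x) - 2 * (1 - (l x)\<^sup>2) * sqrt (nD x) \<le> I x" for x
    unfolding I_def l'_def l_def r_def nS_def nD_eq nE_eq
    by (rule truncated_inner_lower_bound) (use w v_pos \<eta> in \<open>auto intro: less_imp_le\<close>)
  \<comment> \<open>With |\<theta>|^2 = \<open>nS x\<close>, the defect 1 - l^2 is |\<theta>|^2 / (1
    + |\<theta>|^2), at most 1 and also at most |\<theta>|. The second bound is what makes the final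
    estimate linear in |\<theta>|.\<close>
  have l2: "(l x)\<^sup>2 * nS x = 1 - (l x)\<^sup>2" "0 < l x" "(l x)\<^sup>2 \<le> 1" "1 - (l x)\<^sup>2 \<le> sqrt (nS x)" for x
  proof -
    have p: "1 + nS x > 0" using nn(1)[of x] by simp
    have e: "(l x)\<^sup>2 = 1 / (1 + nS x)" using p by (simp add: l_def power_divide)
    show "(l x)\<^sup>2 * nS x = 1 - (l x)\<^sup>2" "(l x)\<^sup>2 \<le> 1" using p nn(1)[of x] by (auto simp: e field_simps)
    show "0 < l x" using p by (simp add: l_def)
    define s where "s = sqrt (nS x)"
    have s: "nS x = s\<^sup>2" "0 \<le> s" using nn(1)[of x] by (auto simp: s_def)
    have "s \<le> 1 + s\<^sup>2" using sqrt_le_1_plus[of "s\<^sup>2"] s by simp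
    then have "s * s \<le> s * (1 + s\<^sup>2)" using s by (intro mult_left_mono) auto
    moreover have "1 + s * s > 0" by (simp add: add_pos_nonneg)
    ultimately show "1 - (l x)\<^sup>2 \<le> sqrt (nS x)"
      unfolding e s(1) using s(2) by (simp add: field_simps power2_eq_square)
  qed
  have R_le: "R x \<le> 1 / \<eta> * (sqrt (nS x) / \<kappa> + \<kappa> * (nV x + n2 x))" for x
  proof -
    have q: "sqrt (\<eta>\<^sup>2 + nD x) > 0" using \<eta> nn(2)[of x] by (simp add: add_pos_nonneg)
    have r: "0 < r x" "r x \<le> 1 / \<eta>" "r x * sqrt (nD x) \<le> 1"
    proof -
      show "0 < r x" using q by (simp add: r_def)
      have "\<eta> \<le> sqrt (\<eta>\<^sup>2 + nD x)" by (rule real_le_rsqrt) (simp add: nn)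
      then show "r x \<le> 1 / \<eta>" using \<eta> unfolding r_def by (intro frac_le) auto
      have "sqrt (nD x) \<le> sqrt (\<eta>\<^sup>2 + nD x)" by simp
      then show "r x * sqrt (nD x) \<le> 1" using q unfolding r_def by (simp add: field_simps)
    qed
    let ?t = "sqrt (nS x)" and ?d = "sqrt (nV x)" and ?e = "sqrt (n2 x)" and ?D = "sqrt (nD x)"
    have a: "\<bar>\<Sum>b\<in>B. w b * (\<theta> b x * dvg (\<xi> b) x)\<bar> \<le> ?t * ?d"
      unfolding nS_def nV_def by (rule weighted_Cauchy_Schwarz[OF w])
    define U where "U c = (\<Sum>b\<in>B. w b * (\<theta> b x * partial c (\<xi> b) x))" for c
    define Z where "Z c = (\<Sum>b\<in>B. \<Sum>e\<in>C. w b * v e * (partial e (\<xi> b) x * partial c (partial e (\<xi> b)) x))" for c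
    have U: "(U c)\<^sup>2 \<le> nS x * (\<Sum>b\<in>B. w b * (partial c (\<xi> b) x)\<^sup>2)" for c
      using power_mono[OF weighted_Cauchy_Schwarz[of B w "\<lambda>b. \<theta> b x" "\<lambda>b. partial c (\<xi> b) x", OF w] abs_ge_zero, of 2]
        nn(1)[of x] w by (simp add: U_def nS_def power_mult_distrib sum_nonneg)
    have Z: "(Z c)\<^sup>2 \<le> nD x * (\<Sum>b\<in>B. \<Sum>e\<in>C. w b * v e * (partial c (partial e (\<xi> b)) x)\<^sup>2)" for c
    proof -
      have S: "(\<Sum>b\<in>B. \<Sum>c\<in>C. w b * v c * f b c) = (\<Sum>i\<in>B \<times> C. (w (fst i) * v (snd i)) * f (fst i) (snd i))" for f
        by (simp add: sum.cartesian_product case_prod_beta)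
      have "\<bar>Z c\<bar> \<le> sqrt (nD x) * sqrt (\<Sum>b\<in>B. \<Sum>e\<in>C. w b * v e * (partial c (partial e (\<xi> b)) x)\<^sup>2)"
        unfolding Z_def nD_eq S
        by (rule weighted_Cauchy_Schwarz) (use w v_pos in \<open>auto intro!: mult_nonneg_nonneg less_imp_le[OF v_pos]\<close>)
      from power_mono[OF this abs_ge_zero, of 2] show ?thesis
        using nn(2)[of x] w v_pos by (simp add: power_mult_distrib sum_nonneg less_imp_le[OF v_pos])
    qed
    have "\<bar>\<Sum>c\<in>C. v c * (U c * Z c)\<bar> \<le> sqrt (\<Sum>c\<in>C. v c * (U c)\<^sup>2) * sqrt (\<Sum>c\<in>C. v c * (Z c)\<^sup>2)"
      by (rule weighted_Cauchy_Schwarz) (use v_pos in \<open>auto intro: less_imp_le\<close>)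
    also have "\<dots> \<le> (?t * ?D) * (?D * ?e)"
    proof -
      have "(\<Sum>c\<in>C. v c * (U c)\<^sup>2) \<le> (\<Sum>c\<in>C. v c * (nS x * (\<Sum>b\<in>B. w b * (partial c (\<xi> b) x)\<^sup>2)))"
        using U v_pos by (intro sum_mono mult_left_mono) (auto intro: less_imp_le)
      also have "\<dots> = nS x * nD x"
        unfolding nD_eq by (subst sum.swap) (simp add: sum_distrib_left mult_ac)
      finally have u: "sqrt (\<Sum>c\<in>C. v c * (U c)\<^sup>2) \<le> ?t * ?D" by (simp flip: real_sqrt_mult)
      have "(\<Sum>c\<in>C. v c * (Z c)\<^sup>2) \<le> (\<Sum>c\<in>C. v c * (nD x * (\<Sum>b\<in>B. \<Sum>e\<in>C. w b * v e * (partial c (partial e (\<xi> b)) x)\<^sup>2)))"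
        using Z v_pos by (intro sum_mono mult_left_mono) (auto intro: less_imp_le)
      also have "\<dots> = nD x * n2 x"
        unfolding n2_eq by (simp add: sum_distrib_left mult_ac)
      finally have z: "sqrt (\<Sum>c\<in>C. v c * (Z c)\<^sup>2) \<le> ?D * ?e" by (simp flip: real_sqrt_mult)
      show ?thesis using u z nn(1,2)[of x] v_pos
        by (intro mult_mono) (auto intro!: sum_nonneg mult_nonneg_nonneg less_imp_le[OF v_pos])
    qed
    finally have b: "\<bar>\<Sum>c\<in>C. v c * (U c * Z c)\<bar> \<le> ?t * ?D * (?D * ?e)" .
    have "R x = l x * (r x * (\<Sum>b\<in>B. w b * (\<theta> b x * dvg (\<xi> b) x)) + r x ^ 3 * (\<Sum>c\<in>C. v c * (U c * Z c)))"
    proof -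
      have "(\<Sum>c\<in>C. v c * (U c * Z c)) = (\<Sum>b\<in>B. w b * (\<theta> b x * (\<Sum>c\<in>C. v c * (Z c * partial c (\<xi> b) x))))"
        unfolding U_def by (simp add: sum_distrib_left sum_distrib_right mult_ac) (rule sum.swap)
      then show ?thesis
        unfolding R_def r'_def Z_def[symmetric]
        by (simp add: algebra_simps sum_distrib_left sum.distrib sum_subtractf sum_negf)
    qed
    also have "\<dots> \<le> l x * (r x * (?t * ?d) + r x ^ 3 * (?t * ?D * (?D * ?e)))"
      using a b r(1) l2(2)[of x] by (intro mult_left_mono add_mono) auto
    also have "\<dots> = (l x * ?t) * r x * (?d + (r x * ?D) * (r x * ?D) * ?e)"
      by (simp add: power3_eq_cube algebra_simps)
    also have "\<dots> \<le> (l x * ?t) * (1 / \<eta>) * (?d + 1 * 1 * ?e)"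
      using r l2(2)[of x] nn(1,2,4,5)[of x] \<eta>
      by (intro mult_mono add_mono) (auto intro!: mult_nonneg_nonneg add_nonneg_nonneg)
    also have "\<dots> = 1 / \<eta> * ((l x * ?t) * (?d + ?e))" by simp
    \<comment> \<open>Young's inequality with weight \<kappa>. The square of l |\<theta>| equals 1 -
      l^2 and hence is at most |\<theta>|, so just an L^1 quantity of \<theta> is left.\<close>
    also have "(l x * ?t) * (?d + ?e) \<le> (l x * ?t)\<^sup>2 / \<kappa> + \<kappa> * (nV x + n2 x)"
    proof -
      let ?a = "l x * ?t"
      have "0 \<le> (?a - \<kappa> * ?d)\<^sup>2 + (?a - \<kappa> * ?e)\<^sup>2" by simp
      also have "\<dots> = 2 * ?a\<^sup>2 + \<kappa> * \<kappa> * (nV x + n2 x) - 2 * \<kappa> * (?a * (?d + ?e))"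
        using nn(4,5)[of x]
        by (simp add: power2_diff power_mult_distrib algebra_simps) (simp add: power2_eq_square mult_ac)
      also have "\<dots> \<le> 2 * (?a\<^sup>2 + \<kappa> * \<kappa> * (nV x + n2 x) - \<kappa> * (?a * (?d + ?e)))"
      proof -
        have "0 \<le> \<kappa> * \<kappa> * (nV x + n2 x)" using nn(4,5)[of x] by simp
        then show ?thesis by (simp add: right_diff_distrib distrib_left)
      qed
      finally have "\<kappa> * (?a * (?d + ?e)) \<le> ?a\<^sup>2 + \<kappa> * \<kappa> * (nV x + n2 x)" by simp
      then show ?thesis using \<kappa> by (simp add: field_simps)
    qed
    also have "(l x * ?t)\<^sup>2 \<le> sqrt (nS x)"
      using l2(1,4)[of x] nn(1)[of x] by (simp add: power_mult_distrib)
    finally show ?thesis using \<eta> \<kappa> by (simp add: mult_left_mono divide_right_mono)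
  qed
  \<comment> \<open>The truncation loss 2 (1 - l^2) |D\<xi>| is split by Young's inequality in the
    same way, again with 1 - l^2 at most |\<theta>|.\<close>
  have pw: "sqrt (nD x) \<le> (\<eta> + I x) + (2 * sqrt (nE x) + (1 / \<kappa> * sqrt (nS x) + \<kappa> * nD x))" for x
  proof -
    let ?a = "1 - (l x)\<^sup>2" and ?b = "sqrt (nD x)"
    have "0 \<le> (?a - \<kappa> * ?b)\<^sup>2" by simp
    also have "\<dots> = ?a * ?a + \<kappa> * \<kappa> * nD x - \<kappa> * (2 * ?a * ?b)"
    proof -
      have "(a - \<kappa> * b)\<^sup>2 = a * a + \<kappa> * \<kappa> * b\<^sup>2 - \<kappa> * (2 * a * b)" for a b
        by (simp add: power2_eq_square algebra_simps)
      from this[of ?a ?b] show ?thesis unfolding real_sqrt_pow2[OF nn(2)[of x]] .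
    qed
    also have "?a * ?a \<le> ?a * 1" using l2(3)[of x] by (intro mult_left_mono) auto
    finally have "\<kappa> * (2 * ?a * ?b) \<le> sqrt (nS x) + \<kappa> * \<kappa> * nD x" using l2(4)[of x] by simp
    then have "2 * ?a * ?b \<le> 1 / \<kappa> * sqrt (nS x) + \<kappa> * nD x" using \<kappa> by (simp add: field_simps)
    then show ?thesis using I_ge[of x] by simp
  qed
  note cs = tempered_sqrt[OF cn(1) nn(1)] tempered_sqrt[OF cn(2) nn(2)] tempered_sqrt[OF cn(3) nn(3)] cn cI cR
  have "ev (\<lambda>x. sqrt (nD x)) \<le> ev (\<lambda>x. (\<eta> + I x) + (2 * sqrt (nE x) + (1 / \<kappa> * sqrt (nS x) + \<kappa> * nD x)))"
    by (rule ev_mono[OF _ _ pw]) (intro tempered_add tempered_mult tempered_const cs)+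
  also have "\<dots> = \<eta> + ev I + (2 * ev (\<lambda>x. sqrt (nE x)) + (1 / \<kappa> * ev (\<lambda>x. sqrt (nS x)) + \<kappa> * ev nD))"
    by (subst ev_add, (intro tempered_add tempered_mult tempered_const cs)+)+ (simp add: prob_space)
  also have "ev I = ev R" by fact
  also have "ev R \<le> ev (\<lambda>x. 1 / \<eta> * (1 / \<kappa> * sqrt (nS x) + \<kappa> * (nV x + n2 x)))"
  proof (rule ev_mono[OF cR])
    show "tempered C (\<lambda>x. 1 / \<eta> * (1 / \<kappa> * sqrt (nS x) + \<kappa> * (nV x + n2 x)))"
      by (intro tempered_mult tempered_add tempered_const cs)
    show "R x \<le> 1 / \<eta> * (1 / \<kappa> * sqrt (nS x) + \<kappa> * (nV x + n2 x))" for x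
      using R_le[of x] by simp
  qed
  also have "\<dots> = 1 / \<eta> * (1 / \<kappa> * ev (\<lambda>x. sqrt (nS x)) + \<kappa> * (ev nV + ev n2))"
  proof -
    have "ev (\<lambda>x. 1 / \<kappa> * sqrt (nS x) + \<kappa> * (nV x + n2 x))
        = ev (\<lambda>x. 1 / \<kappa> * sqrt (nS x)) + ev (\<lambda>x. \<kappa> * (nV x + n2 x))"
      by (rule ev_add) (intro tempered_add tempered_mult tempered_const cs)+
    moreover have "ev (\<lambda>x. nV x + n2 x) = ev nV + ev n2" by (rule ev_add) (intro cs)+
    ultimately show ?thesis by simp
  qed
  also have "ev nV = ev nD + ev n2"
  proof -
    have "ev nV = (\<Sum>b\<in>B. w b * ev (\<lambda>x. (dvg (\<xi> b) x)\<^sup>2))"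
      unfolding nV_def[abs_def] by (subst ev_sum) (auto intro!: tempered_mult tempered_power tempered_dvg \<xi>)
    moreover have "ev nD = (\<Sum>b\<in>B. w b * ev (Dsq 1 (\<xi> b)))"
      unfolding nD_def[abs_def] by (subst ev_sum, (intro tempered_mult tempered_const tempered_Dsq \<xi>; assumption)) simp
    moreover have "ev n2 = (\<Sum>b\<in>B. w b * ev (Dsq 2 (\<xi> b)))"
      unfolding n2_def[abs_def] by (subst ev_sum, (intro tempered_mult tempered_const tempered_Dsq \<xi>; assumption)) simp
    ultimately show ?thesis
      using dvg_square[OF \<xi>] by (simp add: distrib_left sum.distrib)
  qed
  finally have fin: "ev (\<lambda>x. sqrt (nD x)) \<le> \<eta> + 1 / \<eta> * (1 / \<kappa> * ev (\<lambda>x. sqrt (nS x)) + \<kappa> * (ev nD + ev n2 + ev n2))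
     + (2 * ev (\<lambda>x. sqrt (nE x)) + (1 / \<kappa> * ev (\<lambda>x. sqrt (nS x)) + \<kappa> * ev nD))" by simp
  have nn': "0 \<le> ev nD" "0 \<le> ev n2" using nn by (auto intro!: integral_nonneg_AE)
  have "1 / \<eta> * (\<kappa> * (ev nD + ev n2 + ev n2)) + \<kappa> * ev nD \<le> 1 / \<eta> * (\<kappa> * (2 * (ev nD + ev n2))) + \<kappa> * (2 * (ev nD + ev n2))"
    using nn' \<eta> \<kappa> by (intro add_mono mult_left_mono) auto
  with fin show ?thesis
    unfolding nS_def nD_def nE_def n2_def by (simp add: algebra_simps add_divide_distrib)
qed

end

section \<open>Malliavin's integration by parts on the slots\<close>

lemma Basis_matrix_cases:
  fixes u :: "real ^ 'n ^ 'm"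
  assumes "u \<in> Basis"
  obtains i j where "\<And>A. A \<bullet> u = A $ i $ j"
proof -
  obtain i u' where u: "u = axis i u'" "u' \<in> Basis" using assms unfolding Basis_vec_def by blast
  obtain j where j: "u' = axis j 1" using u(2) unfolding Basis_vec_def by auto
  show ?thesis by (rule that[of i j]) (simp add: u(1) j inner_axis)
qed

lemma norm_matrix_le_sum: "norm (A :: real ^ 'n ^ 'm) \<le> (\<Sum>i\<in>UNIV. \<Sum>j\<in>UNIV. \<bar>A $ i $ j\<bar>)"
proof -
  have "norm A \<le> (\<Sum>i\<in>UNIV. norm (A $ i))" unfolding norm_vec_def[of A] by (rule L2_set_le_sum) simp
  also have "\<dots> \<le> (\<Sum>i\<in>UNIV. \<Sum>j\<in>UNIV. \<bar>A $ i $ j\<bar>)" by (intro sum_mono norm_le_l1_cart)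
  finally show ?thesis .
qed

lemma matrix_entry_le_norm: "\<bar>A $ i $ j\<bar> \<le> norm (A :: real ^ 'n ^ 'm)"
  using component_le_norm_cart[of "A $ i" j] Finite_Cartesian_Product.norm_nth_le[of A i] by linarith

context gaussian_slots begin

definition cov :: "('d \<Rightarrow> ('c \<Rightarrow> real) \<Rightarrow> real) \<Rightarrow> ('c \<Rightarrow> real) \<Rightarrow> real ^ 'd ^ 'd" where
  "cov F x = (\<chi> a b. \<Sum>c\<in>C. v c * (partial c (F a) x * partial c (F b) x))"

lemma cov_diag: "cov F x $ a $ a = Dsq 1 (F a) x"
  by (simp add: cov_def power2_eq_square)

text \<open>The divergence of the field h T(\<sigma>) DF contains the derivative of T(\<sigma>)
  along DF, of size |DT| |DF|^2 |D^2 F|. The diagonal of \<sigma> consists of the numbers |DF a|^2,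
  so the bound on \<open>norm A * norm (DT a b A)\<close> absorbs the first derivatives, and what
  remains is linear in |D^2 F|. The constant involves the dimension of the vector but not the number
  of slots.\<close>

lemma integration_by_parts_estimate:
  fixes F :: "'d::finite \<Rightarrow> ('c \<Rightarrow> real) \<Rightarrow> real" and f :: "real ^ 'd \<Rightarrow> real"
    and T :: "'d \<Rightarrow> 'd \<Rightarrow> real ^ 'd ^ 'd \<Rightarrow> real" and m :: "real ^ 'd ^ 'd \<Rightarrow> real" and h :: "real ^ 'd"
    and B B' :: real
  assumes F: "\<And>a. smooth C (F a)"
    and f: "\<And>y. (f has_derivative (\<lambda>u. Gf y \<bullet> u)) (at y)" "continuous_on UNIV Gf"
      "\<And>y. \<bar>f y\<bar> \<le> 1" "\<And>y. norm (Gf y) \<le> B'"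
    and T: "\<And>a b A. (T a b has_derivative (\<lambda>u. DT a b A \<bullet> u)) (at A)" "\<And>a b. continuous_on UNIV (DT a b)"
      "\<And>a b A. \<bar>T a b A\<bar> \<le> B" "\<And>a b A. norm (DT a b A) \<le> B" "\<And>a b A. norm A * norm (DT a b A) \<le> B"
    and inv: "\<And>A a e. (\<Sum>b\<in>UNIV. T a b A * A $ b $ e) = (if a = e then m A else 0)"
  shows "\<bar>ev (\<lambda>x. m (cov F x) * (Gf (\<chi> a. F a x) \<bullet> h))\<bar>
    \<le> B * (CARD('d) + 2 * CARD('d) ^ 3) * norm h * (CARD('d) + (\<Sum>a\<in>UNIV. ev (Dsq 1 (F a)) + ev (Dsq 2 (F a))))"
proof -
  define D where "D = real CARD('d)"
  define Fv where "Fv x = (\<chi> a. F a x)" for x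
  define dFv where "dFv c x = (\<chi> a. partial c (F a) x)" for c x
  define ds where "ds c x = (\<chi> e g. \<Sum>d\<in>C. v d * (partial c (partial d (F e)) x * partial d (F g) x
     + partial d (F e) x * partial c (partial d (F g)) x))" for c x
  define Th where "Th b x = (\<Sum>a\<in>UNIV. h $ a * T a b (cov F x))" for b x
  define dTh where "dTh c b x = (\<Sum>a\<in>UNIV. h $ a * (DT a b (cov F x) \<bullet> ds c x))" for c b x
  have B0: "0 \<le> B" using T(3)[of undefined undefined undefined] by linarith
  have D0: "0 \<le> D" by (simp add: D_def)
  have pf: "pder C c (\<lambda>x. f (Fv x)) (\<lambda>x. Gf (Fv x) \<bullet> dFv c x)" for c
  proof (rule pder_compose_gradient[OF _ f])
    fix b :: "real ^ 'd" assume "b \<in> Basis"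
    then obtain i where b: "b = axis i 1" unfolding Basis_vec_def by auto
    show "pder C c (\<lambda>x. Fv x \<bullet> b) (\<lambda>x. dFv c x \<bullet> b)"
      unfolding b by (simp add: inner_axis Fv_def dFv_def smooth_pder[OF F])
  qed
  have pT: "pder C c (\<lambda>x. T a b (cov F x)) (\<lambda>x. DT a b (cov F x) \<bullet> ds c x)" for a b c
  proof (rule pder_compose_gradient[OF _ T(1,2,3,4)])
    fix u :: "real ^ 'd ^ 'd" assume "u \<in> Basis"
    then obtain i j where u: "\<And>A. A \<bullet> u = A $ i $ j" by (rule Basis_matrix_cases) blast
    show "pder C c (\<lambda>x. cov F x \<bullet> u) (\<lambda>x. ds c x \<bullet> u)"
      unfolding u cov_def ds_def
      by simp (intro pder_sum pder_cmult pder_mult smooth_pder smooth_partial F)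
  qed
  have pTh: "pder C c (Th b) (dTh c b)" for b c
    unfolding Th_def[abs_def] dTh_def[abs_def] by (intro pder_sum pder_cmult pT)
  note base = pderD(1)[OF pf] pderD(2)[OF pf] pderD(1)[OF pTh] pderD(2)[OF pTh] smooth_tempered[OF F]
    smooth_tempered[OF smooth_partial[OF F]] smooth_tempered[OF smooth_partial[OF smooth_partial[OF F]]] tempered_dvg[OF F] tempered_Dsq[OF F]
  \<comment> \<open>\<open>f\<close> times the divergence of the fields \<open>Th b\<close> D(F b):
    \<open>Th b\<close> times the divergence of the gradient, minus the derivative of
    \<open>Th b\<close> along D(F b).\<close>
  define R where "R x = (\<Sum>b\<in>UNIV. f (Fv x) * (Th b x * dvg (F b) x - (\<Sum>c\<in>C. v c * (dTh c b x * partial c (F b) x))))" for x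
  have cR: "tempered C R" unfolding R_def[abs_def]
    by (intro tempered_sum tempered_mult tempered_add tempered_diff tempered_const base)
  have pointwise: "m (cov F x) * (Gf (Fv x) \<bullet> h) =
      (\<Sum>b\<in>UNIV. \<Sum>c\<in>C. v c * ((Gf (Fv x) \<bullet> dFv c x) * (Th b x * partial c (F b) x)))" for x
  proof -
    \<comment> \<open>Here the localised inverse acts: \<open>Th\<close> is the row vector h
      T(\<sigma>), and T(\<sigma>) \<sigma> is m(\<sigma>) times the identity.\<close>
    have X: "(\<Sum>b\<in>UNIV. Th b x * cov F x $ b $ e) = m (cov F x) * h $ e" for e
    proof -
      have "(\<Sum>b\<in>UNIV. Th b x * cov F x $ b $ e) = (\<Sum>a\<in>UNIV. h $ a * (\<Sum>b\<in>UNIV. T a b (cov F x) * cov F x $ b $ e))"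
        unfolding Th_def by (simp add: sum_distrib_left sum_distrib_right mult_ac) (rule sum.swap)
      also have "\<dots> = m (cov F x) * h $ e" unfolding inv by (simp add: if_distrib cong: if_cong)
      finally show ?thesis .
    qed
    have "(\<Sum>b\<in>UNIV. \<Sum>c\<in>C. v c * ((Gf (Fv x) \<bullet> dFv c x) * (Th b x * partial c (F b) x)))
      = (\<Sum>b\<in>UNIV. \<Sum>c\<in>C. \<Sum>e\<in>UNIV. Gf (Fv x) $ e * (Th b x * (v c * (partial c (F b) x * partial c (F e) x))))"
      by (simp add: dFv_def inner_vec_def sum_distrib_left sum_distrib_right mult_ac)
    also have "\<dots> = (\<Sum>b\<in>UNIV. \<Sum>e\<in>UNIV. Gf (Fv x) $ e * (Th b x * cov F x $ b $ e))"
      by (subst sum.swap) (simp add: cov_def sum_distrib_left)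
    also have "\<dots> = (\<Sum>e\<in>UNIV. Gf (Fv x) $ e * (\<Sum>b\<in>UNIV. Th b x * cov F x $ b $ e))"
      by (subst sum.swap) (simp add: sum_distrib_left)
    also have "\<dots> = (\<Sum>e\<in>UNIV. Gf (Fv x) $ e * (m (cov F x) * h $ e))" unfolding X ..
    finally show ?thesis by (simp add: inner_vec_def sum_distrib_left mult_ac)
  qed
  have LR: "ev (\<lambda>x. m (cov F x) * (Gf (Fv x) \<bullet> h)) = ev R"
  proof -
    define H where "H b c x = f (Fv x) * (Th b x * partial c (F b) x)" for b c x
    define H1 where "H1 b c x = (Gf (Fv x) \<bullet> dFv c x) * (Th b x * partial c (F b) x)" for b c x
    define H2 where "H2 b c x = f (Fv x) * (dTh c b x * partial c (F b) x + Th b x * partial c (partial c (F b)) x)" for b c x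
    have cH: "tempered C (H b c)" "tempered C (H1 b c)" "tempered C (H2 b c)" for b c
      unfolding H_def[abs_def] H1_def[abs_def] H2_def[abs_def] by (intro tempered_mult tempered_add base)+
    have step: "ev (\<lambda>x. v c * H1 b c x) = ev (\<lambda>x. x c * H b c x - v c * H2 b c x)" if c: "c \<in> C" for b c
    proof -
      have "pder C c (H b c) (\<lambda>x. H1 b c x + H2 b c x)"
        unfolding H_def[abs_def] H1_def H2_def
        by (rule pder_mult[OF pf pder_mult[OF pTh smooth_pder[OF smooth_partial[OF F]]]])
      from integration_by_parts[OF c this]
      have "v c * (ev (H1 b c) + ev (H2 b c)) = ev (\<lambda>x. x c * H b c x)" using ev_add[OF cH(2,3)] by simp
      moreover have "ev (\<lambda>x. x c * H b c x - v c * H2 b c x) = ev (\<lambda>x. x c * H b c x) - v c * ev (H2 b c)"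
        using ev_diff[OF tempered_mult[OF tempered_coord'[OF c] cH(1)] tempered_mult[OF tempered_const[of C "v c"] cH(3)]] by simp
      ultimately show ?thesis by (simp add: algebra_simps)
    qed
    have "ev (\<lambda>x. m (cov F x) * (Gf (Fv x) \<bullet> h)) = (\<Sum>b\<in>UNIV. \<Sum>c\<in>C. ev (\<lambda>x. v c * H1 b c x))"
      unfolding pointwise H1_def[symmetric] by (rule ev_sum2) (intro tempered_mult tempered_const cH)
    also have "\<dots> = (\<Sum>b\<in>UNIV. \<Sum>c\<in>C. ev (\<lambda>x. x c * H b c x - v c * H2 b c x))"
      by (intro sum.cong refl step)
    also have "\<dots> = ev (\<lambda>x. \<Sum>b\<in>UNIV. \<Sum>c\<in>C. x c * H b c x - v c * H2 b c x)"
      by (rule ev_sum2[symmetric]) (intro tempered_mult tempered_const tempered_diff tempered_coord' cH)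
    also have "(\<lambda>x. \<Sum>b\<in>UNIV. \<Sum>c\<in>C. x c * H b c x - v c * H2 b c x) = R"
      unfolding R_def[abs_def] dvg_def H_def H2_def
      by (intro ext sum.cong refl)
         (simp add: sum_distrib_left algebra_simps sum.distrib sum_subtractf)
    finally show ?thesis .
  qed
  have R_le: "\<bar>R x\<bar> \<le> (B * norm h * D) * (\<Sum>b\<in>UNIV. 1 + (dvg (F b) x)\<^sup>2)
      + (B * norm h * (2 * D ^ 3)) * (\<Sum>e\<in>UNIV. 1 + Dsq 2 (F e) x)" for x
  proof -
    define n1 where "n1 a = Dsq 1 (F a) x" for a
    define n2 where "n2 a = Dsq 2 (F a) x" for a
    define S where "S = (\<Sum>e\<in>UNIV. 1 + n2 e)"
    define sg where "sg = cov F x"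
    have nn: "0 \<le> n1 a" "0 \<le> n2 a" for a by (simp_all add: n1_def n2_def Dsq_nonneg del: One_nat_def)
    have S0: "0 \<le> S" unfolding S_def using nn by (auto intro!: sum_nonneg add_nonneg_nonneg)
    have hsum: "(\<Sum>a\<in>UNIV. \<bar>h $ a\<bar> * k) \<le> D * norm h * k" if "0 \<le> k" for k
      using sum_bounded_above[of UNIV "\<lambda>a. \<bar>h $ a\<bar> * k" "norm h * k"] that component_le_norm_cart[of h]
      by (simp add: D_def mult_right_mono mult.assoc)
    have Th_le: "\<bar>Th b x\<bar> \<le> D * norm h * B" for b
    proof -
      have "\<bar>Th b x\<bar> \<le> (\<Sum>a\<in>UNIV. \<bar>h $ a\<bar> * B)"
        unfolding Th_def by (rule order_trans[OF sum_abs], rule sum_mono) (simp add: abs_mult mult_left_mono T(3))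
      then show ?thesis using hsum[of B] B0 by linarith
    qed
    have n2_eq: "n2 e = (\<Sum>c\<in>C. v c * (\<Sum>d\<in>C. v d * (partial c (partial d (F e)) x)\<^sup>2))" for e
      unfolding n2_def Dsq_2 using partial_commute[OF F] by (auto intro!: sum.cong)
    have v0: "\<And>c. c \<in> C \<Longrightarrow> 0 \<le> v c" using v_pos by (simp add: less_imp_le)
    \<comment> \<open>The derivative of the covariance matrix along D(F b). Contracting the slots
      before taking absolute values keeps the number of slots out of the bound.\<close>
    define Z where "Z b = (\<Sum>c\<in>C. (v c * partial c (F b) x) *\<^sub>R ds c x)" for b
    have Z_le: "norm (Z b) \<le> norm sg * (2 * D * S)" for b
    proof -
      define P where "P e g = (\<Sum>c\<in>C. v c * (partial c (F b) x * (\<Sum>d\<in>C. v d * (partial c (partial d (F e)) x * partial d (F g) x))))" for e g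
      have Zc: "Z b $ e $ g = P e g + P g e" for e g
        unfolding Z_def P_def ds_def
        by (simp add: sum_component sum_distrib_left sum.distrib algebra_simps)
      have P_le: "\<bar>P e g\<bar> \<le> norm sg * (1 + n2 e)" for e g
      proof -
        define U where "U c = (\<Sum>d\<in>C. v d * (partial c (partial d (F e)) x * partial d (F g) x))" for c
        have U2: "(U c)\<^sup>2 \<le> (\<Sum>d\<in>C. v d * (partial c (partial d (F e)) x)\<^sup>2) * n1 g" for c
        proof -
          have "\<bar>U c\<bar> \<le> sqrt (\<Sum>d\<in>C. v d * (partial c (partial d (F e)) x)\<^sup>2) * sqrt (n1 g)"
            unfolding U_def n1_def Dsq_1 by (rule weighted_Cauchy_Schwarz[OF v0])
          from power_mono[OF this abs_ge_zero, of 2] show ?thesis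
            using nn v0 by (simp add: power_mult_distrib sum_nonneg)
        qed
        have V: "(\<Sum>c\<in>C. v c * (U c)\<^sup>2) \<le> n2 e * n1 g"
        proof -
          have "(\<Sum>c\<in>C. v c * (U c)\<^sup>2) \<le> (\<Sum>c\<in>C. v c * ((\<Sum>d\<in>C. v d * (partial c (partial d (F e)) x)\<^sup>2) * n1 g))"
            using U2 v0 by (intro sum_mono mult_left_mono) auto
          then show ?thesis unfolding n2_eq by (simp add: sum_distrib_left mult_ac)
        qed
        have "\<bar>P e g\<bar> \<le> sqrt (n1 b) * sqrt (\<Sum>c\<in>C. v c * (U c)\<^sup>2)"
          unfolding P_def U_def[symmetric] n1_def Dsq_1 by (rule weighted_Cauchy_Schwarz[OF v0])
        also have "sqrt (n1 b) * sqrt (\<Sum>c\<in>C. v c * (U c)\<^sup>2) \<le> sqrt (n1 b) * (sqrt (n2 e) * sqrt (n1 g))"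
          using V by (intro mult_left_mono) (auto simp: nn simp flip: real_sqrt_mult)
        also have "\<dots> = sqrt (n1 b) * sqrt (n1 g) * sqrt (n2 e)" by simp
        also have "\<dots> \<le> norm sg * (1 + n2 e)"
        proof (intro mult_mono sqrt_le_1_plus nn)
          \<comment> \<open>The diagonal entries of the covariance are the squared norms of the
            first derivatives, so each first-derivative factor is at most the root of |sg|.\<close>
          have "n1 b \<le> norm sg" "n1 g \<le> norm sg"
            using matrix_entry_le_norm[of sg b b] matrix_entry_le_norm[of sg g g]
            by (auto simp: n1_def sg_def cov_diag abs_le_iff simp del: One_nat_def)
          then have "sqrt (n1 b) * sqrt (n1 g) \<le> sqrt (norm sg) * sqrt (norm sg)"
            using nn by (intro mult_mono) auto
          then show "sqrt (n1 b) * sqrt (n1 g) \<le> norm sg" by simp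
        qed (use nn in auto)
        finally show ?thesis .
      qed
      have "norm (Z b) \<le> (\<Sum>e\<in>UNIV. \<Sum>g\<in>UNIV. \<bar>Z b $ e $ g\<bar>)" by (rule norm_matrix_le_sum)
      also have "\<dots> \<le> (\<Sum>e\<in>UNIV. \<Sum>g\<in>UNIV. norm sg * (1 + n2 e) + norm sg * (1 + n2 g))"
        unfolding Zc by (intro sum_mono order_trans[OF abs_triangle_ineq] add_mono P_le)
      also have "\<dots> = norm sg * (2 * D * S)"
        unfolding S_def D_def by (simp add: sum.distrib algebra_simps flip: sum_distrib_left sum_distrib_right)
      finally show ?thesis .
    qed
    have dTh_le: "\<bar>\<Sum>c\<in>C. v c * (dTh c b x * partial c (F b) x)\<bar> \<le> D * norm h * (B * (2 * D * S))" for b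
    proof -
      have "(\<Sum>c\<in>C. v c * (dTh c b x * partial c (F b) x)) = (\<Sum>a\<in>UNIV. h $ a * (DT a b sg \<bullet> Z b))"
        unfolding dTh_def Z_def sg_def
        by (simp add: inner_sum_right sum_distrib_left sum_distrib_right mult_ac) (rule sum.swap)
      also have "\<bar>\<dots>\<bar> \<le> (\<Sum>a\<in>UNIV. \<bar>h $ a\<bar> * (B * (2 * D * S)))"
      proof (rule order_trans[OF sum_abs], rule sum_mono)
        fix a
        have "\<bar>DT a b sg \<bullet> Z b\<bar> \<le> norm (DT a b sg) * norm (Z b)" by (rule Cauchy_Schwarz_ineq2)
        also have "\<dots> \<le> norm (DT a b sg) * (norm sg * (2 * D * S))" by (intro mult_left_mono Z_le) simp
        also have "\<dots> = (norm sg * norm (DT a b sg)) * (2 * D * S)" by simp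
        also have "\<dots> \<le> B * (2 * D * S)" using S0 D0 by (intro mult_right_mono T(5)) auto
        finally show "\<bar>h $ a * (DT a b sg \<bullet> Z b)\<bar> \<le> \<bar>h $ a\<bar> * (B * (2 * D * S))"
          by (simp add: abs_mult mult_left_mono)
      qed
      also have "\<dots> \<le> D * norm h * (B * (2 * D * S))" using B0 D0 S0 by (intro hsum) auto
      finally show ?thesis .
    qed
    have "\<bar>R x\<bar> \<le> (\<Sum>b\<in>UNIV. D * norm h * B * (1 + (dvg (F b) x)\<^sup>2) + D * norm h * (B * (2 * D * S)))"
      unfolding R_def
    proof (rule order_trans[OF sum_abs], rule sum_mono)
      fix b
      let ?y = "Th b x * dvg (F b) x" and ?z = "\<Sum>c\<in>C. v c * (dTh c b x * partial c (F b) x)"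
      \<comment> \<open>First moments are traded for second ones, which \<open>dvg_square\<close>
        evaluates.\<close>
      have "\<bar>dvg (F b) x\<bar> \<le> 1 + (dvg (F b) x)\<^sup>2"
        using sqrt_le_1_plus[of "(dvg (F b) x)\<^sup>2"] by simp
      then have 1: "\<bar>?y\<bar> \<le> D * norm h * B * (1 + (dvg (F b) x)\<^sup>2)"
        unfolding abs_mult by (intro mult_mono Th_le) (use B0 D0 in auto)
      have "\<bar>f (Fv x) * (?y - ?z)\<bar> \<le> 1 * \<bar>?y - ?z\<bar>" unfolding abs_mult by (intro mult_right_mono f) auto
      also have "\<dots> \<le> \<bar>?y\<bar> + \<bar>?z\<bar>" by simp
      finally show "\<bar>f (Fv x) * (?y - ?z)\<bar> \<le> D * norm h * B * (1 + (dvg (F b) x)\<^sup>2) + D * norm h * (B * (2 * D * S))"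
        using 1 dTh_le[of b] by linarith
    qed
    also have "\<dots> = (B * norm h * D) * (\<Sum>b\<in>UNIV. 1 + (dvg (F b) x)\<^sup>2) + (B * norm h * (2 * D ^ 3)) * S"
      by (simp add: sum.distrib sum_distrib_left[symmetric] D_def[symmetric] power3_eq_cube algebra_simps)
    finally show ?thesis unfolding S_def n2_def .
  qed
  have "\<bar>ev R\<bar> \<le> ev (\<lambda>x. \<bar>R x\<bar>)" by (rule integral_abs_bound)
  also have "\<dots> \<le> ev (\<lambda>x. (B * norm h * D) * (\<Sum>b\<in>UNIV. 1 + (dvg (F b) x)\<^sup>2)
      + (B * norm h * (2 * D ^ 3)) * (\<Sum>e\<in>UNIV. 1 + Dsq 2 (F e) x))"
  proof (rule integral_mono)
    show "integrable M (\<lambda>\<omega>. \<bar>R (pt \<omega>)\<bar>)" using tempered_integrable[OF cR] by simp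
    show "integrable M (\<lambda>\<omega>. (B * norm h * D) * (\<Sum>b\<in>UNIV. 1 + (dvg (F b) (pt \<omega>))\<^sup>2)
      + (B * norm h * (2 * D ^ 3)) * (\<Sum>e\<in>UNIV. 1 + Dsq 2 (F e) (pt \<omega>)))"
      by (rule tempered_integrable) (intro tempered_add tempered_mult tempered_sum tempered_const tempered_power base)
  qed (rule R_le)
  also have "\<dots> = (B * norm h * D) * ev (\<lambda>x. \<Sum>b\<in>UNIV. 1 + (dvg (F b) x)\<^sup>2)
      + (B * norm h * (2 * D ^ 3)) * ev (\<lambda>x. \<Sum>e\<in>UNIV. 1 + Dsq 2 (F e) x)"
    by (subst ev_add, (intro tempered_add tempered_mult tempered_sum tempered_const tempered_power base)+) simp
  also have "ev (\<lambda>x. \<Sum>b\<in>UNIV. 1 + (dvg (F b) x)\<^sup>2) = D + (\<Sum>a\<in>UNIV. ev (Dsq 1 (F a)) + ev (Dsq 2 (F a)))"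
  proof -
    have "ev (\<lambda>x. \<Sum>b\<in>UNIV. 1 + (dvg (F b) x)\<^sup>2) = (\<Sum>b\<in>UNIV. ev (\<lambda>x. 1 + (dvg (F b) x)\<^sup>2))"
      by (rule ev_sum) (intro tempered_add tempered_const tempered_power base)
    also have "\<dots> = (\<Sum>b\<in>UNIV. 1 + (ev (Dsq 1 (F b)) + ev (Dsq 2 (F b))))"
    proof (intro sum.cong refl)
      fix b
      have "ev (\<lambda>x. 1 + (dvg (F b) x)\<^sup>2) = ev (\<lambda>_. 1) + ev (\<lambda>x. (dvg (F b) x)\<^sup>2)"
        by (rule ev_add) (intro tempered_const tempered_power base)+
      then show "ev (\<lambda>x. 1 + (dvg (F b) x)\<^sup>2) = 1 + (ev (Dsq 1 (F b)) + ev (Dsq 2 (F b)))"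
        unfolding dvg_square[OF F] by (simp add: prob_space)
    qed
    finally show ?thesis by (simp add: sum.distrib D_def)
  qed
  also have "ev (\<lambda>x. \<Sum>e\<in>UNIV. 1 + Dsq 2 (F e) x) = D + (\<Sum>a\<in>UNIV. ev (Dsq 2 (F a)))"
  proof -
    have "ev (\<lambda>x. \<Sum>b\<in>UNIV. 1 + Dsq 2 (F b) x) = (\<Sum>b\<in>UNIV. ev (\<lambda>x. 1 + Dsq 2 (F b) x))"
      by (rule ev_sum) (intro tempered_add tempered_const tempered_power base)
    also have "\<dots> = (\<Sum>b\<in>UNIV. 1 + ev (Dsq 2 (F b)))"
    proof (intro sum.cong refl)
      fix b
      have "ev (\<lambda>x. 1 + Dsq 2 (F b) x) = ev (\<lambda>_. 1) + ev (Dsq 2 (F b))"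
        by (rule ev_add) (intro tempered_const base)+
      then show "ev (\<lambda>x. 1 + Dsq 2 (F b) x) = 1 + ev (Dsq 2 (F b))" by (simp add: prob_space)
    qed
    finally show ?thesis by (simp add: sum.distrib D_def)
  qed
  also have "(\<Sum>a\<in>UNIV. ev (Dsq 2 (F a))) \<le> (\<Sum>a\<in>UNIV. ev (Dsq 1 (F a)) + ev (Dsq 2 (F a)))"
    by (intro sum_mono) (auto intro!: integral_nonneg_AE Dsq_nonneg simp del: Dsq.simps One_nat_def)
  finally have "\<bar>ev R\<bar> \<le> (B * norm h * D) * (D + (\<Sum>a\<in>UNIV. ev (Dsq 1 (F a)) + ev (Dsq 2 (F a))))
     + (B * norm h * (2 * D ^ 3)) * (D + (\<Sum>a\<in>UNIV. ev (Dsq 1 (F a)) + ev (Dsq 2 (F a))))"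
    using B0 D0 by (simp add: mult_left_mono)
  then show ?thesis
    using LR unfolding Fv_def D_def by (simp add: algebra_simps)
qed

end

section \<open>A smooth cut-off of the inverse matrix\<close>

text \<open>Gradient form of continuous differentiability, matching what
  \<open>pder_compose_gradient\<close> asks of the outer function.\<close>

definition C1 :: "('a::euclidean_space \<Rightarrow> real) \<Rightarrow> bool" where
  "C1 f \<longleftrightarrow> (\<exists>G. continuous_on UNIV G \<and> (\<forall>y. (f has_derivative (\<lambda>u. G y \<bullet> u)) (at y)))"

lemma C1I: "continuous_on UNIV G \<Longrightarrow> (\<And>y. (f has_derivative (\<lambda>u. G y \<bullet> u)) (at y)) \<Longrightarrow> C1 f"
  unfolding C1_def by blast

lemma C1E:
  assumes "C1 f"
  obtains G where "continuous_on UNIV G" "\<And>y. (f has_derivative (\<lambda>u. G y \<bullet> u)) (at y)"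
  using assms unfolding C1_def by blast

lemma C1_continuous: "C1 f \<Longrightarrow> continuous_on UNIV f"
  by (erule C1E) (meson has_derivative_continuous continuous_at_imp_continuous_on)

lemma C1_const: "C1 (\<lambda>_. c)"
  by (rule C1I[of "\<lambda>_. 0"]) auto

lemma C1_inner: "C1 (\<lambda>y. y \<bullet> b)"
  by (rule C1I[of "\<lambda>_. b"]) (auto intro!: derivative_eq_intros simp: inner_commute)

lemma C1_add: assumes "C1 f" "C1 g" shows "C1 (\<lambda>y. f y + g y)"
proof -
  obtain F where F: "continuous_on UNIV F" "\<And>y. (f has_derivative (\<lambda>u. F y \<bullet> u)) (at y)" using C1E[OF assms(1)] by blast
  obtain G where G: "continuous_on UNIV G" "\<And>y. (g has_derivative (\<lambda>u. G y \<bullet> u)) (at y)" using C1E[OF assms(2)] by blast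
  show ?thesis
    by (rule C1I[of "\<lambda>y. F y + G y"], intro continuous_intros F G)
       (auto simp: inner_add_left intro!: derivative_intros F G)
qed

lemma C1_mult: assumes "C1 f" "C1 g" shows "C1 (\<lambda>y. f y * g y)"
proof -
  obtain F where F: "continuous_on UNIV F" "\<And>y. (f has_derivative (\<lambda>u. F y \<bullet> u)) (at y)" using C1E[OF assms(1)] by blast
  obtain G where G: "continuous_on UNIV G" "\<And>y. (g has_derivative (\<lambda>u. G y \<bullet> u)) (at y)" using C1E[OF assms(2)] by blast
  show ?thesis
  proof (rule C1I[of "\<lambda>y. f y *\<^sub>R G y + g y *\<^sub>R F y"])
    show "continuous_on UNIV (\<lambda>y. f y *\<^sub>R G y + g y *\<^sub>R F y)"
      by (intro continuous_intros F G C1_continuous assms)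
    show "((\<lambda>y. f y * g y) has_derivative (\<lambda>u. (f y *\<^sub>R G y + g y *\<^sub>R F y) \<bullet> u)) (at y)" for y
      by (rule has_derivative_eq_rhs[OF has_derivative_mult[OF F(2) G(2)]])
         (auto simp: fun_eq_iff algebra_simps)
  qed
qed

lemma C1_diff: "C1 f \<Longrightarrow> C1 g \<Longrightarrow> C1 (\<lambda>y. f y - g y)"
  using C1_add[OF _ C1_mult[OF C1_const[of "-1"]]] by simp

lemma C1_sum: "(\<And>i. i \<in> I \<Longrightarrow> C1 (f i)) \<Longrightarrow> C1 (\<lambda>y. \<Sum>i\<in>I. f i y)"
  by (induction I rule: infinite_finite_induct) (auto intro: C1_const C1_add)

lemma C1_prod: "(\<And>i. i \<in> I \<Longrightarrow> C1 (f i)) \<Longrightarrow> C1 (\<lambda>y. \<Prod>i\<in>I. f i y)"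
  by (induction I rule: infinite_finite_induct) (auto intro: C1_const C1_mult)

lemma C1_compose: fixes h :: "real \<Rightarrow> real" assumes "C1 h" "C1 f" shows "C1 (\<lambda>y. h (f y))"
proof -
  obtain F where F: "continuous_on UNIV F" "\<And>y. (f has_derivative (\<lambda>u. F y \<bullet> u)) (at y)" using C1E[OF assms(2)] by blast
  obtain H where H: "continuous_on UNIV H" "\<And>y. (h has_derivative (\<lambda>u. H y \<bullet> u)) (at y)" using C1E[OF assms(1)] by blast
  show ?thesis
  proof (rule C1I[of "\<lambda>y. H (f y) *\<^sub>R F y"])
    show "continuous_on UNIV (\<lambda>y. H (f y) *\<^sub>R F y)"
      by (intro continuous_intros F continuous_on_compose2[OF H(1) C1_continuous[OF assms(2)]]) auto
    show "((\<lambda>y. h (f y)) has_derivative (\<lambda>u. (H (f y) *\<^sub>R F y) \<bullet> u)) (at y)" for y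
      by (rule has_derivative_eq_rhs[OF has_derivative_compose[OF F(2) H(2)]])
         (auto simp: fun_eq_iff)
  qed
qed

lemma C1_realI:
  fixes h :: "real \<Rightarrow> real"
  assumes "\<And>t. (h has_real_derivative h' t) (at t)" "continuous_on UNIV h'"
  shows "C1 h"
  using assms by (intro C1I[of h']) (auto simp: has_field_derivative_def)

lemma C1_divide:
  assumes "C1 f" "C1 g" "\<And>y. g y > 0" shows "C1 (\<lambda>y. f y / g y)"
proof -
  obtain F where F: "continuous_on UNIV F" "\<And>y. (f has_derivative (\<lambda>u. F y \<bullet> u)) (at y)" using C1E[OF assms(1)] by blast
  obtain G where G: "continuous_on UNIV G" "\<And>y. (g has_derivative (\<lambda>u. G y \<bullet> u)) (at y)" using C1E[OF assms(2)] by blast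
  have nz: "g y \<noteq> 0" for y using assms(3)[of y] by simp
  show ?thesis
  proof (rule C1I[of "\<lambda>y. (1 / g y) *\<^sub>R F y - (f y / (g y * g y)) *\<^sub>R G y"])
    show "continuous_on UNIV (\<lambda>y. (1 / g y) *\<^sub>R F y - (f y / (g y * g y)) *\<^sub>R G y)"
      by (intro continuous_intros F G C1_continuous assms) (use nz in auto)
    show "((\<lambda>y. f y / g y) has_derivative (\<lambda>u. ((1 / g y) *\<^sub>R F y - (f y / (g y * g y)) *\<^sub>R G y) \<bullet> u)) (at y)" for y
      by (rule has_derivative_eq_rhs[OF has_derivative_divide'[OF F(2) G(2) nz]])
         (use nz[of y] in \<open>auto simp: fun_eq_iff inner_diff_left divide_simps\<close>)
  qed
qed

lemma C1_max_square: "C1 (\<lambda>t::real. (max 0 t)\<^sup>2)"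
proof (rule C1_realI[where h'="\<lambda>t. 2 * max 0 t"])
  show "continuous_on UNIV (\<lambda>t::real. 2 * max 0 t)" by (intro continuous_intros)
  fix t :: real
  consider "t > 0" | "t < 0" | "t = 0" by linarith
  then show "((\<lambda>t. (max 0 t)\<^sup>2) has_real_derivative 2 * max 0 t) (at t)"
  proof cases
    case 1
    have "((\<lambda>t. t\<^sup>2) has_real_derivative 2 * max 0 t) (at t)"
      using 1 by (auto intro!: derivative_eq_intros)
    then show ?thesis
      by (rule has_field_derivative_transform_within_open[of _ _ _ "{0<..}"]) (use 1 in auto)
  next
    case 2
    have "((\<lambda>t. 0) has_real_derivative 2 * max 0 t) (at t)" using 2 by auto
    then show ?thesis
      by (rule has_field_derivative_transform_within_open[of _ _ _ "{..<0}"]) (use 2 in auto)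
  next
    case 3
    have "((\<lambda>h::real. (max 0 h)\<^sup>2 / h) \<longlongrightarrow> 0) (at 0)"
    proof (rule Lim_null_comparison)
      show "((\<lambda>h::real. \<bar>h\<bar>) \<longlongrightarrow> 0) (at 0)" by (auto intro!: tendsto_eq_intros)
      show "\<forall>\<^sub>F h::real in at 0. norm ((max 0 h)\<^sup>2 / h) \<le> \<bar>h\<bar>"
        by (rule always_eventually) (auto simp: max_def power2_eq_square)
    qed
    then show ?thesis using 3 by (simp add: has_field_derivative_iff)
  qed
qed

text \<open>Only \<open>C\<^sup>1\<close> is needed, so squares of positive parts replace the usual exponentials.\<close>

definition smoothstep :: "real \<Rightarrow> real" where
  "smoothstep t = (max 0 t)\<^sup>2 / ((max 0 t)\<^sup>2 + (max 0 (1 - t))\<^sup>2)"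

lemma max_squares_pos: "a > 0 \<Longrightarrow> 0 < (max 0 t)\<^sup>2 + (max 0 (a - t))\<^sup>2" for a t :: real
  by (cases "t > 0") (auto simp: max_def intro: add_pos_nonneg add_nonneg_pos)

lemma C1_smoothstep: "C1 smoothstep"
  unfolding smoothstep_def[abs_def]
  by (intro C1_divide C1_add C1_max_square max_squares_pos C1_compose[OF C1_max_square, of "\<lambda>t. 1 - t"])
     (auto intro!: C1_realI[where h'="\<lambda>_. -1"] derivative_eq_intros)

lemma smoothstep_le0: "t \<le> 0 \<Longrightarrow> smoothstep t = 0"
  and smoothstep_ge1: "t \<ge> 1 \<Longrightarrow> smoothstep t = 1"
  and smoothstep_01: "0 \<le> smoothstep t" "smoothstep t \<le> 1"
  using max_squares_pos[of 1 t] by (auto simp: smoothstep_def max_def)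

lemma gradient_zero:
  fixes f :: "'a::euclidean_space \<Rightarrow> real"
  assumes "(f has_derivative (\<lambda>u. G \<bullet> u)) (at y)" "open S" "y \<in> S" "\<And>z. z \<in> S \<Longrightarrow> f z = c"
  shows "G = 0"
proof -
  have "(f has_derivative (\<lambda>u. 0)) (at y)"
    by (rule has_derivative_transform_within_open[OF has_derivative_const assms(2,3)]) (simp add: assms(4))
  from has_derivative_unique[OF assms(1) this] have "(\<lambda>u. G \<bullet> u) = (\<lambda>u. 0)" .
  then show ?thesis by (metis inner_eq_zero_iff)
qed

lemma gradient_bounded:
  fixes G :: "'a::euclidean_space \<Rightarrow> 'b::real_normed_vector"
  assumes "continuous_on UNIV G" "\<And>y. norm y > r \<Longrightarrow> G y = 0"
  shows "\<exists>B. \<forall>y. norm (G y) \<le> B"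
proof -
  have "bounded (G ` cball 0 r)"
    by (intro compact_imp_bounded compact_continuous_image continuous_on_subset[OF assms(1)]) auto
  then obtain B where B: "\<And>y. y \<in> cball 0 r \<Longrightarrow> norm (G y) \<le> B" unfolding bounded_iff by blast
  have "norm (G y) \<le> max B 0" for y
    using B[of y] assms(2)[of y] by (cases "norm y > r") (auto simp: le_max_iff_disj)
  then show ?thesis by blast
qed

text \<open>The gradient also vanishes outside the ball, so all three quantities are continuous with
  compact support. The third one is the weighted bound that
  \<open>integration_by_parts_estimate\<close> relies on.\<close>

lemma C1_compact_support_bound:
  fixes f :: "'a::euclidean_space \<Rightarrow> real"
  assumes "C1 f" "\<And>y. norm y > r \<Longrightarrow> f y = 0"
  shows "\<exists>G B. continuous_on UNIV G \<and> (\<forall>y. (f has_derivative (\<lambda>u. G y \<bullet> u)) (at y)) \<and>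
    (\<forall>y. \<bar>f y\<bar> \<le> B \<and> norm (G y) \<le> B \<and> norm y * norm (G y) \<le> B)"
proof -
  obtain G where G: "continuous_on UNIV G" "\<And>y. (f has_derivative (\<lambda>u. G y \<bullet> u)) (at y)" using C1E[OF assms(1)] by blast
  have G0: "G y = 0" if "norm y > r" for y
    by (rule gradient_zero[OF G(2)[of y], where S="- cball 0 r" and c=0]) (use that assms(2) in auto)
  obtain B1 where 1: "\<And>y. norm (f y) \<le> B1"
    using gradient_bounded[OF C1_continuous[OF assms(1)] assms(2)] by blast
  obtain B2 where 2: "\<And>y. norm (G y) \<le> B2" using gradient_bounded[OF G(1) G0] by blast
  have "\<exists>B. \<forall>y. norm (norm y *\<^sub>R G y) \<le> B"
    by (rule gradient_bounded[of _ r]) (intro continuous_intros G, simp add: G0)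
  then obtain B3 where 3: "\<And>y. norm y * norm (G y) \<le> B3" by auto
  show ?thesis
    by (intro exI[of _ G] exI[of _ "max B1 (max B2 B3)"] conjI allI G)
       (use 1 2 3 in \<open>auto simp: le_max_iff_disj\<close>)
qed

lemma C1_matrix_entry: "C1 (\<lambda>A :: real ^ 'n ^ 'm. A $ i $ j)"
proof -
  have "(\<lambda>A :: real ^ 'n ^ 'm. A $ i $ j) = (\<lambda>A. A \<bullet> axis i (axis j 1))"
    by (simp add: inner_axis)
  then show ?thesis using C1_inner by metis
qed

lemma C1_det:
  assumes "\<And>i j. C1 (\<lambda>A. M A $ i $ j)" shows "C1 (\<lambda>A. det (M A :: real ^ 'n ^ 'n))"
  unfolding det_def by (intro C1_sum C1_mult C1_const C1_prod assms)

text \<open>Cramer's rule writes the inverse as a polynomial matrix divided by the determinant.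
  Multiplying by functions that vanish for small determinants and for large norms gives entries that
  are continuously differentiable on all matrices and compactly supported.\<close>

lemma localized_inverse:
  fixes \<epsilon> K :: real
  assumes "\<epsilon> > 0" "K > 0"
  shows "\<exists>(T :: 'd::finite \<Rightarrow> 'd \<Rightarrow> real ^ 'd ^ 'd \<Rightarrow> real) DT B m.
    (\<forall>a b A. (T a b has_derivative (\<lambda>u. DT a b A \<bullet> u)) (at A)) \<and> (\<forall>a b. continuous_on UNIV (DT a b)) \<and>
    (\<forall>a b A. \<bar>T a b A\<bar> \<le> B \<and> norm (DT a b A) \<le> B \<and> norm A * norm (DT a b A) \<le> B) \<and>
    (\<forall>A a e. (\<Sum>b\<in>UNIV. T a b A * A $ b $ e) = (if a = e then m A else 0)) \<and>
    continuous_on UNIV m \<and> (\<forall>A. 0 \<le> m A \<and> m A \<le> 1) \<and> (\<forall>A. det A \<ge> \<epsilon> \<and> norm A \<le> K \<longrightarrow> m A = 1)"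
proof -
  define e where "e = \<epsilon> / 2"
  have e: "e > 0" "2 * e = \<epsilon>" using assms by (auto simp: e_def)
  \<comment> \<open>Equal to 0 for t below e = \<epsilon>/2 and to 1 for t above 2 e =
    \<epsilon>.\<close>
  define \<psi> where "\<psi> t = smoothstep (t / e - 1)" for t
  \<comment> \<open>This is \<open>\<psi> t / t\<close> without division by 0: the denominator is
    positive everywhere and equals t^2 for t at least e, while the numerator vanishes below
    e.\<close>
  define \<beta> where "\<beta> t = \<psi> t * t / ((max 0 t)\<^sup>2 + (max 0 (e - t))\<^sup>2)" for t
  \<comment> \<open>Equal to 1 for |A| at most K and to 0 for |A| above 2 K. The squared norm is a
    polynomial in the entries, hence differentiable also at 0.\<close>
  define \<zeta> where "\<zeta> A = 1 - smoothstep (A \<bullet> A / K\<^sup>2 - 1)" for A :: "real ^ 'd ^ 'd"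
  \<comment> \<open>The entry (a, b) of the adjugate matrix: the determinant after column
    \<open>a\<close> has been replaced by the unit vector \<open>b\<close>.\<close>
  define R where "R a b A = det (\<chi> i j. if j = a then (axis b 1 :: real ^ 'd) $ i else A $ i $ j)" for a b :: 'd and A :: "real ^ 'd ^ 'd"
  define T where "T a b A = \<zeta> A * \<beta> (det A) * R a b A" for a b A
  define m where "m A = \<zeta> A * \<psi> (det A)" for A
  have id: "C1 (\<lambda>t :: real. t)" by (rule C1_realI[where h'="\<lambda>_. 1"]) auto
  have lin: "C1 (\<lambda>t. t / c - 1)" "C1 (\<lambda>t. c - t)" "C1 (\<lambda>t. t)" for c :: real
    using C1_diff[OF C1_mult[OF id C1_const[of "1 / c"]] C1_const[of 1]] C1_diff[OF C1_const[of c] id] id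
    by simp_all
  have C\<psi>: "C1 \<psi>" unfolding \<psi>_def[abs_def] by (rule C1_compose[OF C1_smoothstep lin(1)])
  have C\<beta>: "C1 \<beta>" unfolding \<beta>_def[abs_def]
    by (intro C1_divide C1_mult C\<psi> lin C1_add C1_max_square C1_compose[OF C1_max_square lin(2)] max_squares_pos e)
  have Csq: "C1 (\<lambda>A :: real ^ 'd ^ 'd. A \<bullet> A)"
    unfolding inner_vec_def inner_real_def by (intro C1_sum C1_mult C1_matrix_entry)
  have C\<zeta>: "C1 \<zeta>" unfolding \<zeta>_def[abs_def]
    by (intro C1_diff C1_const C1_compose[OF C1_smoothstep] C1_compose[OF lin(1) Csq])
  have CR: "C1 (R a b)" for a b unfolding R_def[abs_def]
  proof (rule C1_det)
    fix i j
    show "C1 (\<lambda>A. (\<chi> i j. if j = a then (axis b 1 :: real ^ 'd) $ i else A $ i $ j) $ i $ j)"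
      by (cases "j = a") (auto intro: C1_const C1_matrix_entry)
  qed
  have Cdet: "C1 (\<lambda>A :: real ^ 'd ^ 'd. det A)" by (rule C1_det) (rule C1_matrix_entry)
  have CT: "C1 (T a b)" for a b unfolding T_def[abs_def]
    by (intro C1_mult C\<zeta> CR C1_compose[OF C\<beta> Cdet])
  have Cm: "C1 m" unfolding m_def[abs_def] by (intro C1_mult C\<zeta> C1_compose[OF C\<psi> Cdet])
  have \<psi>\<beta>: "\<beta> t * t = \<psi> t" for t
  proof (cases "t \<le> e")
    case True
    then have "\<psi> t = 0" using e unfolding \<psi>_def by (intro smoothstep_le0) (simp add: field_simps)
    then show ?thesis by (simp add: \<beta>_def)
  next
    case False
    then show ?thesis using e by (simp add: \<beta>_def max_def power2_eq_square)
  qed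
  have \<zeta>0: "\<zeta> A = 0" if "norm A > 2 * K" for A
  proof -
    have "(2 * K)\<^sup>2 \<le> (norm A)\<^sup>2" using that assms by (intro power_mono) auto
    then have "4 * K\<^sup>2 \<le> A \<bullet> A" by (simp add: power_mult_distrib power2_norm_eq_inner)
    then have "2 * K\<^sup>2 \<le> A \<bullet> A" using zero_le_power2[of K] by linarith
    moreover have "K\<^sup>2 > 0" using assms by simp
    ultimately show ?thesis unfolding \<zeta>_def by (subst smoothstep_ge1) (auto simp: field_simps)
  qed
  have inv: "(\<Sum>b\<in>UNIV. T a b A * A $ b $ e) = (if a = e then m A else 0)" for a e A
  \<comment> \<open>At a singular matrix both sides are 0, because \<open>\<beta>\<close> and
    \<open>\<psi>\<close> vanish at 0; elsewhere the sum is Cramer's inverse multiplied by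
    \<open>A\<close>.\<close>
  proof (cases "det A = 0")
    case True
    then have "\<beta> (det A) = 0" "\<psi> (det A) = 0" using \<psi>\<beta>[of 0] by (auto simp: \<beta>_def)
    then show ?thesis by (simp add: T_def m_def)
  next
    case False
    define V where "V = (\<chi> a b. R a b A / det A)"
    have "A *v column b V = axis b 1" for b
      unfolding cramer[OF False] by (simp add: V_def R_def column_def vec_eq_iff)
    then have "A ** V = mat 1"
      by (simp add: vec_eq_iff matrix_matrix_mult_def matrix_vector_mult_def column_def mat_def axis_def)
    then have "V ** A = mat 1" by (simp add: matrix_left_right_inverse)
    then have "(V ** A) $ a $ e = (if a = e then 1 else 0)" by (simp add: mat_def)
    then have 1: "(\<Sum>b\<in>UNIV. R a b A / det A * A $ b $ e) = (if a = e then 1 else 0)"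
      by (simp add: matrix_matrix_mult_def V_def)
    have "(\<Sum>b\<in>UNIV. T a b A * A $ b $ e) = \<zeta> A * (\<beta> (det A) * det A) * (\<Sum>b\<in>UNIV. R a b A / det A * A $ b $ e)"
      using False by (simp add: T_def sum_distrib_left mult_ac)
    then show ?thesis unfolding 1 \<psi>\<beta> m_def by simp
  qed
  have "\<forall>a b. \<exists>G B. continuous_on UNIV G \<and> (\<forall>y. (T a b has_derivative (\<lambda>u. G y \<bullet> u)) (at y)) \<and>
    (\<forall>y. \<bar>T a b y\<bar> \<le> B \<and> norm (G y) \<le> B \<and> norm y * norm (G y) \<le> B)"
    by (intro allI C1_compact_support_bound[OF CT, of "2 * K"]) (simp add: T_def \<zeta>0)
  then obtain DT B where DT: "\<And>a b. continuous_on UNIV (DT a b)" "\<And>a b y. (T a b has_derivative (\<lambda>u. DT a b y \<bullet> u)) (at y)"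
    "\<And>a b y. \<bar>T a b y\<bar> \<le> B a b \<and> norm (DT a b y) \<le> B a b \<and> norm y * norm (DT a b y) \<le> B a b" by metis
  define B' where "B' = Max (range (\<lambda>(a, b). B a b))"
  have B': "B a b \<le> B'" for a b unfolding B'_def by (rule Max_ge) auto
  have DT': "\<bar>T a b y\<bar> \<le> B'" "norm (DT a b y) \<le> B'" "norm y * norm (DT a b y) \<le> B'" for a b y
    using DT(3)[of a b y] B'[of a b] by linarith+
  have m01: "0 \<le> m A \<and> m A \<le> 1" for A
    unfolding m_def \<zeta>_def \<psi>_def using smoothstep_01 by (auto intro!: mult_le_one)
  have m1: "m A = 1" if "det A \<ge> \<epsilon>" "norm A \<le> K" for A
  proof -
    have "\<psi> (det A) = 1" unfolding \<psi>_def using that e by (intro smoothstep_ge1) (simp add: field_simps)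
    moreover have "A \<bullet> A \<le> K\<^sup>2" using power_mono[OF that(2), of 2] by (simp add: power2_norm_eq_inner)
    then have "\<zeta> A = 1" unfolding \<zeta>_def using assms by (subst smoothstep_le0) (auto simp: field_simps)
    ultimately show ?thesis by (simp add: m_def)
  qed
  show ?thesis
    by (intro exI[of _ T] exI[of _ DT] exI[of _ B'] exI[of _ m] conjI allI impI DT(1,2) DT' inv C1_continuous Cm)
       (use m01 m1 in auto)
qed

section \<open>Total variation and translations of the law\<close>

text \<open>Values between 0 and 1 make the class closed under complements and products, which
  mirror complement and intersection of sets in \<open>indicator_approximation\<close>.\<close>

definition test_function :: "('a::euclidean_space \<Rightarrow> real) \<Rightarrow> bool" where
  "test_function f \<longleftrightarrow> (\<exists>G B. continuous_on UNIV G \<and> (\<forall>y. (f has_derivative (\<lambda>u. G y \<bullet> u)) (at y)) \<and>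
     (\<forall>y. norm (G y) \<le> B) \<and> (\<forall>y. 0 \<le> f y \<and> f y \<le> 1))"

lemma test_functionI:
  "continuous_on UNIV G \<Longrightarrow> (\<And>y. (f has_derivative (\<lambda>u. G y \<bullet> u)) (at y)) \<Longrightarrow> (\<And>y. norm (G y) \<le> B) \<Longrightarrow>
   (\<And>y. 0 \<le> f y) \<Longrightarrow> (\<And>y. f y \<le> 1) \<Longrightarrow> test_function f"
  unfolding test_function_def by blast

lemma test_functionE:
  assumes "test_function f"
  obtains G B where "continuous_on UNIV G" "\<And>y. (f has_derivative (\<lambda>u. G y \<bullet> u)) (at y)" "\<And>y. norm (G y) \<le> B"
    "\<And>y. 0 \<le> f y" "\<And>y. f y \<le> 1"
  using assms unfolding test_function_def by blast

lemma test_function_01: "test_function f \<Longrightarrow> 0 \<le> f y \<and> f y \<le> 1"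
  unfolding test_function_def by blast

lemma test_function_continuous: "test_function f \<Longrightarrow> continuous_on UNIV f"
  unfolding test_function_def by (meson has_derivative_continuous continuous_at_imp_continuous_on)

lemma test_function_measurable: "test_function f \<Longrightarrow> f \<in> borel_measurable borel"
  by (rule borel_measurable_continuous_onI[OF test_function_continuous])

lemma test_function_const: "0 \<le> c \<Longrightarrow> c \<le> 1 \<Longrightarrow> test_function (\<lambda>_. c)"
  by (rule test_functionI[of "\<lambda>_. 0" _ 0]) auto

lemma test_function_compl: assumes "test_function f" shows "test_function (\<lambda>y. 1 - f y)"
proof -
  obtain G B where G: "continuous_on UNIV G" "\<And>y. (f has_derivative (\<lambda>u. G y \<bullet> u)) (at y)" "\<And>y. norm (G y) \<le> B"
    "\<And>y. 0 \<le> f y" "\<And>y. f y \<le> 1" using test_functionE[OF assms] by blast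
  show ?thesis
  proof (rule test_functionI[of "\<lambda>y. - G y" _ B])
    show "((\<lambda>y. 1 - f y) has_derivative (\<lambda>u. - G y \<bullet> u)) (at y)" for y
      by (auto intro!: derivative_eq_intros G(2))
  qed (use G in \<open>auto intro!: continuous_intros\<close>)
qed

lemma test_function_mult: assumes "test_function f" "test_function g" shows "test_function (\<lambda>y. f y * g y)"
proof -
  obtain F A where F: "continuous_on UNIV F" "\<And>y. (f has_derivative (\<lambda>u. F y \<bullet> u)) (at y)" "\<And>y. norm (F y) \<le> A"
    "\<And>y. 0 \<le> f y" "\<And>y. f y \<le> 1" using test_functionE[OF assms(1)] by blast
  obtain G B where G: "continuous_on UNIV G" "\<And>y. (g has_derivative (\<lambda>u. G y \<bullet> u)) (at y)" "\<And>y. norm (G y) \<le> B"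
    "\<And>y. 0 \<le> g y" "\<And>y. g y \<le> 1" using test_functionE[OF assms(2)] by blast
  show ?thesis
  proof (rule test_functionI[of "\<lambda>y. f y *\<^sub>R G y + g y *\<^sub>R F y" _ "A + B"])
    show "continuous_on UNIV (\<lambda>y. f y *\<^sub>R G y + g y *\<^sub>R F y)"
      by (intro continuous_intros F G test_function_continuous assms)
    show "((\<lambda>y. f y * g y) has_derivative (\<lambda>u. (f y *\<^sub>R G y + g y *\<^sub>R F y) \<bullet> u)) (at y)" for y
      by (rule has_derivative_eq_rhs[OF has_derivative_mult[OF F(2) G(2)]])
         (auto simp: fun_eq_iff algebra_simps)
    show "norm (f y *\<^sub>R G y + g y *\<^sub>R F y) \<le> A + B" for y
    proof -
      have "norm (f y *\<^sub>R G y + g y *\<^sub>R F y) \<le> f y * norm (G y) + g y * norm (F y)"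
        using norm_triangle_ineq[of "f y *\<^sub>R G y" "g y *\<^sub>R F y"] F G by simp
      also have "\<dots> \<le> 1 * norm (G y) + 1 * norm (F y)" using F G by (intro add_mono mult_right_mono) auto
      finally show ?thesis using F(3)[of y] G(3)[of y] by simp
    qed
  qed (use F G in \<open>auto intro!: mult_le_one\<close>)
qed

section \<open>From test functions to Borel sets and bounded measurable functions\<close>

lemma test_function_halfspace:
  fixes b :: "'a::euclidean_space"
  shows "test_function (\<lambda>y. 1 - smoothstep (k * (y \<bullet> b - a)))"
proof -
  obtain S where S: "continuous_on UNIV S" "\<And>y. (smoothstep has_derivative (\<lambda>u. S y \<bullet> u)) (at y)"
    using C1E[OF C1_smoothstep] by blast
  have "S y = 0" if "norm y > 1" for y
  proof (cases "y > 1")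
    case True then show ?thesis
      by (intro gradient_zero[OF S(2)[of y], where S="{1<..}" and c=1]) (auto intro: smoothstep_ge1)
  next
    case False then show ?thesis using that
      by (intro gradient_zero[OF S(2)[of y], where S="{..<0}" and c=0]) (auto intro: smoothstep_le0)
  qed
  then obtain B where B: "\<And>y. norm (S y) \<le> B" using gradient_bounded[OF S(1)] by blast
  show ?thesis
  proof (rule test_function_compl, rule test_functionI[of "\<lambda>y. (S (k * (y \<bullet> b - a)) * k) *\<^sub>R b" _ "B * \<bar>k\<bar> * norm b"])
    show "continuous_on UNIV (\<lambda>y. (S (k * (y \<bullet> b - a)) * k) *\<^sub>R b)"
      by (intro continuous_intros continuous_on_compose2[OF S(1)]) auto
    fix y
    have "((\<lambda>y. k * (y \<bullet> b - a)) has_derivative (\<lambda>u. k * (u \<bullet> b))) (at y)"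
      by (auto intro!: derivative_eq_intros)
    from has_derivative_compose[OF this S(2)]
    show "((\<lambda>y. smoothstep (k * (y \<bullet> b - a))) has_derivative (\<lambda>u. (S (k * (y \<bullet> b - a)) * k) *\<^sub>R b \<bullet> u)) (at y)"
      by (rule has_derivative_eq_rhs) (auto simp: fun_eq_iff inner_commute)
    show "norm ((S (k * (y \<bullet> b - a)) * k) *\<^sub>R b) \<le> B * \<bar>k\<bar> * norm b"
      using B[of "k * (y \<bullet> b - a)"] by (simp add: abs_mult mult_right_mono)
  qed (use smoothstep_01 in auto)
qed

text \<open>The sets that can be approximated, by a single function for both measures, form a
  sigma-algebra: complements and intersections are mirrored by 1 - g and g h. Steep smooth steps
  approximate the half-spaces, which generate the Borel sets.\<close>

lemma indicator_approximation:
  fixes P Q :: "'a::euclidean_space measure"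
  assumes P: "finite_measure P" "sets P = sets borel" and Q: "finite_measure Q" "sets Q = sets borel"
    and A: "A \<in> sets borel" and "e > 0"
  shows "\<exists>g. test_function g \<and> (\<integral>y. \<bar>g y - indicator A y\<bar> \<partial>P) < e \<and> (\<integral>y. \<bar>g y - indicator A y\<bar> \<partial>Q) < e"
proof -
  define ap where "ap A e g \<longleftrightarrow> test_function g \<and> (\<forall>R\<in>{P, Q}. (\<integral>y. \<bar>g y - indicator A y\<bar> \<partial>R) < e)" for A e g
  have fm: "finite_measure R" "sets R = sets borel" if "R \<in> {P, Q}" for R using that P Q by auto
  have int: "integrable R (\<lambda>y. f y)" if "R \<in> {P, Q}" "f \<in> borel_measurable borel" "\<And>y. \<bar>f y\<bar> \<le> 1" for R and f :: "'a \<Rightarrow> real"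
  proof -
    interpret finite_measure R using fm[OF that(1)] by simp
    have "f \<in> borel_measurable R" using that(2) measurable_cong_sets[OF fm(2)[OF that(1)] refl] by blast
    then show ?thesis by (rule integrable_const_bound[rotated, where B=1]) (use that in auto)
  qed
  have int': "integrable R (\<lambda>y. \<bar>g y - indicator A y\<bar>)" if "R \<in> {P, Q}" "test_function g" "A \<in> sets borel" for R g A
  proof (rule int[OF that(1)])
    show "(\<lambda>y. \<bar>g y - indicator A y\<bar>) \<in> borel_measurable borel"
      using test_function_measurable[OF that(2)] that(3) by measurable
    show "\<bar>\<bar>g y - indicator A y\<bar>\<bar> \<le> 1" for y
      using test_function_01[OF that(2), of y] by (auto simp: indicator_def)
  qed
  have comp: "ap (- A) e (\<lambda>y. 1 - g y)" if "ap A e g" for A e g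
  proof -
    have "\<bar>(1 - g y) - indicator (- A) y\<bar> = \<bar>g y - indicator A y\<bar>" for y by (auto simp: indicator_def)
    then show ?thesis using that unfolding ap_def by (auto intro: test_function_compl)
  qed
  have inter: "ap (A \<inter> B) (a + b) (\<lambda>y. g y * h y)"
    if gh: "ap A a g" "ap B b h" and Am: "A \<in> sets borel" and Bm: "B \<in> sets borel" for A B a b g h
  proof -
    have g: "test_function g" "test_function h" using gh by (auto simp: ap_def)
    have AB: "A \<inter> B \<in> sets borel" using Am Bm by auto
    have le: "\<bar>g y * h y - indicator (A \<inter> B) y\<bar> \<le> \<bar>g y - indicator A y\<bar> + \<bar>h y - indicator B y\<bar>" for y
    proof -
      have "g y * h y - indicator A y * indicator B y = (g y - indicator A y) * h y + indicator A y * (h y - indicator B y)"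
        by (simp add: algebra_simps)
      also have "\<bar>\<dots>\<bar> \<le> \<bar>g y - indicator A y\<bar> * 1 + 1 * \<bar>h y - indicator B y\<bar>"
        using test_function_01[OF g(2), of y]
        by (intro order_trans[OF abs_triangle_ineq] add_mono) (auto simp: abs_mult indicator_def mult_left_le)
      finally show ?thesis by (simp add: indicator_inter_arith)
    qed
    have "(\<integral>y. \<bar>g y * h y - indicator (A \<inter> B) y\<bar> \<partial>R) < a + b" if R: "R \<in> {P, Q}" for R
    proof -
      have "(\<integral>y. \<bar>g y * h y - indicator (A \<inter> B) y\<bar> \<partial>R)
          \<le> (\<integral>y. \<bar>g y - indicator A y\<bar> + \<bar>h y - indicator B y\<bar> \<partial>R)"
        by (rule integral_mono[OF int'[OF R test_function_mult[OF g] AB]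
              Bochner_Integration.integrable_add[OF int'[OF R g(1) Am] int'[OF R g(2) Bm]] le])
      also have "\<dots> = (\<integral>y. \<bar>g y - indicator A y\<bar> \<partial>R) + (\<integral>y. \<bar>h y - indicator B y\<bar> \<partial>R)"
        by (rule Bochner_Integration.integral_add[OF int'[OF R g(1) Am] int'[OF R g(2) Bm]])
      also have "\<dots> < a + b" using gh R unfolding ap_def by (intro add_strict_mono) auto
      finally show ?thesis .
    qed
    then show ?thesis using test_function_mult[OF g] by (auto simp: ap_def)
  qed
  have good: "A \<in> sets borel \<and> (\<forall>e>0. \<exists>g. ap A e g)" if "A \<in> sigma_sets UNIV ((\<lambda>(a, i). {x::'a. x \<bullet> i \<le> a}) ` (UNIV \<times> Basis))" for A
    using that
  proof (induction rule: sigma_sets.induct)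
    case (Basic A)
    then obtain a i where A: "A = {x. x \<bullet> i \<le> a}" by auto
    have Am: "A \<in> sets borel" unfolding A by measurable
    define g where "g n y = 1 - smoothstep (real n * (y \<bullet> i - a))" for n y
    have tg: "test_function (g n)" for n unfolding g_def by (rule test_function_halfspace)
    have "(\<lambda>n. \<integral>y. \<bar>g n y - indicator A y\<bar> \<partial>R) \<longlonglongrightarrow> (\<integral>y. 0 \<partial>R)" if R: "R \<in> {P, Q}" for R
    proof (rule integral_dominated_convergence[where w="\<lambda>_. 1"])
      show "integrable R (\<lambda>_. 1::real)" by (rule int[OF R]) auto
      show "(\<lambda>y. \<bar>g n y - indicator A y\<bar>) \<in> borel_measurable R" for n
        using int'[OF R tg Am] by (rule borel_measurable_integrable)
      show "AE y in R. (\<lambda>n. \<bar>g n y - indicator A y\<bar>) \<longlonglongrightarrow> 0"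
      proof (rule AE_I2)
        fix y
        show "(\<lambda>n. \<bar>g n y - indicator A y\<bar>) \<longlonglongrightarrow> 0"
        proof (cases "y \<in> A")
          case True
          then have "g n y = 1" for n unfolding g_def A
            by (simp add: smoothstep_le0 mult_nonneg_nonpos)
          then show ?thesis using True by simp
        next
          case False
          then obtain N where N: "real N * (y \<bullet> i - a) > 1"
            using ex_less_of_nat_mult[of "y \<bullet> i - a" 1] by (auto simp: A)
          have "g n y = 0" if "n \<ge> N" for n
          proof -
            have "real N * (y \<bullet> i - a) \<le> real n * (y \<bullet> i - a)" using that False by (intro mult_right_mono) (auto simp: A)
            then show ?thesis using N unfolding g_def by (simp add: smoothstep_ge1)
          qed
          then have "eventually (\<lambda>n. \<bar>g n y - indicator A y\<bar> = 0) sequentially"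
            using False by (auto simp: eventually_sequentially)
          then show ?thesis by (rule tendsto_eventually)
        qed
      qed
      show "AE y in R. norm \<bar>g n y - indicator A y\<bar> \<le> 1" for n
        using test_function_01[OF tg] by (auto simp: indicator_def)
    qed auto
    then have lim: "(\<lambda>n. \<integral>y. \<bar>g n y - indicator A y\<bar> \<partial>R) \<longlonglongrightarrow> 0" if "R \<in> {P, Q}" for R using that by simp
    have "\<exists>g. ap A e g" if e: "e > 0" for e
    proof -
      have "eventually (\<lambda>n. (\<integral>y. \<bar>g n y - indicator A y\<bar> \<partial>P) < e) sequentially"
        "eventually (\<lambda>n. (\<integral>y. \<bar>g n y - indicator A y\<bar> \<partial>Q) < e) sequentially"
        using order_tendstoD(2)[OF lim e] by auto
      then have "eventually (\<lambda>n. ap A e (g n)) sequentially"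
        by eventually_elim (auto simp: ap_def tg)
      then show ?thesis by (meson eventually_happens trivial_limit_sequentially)
    qed
    then show ?case using Am by blast
  next
    case Empty
    have "ap {} e (\<lambda>_. 0)" if "e > 0" for e using that by (auto simp: ap_def intro: test_function_const)
    then show ?case by auto
  next
    case (Compl A)
    have "\<exists>g. ap (- A) e g" if "e > 0" for e
      using Compl.IH comp that by blast
    then show ?case using Compl.IH by (simp add: Compl_eq_Diff_UNIV[symmetric] borel_comp)
  next
    case (Union A)
    \<comment> \<open>By continuity from below of both measures, a countable union is replaced by a
      finite one at cost e/2.\<close>
    define B where "B n = (\<Union>i<n. A i)" for n :: nat
    have Bm: "B n \<in> sets borel" for n unfolding B_def using Union by auto
    have B: "\<exists>g. ap (B n) e g" if "e > 0" for n e
      using that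
    proof (induction n arbitrary: e)
      case 0
      then have "ap (B 0) e (\<lambda>_. 0)" by (auto simp: ap_def B_def intro: test_function_const)
      then show ?case by blast
    next
      case (Suc n)
      obtain g where g: "ap (B n) (e/2) g" using Suc.IH[of "e/2"] Suc.prems by auto
      obtain h where h: "ap (A n) (e/2) h" using Union.IH[of n] Suc.prems by (meson half_gt_zero)
      \<comment> \<open>De Morgan: a union is built from the complement and intersection
        steps.\<close>
      have "ap (- (- B n \<inter> - A n)) (e/2 + e/2) (\<lambda>y. 1 - (1 - g y) * (1 - h y))"
        by (intro comp inter g h borel_comp) (use Bm Union.IH in auto)
      moreover have "- (- B n \<inter> - A n) = B (Suc n)" by (auto simp: B_def less_Suc_eq)
      ultimately show ?case by auto
    qed
    have UA: "(\<Union>i. A i) = (\<Union>n. B n)" unfolding B_def by blast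
    have incB: "incseq B" by (auto simp: B_def incseq_def intro: less_le_trans)
    have Um: "(\<Union>i. A i) \<in> sets borel" using Union.IH by auto
    have "\<exists>g. ap (\<Union>i. A i) e g" if e: "e > 0" for e
    proof -
      have lim: "eventually (\<lambda>n. measure R (\<Union>i. A i) - measure R (B n) < e / 2) sequentially" if R: "R \<in> {P, Q}" for R
      proof -
        interpret finite_measure R using fm[OF R] by simp
        have "(\<lambda>n. measure R (B n)) \<longlonglongrightarrow> measure R (\<Union>n. B n)"
          by (rule finite_Lim_measure_incseq[OF _ incB]) (use Bm fm[OF R] in auto)
        from order_tendstoD(1)[OF this, of "measure R (\<Union>n. B n) - e / 2"] e
        show ?thesis unfolding UA by (auto elim: eventually_mono)
      qed
      have "eventually (\<lambda>n. measure P (\<Union>i. A i) - measure P (B n) < e / 2 \<and> measure Q (\<Union>i. A i) - measure Q (B n) < e / 2) sequentially"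
        using lim by (auto intro: eventually_conj)
      then obtain n where n: "\<And>R. R \<in> {P, Q} \<Longrightarrow> measure R (\<Union>i. A i) - measure R (B n) < e / 2"
        by (metis (lifting) eventually_happens trivial_limit_sequentially insertE singletonD)
      obtain g where g: "ap (B n) (e/2) g" using B[of "e/2"] e by auto
      then have tg: "test_function g" by (simp add: ap_def)
      have "(\<integral>y. \<bar>g y - indicator (\<Union>i. A i) y\<bar> \<partial>R) < e" if R: "R \<in> {P, Q}" for R
      proof -
        interpret finite_measure R using fm[OF R] by simp
        have sub: "B n \<subseteq> (\<Union>i. A i)" by (auto simp: B_def)
        have m: "B n \<in> sets R" "(\<Union>i. A i) \<in> sets R" using Bm Um fm[OF R] by auto
        have i2: "integrable R (\<lambda>y. indicator ((\<Union>i. A i) - B n) y :: real)"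
        proof (rule int[OF R borel_measurable_indicator])
          show "(\<Union>i. A i) - B n \<in> sets borel" using Um Bm by (rule sets.Diff)
        qed (auto simp: indicator_def)
        have "(\<integral>y. \<bar>g y - indicator (\<Union>i. A i) y\<bar> \<partial>R) \<le> (\<integral>y. \<bar>g y - indicator (B n) y\<bar> + indicator ((\<Union>i. A i) - B n) y \<partial>R)"
          by (rule integral_mono[OF int'[OF R tg Um] Bochner_Integration.integrable_add[OF int'[OF R tg Bm] i2]])
             (use sub in \<open>auto simp: indicator_def\<close>)
        also have "\<dots> = (\<integral>y. \<bar>g y - indicator (B n) y\<bar> \<partial>R) + (\<integral>y. indicator ((\<Union>i. A i) - B n) y \<partial>R)"
          by (rule Bochner_Integration.integral_add[OF int'[OF R tg Bm] i2])
        also have "(\<integral>y. indicator ((\<Union>i. A i) - B n) y \<partial>R) = measure R ((\<Union>i. A i) - B n)"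
          using m sets.sets_into_space by (auto intro!: arg_cong[where f="measure R"] simp: Int_absorb2)
        also have "\<dots> = measure R (\<Union>i. A i) - measure R (B n)"
          by (rule finite_measure_Diff[OF m(2,1) sub])
        also have "(\<integral>y. \<bar>g y - indicator (B n) y\<bar> \<partial>R) + \<dots> < e/2 + e/2"
          using g R n[OF R] unfolding ap_def by (intro add_strict_mono) auto
        finally show ?thesis by simp
      qed
      then have "ap (\<Union>i. A i) e g" using tg by (auto simp: ap_def)
      then show ?thesis by blast
    qed
    then show ?case using Um by blast
  qed
  have "A \<in> sigma_sets UNIV ((\<lambda>(a, i). {x::'a. x \<bullet> i \<le> a}) ` (UNIV \<times> Basis))"
    using A by (subst (asm) borel_eq_halfspace_le) simp
  from good[OF this] \<open>e > 0\<close> obtain g where "ap A e g" by blast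
  then show ?thesis by (auto simp: ap_def)
qed

text \<open>One \<open>g\<close> approximates the indicator in mean under both laws, so the bound on
  test functions passes to sets up to an arbitrary e.\<close>

lemma measure_diff_bound:
  fixes P Q :: "'a::euclidean_space measure"
  assumes P: "prob_space P" "sets P = sets borel" and Q: "prob_space Q" "sets Q = sets borel"
    and D: "\<And>g. test_function g \<Longrightarrow> \<bar>(\<integral>y. g y \<partial>P) - (\<integral>y. g y \<partial>Q)\<bar> \<le> D"
    and A: "A \<in> sets borel"
  shows "\<bar>measure P A - measure Q A\<bar> \<le> D"
proof (rule field_le_epsilon)
  fix e :: real assume e: "e > 0"
  interpret P: prob_space P by fact
  interpret Q: prob_space Q by fact
  obtain g where g: "test_function g" "(\<integral>y. \<bar>g y - indicator A y\<bar> \<partial>P) < e / 2" "(\<integral>y. \<bar>g y - indicator A y\<bar> \<partial>Q) < e / 2"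
    using indicator_approximation[OF P.finite_measure_axioms P(2) Q.finite_measure_axioms Q(2) A, of "e/2"] e by auto
  have *: "\<bar>(\<integral>y. g y \<partial>R) - measure R A\<bar> \<le> (\<integral>y. \<bar>g y - indicator A y\<bar> \<partial>R)" if R: "prob_space R" "sets R = sets borel" for R
  proof -
    interpret prob_space R by fact
    have "g \<in> borel_measurable R" using test_function_measurable[OF g(1)] measurable_cong_sets[OF R(2) refl] by blast
    then have i: "integrable R g"
      by (rule integrable_const_bound[rotated, where B=1]) (use test_function_01[OF g(1)] in auto)
    have Am: "A \<in> sets R" using A R by simp
    then have i2: "integrable R (\<lambda>y. indicator A y :: real)" by (intro integrable_real_indicator) (auto simp: emeasure_eq_measure)
    have "measure R A = (\<integral>y. indicator A y \<partial>R)" using Am sets.sets_into_space[OF Am] by (simp add: Int_absorb2)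
    then have "(\<integral>y. g y \<partial>R) - measure R A = (\<integral>y. g y - indicator A y \<partial>R)"
      using Bochner_Integration.integral_diff[OF i i2] by simp
    then show ?thesis using integral_abs_bound[of R "\<lambda>y. g y - indicator A y"] by simp
  qed
  show "\<bar>measure P A - measure Q A\<bar> \<le> D + e"
    using *[OF P] *[OF Q] g(2,3) D[OF g(1)] by linarith
qed

text \<open>Layer-cake approximation with k levels. The factor 2 is the length of the interval from
  -1 to 1 in which \<open>f\<close> takes its values.\<close>

lemma integral_diff_bound:
  fixes P Q :: "'a::euclidean_space measure"
  assumes P: "prob_space P" "sets P = sets borel" and Q: "prob_space Q" "sets Q = sets borel"
    and D: "\<And>A. A \<in> sets borel \<Longrightarrow> \<bar>measure P A - measure Q A\<bar> \<le> D"
    and f: "f \<in> borel_measurable borel" "\<And>y. \<bar>f y\<bar> \<le> 1"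
  shows "\<bar>(\<integral>y. f y \<partial>P) - (\<integral>y. f y \<partial>Q)\<bar> \<le> 2 * D"
proof (rule field_le_epsilon)
  fix e :: real assume e: "e > 0"
  obtain k :: nat where k: "4 / e < real k" using reals_Archimedean2 by blast
  have k0: "real k > 0" using k e by (meson divide_pos_pos less_trans zero_less_numeral)
  \<comment> \<open>Super-level sets of f, moved affinely to the range from 0 to k. The number of
    these sets that contain y is the rescaled value rounded down.\<close>
  define A where "A j = {y. real j \<le> real k * ((f y + 1) / 2)}" for j :: nat
  have Am: "A j \<in> sets borel" for j unfolding A_def using f(1) by measurable
  define s where "s y = (\<Sum>j=1..k. indicator (A j) y :: real)" for y
  have s: "\<bar>f y - (2 / real k * s y - 1)\<bar> \<le> 2 / real k" for y
  proof -
    define t where "t = real k * ((f y + 1) / 2)"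
    have t: "0 \<le> t" "t \<le> real k" using f(2)[of y] k0 by (auto simp: t_def abs_le_iff mult_left_le)
    define n where "n = nat \<lfloor>t\<rfloor>"
    have n: "real n \<le> t" "t < real n + 1" using t by (auto simp: n_def)
    have nk: "n \<le> k" using n(1) t(2) by simp
    have "s y = (\<Sum>j=1..k. if real j \<le> t then 1 else 0)" unfolding s_def A_def t_def by (intro sum.cong refl) (simp add: indicator_def)
    also have "\<dots> = real (card ({1..k} \<inter> {j. real j \<le> t}))" by (simp add: sum.If_cases del: One_nat_def)
    also have "{1..k} \<inter> {j. real j \<le> t} = {1..n}" using n nk by auto
    finally have "s y = real n" by simp
    then have "\<bar>t - s y\<bar> \<le> 1" using n by simp
    moreover have "f y - (2 / real k * s y - 1) = 2 / real k * (t - s y)" using k0 by (simp add: t_def field_simps)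
    ultimately show ?thesis using k0 by (simp add: abs_mult divide_right_mono)
  qed
  have *: "\<bar>(\<integral>y. f y \<partial>R) - (2 / real k * (\<Sum>j=1..k. measure R (A j)) - 1)\<bar> \<le> 2 / real k"
    if R: "prob_space R" "sets R = sets borel" for R
  proof -
    interpret prob_space R by fact
    have "f \<in> borel_measurable R" using f(1) measurable_cong_sets[OF R(2) refl] by blast
    then have i: "integrable R f"
      by (rule integrable_const_bound[rotated, where B=1]) (use f in auto)
    have Am': "A j \<in> sets R" for j using Am R by simp
    then have i2: "integrable R (\<lambda>y. indicator (A j) y :: real)" for j by (intro integrable_real_indicator) (auto simp: emeasure_eq_measure)
    have iS: "integrable R s" unfolding s_def by (intro Bochner_Integration.integrable_sum i2)
    have "(\<integral>y. s y \<partial>R) = (\<Sum>j=1..k. measure R (A j))"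
      unfolding s_def using Am' sets.sets_into_space[OF Am'] i2
      by (subst Bochner_Integration.integral_sum) (auto simp: Int_absorb2)
    then have "(\<integral>y. f y \<partial>R) - (2 / real k * (\<Sum>j=1..k. measure R (A j)) - 1) = (\<integral>y. f y - (2 / real k * s y - 1) \<partial>R)"
      using i iS by (simp add: prob_space)
    also have "\<bar>\<dots>\<bar> \<le> (\<integral>y. \<bar>f y - (2 / real k * s y - 1)\<bar> \<partial>R)" by (rule integral_abs_bound)
    also have "\<dots> \<le> (\<integral>y. 2 / real k \<partial>R)" by (intro integral_mono s) (use i iS in auto)
    finally show ?thesis by (simp add: prob_space)
  qed
  have "\<bar>2 / real k * (\<Sum>j=1..k. measure P (A j)) - 2 / real k * (\<Sum>j=1..k. measure Q (A j))\<bar> \<le> 2 * D"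
  proof -
    have "\<bar>\<Sum>j=1..k. measure P (A j) - measure Q (A j)\<bar> \<le> (\<Sum>j=1..k. D)"
      by (rule order_trans[OF sum_abs]) (intro sum_mono D Am)
    then have "2 / real k * \<bar>\<Sum>j=1..k. measure P (A j) - measure Q (A j)\<bar> \<le> 2 / real k * (real k * D)"
      using k0 by (intro mult_left_mono) auto
    then have le: "2 / real k * \<bar>\<Sum>j=1..k. measure P (A j) - measure Q (A j)\<bar> \<le> 2 * D" using k0 by simp
    have "2 / real k * (\<Sum>j=1..k. measure P (A j)) - 2 / real k * (\<Sum>j=1..k. measure Q (A j))
        = 2 / real k * (\<Sum>j=1..k. measure P (A j) - measure Q (A j))"
      unfolding sum_subtractf right_diff_distrib ..
    then show ?thesis using le k0 by (simp only: abs_mult) simp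
  qed
  moreover have "4 / real k < e" using k k0 e by (simp add: field_simps)
  ultimately show "\<bar>(\<integral>y. f y \<partial>P) - (\<integral>y. f y \<partial>Q)\<bar> \<le> 2 * D + e"
    using *[OF P] *[OF Q] by simp
qed

section \<open>Mollification of laws\<close>

lemma nn_integral_lborel_shift:
  fixes y :: "'a::euclidean_space"
  assumes [measurable]: "g \<in> borel_measurable borel"
  shows "(\<integral>\<^sup>+ z. g z \<partial>lborel) = (\<integral>\<^sup>+ h. g (y + h) \<partial>lborel)"
proof -
  have "(\<integral>\<^sup>+ z. g z \<partial>lborel) = (\<integral>\<^sup>+ z. g z \<partial>distr lborel borel ((+) y))" by (simp add: lborel_distr_plus)
  also have "\<dots> = (\<integral>\<^sup>+ h. g (y + h) \<partial>lborel)" by (subst nn_integral_distr) auto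
  finally show ?thesis .
qed

lemma integral_lborel_shift:
  fixes y :: "'a::euclidean_space" and g :: "'a \<Rightarrow> real"
  assumes [measurable]: "g \<in> borel_measurable borel"
  shows "(\<integral>z. g z \<partial>lborel) = (\<integral>h. g (y + h) \<partial>lborel)"
proof -
  have "(\<integral>z. g z \<partial>lborel) = (\<integral>z. g z \<partial>distr lborel borel ((+) y))" by (simp add: lborel_distr_plus)
  also have "\<dots> = (\<integral>h. g (y + h) \<partial>lborel)" by (subst integral_distr) auto
  finally show ?thesis .
qed

lemma mollifier_exists:
  fixes \<delta> :: real
  assumes "\<delta> > 0"
  shows "\<exists>(k :: 'a::euclidean_space \<Rightarrow> real) B. continuous_on UNIV k \<and> (\<forall>h. 0 \<le> k h \<and> k h \<le> B) \<and> (\<forall>h. norm h > \<delta> \<longrightarrow> k h = 0)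
     \<and> integrable lborel k \<and> (\<integral>h. k h \<partial>lborel) = 1"
proof -
  \<comment> \<open>A cone. Continuity of the kernel is what convergence in distribution can use;
    the mass is positive because the cone is at least 1/2 on the ball of half the radius.\<close>
  define k0 where "k0 h = max 0 (1 - norm h / \<delta>)" for h :: 'a
  have c0: "continuous_on UNIV k0" unfolding k0_def[abs_def] using assms by (intro continuous_intros) auto
  then have m [measurable]: "k0 \<in> borel_measurable borel" by (rule borel_measurable_continuous_onI)
  have b: "0 \<le> k0 h" "k0 h \<le> 1" "norm h > \<delta> \<Longrightarrow> k0 h = 0" for h
    using assms by (auto simp: k0_def field_simps)
  have ic: "integrable lborel (\<lambda>h. indicator (cball (0::'a) \<delta>) h :: real)"
    by (intro integrable_real_indicator emeasure_bounded_finite bounded_cball) auto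
  have i0: "integrable lborel k0"
    by (rule Bochner_Integration.integrable_bound[OF ic]) (use b in \<open>auto simp: indicator_def not_le\<close>)
  have ib: "integrable lborel (\<lambda>h. 1/2 * indicator (ball (0::'a) (\<delta>/2)) h :: real)"
    by (intro integrable_mult_right integrable_real_indicator emeasure_bounded_finite bounded_ball) auto
  have "(\<integral>h. 1/2 * indicator (ball (0::'a) (\<delta>/2)) h \<partial>lborel) \<le> (\<integral>h. k0 h \<partial>lborel)"
    by (rule integral_mono[OF ib i0]) (use assms b in \<open>auto simp: indicator_def k0_def field_simps\<close>)
  moreover have "0 < (\<integral>h. 1/2 * (indicator (ball (0::'a) (\<delta>/2)) h :: real) \<partial>lborel)"
    using content_ball_pos[of "\<delta>/2" "0::'a"] assms by simp
  ultimately have pos: "0 < (\<integral>h. k0 h \<partial>lborel)" by linarith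
  define I where "I = (\<integral>h. k0 h \<partial>lborel)"
  show ?thesis
    by (intro exI[of _ "\<lambda>h. k0 h / I"] exI[of _ "1 / I"])
       (use pos b i0 c0 in \<open>auto simp: I_def[symmetric] divide_right_mono intro!: continuous_intros\<close>)
qed

text \<open>\<open>q\<close> is the density of \<open>Y\<close> plus independent noise with density
  \<open>k\<close>. Read the other way round, testing against \<open>q\<close> averages the
  expectations of the translates of \<open>f\<close>, which is where an estimate for translations
  enters.\<close>

lemma mollified_law:
  fixes k :: "'a::euclidean_space \<Rightarrow> real" and Y :: "'w \<Rightarrow> 'a"
  assumes "prob_space R" and Y [measurable]: "Y \<in> borel_measurable R"
    and k: "continuous_on UNIV k" "\<And>h. 0 \<le> k h" "\<And>h. k h \<le> B" "integrable lborel k" "(\<integral>h. k h \<partial>lborel) = 1"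
  defines "q \<equiv> \<lambda>z. \<integral>\<omega>. k (z - Y \<omega>) \<partial>R"
  shows "q \<in> borel_measurable borel" "\<And>z. 0 \<le> q z" "(\<integral>\<^sup>+ z. ennreal (q z) \<partial>lborel) = 1" "integrable lborel q"
    and "\<And>f. test_function f \<Longrightarrow> (\<integral>z. f z * q z \<partial>lborel) = (\<integral>h. k h * (\<integral>\<omega>. f (Y \<omega> + h) \<partial>R) \<partial>lborel)"
    and "\<And>f. test_function f \<Longrightarrow> integrable lborel (\<lambda>h. k h * (\<integral>\<omega>. f (Y \<omega> + h) \<partial>R))"
proof -
  interpret prob_space R by fact
  interpret pr: pair_sigma_finite lborel R ..
  have km [measurable]: "k \<in> borel_measurable borel" by (rule borel_measurable_continuous_onI[OF k(1)])
  have iR: "integrable R (\<lambda>\<omega>. k (z - Y \<omega>))" for z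
    by (rule integrable_const_bound[where B=B]) (use k in auto)
  show qm: "q \<in> borel_measurable borel" unfolding q_def by measurable
  show q0: "0 \<le> q z" for z unfolding q_def using k by (intro integral_nonneg_AE) auto
  have k1: "(\<integral>\<^sup>+ h. ennreal (k h) \<partial>lborel) = 1"
    using nn_integral_eq_integral[OF k(4)] k by simp
  have "(\<integral>\<^sup>+ z. ennreal (q z) \<partial>lborel) = (\<integral>\<^sup>+ z. (\<integral>\<^sup>+ \<omega>. ennreal (k (z - Y \<omega>)) \<partial>R) \<partial>lborel)"
    unfolding q_def using nn_integral_eq_integral[OF iR] k by (intro nn_integral_cong) auto
  also have "\<dots> = (\<integral>\<^sup>+ \<omega>. (\<integral>\<^sup>+ z. ennreal (k (z - Y \<omega>)) \<partial>lborel) \<partial>R)"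
    by (rule pr.Fubini'[symmetric]) measurable
  also have "\<dots> = (\<integral>\<^sup>+ \<omega>. 1 \<partial>R)"
  proof (rule nn_integral_cong)
    fix \<omega>
    show "(\<integral>\<^sup>+ z. ennreal (k (z - Y \<omega>)) \<partial>lborel) = 1"
      by (subst nn_integral_lborel_shift[of _ "Y \<omega>"]) (auto simp: k1)
  qed
  finally show q1: "(\<integral>\<^sup>+ z. ennreal (q z) \<partial>lborel) = 1" by (simp add: emeasure_space_1)
  then show iq: "integrable lborel q" using qm q0 by (intro integrableI_nonneg) auto
  fix f :: "'a \<Rightarrow> real" assume f: "test_function f"
  have fm [measurable]: "f \<in> borel_measurable borel" by (rule test_function_measurable[OF f])
  have f01: "0 \<le> f y" "f y \<le> 1" for y using test_function_01[OF f] by auto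
  have i1: "integrable (lborel \<Otimes>\<^sub>M R) (\<lambda>(h, \<omega>). k h * f (Y \<omega> + h))"
  proof (rule integrableI_bounded)
    show "(\<lambda>(h, \<omega>). k h * f (Y \<omega> + h)) \<in> borel_measurable (lborel \<Otimes>\<^sub>M R)" by measurable
    have "(\<integral>\<^sup>+ p. ennreal (norm (case p of (h, \<omega>) \<Rightarrow> k h * f (Y \<omega> + h))) \<partial>(lborel \<Otimes>\<^sub>M R))
      \<le> (\<integral>\<^sup>+ p. ennreal (k (fst p)) \<partial>(lborel \<Otimes>\<^sub>M R))"
      by (intro nn_integral_mono) (use k f01 in \<open>auto simp: abs_mult mult_left_le\<close>)
    also have "\<dots> = (\<integral>\<^sup>+ h. (\<integral>\<^sup>+ \<omega>. ennreal (k h) \<partial>R) \<partial>lborel)"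
      by (subst nn_integral_fst[symmetric]) auto
    also have "\<dots> = 1" by (simp add: emeasure_space_1 k1)
    finally show "(\<integral>\<^sup>+ p. ennreal (norm (case p of (h, \<omega>) \<Rightarrow> k h * f (Y \<omega> + h))) \<partial>(lborel \<Otimes>\<^sub>M R)) < \<infinity>"
      by (simp add: le_less_trans[OF _ ennreal_one_less_top])
  qed
  have i2: "integrable (lborel \<Otimes>\<^sub>M R) (\<lambda>(z, \<omega>). f z * k (z - Y \<omega>))"
  proof (rule integrableI_bounded)
    show "(\<lambda>(z, \<omega>). f z * k (z - Y \<omega>)) \<in> borel_measurable (lborel \<Otimes>\<^sub>M R)" by measurable
    have "(\<integral>\<^sup>+ p. ennreal (norm (case p of (z, \<omega>) \<Rightarrow> f z * k (z - Y \<omega>))) \<partial>(lborel \<Otimes>\<^sub>M R))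
      \<le> (\<integral>\<^sup>+ p. ennreal (k (fst p - Y (snd p))) \<partial>(lborel \<Otimes>\<^sub>M R))"
      by (intro nn_integral_mono) (use k f01 in \<open>auto simp: abs_mult mult_left_le mult_left_le_one_le\<close>)
    also have "\<dots> = (\<integral>\<^sup>+ z. (\<integral>\<^sup>+ \<omega>. ennreal (k (z - Y \<omega>)) \<partial>R) \<partial>lborel)"
      by (subst nn_integral_fst[symmetric]) auto
    also have "\<dots> = (\<integral>\<^sup>+ z. ennreal (q z) \<partial>lborel)"
      unfolding q_def using nn_integral_eq_integral[OF iR] k by (intro nn_integral_cong) auto
    finally show "(\<integral>\<^sup>+ p. ennreal (norm (case p of (z, \<omega>) \<Rightarrow> f z * k (z - Y \<omega>))) \<partial>(lborel \<Otimes>\<^sub>M R)) < \<infinity>"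
      using q1 by (simp add: le_less_trans[OF _ ennreal_one_less_top])
  qed
  show "integrable lborel (\<lambda>h. k h * (\<integral>\<omega>. f (Y \<omega> + h) \<partial>R))"
    using pr.integrable_fst[OF i1] by simp
  have "(\<integral>z. f z * q z \<partial>lborel) = (\<integral>z. (\<integral>\<omega>. f z * k (z - Y \<omega>) \<partial>R) \<partial>lborel)" unfolding q_def by simp
  also have "\<dots> = (\<integral>\<omega>. (\<integral>z. f z * k (z - Y \<omega>) \<partial>lborel) \<partial>R)"
    using pr.Fubini_integral[OF i2] by simp
  also have "\<dots> = (\<integral>\<omega>. (\<integral>h. k h * f (Y \<omega> + h) \<partial>lborel) \<partial>R)"
  proof (rule Bochner_Integration.integral_cong[OF refl])
    fix \<omega>
    show "(\<integral>z. f z * k (z - Y \<omega>) \<partial>lborel) = (\<integral>h. k h * f (Y \<omega> + h) \<partial>lborel)"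
      by (subst integral_lborel_shift[of _ "Y \<omega>"]) (auto simp: mult.commute)
  qed
  also have "\<dots> = (\<integral>h. (\<integral>\<omega>. k h * f (Y \<omega> + h) \<partial>R) \<partial>lborel)"
    using pr.Fubini_integral[OF i1] by simp
  finally show "(\<integral>z. f z * q z \<partial>lborel) = (\<integral>h. k h * (\<integral>\<omega>. f (Y \<omega> + h) \<partial>R) \<partial>lborel)" by simp
qed

text \<open>The mollified expectation is an average over translations \<open>h\<close>, and the
  kernel gives weight only to those with norm at most \<delta>.\<close>

lemma mollification_error:
  fixes k :: "'a::euclidean_space \<Rightarrow> real" and Y :: "'w \<Rightarrow> 'a"
  assumes "prob_space R" and Y [measurable]: "Y \<in> borel_measurable R"
    and k: "continuous_on UNIV k" "\<And>h. 0 \<le> k h" "\<And>h. k h \<le> B" "integrable lborel k" "(\<integral>h. k h \<partial>lborel) = 1"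
    and supp: "\<And>h. norm h > \<delta> \<Longrightarrow> k h = 0"
    and f: "test_function f" and C: "0 \<le> C"
    and key: "\<And>h. \<bar>\<integral>\<omega>. f (Y \<omega> + h) - f (Y \<omega>) \<partial>R\<bar> \<le> \<eta> + C * norm h"
  shows "\<bar>(\<integral>\<omega>. f (Y \<omega>) \<partial>R) - (\<integral>z. f z * (\<integral>\<omega>. k (z - Y \<omega>) \<partial>R) \<partial>lborel)\<bar> \<le> \<eta> + C * \<delta>"
proof -
  interpret prob_space R by fact
  note ml = mollified_law[OF assms(1) Y k]
  have fm [measurable]: "f \<in> borel_measurable borel" by (rule test_function_measurable[OF f])
  have i: "integrable R (\<lambda>\<omega>. f (Y \<omega> + h))" for h
    by (rule integrable_const_bound[where B=1]) (use test_function_01[OF f] in auto)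
  have d: "\<bar>(\<integral>\<omega>. f (Y \<omega> + h) \<partial>R) - (\<integral>\<omega>. f (Y \<omega>) \<partial>R)\<bar> \<le> \<eta> + C * norm h" for h
    using key[of h] i[of h] i[of 0] by simp
  let ?E = "\<integral>\<omega>. f (Y \<omega>) \<partial>R"
  have "(\<integral>z. f z * (\<integral>\<omega>. k (z - Y \<omega>) \<partial>R) \<partial>lborel) - ?E
      = (\<integral>h. k h * (\<integral>\<omega>. f (Y \<omega> + h) \<partial>R) \<partial>lborel) - (\<integral>h. k h * ?E \<partial>lborel)"
    using ml(5)[OF f] k(5) by simp
  also have "\<dots> = (\<integral>h. k h * (\<integral>\<omega>. f (Y \<omega> + h) \<partial>R) - k h * ?E \<partial>lborel)"
    by (rule Bochner_Integration.integral_diff[symmetric]) (use ml(6)[OF f] k in auto)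
  also have "\<bar>\<dots>\<bar> \<le> (\<integral>h. \<bar>k h * (\<integral>\<omega>. f (Y \<omega> + h) \<partial>R) - k h * ?E\<bar> \<partial>lborel)" by (rule integral_abs_bound)
  also have "\<dots> \<le> (\<integral>h. k h * (\<eta> + C * \<delta>) \<partial>lborel)"
  proof (rule integral_mono)
    show "integrable lborel (\<lambda>h. \<bar>k h * (\<integral>\<omega>. f (Y \<omega> + h) \<partial>R) - k h * ?E\<bar>)"
      using ml(6)[OF f] k by (intro integrable_abs Bochner_Integration.integrable_diff) auto
    show "integrable lborel (\<lambda>h. k h * (\<eta> + C * \<delta>))" using k by simp
    fix h :: 'a
    show "\<bar>k h * (\<integral>\<omega>. f (Y \<omega> + h) \<partial>R) - k h * ?E\<bar> \<le> k h * (\<eta> + C * \<delta>)"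
    proof (cases "norm h > \<delta>")
      case False
      then have "\<eta> + C * norm h \<le> \<eta> + C * \<delta>" using C by (simp add: mult_left_mono)
      with d[of h] have "\<bar>(\<integral>\<omega>. f (Y \<omega> + h) \<partial>R) - ?E\<bar> \<le> \<eta> + C * \<delta>" by linarith
      then have "k h * \<bar>(\<integral>\<omega>. f (Y \<omega> + h) \<partial>R) - ?E\<bar> \<le> k h * (\<eta> + C * \<delta>)" using k(2) by (intro mult_left_mono)
      moreover have "\<bar>k h * (\<integral>\<omega>. f (Y \<omega> + h) \<partial>R) - k h * ?E\<bar> = k h * \<bar>(\<integral>\<omega>. f (Y \<omega> + h) \<partial>R) - ?E\<bar>"
        using k(2)[of h] by (simp add: abs_mult flip: right_diff_distrib)
      ultimately show ?thesis by simp
    qed (simp add: supp)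
  qed
  also have "\<dots> = \<eta> + C * \<delta>" using k by simp
  finally show ?thesis by linarith
qed

text \<open>A supremum of reals is meaningful only over a bounded set; each expectation has absolute
  value at most 1, so 2 is a bound. The three claims are the interface through which
  \<open>tv_dist\<close> is used.\<close>

lemma tv_dist_bounds:
  assumes M: "prob_space M" and M': "prob_space M'" and G [measurable]: "G \<in> borel_measurable M"
    and F [measurable]: "F \<in> borel_measurable M'"
  shows "0 \<le> tv_dist M' F M G"
    and "\<And>f. f \<in> borel_measurable borel \<Longrightarrow> (\<And>x. \<bar>f x\<bar> \<le> 1) \<Longrightarrow>
      \<bar>(LINT \<omega>|M'. f (F \<omega>)) - (LINT \<omega>|M. f (G \<omega>))\<bar> \<le> tv_dist M' F M G"
    and "(\<And>f :: _ \<Rightarrow> real. f \<in> borel_measurable borel \<Longrightarrow> (\<And>x. \<bar>f x\<bar> \<le> 1) \<Longrightarrow>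
      \<bar>(LINT \<omega>|M'. f (F \<omega>)) - (LINT \<omega>|M. f (G \<omega>))\<bar> \<le> D) \<Longrightarrow> tv_dist M' F M G \<le> D"
proof -
  interpret M: prob_space M by fact
  interpret M': prob_space M' by fact
  let ?S = "{f. f \<in> borel_measurable borel \<and> (\<forall>x. \<bar>f x\<bar> \<le> (1::real))}"
  let ?g = "\<lambda>f. \<bar>(LINT \<omega>|M'. f (F \<omega>)) - (LINT \<omega>|M. (f (G \<omega>) :: real))\<bar>"
  have le: "?g f \<le> 2" if "f \<in> ?S" for f
  proof -
    have [measurable]: "f \<in> borel_measurable borel" and b: "\<And>x. \<bar>f x\<bar> \<le> 1" using that by auto
    have "\<bar>LINT \<omega>|M'. f (F \<omega>)\<bar> \<le> (LINT \<omega>|M'. 1)"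
      by (rule order_trans[OF integral_abs_bound], rule integral_mono)
         (auto intro!: b integrable_abs M'.integrable_const_bound[where B=1])
    moreover have "\<bar>LINT \<omega>|M. f (G \<omega>)\<bar> \<le> (LINT \<omega>|M. 1)"
      by (rule order_trans[OF integral_abs_bound], rule integral_mono)
         (auto intro!: b integrable_abs M.integrable_const_bound[where B=1])
    ultimately show ?thesis by (simp add: M.prob_space M'.prob_space)
  qed
  have bdd: "bdd_above (?g ` ?S)" using le by (auto intro!: bdd_aboveI[of _ 2])
  have ne: "(\<lambda>_. 0) \<in> ?S" by auto
  show 2: "\<bar>(LINT \<omega>|M'. f (F \<omega>)) - (LINT \<omega>|M. f (G \<omega>))\<bar> \<le> tv_dist M' F M G"
    if "f \<in> borel_measurable borel" "\<And>x. \<bar>f x\<bar> \<le> 1" for f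
    unfolding tv_dist_def using that by (intro cSUP_upper[OF _ bdd]) auto
  show "0 \<le> tv_dist M' F M G" using 2[of "\<lambda>_. 0"] by simp
  show "tv_dist M' F M G \<le> D" if "\<And>f :: _ \<Rightarrow> real. f \<in> borel_measurable borel \<Longrightarrow> (\<And>x. \<bar>f x\<bar> \<le> 1) \<Longrightarrow>
      \<bar>(LINT \<omega>|M'. f (F \<omega>)) - (LINT \<omega>|M. f (G \<omega>))\<bar> \<le> D"
    unfolding tv_dist_def by (rule cSUP_least) (use ne that in blast)+
qed

text \<open>The smoothness estimate is assumed for the sequence alone. The limit law inherits
  closeness to its mollification, since both sides converge when tested against a continuous bounded
  function.\<close>

lemma tv_dist_tendsto_0:
  fixes F :: "'v \<Rightarrow> 'a::euclidean_space" and Fs :: "nat \<Rightarrow> 'w \<Rightarrow> 'a"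
  assumes M: "prob_space M" and M': "prob_space M'" and Fs [measurable]: "\<And>n. Fs n \<in> borel_measurable M"
    and F [measurable]: "F \<in> borel_measurable M'"
    and distr: "tendsto_in_distribution M Fs M' F"
    and key: "\<And>\<eta>. \<eta> > 0 \<Longrightarrow> \<exists>C. \<forall>\<^sub>F n in sequentially. \<forall>h f. test_function f \<longrightarrow>
        \<bar>LINT \<omega>|M. f (Fs n \<omega> + h) - f (Fs n \<omega>)\<bar> \<le> \<eta> + C * norm h"
  shows "(\<lambda>n. tv_dist M' F M (Fs n)) \<longlonglongrightarrow> 0"
proof (rule LIMSEQ_I)
  fix e :: real assume e: "e > 0"
  interpret M: prob_space M by fact
  interpret M': prob_space M' by fact
  \<comment> \<open>The errors below add up to 12 \<eta>, which 1/16 makes smaller than e.\<close>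
  define \<eta> where "\<eta> = e / 16"
  have \<eta>: "\<eta> > 0" using e by (simp add: \<eta>_def)
  obtain C0 where C0: "\<forall>\<^sub>F n in sequentially. \<forall>h f. test_function f \<longrightarrow>
        \<bar>LINT \<omega>|M. f (Fs n \<omega> + h) - f (Fs n \<omega>)\<bar> \<le> \<eta> + C0 * norm h" using key[OF \<eta>] by blast
  define C where "C = max C0 1"
  have C: "C > 0" "C0 \<le> C" by (auto simp: C_def)
  \<comment> \<open>With this radius mollification costs \<eta> + C \<delta> = 2 \<eta>.\<close>
  define \<delta> where "\<delta> = \<eta> / C"
  have \<delta>: "\<delta> > 0" "C * \<delta> = \<eta>" using \<eta> C by (auto simp: \<delta>_def)
  obtain k :: "'a \<Rightarrow> real" and B where k: "continuous_on UNIV k" "\<And>h. 0 \<le> k h" "\<And>h. k h \<le> B" "integrable lborel k" "(\<integral>h. k h \<partial>lborel) = 1"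
    and supp: "\<And>h. norm h > \<delta> \<Longrightarrow> k h = 0" using mollifier_exists[OF \<delta>(1)] by metis
  define q where "q n z = (LINT \<omega>|M. k (z - Fs n \<omega>))" for n z
  define p where "p z = (LINT \<omega>|M'. k (z - F \<omega>))" for z
  note mq = mollified_law[OF M Fs k, folded q_def]
  note mp = mollified_law[OF M' F k, folded p_def]
  have "(\<lambda>n. q n z) \<longlonglongrightarrow> p z" for z
  proof -
    have "continuous_on UNIV (\<lambda>y. k (z - y)) \<and> bounded (range (\<lambda>y. k (z - y)))"
    proof
      show "continuous_on UNIV (\<lambda>y. k (z - y))"
        by (rule continuous_on_compose2[OF k(1)]) (auto intro!: continuous_intros)
      show "bounded (range (\<lambda>y. k (z - y)))" unfolding bounded_iff using k(2,3) by (intro exI[of _ B]) auto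
    qed
    then show ?thesis using distr unfolding tendsto_in_distribution_def q_def p_def by blast
  qed
  then have "(\<lambda>n. \<integral>\<^sup>+ z. norm (q n z - p z) \<partial>lborel) \<longlonglongrightarrow> 0"
    by (intro Scheffe_lemma2) (use mq(1-4) mp(1-4) in auto)
  then have "\<forall>\<^sub>F n in sequentially. (\<integral>\<^sup>+ z. norm (q n z - p z) \<partial>lborel) < ennreal \<eta>"
    by (rule order_tendstoD(2)) (use \<eta> in simp)
  then have L1: "\<forall>\<^sub>F n in sequentially. (\<integral>z. \<bar>q n z - p z\<bar> \<partial>lborel) < \<eta>"
  proof eventually_elim
    case (elim n)
    have "(\<integral>\<^sup>+ z. norm (q n z - p z) \<partial>lborel) = ennreal (\<integral>z. \<bar>q n z - p z\<bar> \<partial>lborel)"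
      using mq(4) mp(4) by (subst nn_integral_eq_integral) auto
    then show ?case using elim by (simp add: ennreal_less_iff)
  qed
  have near: "\<bar>(\<integral>z. f z * q n z \<partial>lborel) - (\<integral>z. f z * p z \<partial>lborel)\<bar> \<le> (\<integral>z. \<bar>q n z - p z\<bar> \<partial>lborel)"
    if f: "test_function f" for f n
  proof -
    have fm [measurable]: "f \<in> borel_measurable borel" by (rule test_function_measurable[OF f])
    have i: "integrable lborel (\<lambda>z. f z * r z)" if "integrable lborel r" for r
      by (rule Bochner_Integration.integrable_bound[OF that])
         (use that test_function_01[OF f] in \<open>auto simp: abs_mult mult_left_le_one_le intro!: borel_measurable_times\<close>)
    have "(\<integral>z. f z * q n z \<partial>lborel) - (\<integral>z. f z * p z \<partial>lborel) = (\<integral>z. f z * (q n z - p z) \<partial>lborel)"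
      using i[OF mq(4)] i[OF mp(4)] by (simp add: right_diff_distrib)
    also have "\<bar>\<dots>\<bar> \<le> (\<integral>z. \<bar>f z * (q n z - p z)\<bar> \<partial>lborel)" by (rule integral_abs_bound)
    also have "\<dots> \<le> (\<integral>z. \<bar>q n z - p z\<bar> \<partial>lborel)"
      by (intro integral_mono integrable_abs i Bochner_Integration.integrable_diff mq mp)
         (use test_function_01[OF f] in \<open>auto simp: abs_mult mult_left_le_one_le\<close>)
    finally show ?thesis .
  qed
  have moll: "\<forall>\<^sub>F n in sequentially. \<forall>f. test_function f \<longrightarrow> \<bar>(LINT \<omega>|M. f (Fs n \<omega>)) - (\<integral>z. f z * q n z \<partial>lborel)\<bar> \<le> 2 * \<eta>"
    using C0
  proof eventually_elim
    case (elim n)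
    show ?case
    proof (intro allI impI)
      fix f :: "'a \<Rightarrow> real" assume f: "test_function f"
      have "\<bar>LINT \<omega>|M. f (Fs n \<omega> + h) - f (Fs n \<omega>)\<bar> \<le> \<eta> + C * norm h" for h
      proof -
        have "C0 * norm h \<le> C * norm h" using C by (intro mult_right_mono) auto
        moreover have "\<bar>LINT \<omega>|M. f (Fs n \<omega> + h) - f (Fs n \<omega>)\<bar> \<le> \<eta> + C0 * norm h"
          using elim f by blast
        ultimately show ?thesis by linarith
      qed
      from mollification_error[where \<delta>=\<delta>, OF M Fs k supp f less_imp_le[OF C(1)] this]
      show "\<bar>(LINT \<omega>|M. f (Fs n \<omega>)) - (\<integral>z. f z * q n z \<partial>lborel)\<bar> \<le> 2 * \<eta>"
        using \<delta>(2) by (simp add: q_def)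
    qed
  qed
  \<comment> \<open>2 \<eta> for mollifying \<open>Fs n\<close> and \<eta> for the L^1 distance of
    the mollified densities, carried to the limit in n.\<close>
  have limF: "\<bar>(LINT \<omega>|M'. f (F \<omega>)) - (\<integral>z. f z * p z \<partial>lborel)\<bar> \<le> 3 * \<eta>" if f: "test_function f" for f
  proof -
    have "continuous_on UNIV f \<and> bounded (range f)"
      using test_function_continuous[OF f] test_function_01[OF f] by (auto simp: bounded_iff intro!: exI[of _ 1])
    then have "(\<lambda>n. LINT \<omega>|M. f (Fs n \<omega>)) \<longlonglongrightarrow> (LINT \<omega>|M'. f (F \<omega>))"
      using distr unfolding tendsto_in_distribution_def by blast
    then have "(\<lambda>n. \<bar>(LINT \<omega>|M. f (Fs n \<omega>)) - (\<integral>z. f z * p z \<partial>lborel)\<bar>) \<longlonglongrightarrow> \<bar>(LINT \<omega>|M'. f (F \<omega>)) - (\<integral>z. f z * p z \<partial>lborel)\<bar>"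
      by (intro tendsto_intros)
    moreover have "\<forall>\<^sub>F n in sequentially. \<bar>(LINT \<omega>|M. f (Fs n \<omega>)) - (\<integral>z. f z * p z \<partial>lborel)\<bar> \<le> 3 * \<eta>"
      using moll L1
    proof eventually_elim
      case (elim n)
      then have "\<bar>(LINT \<omega>|M. f (Fs n \<omega>)) - (\<integral>z. f z * q n z \<partial>lborel)\<bar> \<le> 2 * \<eta>" using f by blast
      then show ?case using near[OF f, of n] elim(2) by linarith
    qed
    ultimately show ?thesis by (rule tendsto_upperbound) simp
  qed
  \<comment> \<open>On test functions the laws differ by at most 3 \<eta> + \<eta> + 2 \<eta>;
    passing to measurable functions bounded by 1 doubles this.\<close>
  have tv: "\<forall>\<^sub>F n in sequentially. tv_dist M' F M (Fs n) \<le> 12 * \<eta>"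
    using moll L1
  proof eventually_elim
    case (elim n)
    let ?P = "distr M' borel F" and ?Q = "distr M borel (Fs n)"
    have P: "prob_space ?P" "sets ?P = sets borel" "prob_space ?Q" "sets ?Q = sets borel"
      by (auto intro: M.prob_space_distr M'.prob_space_distr)
    have t: "\<bar>(\<integral>y. f y \<partial>?P) - (\<integral>y. f y \<partial>?Q)\<bar> \<le> 6 * \<eta>" if f: "test_function f" for f
    proof -
      have [measurable]: "f \<in> borel_measurable borel" by (rule test_function_measurable[OF f])
      have "\<bar>(LINT \<omega>|M'. f (F \<omega>)) - (LINT \<omega>|M. f (Fs n \<omega>))\<bar> \<le> 6 * \<eta>"
      proof -
        have "\<bar>(LINT \<omega>|M. f (Fs n \<omega>)) - (\<integral>z. f z * q n z \<partial>lborel)\<bar> \<le> 2 * \<eta>" using elim(1) f by blast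
        then show ?thesis using limF[OF f] near[OF f, of n] elim(2) by linarith
      qed
      then show ?thesis by (simp add: integral_distr)
    qed
    show ?case
    proof (rule tv_dist_bounds(3)[OF M M' Fs F])
      fix f :: "'a \<Rightarrow> real" assume f [measurable]: "f \<in> borel_measurable borel" and f1: "\<And>x. \<bar>f x\<bar> \<le> 1"
      have "\<bar>(\<integral>y. f y \<partial>?P) - (\<integral>y. f y \<partial>?Q)\<bar> \<le> 2 * (6 * \<eta>)"
        by (rule integral_diff_bound[OF P measure_diff_bound[OF P t] f f1])
      then show "\<bar>(LINT \<omega>|M'. f (F \<omega>)) - (LINT \<omega>|M. f (Fs n \<omega>))\<bar> \<le> 12 * \<eta>" by (simp add: integral_distr)
    qed
  qed
  show "\<exists>N. \<forall>n\<ge>N. norm (tv_dist M' F M (Fs n) - 0) < e"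
    using tv_dist_bounds(1)[OF M M' Fs F] e 
    by (intro iffD1[OF eventually_sequentially] eventually_mono[OF tv])
       (simp add: \<eta>_def)
qed

section \<open>Cylindrical functionals on a time grid\<close>

definition dep_on :: "nat \<Rightarrow> ((nat \<times> 'N \<Rightarrow> real) \<Rightarrow> real) \<Rightarrow> bool" where
  "dep_on N \<phi> \<longleftrightarrow> (\<forall>x y. (\<forall>j<N. \<forall>i. x (j, i) = y (j, i)) \<longrightarrow> \<phi> x = \<phi> y)"

lemma dep_on_partial: assumes "dep_on N \<phi>" shows "dep_on N (partial c \<phi>)"
  unfolding dep_on_def
proof (intro allI impI)
  fix x y :: "nat \<times> 'a \<Rightarrow> real" assume xy: "\<forall>j<N. \<forall>i. x (j, i) = y (j, i)"
  have e: "\<phi> u = \<phi> w" if "\<forall>j<N. \<forall>i. u (j, i) = w (j, i)" for u w using assms that unfolding dep_on_def by blast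
  have "(\<lambda>t. \<phi> (x(c := t))) = (\<lambda>t. \<phi> (y(c := t)))" by (intro ext e) (use xy in auto)
  \<comment> \<open>Either the two points agree at \<open>c\<close>, or \<phi> ignores that
    coordinate and its derivative is that of a constant.\<close>
  moreover have "x c = y c \<or> deriv (\<lambda>t. \<phi> (y(c := t))) (x c) = deriv (\<lambda>t. \<phi> (y(c := t))) (y c)"
  proof (cases "fst c < N")
    case True then show ?thesis using xy by (cases c) auto
  next
    case False
    have "(\<lambda>t. \<phi> (y(c := t))) = (\<lambda>t. \<phi> y)" by (intro ext e) (use False in auto)
    then show ?thesis by simp
  qed
  ultimately show "partial c \<phi> x = partial c \<phi> y" unfolding partial_def by auto
qed

lemma smooth_poly_growth_smooth:
  assumes "smooth_poly_growth N (\<phi> :: (nat \<times> 'N::finite \<Rightarrow> real) \<Rightarrow> real)"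
  shows "smooth ({..<N} \<times> UNIV) \<phi>" "dep_on N \<phi>"
proof -
  have "(\<Sum>j<N. \<Sum>i\<in>UNIV. \<bar>x (j, i)\<bar>) = (\<Sum>c\<in>{..<N} \<times> UNIV. \<bar>x c\<bar>)" for x :: "nat \<times> 'N \<Rightarrow> real"
    by (simp add: sum.cartesian_product)
  then show "smooth ({..<N} \<times> UNIV) \<phi>" using assms unfolding smooth_poly_growth_def smooth_def tempered_def by simp
  show "dep_on N \<phi>" using assms unfolding smooth_poly_growth_def dep_on_def by blast
qed

lemma sum_PiE_lessThan_Suc:
  fixes f :: "(nat \<Rightarrow> 'b) \<Rightarrow> 'c::comm_monoid_add"
  shows "(\<Sum>J\<in>{..<Suc k} \<rightarrow>\<^sub>E B. f J) = (\<Sum>j\<in>B. \<Sum>J\<in>{..<k} \<rightarrow>\<^sub>E B. f (J(k := j)))"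
proof -
  have "{..<Suc k} \<rightarrow>\<^sub>E B = (\<lambda>(j, J). J(k := j)) ` (B \<times> ({..<k} \<rightarrow>\<^sub>E B))"
    unfolding lessThan_Suc by (rule PiE_insert_eq)
  moreover have "inj_on (\<lambda>(j, J). J(k := j)) (B \<times> ({..<k} \<rightarrow>\<^sub>E B))"
    by (rule inj_combinator) simp
  ultimately have "(\<Sum>J\<in>{..<Suc k} \<rightarrow>\<^sub>E B. f J) = (\<Sum>p\<in>B \<times> ({..<k} \<rightarrow>\<^sub>E B). f ((\<lambda>(j, J). J(k := j)) p))"
    by (simp only: sum.reindex o_def)
  then show ?thesis by (simp add: sum.cartesian_product case_prod_beta)
qed

lemma cyl_deriv_0: "cyl_deriv W ts \<phi> 0 \<alpha> s \<omega> = cyl_val W ts \<phi> \<omega>"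
  by (simp add: cyl_deriv_def cyl_val_def)

text \<open>The last index is the innermost differentiation in \<open>iter_partial\<close>, so
  removing it replaces \<phi> by a partial derivative and permits induction for all \<phi> at
  once.\<close>

lemma cyl_deriv_Suc:
  "cyl_deriv W ts \<phi> (Suc k) \<alpha> s \<omega> =
    (\<Sum>j<length ts. indicator {0..<ts ! j} (s k) * cyl_deriv W ts (partial (j, \<alpha> k) \<phi>) k \<alpha> s \<omega>)"
proof -
  have "cyl_deriv W ts \<phi> (Suc k) \<alpha> s \<omega> = (\<Sum>j<length ts. \<Sum>J\<in>{..<k} \<rightarrow>\<^sub>E {..<length ts}.
     iter_partial (map (\<lambda>l. (J l, \<alpha> l)) [0..<k]) (partial (j, \<alpha> k) \<phi>) (cyl_point W ts \<omega>) *
     ((\<Prod>l<k. indicator {0..<ts ! J l} (s l)) * indicator {0..<ts ! j} (s k)))"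
    unfolding cyl_deriv_def sum_PiE_lessThan_Suc
  proof (intro sum.cong refl)
    fix j :: nat and J :: "nat \<Rightarrow> nat"
    have 1: "map (\<lambda>l. ((J(k := j)) l, \<alpha> l)) [0..<Suc k] = map (\<lambda>l. (J l, \<alpha> l)) [0..<k] @ [(j, \<alpha> k)]"
      by auto
    have 2: "(\<Prod>l<Suc k. indicator {0..<ts ! (J(k := j)) l} (s l)) =
       (\<Prod>l<k. indicator {0..<ts ! J l} (s l)) * (indicator {0..<ts ! j} (s k) :: real)"
      by simp
    show "iter_partial (map (\<lambda>l. ((J(k := j)) l, \<alpha> l)) [0..<Suc k]) \<phi> (cyl_point W ts \<omega>) *
       (\<Prod>l<Suc k. indicator {0..<ts ! (J(k := j)) l} (s l)) =
      iter_partial (map (\<lambda>l. (J l, \<alpha> l)) [0..<k]) (partial (j, \<alpha> k) \<phi>) (cyl_point W ts \<omega>) *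
       ((\<Prod>l<k. indicator {0..<ts ! J l} (s l)) * indicator {0..<ts ! j} (s k))"
      unfolding 1 2 iter_partial_append by simp
  qed
  then show ?thesis by (simp add: cyl_deriv_def sum_distrib_left mult_ac)
qed

lemma partial_linear_combination:
  assumes "\<And>i. i \<in> I \<Longrightarrow> smooth D (g i)"
  shows "partial c (\<lambda>x. \<Sum>i\<in>I. a i * g i x) = (\<lambda>x. \<Sum>i\<in>I. a i * partial c (g i) x)"
  by (rule pder_partial[of D], rule pder_sum, rule pder_cmult, rule smooth_pder, rule assms)

lemma iter_partial_linear_combination:
  assumes "\<And>i. i \<in> I \<Longrightarrow> smooth D (g i)"
  shows "iter_partial cs (\<lambda>x. \<Sum>i\<in>I. a i * g i x) = (\<lambda>x. \<Sum>i\<in>I. a i * iter_partial cs (g i) x)"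
proof (induction cs)
  case (Cons c cs)
  show ?case unfolding iter_partial.simps Cons
    by (rule partial_linear_combination[OF smooth_iter[OF assms]])
qed simp

section \<open>Functionals of the increments over a grid\<close>

lemma sigma_finite_unit_interval: "sigma_finite_measure (restrict_space lborel {0..<1::real})"
proof -
  have "finite_measure (restrict_space lborel {0..<1::real})"
    by (rule finite_measureI) (simp add: emeasure_restrict_space space_restrict_space)
  then show ?thesis by (rule finite_measure.axioms(1))
qed

text \<open>One grid will contain the time points of all functionals in an inequality, which turns
  the inequality into one about finitely many independent Gaussian variables. Strict monotonicity
  gives them positive variances.\<close>

locale brownian_grid =
  fixes M :: "'w measure" and W :: "'N::finite \<Rightarrow> real \<Rightarrow> 'w \<Rightarrow> real" and t :: "nat \<Rightarrow> real" and n :: nat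
  assumes bm: "brownian_motion M W" and tm: "strict_mono_on {..n} t" and t0: "t 0 = 0" and tn: "t n = 1"
begin

definition slots :: "('N \<times> nat) set" where "slots = UNIV \<times> {..<n}"
definition len :: "'N \<times> nat \<Rightarrow> real" where "len = (\<lambda>(i, l). t (Suc l) - t l)"
definition incr :: "'N \<times> nat \<Rightarrow> 'w \<Rightarrow> real" where "incr = (\<lambda>(i, l) \<omega>. W i (t (Suc l)) \<omega> - W i (t l) \<omega>)"

lemma t_less: "a < b \<Longrightarrow> b \<le> n \<Longrightarrow> t a < t b"
  using strict_mono_onD[OF tm, of a b] by simp

lemma t_le_iff: "a \<le> n \<Longrightarrow> b \<le> n \<Longrightarrow> t a \<le> t b \<longleftrightarrow> a \<le> b"
  by (metis linorder_not_less order.strict_iff_not t_less order_le_less)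

lemma t_01: "a \<le> n \<Longrightarrow> 0 \<le> t a \<and> t a \<le> 1"
  using t_le_iff[of 0 a] t_le_iff[of a n] t0 tn by simp

sublocale gaussian_slots M slots len incr
proof (intro gaussian_slots.intro gaussian_slots_axioms.intro)
  show "prob_space M" using bm by (simp add: brownian_motion_def)
  show "finite slots" by (simp add: slots_def)
  show "0 < len c" if "c \<in> slots" for c using that t_less by (auto simp: slots_def len_def)
  have "t ` {..n} \<subseteq> {0..1}" using t_01 by auto
  then show "prob_space.indep_vars M (\<lambda>_. borel) incr slots"
    using bm tm unfolding brownian_motion_def incr_def slots_def by blast
  fix c assume "c \<in> slots"
  then obtain i l where c: "c = (i, l)" "l < n" by (auto simp: slots_def)
  then have "0 \<le> t l \<and> t l < t (Suc l) \<and> t (Suc l) \<le> 1" using t_01[of l] t_01[of "Suc l"] t_less[of l "Suc l"] by auto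
  then show "distributed M lborel (incr c) (\<lambda>x. ennreal (normal_density 0 (sqrt (len c)) x))"
    using bm unfolding brownian_motion_def c incr_def len_def by auto
qed

lemma len_nonneg: "l < n \<Longrightarrow> 0 \<le> len (i, l)"
  using t_less[of l "Suc l"] by (simp add: len_def)

text \<open>
  Writing \<open>W\<^bsub>ts ! j\<^esub>\<close> as a sum of increments over the grid makes a functional of the path values
  a function \<open>lift ts \<phi>\<close> of independent Gaussian slots.
\<close>

definition covers :: "real list \<Rightarrow> nat \<Rightarrow> nat \<Rightarrow> real" where
  "covers ts l j = (if l < n \<and> j < length ts \<and> t (Suc l) \<le> ts ! j then 1 else 0)"

definition path :: "real list \<Rightarrow> ('N \<times> nat \<Rightarrow> real) \<Rightarrow> nat \<times> 'N \<Rightarrow> real" where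
  "path ts x = (\<lambda>(j, i). \<Sum>l<n. covers ts l j * x (i, l))"

definition lift :: "real list \<Rightarrow> ((nat \<times> 'N \<Rightarrow> real) \<Rightarrow> real) \<Rightarrow> ('N \<times> nat \<Rightarrow> real) \<Rightarrow> real" where
  "lift ts \<phi> x = \<phi> (path ts x)"

text \<open>Path values are linear in the increments, with coefficients 0 and 1, so each is at most
  the sum of the absolute increments.\<close>

lemma tempered_lift: assumes "tempered ({..<length ts} \<times> UNIV) \<phi>" shows "tempered slots (lift ts \<phi>)"
proof -
  let ?K = "{..<length ts} \<times> (UNIV :: 'N set)"
  obtain K q where K: "0 \<le> K" "\<And>x. \<bar>\<phi> x\<bar> \<le> K * (1 + (\<Sum>c\<in>?K. \<bar>x c\<bar>)) ^ q" using temperedE[OF assms] by blast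
  have pc: "continuous_on UNIV (path ts)"
  proof (rule continuous_on_coordinatewise_then_product)
    fix c
    show "continuous_on UNIV (\<lambda>x. path ts x c)"
      unfolding path_def by (cases c) (auto intro!: continuous_intros)
  qed
  show ?thesis
  proof (rule temperedI[where K="K * (1 + real (card ?K)) ^ q" and q=q])
    show "continuous_on UNIV (lift ts \<phi>)"
      unfolding lift_def[abs_def] by (rule continuous_on_compose2[OF tempered_cont[OF assms] pc]) auto
    fix x :: "'N \<times> nat \<Rightarrow> real"
    let ?S = "\<Sum>c\<in>slots. \<bar>x c\<bar>"
    have S0: "0 \<le> ?S" by (simp add: sum_nonneg)
    have "\<bar>path ts x c\<bar> \<le> ?S" for c
    proof -
      obtain j i where c: "c = (j, i)" by (cases c)
      have "\<bar>path ts x c\<bar> \<le> (\<Sum>l<n. \<bar>x (i, l)\<bar>)"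
        unfolding path_def c by (simp, rule order_trans[OF sum_abs], rule sum_mono) (auto simp: covers_def)
      also have "\<dots> = (\<Sum>c\<in>Pair i ` {..<n}. \<bar>x c\<bar>)" by (subst sum.reindex) (auto simp: inj_on_def)
      also have "\<dots> \<le> ?S" by (rule sum_mono2) (auto simp: slots_def)
      finally show ?thesis .
    qed
    then have "(\<Sum>c\<in>?K. \<bar>path ts x c\<bar>) \<le> real (card ?K) * ?S"
      using sum_bounded_above[of ?K "\<lambda>c. \<bar>path ts x c\<bar>" ?S] by simp
    then have "1 + (\<Sum>c\<in>?K. \<bar>path ts x c\<bar>) \<le> (1 + real (card ?K)) * (1 + ?S)"
      using S0 by (simp add: algebra_simps add_increasing)
    then have "(1 + (\<Sum>c\<in>?K. \<bar>path ts x c\<bar>)) ^ q \<le> ((1 + real (card ?K)) * (1 + ?S)) ^ q"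
      by (intro power_mono) (auto simp: sum_nonneg add_nonneg_nonneg)
    then have "K * (1 + (\<Sum>c\<in>?K. \<bar>path ts x c\<bar>)) ^ q \<le> K * ((1 + real (card ?K)) ^ q * (1 + ?S) ^ q)"
      using K(1) by (simp add: power_mult_distrib mult_left_mono)
    then show "\<bar>lift ts \<phi> x\<bar> \<le> K * (1 + real (card ?K)) ^ q * (1 + ?S) ^ q"
      using K(2)[of "path ts x"] unfolding lift_def by (simp add: mult_ac)
  qed
qed

lemma pder_lift:
  assumes \<phi>: "smooth ({..<length ts} \<times> UNIV) \<phi>"
  shows "pder slots (i, l) (lift ts \<phi>) (\<lambda>x. \<Sum>j<length ts. covers ts l j * lift ts (partial (j, i) \<phi>) x)"
  unfolding pder_def
proof (intro conjI allI)
  show "tempered slots (lift ts \<phi>)" by (rule tempered_lift[OF smooth_tempered[OF \<phi>]])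
  show "tempered slots (\<lambda>x. \<Sum>j<length ts. covers ts l j * lift ts (partial (j, i) \<phi>) x)"
    by (intro tempered_sum tempered_mult tempered_const tempered_lift smooth_tempered smooth_partial \<phi>)
  fix x
  let ?K = "{..<length ts} \<times> (UNIV :: 'N set)"
  \<comment> \<open>The direction in which the path values move when the increment in slot
    \<open>(i, l)\<close> changes at unit speed: just component \<open>i\<close> moves, at the times
    that lie beyond the interval.\<close>
  define a where "a = (\<lambda>(j, i'). if i' = i then covers ts l j else 0)"
  have upd: "path ts (x((i, l) := s)) = (\<lambda>c. path ts x c + (if c \<in> ?K then (s - x (i, l)) * a c else 0))" for s
  proof
    fix c :: "nat \<times> 'N"
    obtain j i' where c: "c = (j, i')" by (cases c)
    show "path ts (x((i, l) := s)) c = path ts x c + (if c \<in> ?K then (s - x (i, l)) * a c else 0)"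
    proof (cases "i' = i \<and> l < n")
      case True
      have "path ts (x((i, l) := s)) c = covers ts l j * s + (\<Sum>l'\<in>{..<n} - {l}. covers ts l' j * x (i, l'))"
        using True by (simp add: path_def c sum.remove[of "{..<n}" l])
      moreover have "path ts x c = covers ts l j * x (i, l) + (\<Sum>l'\<in>{..<n} - {l}. covers ts l' j * x (i, l'))"
        using True by (simp add: path_def c sum.remove[of "{..<n}" l])
      moreover have "j \<ge> length ts \<Longrightarrow> covers ts l j = 0" by (simp add: covers_def)
      ultimately show ?thesis using True by (auto simp: a_def c algebra_simps not_less)
    next
      case False
      have "path ts (x((i, l) := s)) c = path ts x c" unfolding path_def c using False by (auto intro!: sum.cong)
      moreover have "a c = 0" using False by (auto simp: a_def c covers_def)
      ultimately show ?thesis by simp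
    qed
  qed
  have "((\<lambda>s. \<phi> (\<lambda>c. path ts x c + (if c \<in> ?K then s * a c else 0))) has_real_derivative (\<Sum>c\<in>?K. a c * partial c \<phi> (path ts x))) (at 0)"
    using directional_derivative[of ?K ?K \<phi> "\<lambda>c. partial c \<phi>" "path ts x" a] smooth_pder[OF \<phi>] by simp
  then have "((\<lambda>s. \<phi> (\<lambda>c. path ts x c + (if c \<in> ?K then (s + - x (i, l)) * a c else 0)))
      has_real_derivative (\<Sum>c\<in>?K. a c * partial c \<phi> (path ts x))) (at (x (i, l)))"
    by (subst DERIV_shift[symmetric]) simp
  from this[unfolded add_uminus_conv_diff]
  have "((\<lambda>s. lift ts \<phi> (x((i, l) := s))) has_real_derivative (\<Sum>c\<in>?K. a c * partial c \<phi> (path ts x))) (at (x (i, l)))"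
    unfolding lift_def upd .
  also have "(\<Sum>c\<in>?K. a c * partial c \<phi> (path ts x)) = (\<Sum>j<length ts. covers ts l j * lift ts (partial (j, i) \<phi>) x)"
  proof -
    have "(\<Sum>c\<in>?K. f c) = (\<Sum>j<length ts. \<Sum>i'\<in>UNIV. f (j, i'))" for f :: "nat \<times> 'N \<Rightarrow> real"
      by (subst sum.cartesian_product) simp
    then show ?thesis
      by (simp add: a_def lift_def if_distrib[of "\<lambda>z. z * _"] sum.delta cong: if_cong)
  qed
  finally show "((\<lambda>s. lift ts \<phi> (x((i, l) := s))) has_real_derivative (\<Sum>j<length ts. covers ts l j * lift ts (partial (j, i) \<phi>) x)) (at (x (i, l)))" .
qed

text \<open>The linear span of the lifts. A partial derivative of a lift is a linear combination of
  lifts, so the span is closed under differentiation, as coinduction asks, while the set of lifts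
  itself need not be.\<close>

inductive_set lifts :: "real list \<Rightarrow> (('N \<times> nat \<Rightarrow> real) \<Rightarrow> real) set" for ts where
  base: "smooth ({..<length ts} \<times> UNIV) \<phi> \<Longrightarrow> lift ts \<phi> \<in> lifts ts"
| zero: "(\<lambda>_. 0) \<in> lifts ts"
| add: "f \<in> lifts ts \<Longrightarrow> g \<in> lifts ts \<Longrightarrow> (\<lambda>x. f x + g x) \<in> lifts ts"
| scale: "f \<in> lifts ts \<Longrightarrow> (\<lambda>x. k * f x) \<in> lifts ts"

lemma smooth_lift: assumes "smooth ({..<length ts} \<times> UNIV) \<phi>" shows "smooth slots (lift ts \<phi>)"
proof (rule smooth_coinduct_set[where S="lifts ts"])
  fix g c assume "g \<in> lifts ts"
  then show "\<exists>g'\<in>lifts ts. pder slots c g g'"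
  proof induction
    case (base \<phi>)
    obtain i l where c: "c = (i, l)" by (cases c)
    have "(\<lambda>x. \<Sum>j\<in>J. covers ts l j * lift ts (partial (j, i) \<phi>) x) \<in> lifts ts" if "finite J" for J
      using that by induction (auto intro!: lifts.intros smooth_partial base)
    then show ?case using pder_lift[OF base, of i l] unfolding c by blast
  qed (auto intro: pder_const pder_add pder_cmult lifts.intros)
qed (rule lifts.base[OF assms])

lemma partial_lift:
  "smooth ({..<length ts} \<times> UNIV) \<phi> \<Longrightarrow>
    partial (i, l) (lift ts \<phi>) = (\<lambda>x. \<Sum>j<length ts. covers ts l j * lift ts (partial (j, i) \<phi>) x)"
  by (rule pder_partial[OF pder_lift])

text \<open>The index l with t l \<le> s < t (Suc l), encoded as the number of interval end points
  passed by \<open>s\<close>, which makes measurability immediate.\<close>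

definition cell :: "real \<Rightarrow> nat" where "cell s = (\<Sum>l<n. if t (Suc l) \<le> s then 1 else 0)"

lemma cell_eq: assumes "l < n" "t l \<le> s" "s < t (Suc l)" shows "cell s = l"
proof -
  have "{l'. l' < n \<and> t (Suc l') \<le> s} = {..<l}"
  proof (intro set_eqI iffI)
    fix l' assume "l' \<in> {l'. l' < n \<and> t (Suc l') \<le> s}"
    then have "t (Suc l') < t (Suc l)" "l' < n" using assms by auto
    then show "l' \<in> {..<l}" using t_le_iff[of "Suc l" "Suc l'"] assms by (auto simp: not_le)
  next
    fix l' assume "l' \<in> {..<l}"
    then have "t (Suc l') \<le> t l" "l' < n" using t_le_iff[of "Suc l'" l] assms by auto
    then show "l' \<in> {l'. l' < n \<and> t (Suc l') \<le> s}" using assms by auto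
  qed
  moreover have "cell s = card {l'. l' < n \<and> t (Suc l') \<le> s}"
    unfolding cell_def by (simp add: sum.If_cases Int_def)
  ultimately show ?thesis by simp
qed

lemma cell_exists: assumes "0 \<le> s" "s < 1" shows "\<exists>l<n. t l \<le> s \<and> s < t (Suc l)"
proof -
  define m where "m = (LEAST m. s < t m)"
  have ex: "s < t n" using assms tn by simp
  then have m: "s < t m" "m \<le> n" unfolding m_def by (rule LeastI, rule Least_le)
  have "m \<noteq> 0" using m(1) t0 assms by (metis not_le)
  then obtain l where l: "m = Suc l" by (cases m) auto
  have "\<not> s < t l" using not_less_Least[of l "\<lambda>m. s < t m"] unfolding m_def[symmetric] l by simp
  then show ?thesis using m l by (intro exI[of _ l]) auto
qed

lemma cell_measurable [measurable]: "cell \<in> borel \<rightarrow>\<^sub>M count_space UNIV"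
  unfolding cell_def[abs_def] by measurable

text \<open>No time point of \<open>ts\<close> lies strictly inside a grid interval, so the
  indicator is constant on each cell.\<close>

lemma indicator_covers:
  assumes "0 \<le> s" "s < 1" "set ts \<subseteq> t ` {..n}" "j < length ts"
  shows "indicator {0..<ts ! j} s = covers ts (cell s) j"
proof -
  obtain l where l: "l < n" "t l \<le> s" "s < t (Suc l)" using cell_exists[OF assms(1,2)] by blast
  obtain m where m: "m \<le> n" "ts ! j = t m" using assms(3,4) nth_mem[of j ts] by fastforce
  have "s < t m \<longleftrightarrow> t (Suc l) \<le> t m"
  proof (cases "Suc l \<le> m")
    case True
    then show ?thesis using l m t_le_iff[of "Suc l" m] by auto
  next
    case False
    then show ?thesis using l m t_le_iff[of "Suc l" m] t_le_iff[of m l] by auto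
  qed
  then show ?thesis using l m assms by (simp add: cell_eq[OF l] covers_def indicator_def)
qed

lemma pt_slot: "pt \<omega> (i, l) = (if l < n then W i (t (Suc l)) \<omega> - W i (t l) \<omega> else 0)"
  unfolding pt_def by (simp add: slots_def incr_def)

text \<open>The increments telescope down to the value at time 0. That value is 0 almost surely
  only, hence the hypothesis on the single \<omega>.\<close>

lemma path_pt:
  assumes "\<And>i. W i 0 \<omega> = 0" "set ts \<subseteq> t ` {..n}" "j < length ts"
  shows "path ts (pt \<omega>) (j, i) = W i (ts ! j) \<omega>"
proof -
  obtain m where m: "m \<le> n" "ts ! j = t m" using assms(2,3) nth_mem[of j ts] by fastforce
  have "path ts (pt \<omega>) (j, i) = (\<Sum>l<n. if l < m then W i (t (Suc l)) \<omega> - W i (t l) \<omega> else 0)"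
    unfolding path_def by (simp, intro sum.cong refl)
      (use m assms(3) t_le_iff in \<open>auto simp: covers_def pt_slot Suc_le_eq\<close>)
  also have "\<dots> = (\<Sum>l<m. W i (t (Suc l)) \<omega> - W i (t l) \<omega>)"
    using m by (intro sum.mono_neutral_cong_right) auto
  also have "\<dots> = W i (t m) \<omega>" 
    using assms(1)[of i] t0 sum_lessThan_telescope[of "\<lambda>l. W i (t l) \<omega>" m] by simp
  finally show ?thesis using m by simp
qed

lemma cyl_val_lift:
  assumes "\<And>i. W i 0 \<omega> = 0" "set ts \<subseteq> t ` {..n}" "dep_on (length ts) \<phi>"
  shows "cyl_val W ts \<phi> \<omega> = lift ts \<phi> (pt \<omega>)"
proof -
  have "\<forall>j<length ts. \<forall>i. cyl_point W ts \<omega> (j, i) = path ts (pt \<omega>) (j, i)"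
    using path_pt[OF assms(1,2)] by (simp add: cyl_point_def)
  then show ?thesis using assms(3) unfolding cyl_val_def lift_def dep_on_def by blast
qed

text \<open>A derivative kernel of a cylindrical functional is a step function on products of cells.
  Differentiation at time s is differentiation in the increment over the cell of s, because exactly
  the path values at the later time points contain that increment.\<close>

lemma cyl_deriv_lift:
  assumes \<omega>: "\<And>i. W i 0 \<omega> = 0" and ts: "set ts \<subseteq> t ` {..n}"
    and s: "\<And>q. q < k \<Longrightarrow> 0 \<le> s q \<and> s q < 1"
    and \<phi>: "dep_on (length ts) \<phi>" "smooth ({..<length ts} \<times> UNIV) \<phi>"
  shows "cyl_deriv W ts \<phi> k \<alpha> s \<omega> = iter_partial (map (\<lambda>q. (\<alpha> q, cell (s q))) [0..<k]) (lift ts \<phi>) (pt \<omega>)"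
  using s \<phi>
proof (induction k arbitrary: \<phi>)
  case 0
  then show ?case by (simp add: cyl_deriv_0 cyl_val_lift[OF \<omega> ts])
next
  case (Suc k)
  have "cyl_deriv W ts \<phi> (Suc k) \<alpha> s \<omega> = (\<Sum>j<length ts. covers ts (cell (s k)) j *
      iter_partial (map (\<lambda>q. (\<alpha> q, cell (s q))) [0..<k]) (lift ts (partial (j, \<alpha> k) \<phi>)) (pt \<omega>))"
    unfolding cyl_deriv_Suc
    by (intro sum.cong refl arg_cong2[where f="(*)"] indicator_covers[OF _ _ ts] Suc.IH dep_on_partial smooth_partial)
       (use Suc.prems in auto)
  also have "\<dots> = iter_partial (map (\<lambda>q. (\<alpha> q, cell (s q))) [0..<k])
      (\<lambda>x. \<Sum>j<length ts. covers ts (cell (s k)) j * lift ts (partial (j, \<alpha> k) \<phi>) x) (pt \<omega>)"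
    by (subst iter_partial_linear_combination[OF smooth_lift[OF smooth_partial[OF Suc.prems(3)]]]) simp
  also have "\<dots> = iter_partial (map (\<lambda>q. (\<alpha> q, cell (s q))) [0..<Suc k]) (lift ts \<phi>) (pt \<omega>)"
    by (simp add: iter_partial_append partial_lift[OF Suc.prems(3)])
  finally show ?case .
qed

lemma nn_integral_cell:
  fixes H :: "nat \<Rightarrow> ennreal"
  shows "(\<integral>\<^sup>+ y. H (cell y) \<partial>restrict_space lborel {0..<1}) = (\<Sum>l<n. ennreal (t (Suc l) - t l) * H l)"
proof -
  have "(\<integral>\<^sup>+ y. H (cell y) \<partial>restrict_space lborel {0..<1}) = (\<integral>\<^sup>+ y. H (cell y) * indicator {0..<1} y \<partial>lborel)"
    by (rule nn_integral_restrict_space) simp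
  also have "\<dots> = (\<integral>\<^sup>+ y. (\<Sum>l<n. H l * indicator {t l..<t (Suc l)} y) \<partial>lborel)"
  proof (rule nn_integral_cong)
    fix y :: real
    show "H (cell y) * indicator {0..<1} y = (\<Sum>l<n. H l * indicator {t l..<t (Suc l)} y)"
    proof (cases "0 \<le> y \<and> y < 1")
      case True
      then obtain l where l: "l < n" "t l \<le> y" "y < t (Suc l)" using cell_exists by blast
      have "(\<Sum>l'<n. H l' * indicator {t l'..<t (Suc l')} y) = (\<Sum>l'<n. if l' = l then H l else 0)"
        using l cell_eq[OF l] cell_eq[of _ y] by (intro sum.cong refl) (auto simp: indicator_def)
      then show ?thesis using True l cell_eq[OF l] by simp
    next
      case False
      have "y \<notin> {t l..<t (Suc l)}" if "l < n" for l
        using False t_01[of l] t_01[of "Suc l"] that by auto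
      then have "(\<Sum>l<n. H l * indicator {t l..<t (Suc l)} y) = 0" by (intro sum.neutral ballI) simp
      then show ?thesis using False by (auto simp: indicator_def)
    qed
  qed
  also have "\<dots> = (\<Sum>l<n. ennreal (t (Suc l) - t l) * H l)"
    using t_less by (subst nn_integral_sum) (auto simp: nn_integral_cmult mult.commute less_imp_le)
  finally show ?thesis .
qed

text \<open>Collecting the cells in a list gives a map into a countable set, so every function of
  the cells is measurable at once, with no condition on \<open>H\<close>.\<close>

lemma cells_measurable: "(\<lambda>s. H (map (\<lambda>q. cell (s q)) [0..<k])) \<in> borel_measurable (unit_cube k)"
  for H :: "nat list \<Rightarrow> 'b::topological_space"
proof -
  have c: "cell \<in> restrict_space lborel {0..<1} \<rightarrow>\<^sub>M count_space UNIV"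
    by (rule measurable_restrict_space1, subst measurable_cong_sets[OF sets_lborel refl], rule cell_measurable)
  have "(\<lambda>s. map (\<lambda>q. cell (s q)) [0..<k]) \<in> unit_cube k \<rightarrow>\<^sub>M count_space UNIV"
  proof (rule measurable_count_space_eq2_countable[THEN iffD2], intro conjI ballI)
    fix xs :: "nat list"
    have eq: "(map (\<lambda>q. cell (s q)) [0..<k] = xs) \<longleftrightarrow> (length xs = k \<and> (\<forall>q\<in>{..<k}. cell (s q) = xs ! q))" for s
    proof
      show "map (\<lambda>q. cell (s q)) [0..<k] = xs" if "length xs = k \<and> (\<forall>q\<in>{..<k}. cell (s q) = xs ! q)"
        using that by (intro nth_equalityI) simp_all
    qed auto
    have "(\<lambda>s. map (\<lambda>q. cell (s q)) [0..<k]) -` {xs} \<inter> space (unit_cube k)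
        = {s\<in>space (unit_cube k). length xs = k \<and> (\<forall>q\<in>{..<k}. cell (s q) = xs ! q)}"
      unfolding vimage_def Int_def mem_Collect_eq singleton_iff eq by (rule Collect_cong) blast
    also have "\<dots> \<in> sets (unit_cube k)"
    proof (rule sets.sets_Collect_conj)
      show "{s \<in> space (unit_cube k). length xs = k} \<in> sets (unit_cube k)" by (rule sets.sets_Collect_const)
    next
      show "{s \<in> space (unit_cube k). \<forall>q\<in>{..<k}. cell (s q) = xs ! q} \<in> sets (unit_cube k)"
      proof (rule sets.sets_Collect_finite_All)
      fix q assume "q \<in> {..<k}"
      then have "(\<lambda>s. cell (s q)) \<in> unit_cube k \<rightarrow>\<^sub>M count_space UNIV"
        unfolding unit_cube_def
        by (intro measurable_compose[OF measurable_component_singleton[of q "{..<k}" "\<lambda>_. restrict_space lborel {0..<1}"] c])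
      from measurable_sets[OF this, of "{xs ! q}"]
      show "{s \<in> space (unit_cube k). cell (s q) = xs ! q} \<in> sets (unit_cube k)"
        by (simp add: vimage_def Int_def conj_commute)
      qed simp
    qed
    finally show "(\<lambda>s. map (\<lambda>q. cell (s q)) [0..<k]) -` {xs} \<inter> space (unit_cube k) \<in> sets (unit_cube k)" .
  qed auto
  moreover have "H \<in> count_space UNIV \<rightarrow>\<^sub>M borel" by (simp add: measurable_count_space_eq1)
  ultimately show ?thesis by (rule measurable_compose[where g=H])
qed

lemma iter_partial_cells_measurable:
  fixes G :: "real \<Rightarrow> 'b::topological_space"
  shows "(\<lambda>s. G (iter_partial (map (\<lambda>q. (\<alpha> q, cell (s q))) [0..<k]) g x)) \<in> borel_measurable (unit_cube k)"
proof -
  have "map (\<lambda>q. (\<alpha> q, cell (s q))) [0..<k] = zip (map \<alpha> [0..<k]) (map (\<lambda>q. cell (s q)) [0..<k])" for s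
    by (simp add: zip_map_map zip_same_conv_map)
  then show ?thesis
    using cells_measurable[of "\<lambda>cs. G (iter_partial (zip (map \<alpha> [0..<k]) cs) g x)" k] by simp
qed

text \<open>Integrating a step function over one more time variable sums over the cells with their
  lengths, which are the variances of the slots; this is the recursion of
  \<open>Dsq\<close>.\<close>

lemma Dsq_eq_deriv_sq:
  "(\<Sum>\<alpha>\<in>{..<k} \<rightarrow>\<^sub>E UNIV. \<integral>\<^sup>+ s. ennreal ((iter_partial (map (\<lambda>q. (\<alpha> q, cell (s q))) [0..<k]) g x)\<^sup>2) \<partial>unit_cube k)
    = ennreal (Dsq k g x)"
proof (induction k arbitrary: g)
  case 0
  show ?case by (simp add: unit_cube_def space_PiM_empty)
next
  case (Suc k)
  interpret product_sigma_finite "\<lambda>_::nat. restrict_space lborel {0..<1::real}"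
    by (rule product_sigma_finite.intro) (rule sigma_finite_unit_interval)
  let ?I = "\<lambda>k \<alpha> s g. iter_partial (map (\<lambda>q. (\<alpha> q, cell (s q))) [0..<k]) g x"
  have step: "(\<integral>\<^sup>+ s. ennreal ((?I (Suc k) (\<alpha>(k := i)) s g)\<^sup>2) \<partial>unit_cube (Suc k))
     = (\<Sum>l<n. ennreal (len (i, l)) * (\<integral>\<^sup>+ s. ennreal ((?I k \<alpha> s (partial (i, l) g))\<^sup>2) \<partial>unit_cube k))" for \<alpha> i
  proof -
    have m: "(\<lambda>s. ennreal ((?I (Suc k) (\<alpha>(k := i)) s g)\<^sup>2)) \<in> borel_measurable (Pi\<^sub>M (insert k {..<k}) (\<lambda>_. restrict_space lborel {0..<1}))"
      using iter_partial_cells_measurable[of "\<lambda>z. ennreal (z\<^sup>2)" "\<alpha>(k := i)" "Suc k" g x]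
      unfolding unit_cube_def lessThan_Suc .
    have "(\<integral>\<^sup>+ s. ennreal ((?I (Suc k) (\<alpha>(k := i)) s g)\<^sup>2) \<partial>unit_cube (Suc k))
       = (\<integral>\<^sup>+ s. (\<integral>\<^sup>+ y. ennreal ((?I (Suc k) (\<alpha>(k := i)) (s(k := y)) g)\<^sup>2) \<partial>restrict_space lborel {0..<1}) \<partial>unit_cube k)"
      unfolding unit_cube_def lessThan_Suc by (rule product_nn_integral_insert[OF _ _ m]) auto
    also have "\<dots> = (\<integral>\<^sup>+ s. (\<integral>\<^sup>+ y. ennreal ((?I k \<alpha> s (partial (i, cell y) g))\<^sup>2) \<partial>restrict_space lborel {0..<1}) \<partial>unit_cube k)"
    proof (intro nn_integral_cong)
      fix s y
      have eq: "map (\<lambda>q. ((\<alpha>(k := i)) q, cell ((s(k := y)) q))) [0..<Suc k] = map (\<lambda>q. (\<alpha> q, cell (s q))) [0..<k] @ [(i, cell y)]"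
        by auto
      show "ennreal ((?I (Suc k) (\<alpha>(k := i)) (s(k := y)) g)\<^sup>2) = ennreal ((?I k \<alpha> s (partial (i, cell y) g))\<^sup>2)"
        unfolding eq iter_partial_append by simp
    qed
    also have "\<dots> = (\<integral>\<^sup>+ s. (\<Sum>l<n. ennreal (len (i, l)) * ennreal ((?I k \<alpha> s (partial (i, l) g))\<^sup>2)) \<partial>unit_cube k)"
      using nn_integral_cell[of "\<lambda>l. ennreal ((?I k \<alpha> _ (partial (i, l) g))\<^sup>2)"] by (simp add: len_def)
    also have "\<dots> = (\<Sum>l<n. ennreal (len (i, l)) * (\<integral>\<^sup>+ s. ennreal ((?I k \<alpha> s (partial (i, l) g))\<^sup>2) \<partial>unit_cube k))"
      using iter_partial_cells_measurable[of "\<lambda>z. ennreal (z\<^sup>2)" \<alpha> k _ x]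
      by (subst nn_integral_sum) (auto simp: nn_integral_cmult)
    finally show ?thesis .
  qed
  have "(\<Sum>\<alpha>\<in>{..<Suc k} \<rightarrow>\<^sub>E UNIV. \<integral>\<^sup>+ s. ennreal ((?I (Suc k) \<alpha> s g)\<^sup>2) \<partial>unit_cube (Suc k))
     = (\<Sum>i\<in>UNIV. \<Sum>\<alpha>\<in>{..<k} \<rightarrow>\<^sub>E UNIV. \<Sum>l<n. ennreal (len (i, l)) * (\<integral>\<^sup>+ s. ennreal ((?I k \<alpha> s (partial (i, l) g))\<^sup>2) \<partial>unit_cube k))"
    unfolding sum_PiE_lessThan_Suc step ..
  also have "\<dots> = (\<Sum>i\<in>UNIV. \<Sum>l<n. ennreal (len (i, l)) * (\<Sum>\<alpha>\<in>{..<k} \<rightarrow>\<^sub>E UNIV. \<integral>\<^sup>+ s. ennreal ((?I k \<alpha> s (partial (i, l) g))\<^sup>2) \<partial>unit_cube k))"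
    by (intro sum.cong refl) (subst sum.swap, simp add: sum_distrib_left)
  also have "\<dots> = (\<Sum>i\<in>UNIV. \<Sum>l<n. ennreal (len (i, l) * Dsq k (partial (i, l) g) x))"
    unfolding Suc.IH by (intro sum.cong refl) (simp add: ennreal_mult'' Dsq_nonneg)
  also have "\<dots> = ennreal (\<Sum>i\<in>UNIV. \<Sum>l<n. len (i, l) * Dsq k (partial (i, l) g) x)"
  proof -
    have nn: "0 \<le> len (i, l) * Dsq k (partial (i, l) g) x" if "l \<in> {..<n}" for i l
      using len_nonneg[of l i] Dsq_nonneg that by simp
    show ?thesis
      by (subst sum_ennreal[OF nn], assumption) (rule sum_ennreal[OF sum_nonneg[OF nn]])
  qed
  also have "(\<Sum>i\<in>UNIV. \<Sum>l<n. len (i, l) * Dsq k (partial (i, l) g) x) = Dsq (Suc k) g x"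
  proof -
    have "Dsq (Suc k) g x = (\<Sum>c\<in>UNIV \<times> {..<n}. len c * Dsq k (partial c g) x)"
      unfolding slots_def[symmetric] by (rule Dsq.simps(2))
    then show ?thesis by (simp add: sum.cartesian_product case_prod_beta)
  qed
  finally show ?case .
qed

lemma space_unit_cube: "s \<in> space (unit_cube k) \<Longrightarrow> q < k \<Longrightarrow> 0 \<le> s q \<and> s q < 1"
  unfolding unit_cube_def space_PiM by (auto simp: space_restrict_space PiE_iff)

lemma deriv_sq_cyl_diff:
  assumes \<omega>: "\<And>i. W i 0 \<omega> = 0" and ts: "set ts \<subseteq> t ` {..n}" "set ts' \<subseteq> t ` {..n}"
    and \<phi>: "smooth_poly_growth (length ts) \<phi>" and \<psi>: "smooth_poly_growth (length ts') \<psi>"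
  shows "deriv_sq k (\<lambda>\<alpha> s \<omega>. cyl_deriv W ts \<phi> k \<alpha> s \<omega> - cyl_deriv W ts' \<psi> k \<alpha> s \<omega>) \<omega>
    = ennreal (Dsq k (\<lambda>x. lift ts \<phi> x - lift ts' \<psi> x) (pt \<omega>))"
  unfolding deriv_sq_def Dsq_eq_deriv_sq[symmetric]
proof (intro sum.cong refl nn_integral_cong)
  fix \<alpha> s assume "s \<in> space (unit_cube k)"
  then have s: "\<And>q. q < k \<Longrightarrow> 0 \<le> s q \<and> s q < 1" using space_unit_cube by blast
  show "ennreal ((cyl_deriv W ts \<phi> k \<alpha> s \<omega> - cyl_deriv W ts' \<psi> k \<alpha> s \<omega>)\<^sup>2) =
     ennreal ((iter_partial (map (\<lambda>q. (\<alpha> q, cell (s q))) [0..<k]) (\<lambda>x. lift ts \<phi> x - lift ts' \<psi> x) (pt \<omega>))\<^sup>2)"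
  proof -
    have "cyl_deriv W ts \<phi> k \<alpha> s \<omega> = iter_partial (map (\<lambda>q. (\<alpha> q, cell (s q))) [0..<k]) (lift ts \<phi>) (pt \<omega>)"
      by (rule cyl_deriv_lift[OF \<omega> ts(1) s smooth_poly_growth_smooth(2,1)[OF \<phi>]])
    moreover have "cyl_deriv W ts' \<psi> k \<alpha> s \<omega> = iter_partial (map (\<lambda>q. (\<alpha> q, cell (s q))) [0..<k]) (lift ts' \<psi>) (pt \<omega>)"
      by (rule cyl_deriv_lift[OF \<omega> ts(2) s smooth_poly_growth_smooth(2,1)[OF \<psi>]])
    ultimately show ?thesis
      unfolding iter_partial_diff[OF smooth_lift[OF smooth_poly_growth_smooth(1)[OF \<phi>]] smooth_lift[OF smooth_poly_growth_smooth(1)[OF \<psi>]]]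
      by simp
  qed
qed

lemma deriv_sq_cyl:
  assumes \<omega>: "\<And>i. W i 0 \<omega> = 0" and ts: "set ts \<subseteq> t ` {..n}"
    and \<phi>: "smooth_poly_growth (length ts) \<phi>"
  shows "deriv_sq k (cyl_deriv W ts \<phi> k) \<omega> = ennreal (Dsq k (lift ts \<phi>) (pt \<omega>))"
  unfolding deriv_sq_def Dsq_eq_deriv_sq[symmetric]
proof (intro sum.cong refl nn_integral_cong)
  fix \<alpha> s assume "s \<in> space (unit_cube k)"
  then have s: "\<And>q. q < k \<Longrightarrow> 0 \<le> s q \<and> s q < 1" using space_unit_cube by blast
  show "ennreal ((cyl_deriv W ts \<phi> k \<alpha> s \<omega>)\<^sup>2) =
     ennreal ((iter_partial (map (\<lambda>q. (\<alpha> q, cell (s q))) [0..<k]) (lift ts \<phi>) (pt \<omega>))\<^sup>2)"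
    by (subst cyl_deriv_lift[OF \<omega> ts(1) s smooth_poly_growth_smooth(2,1)[OF \<phi>]]) simp_all
qed

end

lemma brownian_grid_exists:
  assumes "brownian_motion M W" "finite S" "S \<subseteq> {0..1}"
  obtains t n where "brownian_grid M W t n" "S \<subseteq> t ` {..n}"
proof -
  \<comment> \<open>The end points 0 and 1 are added so that the increments cover the whole time
    interval.\<close>
  define L where "L = sorted_list_of_set (insert 0 (insert 1 S))"
  have L: "sorted L" "distinct L" "set L = insert 0 (insert 1 S)"
    using assms(2) unfolding L_def
    by (simp_all only: sorted_sorted_list_of_set distinct_sorted_list_of_set set_sorted_list_of_set finite_insert)
  have sub: "set L \<subseteq> {0..1}" using assms(3) L(3) by auto
  have ne: "L \<noteq> []" using L(3) by auto
  define n where "n = length L - 1"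
  have len: "length L = Suc n" using ne by (simp add: n_def)
  have img: "nth L ` {..n} = set L" using len by (auto simp: set_conv_nth image_def less_Suc_eq_le)
  have mono: "strict_mono_on {..n} (nth L)"
    using L(1,2) len by (intro strict_mono_onI) (metis atMost_iff less_Suc_eq_le sorted_wrt_iff_nth_less strict_sorted_iff)
  have "L ! 0 = 0"
  proof -
    obtain j where j: "j \<le> n" "L ! j = 0" using img L(3) by (metis atMost_iff imageE insertI1)
    have "L ! 0 \<le> L ! j" using sorted_nth_mono[OF L(1), of 0 j] j len by simp
    moreover have "0 \<le> L ! 0" using sub img by (metis atLeastAtMost_iff atMost_iff imageI le0 subsetD)
    ultimately show ?thesis using j by simp
  qed
  moreover have "L ! n = 1"
  proof -
    obtain j where j: "j \<le> n" "L ! j = 1" using img L(3) by (metis atMost_iff imageE insertCI)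
    have "L ! j \<le> L ! n" using sorted_nth_mono[OF L(1), of j n] j len by simp
    moreover have "L ! n \<le> 1" using sub img by (metis atLeastAtMost_iff atMost_iff imageI order_refl subsetD)
    ultimately show ?thesis using j by simp
  qed
  ultimately have "brownian_grid M W (nth L) n" using assms(1) mono by (simp add: brownian_grid_def)
  moreover have "S \<subseteq> nth L ` {..n}" using img L(3) by auto
  ultimately show ?thesis by (rule that)
qed

section \<open>Closability of the Malliavin derivatives\<close>

context gaussian_slots begin

text \<open>For k = 0 the family in \<open>closability_estimate\<close> has one member. For k = 1 it
  consists of the first partial derivatives weighted by the variances, and the estimate compares
  second derivatives; this is why it is stated for weighted families.\<close>

lemma closability_estimate_Dsq:
  assumes k: "k \<in> {0, 1}" and \<theta>: "smooth C \<theta>" and \<xi>: "smooth C \<xi>" and "\<eta> > 0" "\<kappa> > 0"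
  shows "ev (\<lambda>x. sqrt (Dsq (Suc k) \<xi> x))
    \<le> \<eta> + 2 * ev (\<lambda>x. sqrt (Dsq (Suc k) (\<lambda>x. \<theta> x - \<xi> x) x))
      + (1 + 1 / \<eta>) / \<kappa> * ev (\<lambda>x. sqrt (Dsq k \<theta> x))
      + 2 * \<kappa> * (1 + 1 / \<eta>) * (ev (Dsq (Suc k) \<xi>) + ev (Dsq (Suc (Suc k)) \<xi>))"
proof (cases "k = 0")
  case True
  show ?thesis
    using closability_estimate[of "{()}" "\<lambda>_. 1" "\<lambda>_. \<theta>" "\<lambda>_. \<xi>" \<eta> \<kappa>] assms True
    by (simp add: numeral_2_eq_2)
next
  case False
  then have k: "k = 1" using k by simp
  have d: "(\<lambda>x. partial b \<theta> x - partial b \<xi> x) = partial b (\<lambda>x. \<theta> x - \<xi> x)" for b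
    using partial_diff[OF \<theta> \<xi>] by simp
  show ?thesis
    using closability_estimate[of C v "\<lambda>b. partial b \<theta>" "\<lambda>b. partial b \<xi>" \<eta> \<kappa>] v_pos
      smooth_partial[OF \<theta>] smooth_partial[OF \<xi>] assms(4,5)
    unfolding d k by (simp add: numeral_2_eq_2 less_imp_le)
qed

end

section \<open>Square roots of extended reals and convergence in L^1\<close>

abbreviation esqrt :: "ennreal \<Rightarrow> ennreal" where "esqrt x \<equiv> epowr x (1 / 2)"

lemma epowr_measurable [measurable]: "(\<lambda>x. epowr x p) \<in> borel_measurable borel"
  unfolding epowr_def by measurable

lemma esqrt_ennreal: "0 \<le> r \<Longrightarrow> esqrt (ennreal r) = ennreal (sqrt r)"
  by (simp add: epowr_def powr_half_sqrt)

lemma epowr_1 [simp]: "epowr x 1 = x"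
  by (cases x) (auto simp: epowr_def)

lemma esqrt_mono: "x \<le> y \<Longrightarrow> esqrt x \<le> esqrt y"
proof (cases y)
  case (real r)
  assume "x \<le> y"
  then obtain q where "x = ennreal q" "0 \<le> q" using real by (cases x) (auto simp: top_unique)
  then show ?thesis using \<open>x \<le> y\<close> real by (simp add: esqrt_ennreal)
qed (simp add: epowr_def)

lemma esqrt_double_add: "esqrt (2 * x + 2 * y) \<le> 2 * esqrt x + 2 * esqrt y"
proof (cases "x = \<top> \<or> y = \<top>")
  case False
  then obtain a b where ab: "x = ennreal a" "0 \<le> a" "y = ennreal b" "0 \<le> b" by (cases x; cases y) auto
  have e: "2 * x + 2 * y = ennreal (2 * a + 2 * b)" "2 * esqrt x + 2 * esqrt y = ennreal (2 * sqrt a + 2 * sqrt b)"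
    using ab by (simp_all add: esqrt_ennreal ennreal_mult ennreal_plus)
  have "sqrt (2 * a + 2 * b) \<le> 2 * sqrt a + 2 * sqrt b"
    using ab by (intro real_le_lsqrt) (auto simp: power2_sum power_mult_distrib)
  moreover have "esqrt (ennreal (2 * a + 2 * b)) = ennreal (sqrt (2 * a + 2 * b))"
    using ab by (intro esqrt_ennreal) auto
  ultimately show ?thesis unfolding e by (simp only: ennreal_leI)
next
  case True
  then have E: "2 * esqrt x + 2 * esqrt y = \<top>" by (auto simp: epowr_def ennreal_mult_eq_top_iff)
  show ?thesis unfolding E by (rule top_greatest)
qed

lemma esqrt_le_AMGM: assumes "\<kappa> > 0" shows "esqrt x \<le> ennreal \<kappa> + ennreal (1 / \<kappa>) * x"
proof (cases x)
  case (real r)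
  have "sqrt r \<le> \<kappa> + r / \<kappa>"
  proof -
    have "0 \<le> (sqrt r - \<kappa>)\<^sup>2" by simp
    then have "2 * \<kappa> * sqrt r \<le> r + \<kappa> * \<kappa>" using real by (simp add: power2_diff power2_eq_square[of \<kappa>] mult_ac)
    moreover have "0 \<le> \<kappa> * sqrt r" using assms real by simp
    ultimately have "\<kappa> * sqrt r \<le> r + \<kappa> * \<kappa>" by linarith
    then show ?thesis using assms by (simp add: field_simps)
  qed
  then show ?thesis using real assms by (simp add: esqrt_ennreal flip: ennreal_mult ennreal_plus)
next
  case top
  then show ?thesis using assms by (simp add: ennreal_mult_top)
qed

lemma esqrt_mult_self: "esqrt x * esqrt x = x"
  by (cases x) (auto simp: esqrt_ennreal epowr_def powr_half_sqrt simp flip: ennreal_mult)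

lemma esqrt_eq_0: "esqrt x = 0 \<Longrightarrow> x = 0"
  using esqrt_mult_self[of x] by simp

lemma esqrt_tendsto_0_D:
  assumes "(\<lambda>n. esqrt (f n)) \<longlonglongrightarrow> 0" shows "f \<longlonglongrightarrow> 0"
proof (rule tendsto_sandwich[OF _ _ tendsto_const assms])
  have "\<forall>\<^sub>F n in sequentially. esqrt (f n) < 1" using assms by (rule order_tendstoD) simp
  then show "\<forall>\<^sub>F n in sequentially. f n \<le> esqrt (f n)"
  proof eventually_elim
    case (elim n)
    have "f n = esqrt (f n) * esqrt (f n)" by (simp add: esqrt_mult_self)
    also have "\<dots> \<le> esqrt (f n) * 1" using elim by (intro mult_left_mono) auto
    finally show ?case by simp
  qed
qed simp

text \<open>\<open>h n\<close> stands for a squared norm, so this says that the norm itself tends to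
  0 in L^1.\<close>

definition L1_null :: "'w measure \<Rightarrow> (nat \<Rightarrow> 'w \<Rightarrow> ennreal) \<Rightarrow> bool" where
  "L1_null M h \<longleftrightarrow> (\<lambda>n. \<integral>\<^sup>+ \<omega>. esqrt (h n \<omega>) \<partial>M) \<longlonglongrightarrow> 0"

lemma tendsto_0_le:
  fixes f g :: "nat \<Rightarrow> ennreal"
  assumes "g \<longlonglongrightarrow> 0" "\<And>n. f n \<le> g n" shows "f \<longlonglongrightarrow> 0"
  by (rule tendsto_sandwich[OF _ _ tendsto_const assms(1)]) (use assms(2) in auto)

lemma tendsto_0_double_add:
  fixes f g :: "nat \<Rightarrow> ennreal"
  assumes "f \<longlonglongrightarrow> 0" "g \<longlonglongrightarrow> 0" shows "(\<lambda>n. 2 * f n + 2 * g n) \<longlonglongrightarrow> 0"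
proof -
  have "(\<lambda>n. (f n + f n) + (g n + g n)) \<longlonglongrightarrow> (0 + 0) + (0 + 0)" by (intro tendsto_intros assms)
  then show ?thesis by (simp add: mult_2)
qed

lemma L1_null_le:
  assumes "L1_null M g" "\<And>n \<omega>. \<omega> \<in> space M \<Longrightarrow> h n \<omega> \<le> g n \<omega>" shows "L1_null M h"
  unfolding L1_null_def
  by (rule tendsto_0_le[OF assms(1)[unfolded L1_null_def]]) (intro nn_integral_mono esqrt_mono assms(2))

lemma L1_null_add:
  assumes "L1_null M f" "L1_null M g" and [measurable]: "\<And>n. f n \<in> borel_measurable M" "\<And>n. g n \<in> borel_measurable M"
  shows "L1_null M (\<lambda>n \<omega>. 2 * f n \<omega> + 2 * g n \<omega>)"
  unfolding L1_null_def
proof (rule tendsto_0_le[OF tendsto_0_double_add[OF assms(1,2)[unfolded L1_null_def]]])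
  fix n
  have "(\<integral>\<^sup>+ \<omega>. esqrt (2 * f n \<omega> + 2 * g n \<omega>) \<partial>M) \<le> (\<integral>\<^sup>+ \<omega>. 2 * esqrt (f n \<omega>) + 2 * esqrt (g n \<omega>) \<partial>M)"
    by (intro nn_integral_mono esqrt_double_add)
  also have "\<dots> = 2 * (\<integral>\<^sup>+ \<omega>. esqrt (f n \<omega>) \<partial>M) + 2 * (\<integral>\<^sup>+ \<omega>. esqrt (g n \<omega>) \<partial>M)"
    by (subst nn_integral_add) (auto simp: nn_integral_cmult)
  finally show "(\<integral>\<^sup>+ \<omega>. esqrt (2 * f n \<omega> + 2 * g n \<omega>) \<partial>M) \<le> \<dots>" .
qed

text \<open>The arithmetic-geometric mean inequality with a free weight replaces Jensen's
  inequality, so infinite values of \<open>h\<close> need no separate treatment.\<close>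

lemma (in prob_space) L1_null_L2:
  assumes "(\<lambda>n. \<integral>\<^sup>+ \<omega>. h n \<omega> \<partial>M) \<longlonglongrightarrow> 0" and [measurable]: "\<And>n. h n \<in> borel_measurable M"
  shows "L1_null M h"
  unfolding L1_null_def
proof (rule order_tendstoI)
  fix e :: ennreal assume "0 < e"
  then obtain \<kappa> where \<kappa>: "\<kappa> > 0" "ennreal (2 * \<kappa>) \<le> e"
  proof (cases e)
    case (real r)
    then show ?thesis using \<open>0 < e\<close> that[of "r / 2"] by simp
  next
    case top then show ?thesis using that[of 1] by simp
  qed
  have "\<forall>\<^sub>F n in sequentially. (\<integral>\<^sup>+ \<omega>. h n \<omega> \<partial>M) < ennreal (\<kappa> * \<kappa>)"
    using assms(1) by (rule order_tendstoD) (use \<kappa> in simp)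
  then show "\<forall>\<^sub>F n in sequentially. (\<integral>\<^sup>+ \<omega>. esqrt (h n \<omega>) \<partial>M) < e"
  proof eventually_elim
    case (elim n)
    have "(\<integral>\<^sup>+ \<omega>. esqrt (h n \<omega>) \<partial>M) \<le> (\<integral>\<^sup>+ \<omega>. ennreal \<kappa> + ennreal (1 / \<kappa>) * h n \<omega> \<partial>M)"
      by (intro nn_integral_mono esqrt_le_AMGM \<kappa>)
    also have "\<dots> = ennreal \<kappa> + ennreal (1 / \<kappa>) * (\<integral>\<^sup>+ \<omega>. h n \<omega> \<partial>M)"
      by (subst nn_integral_add) (auto simp: nn_integral_cmult emeasure_space_1)
    also have "\<dots> < ennreal \<kappa> + ennreal \<kappa>"
    proof -
      have "ennreal (1 / \<kappa>) * (\<integral>\<^sup>+ \<omega>. h n \<omega> \<partial>M) < ennreal (1 / \<kappa>) * ennreal (\<kappa> * \<kappa>)"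
        using elim \<kappa> by (intro ennreal_mult_strict_left_mono) auto
      also have "\<dots> = ennreal \<kappa>" using \<kappa> by (simp flip: ennreal_mult)
      finally show ?thesis by simp
    qed
    also have "\<dots> = ennreal (2 * \<kappa>)" using \<kappa> by (simp flip: ennreal_plus)
    finally show ?case using \<kappa>(2) by (rule less_le_trans)
  qed
qed simp

section \<open>Kernels of derivatives and their squared norms\<close>

definition jointly_measurable :: "'w measure \<Rightarrow> nat \<Rightarrow> ((nat \<Rightarrow> 'N) \<Rightarrow> (nat \<Rightarrow> real) \<Rightarrow> 'w \<Rightarrow> real) \<Rightarrow> bool" where
  "jointly_measurable M k V \<longleftrightarrow>
     (\<forall>\<alpha>\<in>{..<k} \<rightarrow>\<^sub>E UNIV. (\<lambda>(s, \<omega>). V \<alpha> s \<omega>) \<in> borel_measurable (unit_cube k \<Otimes>\<^sub>M M))"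

lemma jointly_measurable_diff:
  assumes "jointly_measurable M k V" "jointly_measurable M k V'"
  shows "jointly_measurable M k (\<lambda>\<alpha> s \<omega>. V \<alpha> s \<omega> - V' \<alpha> s \<omega>)"
  unfolding jointly_measurable_def
proof
  fix \<alpha> :: "nat \<Rightarrow> 'b" assume "\<alpha> \<in> {..<k} \<rightarrow>\<^sub>E UNIV"
  then have "(\<lambda>p. V \<alpha> (fst p) (snd p)) \<in> borel_measurable (unit_cube k \<Otimes>\<^sub>M M)"
    "(\<lambda>p. V' \<alpha> (fst p) (snd p)) \<in> borel_measurable (unit_cube k \<Otimes>\<^sub>M M)"
    using assms unfolding jointly_measurable_def by (auto simp: case_prod_beta)
  then show "(\<lambda>(s, \<omega>). V \<alpha> s \<omega> - V' \<alpha> s \<omega>) \<in> borel_measurable (unit_cube k \<Otimes>\<^sub>M M)"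
    unfolding case_prod_beta by (rule borel_measurable_diff)
qed

lemma jointly_measurable_section:
  assumes "jointly_measurable M k V" "\<alpha> \<in> {..<k} \<rightarrow>\<^sub>E UNIV" "\<omega> \<in> space M"
  shows "(\<lambda>s. V \<alpha> s \<omega>) \<in> borel_measurable (unit_cube k)"
  using measurable_compose[OF measurable_Pair2'[OF assms(3)], of "\<lambda>(s, \<omega>). V \<alpha> s \<omega>" "unit_cube k" borel]
    assms unfolding jointly_measurable_def by auto

lemma sigma_finite_unit_cube: "sigma_finite_measure (unit_cube k)"
proof -
  interpret product_sigma_finite "\<lambda>_::nat. restrict_space lborel {0..<1::real}"
    by (rule product_sigma_finite.intro) (rule sigma_finite_unit_interval)
  show ?thesis unfolding unit_cube_def by (rule sigma_finite) simp
qed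

lemma deriv_sq_measurable:
  assumes "jointly_measurable M k V"
  shows "deriv_sq k V \<in> borel_measurable M"
proof -
  interpret U: sigma_finite_measure "unit_cube k" by (rule sigma_finite_unit_cube)
  have "(\<lambda>\<omega>. \<integral>\<^sup>+ s. ennreal ((V \<alpha> s \<omega>)\<^sup>2) \<partial>unit_cube k) \<in> borel_measurable M" if "\<alpha> \<in> {..<k} \<rightarrow>\<^sub>E UNIV" for \<alpha>
  proof (rule U.borel_measurable_nn_integral)
    have "(\<lambda>(s, \<omega>). V \<alpha> s \<omega>) \<in> borel_measurable (unit_cube k \<Otimes>\<^sub>M M)"
      using assms that unfolding jointly_measurable_def by blast
    from measurable_compose[OF measurable_pair_swap' this]
    have [measurable]: "(\<lambda>p. V \<alpha> (snd p) (fst p)) \<in> borel_measurable (M \<Otimes>\<^sub>M unit_cube k)"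
      by (simp add: case_prod_beta)
    show "(\<lambda>(\<omega>, s). ennreal ((V \<alpha> s \<omega>)\<^sup>2)) \<in> borel_measurable (M \<Otimes>\<^sub>M unit_cube k)"
      unfolding case_prod_beta by measurable
  qed
  then show ?thesis unfolding deriv_sq_def[abs_def] by (intro borel_measurable_sum) auto
qed

text \<open>Obtained pointwise from (a - c)^2 \<le> 2 (a - b)^2 + 2 (b - c)^2. The constant 2 is
  harmless, and the inequality makes sense for infinite norms.\<close>

lemma deriv_sq_triangle:
  assumes V: "jointly_measurable M k V1" "jointly_measurable M k V2" "jointly_measurable M k V3" and \<omega>: "\<omega> \<in> space M"
  shows "deriv_sq k (\<lambda>\<alpha> s \<omega>. V1 \<alpha> s \<omega> - V3 \<alpha> s \<omega>) \<omega>
    \<le> 2 * deriv_sq k (\<lambda>\<alpha> s \<omega>. V1 \<alpha> s \<omega> - V2 \<alpha> s \<omega>) \<omega> + 2 * deriv_sq k (\<lambda>\<alpha> s \<omega>. V2 \<alpha> s \<omega> - V3 \<alpha> s \<omega>) \<omega>"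
proof -
  have "(\<integral>\<^sup>+ s. ennreal ((V1 \<alpha> s \<omega> - V3 \<alpha> s \<omega>)\<^sup>2) \<partial>unit_cube k)
      \<le> 2 * (\<integral>\<^sup>+ s. ennreal ((V1 \<alpha> s \<omega> - V2 \<alpha> s \<omega>)\<^sup>2) \<partial>unit_cube k)
        + 2 * (\<integral>\<^sup>+ s. ennreal ((V2 \<alpha> s \<omega> - V3 \<alpha> s \<omega>)\<^sup>2) \<partial>unit_cube k)"
    if \<alpha>: "\<alpha> \<in> {..<k} \<rightarrow>\<^sub>E UNIV" for \<alpha>
  proof -
    note [measurable] = V[THEN jointly_measurable_section[OF _ \<alpha> \<omega>]]
    have "(a - c)\<^sup>2 \<le> 2 * (a - b)\<^sup>2 + 2 * (b - c)\<^sup>2" for a b c :: real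
    proof -
      have "0 \<le> ((a - b) - (b - c))\<^sup>2" by simp
      then show ?thesis by (simp add: power2_eq_square algebra_simps)
    qed
    then have "ennreal ((a - c)\<^sup>2) \<le> 2 * ennreal ((a - b)\<^sup>2) + 2 * ennreal ((b - c)\<^sup>2)" for a b c :: real
      by (simp flip: ennreal_numeral ennreal_mult ennreal_plus)
    then have "(\<integral>\<^sup>+ s. ennreal ((V1 \<alpha> s \<omega> - V3 \<alpha> s \<omega>)\<^sup>2) \<partial>unit_cube k)
      \<le> (\<integral>\<^sup>+ s. 2 * ennreal ((V1 \<alpha> s \<omega> - V2 \<alpha> s \<omega>)\<^sup>2) + 2 * ennreal ((V2 \<alpha> s \<omega> - V3 \<alpha> s \<omega>)\<^sup>2) \<partial>unit_cube k)"
      by (intro nn_integral_mono)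
    also have "\<dots> = 2 * (\<integral>\<^sup>+ s. ennreal ((V1 \<alpha> s \<omega> - V2 \<alpha> s \<omega>)\<^sup>2) \<partial>unit_cube k)
        + 2 * (\<integral>\<^sup>+ s. ennreal ((V2 \<alpha> s \<omega> - V3 \<alpha> s \<omega>)\<^sup>2) \<partial>unit_cube k)"
      by (subst nn_integral_add) (auto simp: nn_integral_cmult)
    finally show ?thesis .
  qed
  then show ?thesis
    unfolding deriv_sq_def sum_distrib_left sum.distrib[symmetric] by (rule sum_mono)
qed

lemma deriv_sq_commute:
  "deriv_sq k (\<lambda>\<alpha> s \<omega>. V \<alpha> s \<omega> - V' \<alpha> s \<omega>) = deriv_sq k (\<lambda>\<alpha> s \<omega>. V' \<alpha> s \<omega> - V \<alpha> s \<omega>)"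
  by (intro ext) (simp add: deriv_sq_def power2_commute)

lemma dep_on_iter_partial: "dep_on N \<phi> \<Longrightarrow> dep_on N (iter_partial cs \<phi>)"
  by (induction cs) (auto intro: dep_on_partial)

locale brownian =
  fixes M :: "'w measure" and W :: "'N::finite \<Rightarrow> real \<Rightarrow> 'w \<Rightarrow> real"
  assumes bm: "brownian_motion M W"
begin

sublocale prob_space M using bm by (simp add: brownian_motion_def)

definition cylinder :: "real list \<Rightarrow> ((nat \<times> 'N \<Rightarrow> real) \<Rightarrow> real) \<Rightarrow> bool" where
  "cylinder ts \<phi> \<longleftrightarrow> set ts \<subseteq> {0..1} \<and> smooth_poly_growth (length ts) \<phi>"

lemma iter_partial_measurable:
  assumes "cylinder ts \<phi>"
  shows "(\<lambda>\<omega>. iter_partial cs \<phi> (cyl_point W ts \<omega>)) \<in> borel_measurable M"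
proof -
  have ts: "set ts \<subseteq> {0..1}" and \<phi>: "smooth_poly_growth (length ts) \<phi>" using assms by (auto simp: cylinder_def)
  \<comment> \<open>\<open>cyl_point\<close> also reads \<open>ts ! j\<close> beyond the end of the
    list, where measurability of \<open>W\<close> is unknown. Those coordinates are ignored by
    \<phi> and may be set to 0.\<close>
  define P where "P \<omega> = (\<lambda>(j, i). if j < length ts then W i (ts ! j) \<omega> else 0)" for \<omega>
  have "P \<in> M \<rightarrow>\<^sub>M PiM UNIV (\<lambda>_. borel)"
  proof (rule measurable_PiM_single')
    fix c :: "nat \<times> 'N"
    obtain j i where c: "c = (j, i)" by (cases c)
    show "(\<lambda>\<omega>. P \<omega> c) \<in> borel_measurable M"
    proof (cases "j < length ts")
      case True
      then have "ts ! j \<in> {0..1}" using ts by (meson nth_mem subsetD)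
      then have "W i (ts ! j) \<in> borel_measurable M" using bm unfolding brownian_motion_def by blast
      then show ?thesis using True by (simp add: P_def c)
    qed (simp add: P_def c)
  qed auto
  then have P: "P \<in> M \<rightarrow>\<^sub>M borel"
    by (subst (asm) measurable_cong_sets[OF refl sets_PiM_equal_borel])
  have "continuous_on UNIV (iter_partial cs \<phi>)" using \<phi> unfolding smooth_poly_growth_def by blast
  from measurable_compose[OF P borel_measurable_continuous_onI[OF this]]
  have "(\<lambda>\<omega>. iter_partial cs \<phi> (P \<omega>)) \<in> borel_measurable M" .
  moreover have "iter_partial cs \<phi> (P \<omega>) = iter_partial cs \<phi> (cyl_point W ts \<omega>)" for \<omega>
  proof -
    have "dep_on (length ts) (iter_partial cs \<phi>)"
      by (rule dep_on_iter_partial[OF smooth_poly_growth_smooth(2)[OF \<phi>]])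
    moreover have "\<forall>j<length ts. \<forall>i. P \<omega> (j, i) = cyl_point W ts \<omega> (j, i)" by (simp add: P_def cyl_point_def)
    ultimately show ?thesis unfolding dep_on_def by blast
  qed
  ultimately show ?thesis by simp
qed

lemma cyl_val_measurable: "cylinder ts \<phi> \<Longrightarrow> cyl_val W ts \<phi> \<in> borel_measurable M"
  using iter_partial_measurable[of ts \<phi> "[]"] by (simp add: cyl_val_def[abs_def])

lemma cyl_deriv_measurable:
  assumes "cylinder ts \<phi>" shows "jointly_measurable M k (cyl_deriv W ts \<phi> k)"
  unfolding jointly_measurable_def
proof
  fix \<alpha> :: "nat \<Rightarrow> 'N"
  have i: "(\<lambda>p. indicator {0..<a} ((fst p) l) :: real) \<in> borel_measurable (unit_cube k \<Otimes>\<^sub>M M)" if "l < k" for l a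
  proof -
    have "(\<lambda>s. s l) \<in> unit_cube k \<rightarrow>\<^sub>M restrict_space lborel {0..<1}"
      unfolding unit_cube_def using that by (intro measurable_component_singleton) simp
    moreover have "(\<lambda>y. indicator {0..<a} y :: real) \<in> borel_measurable (restrict_space lborel {0..<1})"
      by (rule measurable_restrict_space1) simp
    ultimately have "(\<lambda>s. indicator {0..<a} (s l) :: real) \<in> borel_measurable (unit_cube k)"
      by (rule measurable_compose)
    then show ?thesis by (rule measurable_compose[OF measurable_fst])
  qed
  show "(\<lambda>(s, \<omega>). cyl_deriv W ts \<phi> k \<alpha> s \<omega>) \<in> borel_measurable (unit_cube k \<Otimes>\<^sub>M M)"
    unfolding cyl_deriv_def case_prod_beta
    by (intro borel_measurable_sum borel_measurable_times borel_measurable_prod i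
        measurable_compose[OF measurable_snd iter_partial_measurable[OF assms]]) auto
qed

lemma W0: "AE \<omega> in M. \<forall>i. W i 0 \<omega> = 0"
  using bm unfolding brownian_motion_def by (simp add: AE_all_countable)

lemma grid_for:
  assumes "finite S" "S \<subseteq> {0..1}"
  obtains t n where "brownian_grid M W t n" "S \<subseteq> t ` {..n}"
  using brownian_grid_exists[OF bm assms] by blast

end

context brownian_grid begin

lemma nn_integral_pt:
  assumes "tempered slots g" "\<And>x. 0 \<le> g x" "AE \<omega> in M. h \<omega> = ennreal (g (pt \<omega>))"
  shows "(\<integral>\<^sup>+ \<omega>. h \<omega> \<partial>M) = ennreal (ev g)" "(\<integral>\<^sup>+ \<omega>. esqrt (h \<omega>) \<partial>M) = ennreal (ev (\<lambda>x. sqrt (g x)))"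
proof -
  have "(\<integral>\<^sup>+ \<omega>. h \<omega> \<partial>M) = (\<integral>\<^sup>+ \<omega>. ennreal (g (pt \<omega>)) \<partial>M)" using assms(3) by (rule nn_integral_cong_AE)
  also have "\<dots> = ennreal (ev g)" by (rule nn_integral_eq_integral[OF tempered_integrable[OF assms(1)]]) (use assms(2) in auto)
  finally show "(\<integral>\<^sup>+ \<omega>. h \<omega> \<partial>M) = ennreal (ev g)" .
  have "(\<integral>\<^sup>+ \<omega>. esqrt (h \<omega>) \<partial>M) = (\<integral>\<^sup>+ \<omega>. ennreal (sqrt (g (pt \<omega>))) \<partial>M)"
    using assms(3) by (intro nn_integral_cong_AE) (auto simp: esqrt_ennreal assms(2))
  also have "\<dots> = ennreal (ev (\<lambda>x. sqrt (g x)))"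
    by (rule nn_integral_eq_integral[OF tempered_integrable[OF tempered_sqrt[OF assms(1,2)]]]) (use assms(2) in auto)
  finally show "(\<integral>\<^sup>+ \<omega>. esqrt (h \<omega>) \<partial>M) = ennreal (ev (\<lambda>x. sqrt (g x)))" .
qed

lemma deriv_sq_cyl_diff2:
  assumes \<omega>: "\<And>i. W i 0 \<omega> = 0"
    and ts: "set ts \<subseteq> t ` {..n}" "set us \<subseteq> t ` {..n}" "set ts' \<subseteq> t ` {..n}" "set us' \<subseteq> t ` {..n}"
    and \<phi>: "smooth_poly_growth (length ts) \<phi>" "smooth_poly_growth (length us) \<psi>"
      "smooth_poly_growth (length ts') \<phi>'" "smooth_poly_growth (length us') \<psi>'"
  shows "deriv_sq k (\<lambda>\<alpha> s \<omega>. (cyl_deriv W ts \<phi> k \<alpha> s \<omega> - cyl_deriv W us \<psi> k \<alpha> s \<omega>)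
      - (cyl_deriv W ts' \<phi>' k \<alpha> s \<omega> - cyl_deriv W us' \<psi>' k \<alpha> s \<omega>)) \<omega>
    = ennreal (Dsq k (\<lambda>x. (lift ts \<phi> x - lift us \<psi> x) - (lift ts' \<phi>' x - lift us' \<psi>' x)) (pt \<omega>))"
  unfolding deriv_sq_def Dsq_eq_deriv_sq[symmetric]
proof (intro sum.cong refl nn_integral_cong)
  fix \<alpha> s assume "s \<in> space (unit_cube k)"
  then have s: "\<And>q. q < k \<Longrightarrow> 0 \<le> s q \<and> s q < 1" using space_unit_cube by blast
  note sm = smooth_lift[OF smooth_poly_growth_smooth(1)]
  have l: "cyl_deriv W ts \<phi> k \<alpha> s \<omega> = iter_partial (map (\<lambda>q. (\<alpha> q, cell (s q))) [0..<k]) (lift ts \<phi>) (pt \<omega>)"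
    if "set ts \<subseteq> t ` {..n}" "smooth_poly_growth (length ts) \<phi>" for ts \<phi>
    by (rule cyl_deriv_lift[OF \<omega> that(1) s smooth_poly_growth_smooth(2,1)[OF that(2)]])
  show "ennreal (((cyl_deriv W ts \<phi> k \<alpha> s \<omega> - cyl_deriv W us \<psi> k \<alpha> s \<omega>)
      - (cyl_deriv W ts' \<phi>' k \<alpha> s \<omega> - cyl_deriv W us' \<psi>' k \<alpha> s \<omega>))\<^sup>2) =
     ennreal ((iter_partial (map (\<lambda>q. (\<alpha> q, cell (s q))) [0..<k])
       (\<lambda>x. (lift ts \<phi> x - lift us \<psi> x) - (lift ts' \<phi>' x - lift us' \<psi>' x)) (pt \<omega>))\<^sup>2)"
    unfolding iter_partial_diff[OF smooth_diff[OF sm[OF \<phi>(1)] sm[OF \<phi>(2)]] smooth_diff[OF sm[OF \<phi>(3)] sm[OF \<phi>(4)]]]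
      iter_partial_diff[OF sm[OF \<phi>(1)] sm[OF \<phi>(2)]] iter_partial_diff[OF sm[OF \<phi>(3)] sm[OF \<phi>(4)]]
    by (simp add: l ts \<phi>)
qed

end

section \<open>Two approximations of one functional have the same derivatives\<close>

context brownian begin

definition dist_sq :: "nat \<Rightarrow> real list \<Rightarrow> ((nat \<times> 'N \<Rightarrow> real) \<Rightarrow> real) \<Rightarrow> real list \<Rightarrow> ((nat \<times> 'N \<Rightarrow> real) \<Rightarrow> real) \<Rightarrow> 'w \<Rightarrow> ennreal" where
  "dist_sq k ts \<phi> us \<psi> = deriv_sq k (\<lambda>\<alpha> s \<omega>. cyl_deriv W ts \<phi> k \<alpha> s \<omega> - cyl_deriv W us \<psi> k \<alpha> s \<omega>)"

text \<open>All four functionals are placed on one common grid; the unprimed difference is \<theta>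
  and the primed one is \<xi>. The second claim, finiteness of the energies of \<xi>, lets \<kappa>
  be chosen small against them.\<close>

lemma closability_estimate_cylinder:
  assumes c: "cylinder ts \<phi>" "cylinder us \<psi>" "cylinder ts' \<phi>'" "cylinder us' \<psi>'"
    and k: "k \<in> {0, 1}" and pos: "\<eta> > 0" "\<kappa> > 0"
  shows "(\<integral>\<^sup>+ \<omega>. esqrt (dist_sq (Suc k) ts' \<phi>' us' \<psi>' \<omega>) \<partial>M) \<le> ennreal \<eta>
     + 2 * (\<integral>\<^sup>+ \<omega>. esqrt (deriv_sq (Suc k) (\<lambda>\<alpha> s \<omega>. (cyl_deriv W ts \<phi> (Suc k) \<alpha> s \<omega> - cyl_deriv W us \<psi> (Suc k) \<alpha> s \<omega>)
         - (cyl_deriv W ts' \<phi>' (Suc k) \<alpha> s \<omega> - cyl_deriv W us' \<psi>' (Suc k) \<alpha> s \<omega>)) \<omega>) \<partial>M)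
     + ennreal ((1 + 1 / \<eta>) / \<kappa>) * (\<integral>\<^sup>+ \<omega>. esqrt (dist_sq k ts \<phi> us \<psi> \<omega>) \<partial>M)
     + ennreal (2 * \<kappa> * (1 + 1 / \<eta>)) * ((\<integral>\<^sup>+ \<omega>. dist_sq (Suc k) ts' \<phi>' us' \<psi>' \<omega> \<partial>M) + (\<integral>\<^sup>+ \<omega>. dist_sq (Suc (Suc k)) ts' \<phi>' us' \<psi>' \<omega> \<partial>M))"
    and "(\<integral>\<^sup>+ \<omega>. dist_sq j ts' \<phi>' us' \<psi>' \<omega> \<partial>M) < \<infinity>"
proof -
  have "finite (set ts \<union> set us \<union> set ts' \<union> set us')" "set ts \<union> set us \<union> set ts' \<union> set us' \<subseteq> {0..1}"
    using c by (auto simp: cylinder_def)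
  then obtain t n where g: "brownian_grid M W t n" and S: "set ts \<union> set us \<union> set ts' \<union> set us' \<subseteq> t ` {..n}"
    by (rule grid_for)
  interpret g: brownian_grid M W t n by fact
  have ts: "set ts \<subseteq> t ` {..n}" "set us \<subseteq> t ` {..n}" "set ts' \<subseteq> t ` {..n}" "set us' \<subseteq> t ` {..n}" using S by auto
  have \<phi>: "smooth_poly_growth (length ts) \<phi>" "smooth_poly_growth (length us) \<psi>"
      "smooth_poly_growth (length ts') \<phi>'" "smooth_poly_growth (length us') \<psi>'" using c by (auto simp: cylinder_def)
  define th where "th x = g.lift ts \<phi> x - g.lift us \<psi> x" for x
  define xi where "xi x = g.lift ts' \<phi>' x - g.lift us' \<psi>' x" for x
  have sm: "smooth g.slots th" "smooth g.slots xi"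
    unfolding th_def[abs_def] xi_def[abs_def] by (intro smooth_diff g.smooth_lift smooth_poly_growth_smooth(1) \<phi>)+
  have ae1: "AE \<omega> in M. dist_sq j ts \<phi> us \<psi> \<omega> = ennreal (g.Dsq j th (g.pt \<omega>))" for j
    using W0 by eventually_elim (simp add: dist_sq_def th_def[abs_def] g.deriv_sq_cyl_diff[OF _ ts(1,2) \<phi>(1,2)])
  have ae2: "AE \<omega> in M. dist_sq j ts' \<phi>' us' \<psi>' \<omega> = ennreal (g.Dsq j xi (g.pt \<omega>))" for j
    using W0 by eventually_elim (simp add: dist_sq_def xi_def[abs_def] g.deriv_sq_cyl_diff[OF _ ts(3,4) \<phi>(3,4)])
  have ae3: "AE \<omega> in M. deriv_sq j (\<lambda>\<alpha> s \<omega>. (cyl_deriv W ts \<phi> j \<alpha> s \<omega> - cyl_deriv W us \<psi> j \<alpha> s \<omega>)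
         - (cyl_deriv W ts' \<phi>' j \<alpha> s \<omega> - cyl_deriv W us' \<psi>' j \<alpha> s \<omega>)) \<omega> = ennreal (g.Dsq j (\<lambda>x. th x - xi x) (g.pt \<omega>))" for j
    using W0 by eventually_elim (simp add: th_def xi_def g.deriv_sq_cyl_diff2[OF _ ts \<phi>])
  note cD = g.tempered_Dsq[OF sm(1)] g.tempered_Dsq[OF sm(2)] g.tempered_Dsq[OF smooth_diff[OF sm]]
  note nn = g.nn_integral_pt[OF cD(1) g.Dsq_nonneg ae1] g.nn_integral_pt[OF cD(2) g.Dsq_nonneg ae2] g.nn_integral_pt[OF cD(3) g.Dsq_nonneg ae3]
  have pos': "0 \<le> g.ev (g.Dsq j h)" "0 \<le> g.ev (\<lambda>x. sqrt (g.Dsq j h x))" for j h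
    by (auto intro!: integral_nonneg_AE g.Dsq_nonneg simp del: g.Dsq.simps)
  show "(\<integral>\<^sup>+ \<omega>. dist_sq j ts' \<phi>' us' \<psi>' \<omega> \<partial>M) < \<infinity>" unfolding nn by simp
  have "0 \<le> (1 + 1 / \<eta>) / \<kappa>" "0 \<le> 2 * \<kappa> * (1 + 1 / \<eta>)" using pos by auto
  then show "(\<integral>\<^sup>+ \<omega>. esqrt (dist_sq (Suc k) ts' \<phi>' us' \<psi>' \<omega>) \<partial>M) \<le> ennreal \<eta>
     + 2 * (\<integral>\<^sup>+ \<omega>. esqrt (deriv_sq (Suc k) (\<lambda>\<alpha> s \<omega>. (cyl_deriv W ts \<phi> (Suc k) \<alpha> s \<omega> - cyl_deriv W us \<psi> (Suc k) \<alpha> s \<omega>)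
         - (cyl_deriv W ts' \<phi>' (Suc k) \<alpha> s \<omega> - cyl_deriv W us' \<psi>' (Suc k) \<alpha> s \<omega>)) \<omega>) \<partial>M)
     + ennreal ((1 + 1 / \<eta>) / \<kappa>) * (\<integral>\<^sup>+ \<omega>. esqrt (dist_sq k ts \<phi> us \<psi> \<omega>) \<partial>M)
     + ennreal (2 * \<kappa> * (1 + 1 / \<eta>)) * ((\<integral>\<^sup>+ \<omega>. dist_sq (Suc k) ts' \<phi>' us' \<psi>' \<omega> \<partial>M) + (\<integral>\<^sup>+ \<omega>. dist_sq (Suc (Suc k)) ts' \<phi>' us' \<psi>' \<omega> \<partial>M))"
    unfolding nn
    using g.closability_estimate_Dsq[OF k sm pos] pos' pos
    by (simp del: g.Dsq.simps flip: ennreal_plus ennreal_mult ennreal_numeral)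
qed

lemma jointly_measurable_zero: "jointly_measurable M k (\<lambda>\<alpha> s \<omega>. 0)"
  by (simp add: jointly_measurable_def)

lemma deriv_sq_diff_le:
  assumes "jointly_measurable M k V" "jointly_measurable M k V'" "\<omega> \<in> space M"
  shows "deriv_sq k (\<lambda>\<alpha> s \<omega>. V \<alpha> s \<omega> - V' \<alpha> s \<omega>) \<omega> \<le> 2 * deriv_sq k V \<omega> + 2 * deriv_sq k V' \<omega>"
proof -
  have "deriv_sq k (\<lambda>\<alpha> s \<omega>. 0 - V' \<alpha> s \<omega>) \<omega> = deriv_sq k V' \<omega>" by (simp add: deriv_sq_def)
  then show ?thesis
    using deriv_sq_triangle[OF assms(1) jointly_measurable_zero assms(2,3)] by simp
qed

text \<open>The order of choices carries the argument. The difference of the approximants at a late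
  index m is \<xi>; then \<kappa> is chosen against the second derivatives of \<xi>; last, an index
  n is chosen at which the difference \<theta> is small compared with \<kappa>. D\<theta> and D\<xi>
  are close since both approximate U - U'. So the derivatives of the differences tend to 0, and U
  and U' agree.\<close>

lemma closable_step:
  assumes cyl: "\<And>n. cylinder (ts n) (\<phi> n)" "\<And>n. cylinder (us n) (\<psi> n)" and k: "k \<in> {0, 1}"
    and U: "jointly_measurable M (Suc k) U" "jointly_measurable M (Suc k) U'"
    and conv: "L1_null M (\<lambda>n. deriv_sq (Suc k) (\<lambda>\<alpha> s \<omega>. U \<alpha> s \<omega> - cyl_deriv W (ts n) (\<phi> n) (Suc k) \<alpha> s \<omega>))"
      "L1_null M (\<lambda>n. deriv_sq (Suc k) (\<lambda>\<alpha> s \<omega>. U' \<alpha> s \<omega> - cyl_deriv W (us n) (\<psi> n) (Suc k) \<alpha> s \<omega>))"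
    and Z: "L1_null M (\<lambda>n. dist_sq k (ts n) (\<phi> n) (us n) (\<psi> n))"
  shows "L1_null M (\<lambda>n. dist_sq (Suc k) (ts n) (\<phi> n) (us n) (\<psi> n))"
    and "AE \<omega> in M. deriv_sq (Suc k) (\<lambda>\<alpha> s \<omega>. U \<alpha> s \<omega> - U' \<alpha> s \<omega>) \<omega> = 0"
proof -
  \<comment> \<open>The error of the difference of approximants as an approximation of U - U'. Two
    such errors differ by the derivative of \<theta> - \<xi>, which bounds
    \<open>BD\<close>.\<close>
  define R where "R n \<alpha> s \<omega> = (U \<alpha> s \<omega> - cyl_deriv W (ts n) (\<phi> n) (Suc k) \<alpha> s \<omega>) - (U' \<alpha> s \<omega> - cyl_deriv W (us n) (\<psi> n) (Suc k) \<alpha> s \<omega>)" for n \<alpha> s \<omega>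
  note jm = cyl_deriv_measurable[OF cyl(1)] cyl_deriv_measurable[OF cyl(2)]
  note jm1 = jointly_measurable_diff[OF U(1) jm(1)] jointly_measurable_diff[OF U(2) jm(2)]
  have jR: "jointly_measurable M (Suc k) (R n)" for n
    unfolding R_def[abs_def] by (rule jointly_measurable_diff[OF jm1])
  have cR: "L1_null M (\<lambda>n. deriv_sq (Suc k) (R n))"
    by (rule L1_null_le[OF L1_null_add[OF conv deriv_sq_measurable[OF jm1(1)] deriv_sq_measurable[OF jm1(2)]]])
       (unfold R_def[abs_def], rule deriv_sq_diff_le[OF jm1])
  define c where "c n = (\<integral>\<^sup>+ \<omega>. esqrt (deriv_sq (Suc k) (R n) \<omega>) \<partial>M)" for n
  have c0: "c \<longlonglongrightarrow> 0" using cR unfolding L1_null_def c_def[abs_def] .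
  define A where "A k n = (\<integral>\<^sup>+ \<omega>. esqrt (dist_sq k (ts n) (\<phi> n) (us n) (\<psi> n) \<omega>) \<partial>M)" for k n
  have A0: "A k \<longlonglongrightarrow> 0" using Z unfolding L1_null_def A_def .
  define BD where "BD n m = (\<integral>\<^sup>+ \<omega>. esqrt (deriv_sq (Suc k) (\<lambda>\<alpha> s \<omega>. (cyl_deriv W (ts n) (\<phi> n) (Suc k) \<alpha> s \<omega> - cyl_deriv W (us n) (\<psi> n) (Suc k) \<alpha> s \<omega>)
         - (cyl_deriv W (ts m) (\<phi> m) (Suc k) \<alpha> s \<omega> - cyl_deriv W (us m) (\<psi> m) (Suc k) \<alpha> s \<omega>)) \<omega>) \<partial>M)" for n m
  have mR [measurable]: "deriv_sq (Suc k) (R n) \<in> borel_measurable M" for n by (rule deriv_sq_measurable[OF jR])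
  have BD: "BD n m \<le> 2 * c m + 2 * c n" for n m
  proof -
    have eq: "(\<lambda>\<alpha> s \<omega>. (cyl_deriv W (ts n) (\<phi> n) (Suc k) \<alpha> s \<omega> - cyl_deriv W (us n) (\<psi> n) (Suc k) \<alpha> s \<omega>)
         - (cyl_deriv W (ts m) (\<phi> m) (Suc k) \<alpha> s \<omega> - cyl_deriv W (us m) (\<psi> m) (Suc k) \<alpha> s \<omega>)) = (\<lambda>\<alpha> s \<omega>. R m \<alpha> s \<omega> - R n \<alpha> s \<omega>)"
      by (simp add: R_def fun_eq_iff)
    have "BD n m \<le> (\<integral>\<^sup>+ \<omega>. esqrt (2 * deriv_sq (Suc k) (R m) \<omega> + 2 * deriv_sq (Suc k) (R n) \<omega>) \<partial>M)"
      unfolding BD_def eq by (intro nn_integral_mono esqrt_mono deriv_sq_diff_le jR)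
    also have "\<dots> \<le> (\<integral>\<^sup>+ \<omega>. 2 * esqrt (deriv_sq (Suc k) (R m) \<omega>) + 2 * esqrt (deriv_sq (Suc k) (R n) \<omega>) \<partial>M)"
      by (intro nn_integral_mono esqrt_double_add)
    also have "\<dots> = 2 * c m + 2 * c n" unfolding c_def by (subst nn_integral_add) (auto simp: nn_integral_cmult)
    finally show ?thesis .
  qed
  have A1: "A (Suc k) \<longlonglongrightarrow> 0"
  proof (rule order_tendstoI)
    fix e' :: ennreal assume "0 < e'"
    \<comment> \<open>The four terms of the estimate contribute e, 8 e, e and e, which 12 e
      dominates.\<close>
    then obtain e where e: "e > 0" "ennreal (12 * e) < e'"
    proof (cases e')
      case (real r)
      then show ?thesis using \<open>0 < e'\<close> that[of "r / 24"] by (simp add: ennreal_less_iff)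
    next
      case top then show ?thesis using that[of 1] by simp
    qed
    have "\<forall>\<^sub>F n in sequentially. c n < ennreal e" using c0 by (rule order_tendstoD) (use e in simp)
    then obtain N where N: "\<And>n. n \<ge> N \<Longrightarrow> c n < ennreal e" by (auto simp: eventually_sequentially)
    have "A (Suc k) m < e'" if m: "m \<ge> N" for m
    proof -
      define K where "K = (\<integral>\<^sup>+ \<omega>. dist_sq (Suc k) (ts m) (\<phi> m) (us m) (\<psi> m) \<omega> \<partial>M) + (\<integral>\<^sup>+ \<omega>. dist_sq (Suc (Suc k)) (ts m) (\<phi> m) (us m) (\<psi> m) \<omega> \<partial>M)"
      have "K < \<infinity>" unfolding K_def
        using closability_estimate_cylinder(2)[OF cyl(1,2,1,2) k e(1) e(1)] by simp
      then obtain Kr where Kr: "K = ennreal Kr" "0 \<le> Kr" by (cases K) auto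
      \<comment> \<open>Chosen so that the term with the energies of \<xi> is at most e;
        \<open>Kr + 1\<close> avoids a zero denominator.\<close>
      define \<kappa> where "\<kappa> = e / (2 * (1 + 1 / e) * (Kr + 1))"
      have d: "2 * (1 + 1 / e) * (Kr + 1) > 0" using e Kr by (intro mult_pos_pos) (auto intro: add_pos_nonneg add_nonneg_pos)
      have \<kappa>: "\<kappa> > 0" using d e by (simp add: \<kappa>_def)
      have \<kappa>K: "2 * \<kappa> * (1 + 1 / e) * Kr \<le> e"
      proof -
        have "\<kappa> * (2 * (1 + 1 / e) * (Kr + 1)) = e"
          unfolding \<kappa>_def using less_imp_neq[OF d] by (metis nonzero_divide_eq_eq)
        then have "2 * \<kappa> * (1 + 1 / e) * (Kr + 1) = e" by (metis mult.assoc mult.commute)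
        moreover have "2 * \<kappa> * (1 + 1 / e) * Kr \<le> 2 * \<kappa> * (1 + 1 / e) * (Kr + 1)"
          using \<kappa> e by (intro mult_left_mono) auto
        ultimately show ?thesis by simp
      qed
      define q where "q = (1 + 1 / e) / \<kappa>"
      have q: "q > 0" using e \<kappa> by (simp add: q_def add_pos_pos)
      have "\<forall>\<^sub>F n in sequentially. A k n < ennreal (e / q)" using A0 by (rule order_tendstoD) (use e q in simp)
      \<comment> \<open>This index comes after \<kappa>, hence after m: \<open>A k n\<close> must be
        small compared with a quantity that depends on m.\<close>
      then obtain n where n: "n \<ge> N" "A k n < ennreal (e / q)"
        by (metis eventually_sequentially nle_le order_refl)
      have "A (Suc k) m \<le> ennreal e + 2 * BD n m + ennreal q * A k n + ennreal (2 * \<kappa> * (1 + 1 / e)) * K"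
        unfolding A_def BD_def K_def q_def
        by (rule closability_estimate_cylinder(1)[OF cyl(1,2,1,2) k e(1) \<kappa>])
      also have "\<dots> \<le> ennreal e + 2 * (2 * ennreal e + 2 * ennreal e) + ennreal q * ennreal (e / q) + ennreal (2 * \<kappa> * (1 + 1 / e)) * ennreal Kr"
      proof (intro add_mono mult_left_mono order_refl)
        show "BD n m \<le> 2 * ennreal e + 2 * ennreal e"
          by (rule order_trans[OF BD]) (intro add_mono mult_left_mono less_imp_le N m n; simp)
      qed (use n Kr in auto)
      also have "\<dots> = ennreal (e + 2 * (2 * e + 2 * e) + e + 2 * \<kappa> * (1 + 1 / e) * Kr)"
      proof -
        have "ennreal q * ennreal (e / q) = ennreal e" using q e by (simp flip: ennreal_mult)
        moreover have "ennreal (2 * \<kappa> * (1 + 1 / e)) * ennreal Kr = ennreal (2 * \<kappa> * (1 + 1 / e) * Kr)"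
          using \<kappa> e Kr by (intro ennreal_mult[symmetric]) auto
        moreover have "0 \<le> 2 * \<kappa> * (1 + 1 / e) * Kr" using \<kappa> e Kr by simp
        ultimately show ?thesis using e
          by (simp only: ennreal_plus[symmetric] ennreal_mult[symmetric] ennreal_numeral[symmetric] add_nonneg_nonneg mult_nonneg_nonneg less_imp_le zero_le_numeral)
      qed
      also have "\<dots> \<le> ennreal (12 * e)"
      proof (rule ennreal_leI)
        have "e + 2 * (2 * e + 2 * e) + e + x \<le> 12 * e" if "x \<le> e" for x using that e by simp
        from this[OF \<kappa>K] show "e + 2 * (2 * e + 2 * e) + e + 2 * \<kappa> * (1 + 1 / e) * Kr \<le> 12 * e" .
      qed
      also have "\<dots> < e'" by (rule e)
      finally show ?thesis .
    qed
    then show "\<forall>\<^sub>F m in sequentially. A (Suc k) m < e'" by (auto simp: eventually_sequentially)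
  qed simp
  then show "L1_null M (\<lambda>n. dist_sq (Suc k) (ts n) (\<phi> n) (us n) (\<psi> n))" unfolding L1_null_def A_def .
  note jd = jointly_measurable_diff[OF jm(1) jm(2)]
  have md [measurable]: "dist_sq (Suc k) (ts n) (\<phi> n) (us n) (\<psi> n) \<in> borel_measurable M" for n
    unfolding dist_sq_def by (rule deriv_sq_measurable[OF jd])
  have mU [measurable]: "deriv_sq (Suc k) (\<lambda>\<alpha> s \<omega>. U \<alpha> s \<omega> - U' \<alpha> s \<omega>) \<in> borel_measurable M"
    by (rule deriv_sq_measurable[OF jointly_measurable_diff[OF U]])
  let ?I = "\<integral>\<^sup>+ \<omega>. esqrt (deriv_sq (Suc k) (\<lambda>\<alpha> s \<omega>. U \<alpha> s \<omega> - U' \<alpha> s \<omega>) \<omega>) \<partial>M"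
  have "?I \<le> 2 * c n + 2 * A (Suc k) n" for n
  proof -
    have eq: "(\<lambda>\<alpha> s \<omega>. U \<alpha> s \<omega> - U' \<alpha> s \<omega>) = (\<lambda>\<alpha> s \<omega>. R n \<alpha> s \<omega> -
        (cyl_deriv W (us n) (\<psi> n) (Suc k) \<alpha> s \<omega> - cyl_deriv W (ts n) (\<phi> n) (Suc k) \<alpha> s \<omega>))"
      by (simp add: R_def fun_eq_iff)
    have "?I \<le> (\<integral>\<^sup>+ \<omega>. esqrt (2 * deriv_sq (Suc k) (R n) \<omega> + 2 * dist_sq (Suc k) (ts n) (\<phi> n) (us n) (\<psi> n) \<omega>) \<partial>M)"
    proof (intro nn_integral_mono esqrt_mono)
      fix \<omega> assume \<omega>: "\<omega> \<in> space M"
      show "deriv_sq (Suc k) (\<lambda>\<alpha> s \<omega>. U \<alpha> s \<omega> - U' \<alpha> s \<omega>) \<omega>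
          \<le> 2 * deriv_sq (Suc k) (R n) \<omega> + 2 * dist_sq (Suc k) (ts n) (\<phi> n) (us n) (\<psi> n) \<omega>"
        using deriv_sq_diff_le[OF jR jointly_measurable_diff[OF jm(2) jm(1)] \<omega>]
        unfolding eq dist_sq_def by (subst (2) deriv_sq_commute) simp
    qed
    also have "\<dots> \<le> (\<integral>\<^sup>+ \<omega>. 2 * esqrt (deriv_sq (Suc k) (R n) \<omega>) + 2 * esqrt (dist_sq (Suc k) (ts n) (\<phi> n) (us n) (\<psi> n) \<omega>) \<partial>M)"
      by (intro nn_integral_mono esqrt_double_add)
    also have "\<dots> = 2 * c n + 2 * A (Suc k) n" unfolding c_def A_def by (subst nn_integral_add) (auto simp: nn_integral_cmult)
    finally show ?thesis .
  qed
  then have "(\<lambda>n::nat. ?I) \<longlonglongrightarrow> 0" by (rule tendsto_0_le[OF tendsto_0_double_add[OF c0 A1]])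
  then have "?I = 0" by (simp add: LIMSEQ_const_iff)
  then have "AE \<omega> in M. esqrt (deriv_sq (Suc k) (\<lambda>\<alpha> s \<omega>. U \<alpha> s \<omega> - U' \<alpha> s \<omega>) \<omega>) = 0"
    by (subst (asm) nn_integral_0_iff_AE) auto
  then show "AE \<omega> in M. deriv_sq (Suc k) (\<lambda>\<alpha> s \<omega>. U \<alpha> s \<omega> - U' \<alpha> s \<omega>) \<omega> = 0"
    by eventually_elim (rule esqrt_eq_0)
qed

lemma deriv_sq_0_cyl: "deriv_sq 0 (\<lambda>\<alpha> s \<omega>. cyl_deriv W ts \<phi> 0 \<alpha> s \<omega> - cyl_deriv W us \<psi> 0 \<alpha> s \<omega>) \<omega>
    = ennreal ((cyl_val W ts \<phi> \<omega> - cyl_val W us \<psi> \<omega>)\<^sup>2)"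
  by (simp add: deriv_sq_def cyl_deriv_0 unit_cube_def space_PiM_empty)

lemma jet_sq_ge:
  "ennreal ((F \<omega>)\<^sup>2) \<le> jet_sq m F U \<omega>" "k \<in> {1..m} \<Longrightarrow> deriv_sq k (U k) \<omega> \<le> jet_sq m F U \<omega>"
proof -
  show "ennreal ((F \<omega>)\<^sup>2) \<le> jet_sq m F U \<omega>" by (simp add: jet_sq_def)
  assume "k \<in> {1..m}"
  then have "deriv_sq k (U k) \<omega> \<le> (\<Sum>k=1..m. deriv_sq k (U k) \<omega>)" by (intro member_le_sum) auto
  then show "deriv_sq k (U k) \<omega> \<le> jet_sq m F U \<omega>" unfolding jet_sq_def by (rule order_trans) simp
qed

lemma in_closure_L1:
  assumes "in_closure M W m 1 F U"
  obtains ts \<phi> where "\<And>n. cylinder (ts n) (\<phi> n)"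
    "L1_null M (\<lambda>n \<omega>. ennreal ((F \<omega> - cyl_val W (ts n) (\<phi> n) \<omega>)\<^sup>2))"
    "\<And>k. k \<in> {1..m} \<Longrightarrow> L1_null M (\<lambda>n. deriv_sq k (\<lambda>\<alpha> s \<omega>. U k \<alpha> s \<omega> - cyl_deriv W (ts n) (\<phi> n) k \<alpha> s \<omega>))"
    "F \<in> borel_measurable M" "\<And>k. k \<in> {1..m} \<Longrightarrow> jointly_measurable M k (U k)"
proof -
  obtain ts \<phi> where c: "\<forall>n. set (ts n) \<subseteq> {0..1} \<and> smooth_poly_growth (length (ts n)) (\<phi> n)"
    and l: "(\<lambda>n. Lp_norm_of_sq M 1 (jet_sq m (\<lambda>\<omega>. F \<omega> - cyl_val W (ts n) (\<phi> n) \<omega>)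
                         (\<lambda>k \<alpha> s \<omega>. U k \<alpha> s \<omega> - cyl_deriv W (ts n) (\<phi> n) k \<alpha> s \<omega>))) \<longlonglongrightarrow> 0"
    using assms unfolding in_closure_def by blast
  have l': "L1_null M (\<lambda>n. jet_sq m (\<lambda>\<omega>. F \<omega> - cyl_val W (ts n) (\<phi> n) \<omega>)
                         (\<lambda>k \<alpha> s \<omega>. U k \<alpha> s \<omega> - cyl_deriv W (ts n) (\<phi> n) k \<alpha> s \<omega>))"
    using l unfolding L1_null_def Lp_norm_of_sq_def by simp
  show ?thesis
  proof (rule that)
    show "L1_null M (\<lambda>n \<omega>. ennreal ((F \<omega> - cyl_val W (ts n) (\<phi> n) \<omega>)\<^sup>2))"
      by (rule L1_null_le[OF l'], rule jet_sq_ge(1))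
    show "L1_null M (\<lambda>n. deriv_sq k (\<lambda>\<alpha> s \<omega>. U k \<alpha> s \<omega> - cyl_deriv W (ts n) (\<phi> n) k \<alpha> s \<omega>))" if "k \<in> {1..m}" for k
      by (rule L1_null_le[OF l'], rule jet_sq_ge(2)[OF that])
  qed (use c assms in \<open>auto simp: cylinder_def in_closure_def jointly_measurable_def\<close>)
qed

lemma in_closure_L2:
  assumes "in_closure M W m 2 F U"
  obtains ts \<phi> where "\<And>n. cylinder (ts n) (\<phi> n)"
    "(\<lambda>n. \<integral>\<^sup>+ \<omega>. ennreal ((F \<omega> - cyl_val W (ts n) (\<phi> n) \<omega>)\<^sup>2) \<partial>M) \<longlonglongrightarrow> 0"
    "\<And>k. k \<in> {1..m} \<Longrightarrow> (\<lambda>n. \<integral>\<^sup>+ \<omega>. deriv_sq k (\<lambda>\<alpha> s \<omega>. U k \<alpha> s \<omega> - cyl_deriv W (ts n) (\<phi> n) k \<alpha> s \<omega>) \<omega> \<partial>M) \<longlonglongrightarrow> 0"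
    "F \<in> borel_measurable M" "\<And>k. k \<in> {1..m} \<Longrightarrow> jointly_measurable M k (U k)"
proof -
  obtain ts \<phi> where c: "\<forall>n. set (ts n) \<subseteq> {0..1} \<and> smooth_poly_growth (length (ts n)) (\<phi> n)"
    and l: "(\<lambda>n. Lp_norm_of_sq M 2 (jet_sq m (\<lambda>\<omega>. F \<omega> - cyl_val W (ts n) (\<phi> n) \<omega>)
                         (\<lambda>k \<alpha> s \<omega>. U k \<alpha> s \<omega> - cyl_deriv W (ts n) (\<phi> n) k \<alpha> s \<omega>))) \<longlonglongrightarrow> 0"
    using assms unfolding in_closure_def by blast
  have l': "(\<lambda>n. \<integral>\<^sup>+ \<omega>. jet_sq m (\<lambda>\<omega>. F \<omega> - cyl_val W (ts n) (\<phi> n) \<omega>)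
                         (\<lambda>k \<alpha> s \<omega>. U k \<alpha> s \<omega> - cyl_deriv W (ts n) (\<phi> n) k \<alpha> s \<omega>) \<omega> \<partial>M) \<longlonglongrightarrow> 0"
    by (rule esqrt_tendsto_0_D) (use l in \<open>simp add: Lp_norm_of_sq_def\<close>)
  show ?thesis
  proof (rule that)
    show "(\<lambda>n. \<integral>\<^sup>+ \<omega>. ennreal ((F \<omega> - cyl_val W (ts n) (\<phi> n) \<omega>)\<^sup>2) \<partial>M) \<longlonglongrightarrow> 0"
      by (rule tendsto_0_le[OF l'], intro nn_integral_mono, rule jet_sq_ge(1))
    show "(\<lambda>n. \<integral>\<^sup>+ \<omega>. deriv_sq k (\<lambda>\<alpha> s \<omega>. U k \<alpha> s \<omega> - cyl_deriv W (ts n) (\<phi> n) k \<alpha> s \<omega>) \<omega> \<partial>M) \<longlonglongrightarrow> 0" if "k \<in> {1..m}" for k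
      by (rule tendsto_0_le[OF l'], intro nn_integral_mono, rule jet_sq_ge(2)[OF that])
  qed (use c assms in \<open>auto simp: cylinder_def in_closure_def jointly_measurable_def\<close>)
qed

lemma in_closure_mono:
  assumes "in_closure M W m 1 F U" "k \<le> m" shows "in_closure M W k 1 F U"
proof -
  obtain ts \<phi> where c: "\<forall>n. set (ts n) \<subseteq> {0..1} \<and> smooth_poly_growth (length (ts n)) (\<phi> n)"
    and l: "(\<lambda>n. Lp_norm_of_sq M 1 (jet_sq m (\<lambda>\<omega>. F \<omega> - cyl_val W (ts n) (\<phi> n) \<omega>)
                         (\<lambda>k \<alpha> s \<omega>. U k \<alpha> s \<omega> - cyl_deriv W (ts n) (\<phi> n) k \<alpha> s \<omega>))) \<longlonglongrightarrow> 0"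
    using assms unfolding in_closure_def by blast
  have "jet_sq k G V \<omega> \<le> jet_sq m G V \<omega>" for G and V :: "('N, 'w) jet" and \<omega>
    unfolding jet_sq_def using assms(2) by (intro add_left_mono sum_mono2) auto
  then have "(\<lambda>n. Lp_norm_of_sq M 1 (jet_sq k (\<lambda>\<omega>. F \<omega> - cyl_val W (ts n) (\<phi> n) \<omega>)
                         (\<lambda>k \<alpha> s \<omega>. U k \<alpha> s \<omega> - cyl_deriv W (ts n) (\<phi> n) k \<alpha> s \<omega>))) \<longlonglongrightarrow> 0"
    by (intro tendsto_0_le[OF l]) (auto simp: Lp_norm_of_sq_def intro!: nn_integral_mono esqrt_mono)
  moreover have "{1..k} \<subseteq> {1..m}" using assms(2) by auto
  ultimately show ?thesis using assms(1) c unfolding in_closure_def by blast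
qed

lemma L1_null_dist_0:
  assumes cyl: "\<And>n. cylinder (ts n) (\<phi> n)" "\<And>n. cylinder (us n) (\<psi> n)" and F: "F \<in> borel_measurable M"
    and "L1_null M (\<lambda>n \<omega>. ennreal ((F \<omega> - cyl_val W (ts n) (\<phi> n) \<omega>)\<^sup>2))"
      "L1_null M (\<lambda>n \<omega>. ennreal ((F \<omega> - cyl_val W (us n) (\<psi> n) \<omega>)\<^sup>2))"
  shows "L1_null M (\<lambda>n. dist_sq 0 (ts n) (\<phi> n) (us n) (\<psi> n))"
proof (rule L1_null_le[OF L1_null_add[OF assms(4,5)]])
  note [measurable] = F cyl_val_measurable[OF cyl(1)] cyl_val_measurable[OF cyl(2)]
  show "(\<lambda>\<omega>. ennreal ((F \<omega> - cyl_val W (ts n) (\<phi> n) \<omega>)\<^sup>2)) \<in> borel_measurable M"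
    "(\<lambda>\<omega>. ennreal ((F \<omega> - cyl_val W (us n) (\<psi> n) \<omega>)\<^sup>2)) \<in> borel_measurable M" for n by measurable
  fix n \<omega>
  have "(a - c)\<^sup>2 \<le> 2 * (b - a)\<^sup>2 + 2 * (b - c)\<^sup>2" for a b c :: real
  proof -
    have "0 \<le> ((a - b) - (b - c))\<^sup>2" by simp
    then show ?thesis by (simp add: power2_eq_square algebra_simps)
  qed
  then show "dist_sq 0 (ts n) (\<phi> n) (us n) (\<psi> n) \<omega> \<le> 2 * ennreal ((F \<omega> - cyl_val W (ts n) (\<phi> n) \<omega>)\<^sup>2)
      + 2 * ennreal ((F \<omega> - cyl_val W (us n) (\<psi> n) \<omega>)\<^sup>2)"
    unfolding dist_sq_def deriv_sq_0_cyl by (simp flip: ennreal_numeral ennreal_mult ennreal_plus)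
qed

lemma malliavin_deriv_in_closure:
  assumes "in_closure M W m 1 F U" "k \<le> m"
  obtains U' where "in_closure M W k 1 F U'" "malliavin_deriv M W F k = U' k"
proof -
  have "in_closure M W k 1 F U" by (rule in_closure_mono[OF assms])
  then have "in_closure M W k 1 F (SOME U. in_closure M W k 1 F U)" by (rule someI[of "in_closure M W k 1 F"])
  then show ?thesis by (rule that) (simp add: malliavin_deriv_def)
qed

text \<open>The choice in \<open>malliavin_deriv\<close> is made separately for each order and knows
  convergence in L^1 only, while integration by parts needs approximation in L^2. Closability
  identifies the chosen derivatives of orders 1 and 2 with those of one limit in L^2, so a single
  sequence approximates the functional and both derivatives.\<close>

lemma malliavin_deriv_approximation:
  assumes "F \<in> malliavin_sobolev_inf M W 3"
  obtains ts \<phi> where "\<And>n. cylinder (ts n) (\<phi> n)" "F \<in> borel_measurable M"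
    "(\<lambda>n. \<integral>\<^sup>+ \<omega>. ennreal ((F \<omega> - cyl_val W (ts n) (\<phi> n) \<omega>)\<^sup>2) \<partial>M) \<longlonglongrightarrow> 0"
    "\<And>k. k \<in> {1, 2} \<Longrightarrow> jointly_measurable M k (malliavin_deriv M W F k)"
    "\<And>k. k \<in> {1, 2} \<Longrightarrow> (\<lambda>n. \<integral>\<^sup>+ \<omega>. deriv_sq k (\<lambda>\<alpha> s \<omega>. malliavin_deriv M W F k \<alpha> s \<omega> - cyl_deriv W (ts n) (\<phi> n) k \<alpha> s \<omega>) \<omega> \<partial>M) \<longlonglongrightarrow> 0"
proof -
  \<comment> \<open>\<open>V\<close> comes with the approximation in L^2 that is wanted;
    \<open>V1\<close> guarantees that the choice in \<open>malliavin_deriv\<close> has a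
    candidate.\<close>
  obtain V where V: "in_closure M W 3 2 F V"
    using assms unfolding malliavin_sobolev_inf_def malliavin_sobolev_def by fastforce
  obtain V1 where V1: "in_closure M W 3 1 F V1"
    using assms unfolding malliavin_sobolev_inf_def malliavin_sobolev_def by fastforce
  obtain ts \<phi> where c: "\<And>n. cylinder (ts n) (\<phi> n)"
    and F0: "(\<lambda>n. \<integral>\<^sup>+ \<omega>. ennreal ((F \<omega> - cyl_val W (ts n) (\<phi> n) \<omega>)\<^sup>2) \<partial>M) \<longlonglongrightarrow> 0"
    and FD: "\<And>k. k \<in> {1..3} \<Longrightarrow> (\<lambda>n. \<integral>\<^sup>+ \<omega>. deriv_sq k (\<lambda>\<alpha> s \<omega>. V k \<alpha> s \<omega> - cyl_deriv W (ts n) (\<phi> n) k \<alpha> s \<omega>) \<omega> \<partial>M) \<longlonglongrightarrow> 0"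
    and Fm: "F \<in> borel_measurable M" and jV: "\<And>k. k \<in> {1..3} \<Longrightarrow> jointly_measurable M k (V k)"
    using in_closure_L2[OF V] by blast
  have cF: "L1_null M (\<lambda>n \<omega>. ennreal ((F \<omega> - cyl_val W (ts n) (\<phi> n) \<omega>)\<^sup>2))"
  proof (rule L1_null_L2[OF F0])
    note [measurable] = Fm cyl_val_measurable[OF c]
    show "(\<lambda>\<omega>. ennreal ((F \<omega> - cyl_val W (ts n) (\<phi> n) \<omega>)\<^sup>2)) \<in> borel_measurable M" for n by measurable
  qed
  have cD: "L1_null M (\<lambda>n. deriv_sq k (\<lambda>\<alpha> s \<omega>. V k \<alpha> s \<omega> - cyl_deriv W (ts n) (\<phi> n) k \<alpha> s \<omega>))" if "k \<in> {1..3}" for k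
    by (rule L1_null_L2[OF FD[OF that] deriv_sq_measurable[OF jointly_measurable_diff[OF jV[OF that] cyl_deriv_measurable[OF c]]]])
  have main: "jointly_measurable M k (malliavin_deriv M W F k) \<and>
      (AE \<omega> in M. deriv_sq k (\<lambda>\<alpha> s \<omega>. V k \<alpha> s \<omega> - malliavin_deriv M W F k \<alpha> s \<omega>) \<omega> = 0)" if k: "k \<in> {1, 2}" for k
  proof -
    have "k \<le> 3" using k by auto
    then obtain U where U: "in_closure M W k 1 F U" "malliavin_deriv M W F k = U k"
      using malliavin_deriv_in_closure[OF V1] by blast
    obtain us \<psi> where d: "\<And>n. cylinder (us n) (\<psi> n)"
      and G0: "L1_null M (\<lambda>n \<omega>. ennreal ((F \<omega> - cyl_val W (us n) (\<psi> n) \<omega>)\<^sup>2))"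
      and GD: "\<And>j. j \<in> {1..k} \<Longrightarrow> L1_null M (\<lambda>n. deriv_sq j (\<lambda>\<alpha> s \<omega>. U j \<alpha> s \<omega> - cyl_deriv W (us n) (\<psi> n) j \<alpha> s \<omega>))"
      and jU: "\<And>j. j \<in> {1..k} \<Longrightarrow> jointly_measurable M j (U j)"
      by (rule in_closure_L1[OF U(1)]) blast
    have Z0: "L1_null M (\<lambda>n. dist_sq 0 (ts n) (\<phi> n) (us n) (\<psi> n))" by (rule L1_null_dist_0[OF c d Fm cF G0])
    have 1: "1 \<in> {1..k}" "1 \<in> {1..3::nat}" using k by auto
    note s1 = closable_step[OF c d, of 0 "V 1" "U 1", unfolded One_nat_def[symmetric], OF _ jV[OF 1(2)] jU[OF 1(1)] cD[OF 1(2)] GD[OF 1(1)] Z0]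
    show ?thesis
    proof (cases "k = 1")
      case True
      show ?thesis unfolding U(2) using s1(2) jU[OF 1(1)] by (simp add: True)
    next
      case False
      then have k2: "k = Suc 1" "Suc 1 \<in> {1..k}" "Suc 1 \<in> {1..3::nat}" using k by auto
      \<comment> \<open>The step to order 2 starts from convergence of the first derivatives of the
        differences, which is the first conclusion of the step to order 1.\<close>
      have "AE \<omega> in M. deriv_sq (Suc 1) (\<lambda>\<alpha> s \<omega>. V (Suc 1) \<alpha> s \<omega> - U (Suc 1) \<alpha> s \<omega>) \<omega> = 0"
        by (rule closable_step(2)[OF c d _ jV[OF k2(3)] jU[OF k2(2)] cD[OF k2(3)] GD[OF k2(2)]]) (use s1(1) in simp_all)
      then show ?thesis unfolding U(2) using jU[OF k2(2)] by (simp add: k2(1))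
    qed
  qed
  show ?thesis
  proof (rule that[OF c Fm F0])
    fix k :: nat assume k: "k \<in> {1, 2}"
    then have k3: "k \<in> {1..3}" by auto
    let ?U = "malliavin_deriv M W F k"
    show jU: "jointly_measurable M k ?U" using main[OF k] by blast
    note jc = cyl_deriv_measurable[OF c]
    note [measurable] = deriv_sq_measurable[OF jointly_measurable_diff[OF jV[OF k3] jc]]
    show "(\<lambda>n. \<integral>\<^sup>+ \<omega>. deriv_sq k (\<lambda>\<alpha> s \<omega>. ?U \<alpha> s \<omega> - cyl_deriv W (ts n) (\<phi> n) k \<alpha> s \<omega>) \<omega> \<partial>M) \<longlonglongrightarrow> 0"
    proof (rule tendsto_0_le[OF tendsto_0_double_add[OF FD[OF k3] tendsto_const]])
      fix n
      have "AE \<omega> in M. deriv_sq k (\<lambda>\<alpha> s \<omega>. ?U \<alpha> s \<omega> - V k \<alpha> s \<omega>) \<omega> = 0"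
        using main[OF k] by (subst deriv_sq_commute) blast
      moreover have "AE \<omega> in M. deriv_sq k (\<lambda>\<alpha> s \<omega>. ?U \<alpha> s \<omega> - cyl_deriv W (ts n) (\<phi> n) k \<alpha> s \<omega>) \<omega>
          \<le> 2 * deriv_sq k (\<lambda>\<alpha> s \<omega>. ?U \<alpha> s \<omega> - V k \<alpha> s \<omega>) \<omega> + 2 * deriv_sq k (\<lambda>\<alpha> s \<omega>. V k \<alpha> s \<omega> - cyl_deriv W (ts n) (\<phi> n) k \<alpha> s \<omega>) \<omega>"
        by (rule AE_I2) (rule deriv_sq_triangle[OF jU jV[OF k3] jc])
      ultimately have "AE \<omega> in M. deriv_sq k (\<lambda>\<alpha> s \<omega>. ?U \<alpha> s \<omega> - cyl_deriv W (ts n) (\<phi> n) k \<alpha> s \<omega>) \<omega>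
          \<le> 2 * deriv_sq k (\<lambda>\<alpha> s \<omega>. V k \<alpha> s \<omega> - cyl_deriv W (ts n) (\<phi> n) k \<alpha> s \<omega>) \<omega>"
        by eventually_elim simp
      then have "(\<integral>\<^sup>+ \<omega>. deriv_sq k (\<lambda>\<alpha> s \<omega>. ?U \<alpha> s \<omega> - cyl_deriv W (ts n) (\<phi> n) k \<alpha> s \<omega>) \<omega> \<partial>M)
         \<le> (\<integral>\<^sup>+ \<omega>. 2 * deriv_sq k (\<lambda>\<alpha> s \<omega>. V k \<alpha> s \<omega> - cyl_deriv W (ts n) (\<phi> n) k \<alpha> s \<omega>) \<omega> \<partial>M)"
        by (rule nn_integral_mono_AE)
      then show "(\<integral>\<^sup>+ \<omega>. deriv_sq k (\<lambda>\<alpha> s \<omega>. ?U \<alpha> s \<omega> - cyl_deriv W (ts n) (\<phi> n) k \<alpha> s \<omega>) \<omega> \<partial>M)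
         \<le> 2 * (\<integral>\<^sup>+ \<omega>. deriv_sq k (\<lambda>\<alpha> s \<omega>. V k \<alpha> s \<omega> - cyl_deriv W (ts n) (\<phi> n) k \<alpha> s \<omega>) \<omega> \<partial>M) + 2 * 0"
        by (simp add: nn_integral_cmult)
    qed
  qed
qed

end

section \<open>The Malliavin covariance matrix\<close>

lemma sum_PiE_singleton:
  fixes f :: "(nat \<Rightarrow> 'b) \<Rightarrow> 'c::comm_monoid_add"
  shows "(\<Sum>\<alpha>\<in>{..<1} \<rightarrow>\<^sub>E B. f \<alpha>) = (\<Sum>k\<in>B. f (\<lambda>_\<in>{..<1}. k))"
proof -
  have "(\<lambda>_. undefined)(0 := k) = (\<lambda>_\<in>{..<1::nat}. k)" for k :: 'b
    by (auto simp: fun_eq_iff restrict_def)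
  then show ?thesis using sum_PiE_lessThan_Suc[of f 0 B] by (simp add: One_nat_def)
qed

abbreviation unit_interval :: "real measure" where "unit_interval \<equiv> restrict_space lborel {0..<1}"

lemma nn_integral_unit_cube_1:
  assumes "f \<in> borel_measurable (unit_cube 1)"
  shows "(\<integral>\<^sup>+ s. f s \<partial>unit_cube 1) = (\<integral>\<^sup>+ s. f (\<lambda>_\<in>{..<1}. s) \<partial>unit_interval)"
proof -
  interpret product_sigma_finite "\<lambda>_::nat. unit_interval"
    by (rule product_sigma_finite.intro) (rule sigma_finite_unit_interval)
  have u: "unit_cube 1 = PiM {0::nat} (\<lambda>_. unit_interval)" by (simp add: unit_cube_def lessThan_Suc)
  have fm: "f \<in> borel_measurable (PiM {0::nat} (\<lambda>_. unit_interval))" using assms unfolding u .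
  have r: "(\<lambda>s. \<lambda>_\<in>{0::nat}. s) \<in> unit_interval \<rightarrow>\<^sub>M PiM {0::nat} (\<lambda>_. unit_interval)"
    by (rule measurable_restrict) simp
  have "(\<integral>\<^sup>+ s. f (\<lambda>_\<in>{0::nat}. s) \<partial>unit_interval)
      = (\<integral>\<^sup>+ s. f (\<lambda>_\<in>{0::nat}. s) \<partial>distr (PiM {0::nat} (\<lambda>_. unit_interval)) unit_interval (\<lambda>x. x 0))"
    by (rule arg_cong[where f="\<lambda>N. \<integral>\<^sup>+ s. f (\<lambda>_\<in>{0::nat}. s) \<partial>N", OF distr_singleton[of 0, symmetric]])
  also have "\<dots> = (\<integral>\<^sup>+ x. f (\<lambda>_\<in>{0::nat}. x 0) \<partial>PiM {0::nat} (\<lambda>_. unit_interval))"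
  proof (rule nn_integral_distr)
    show "(\<lambda>x. x 0) \<in> PiM {0::nat} (\<lambda>_. unit_interval) \<rightarrow>\<^sub>M unit_interval"
      by (rule measurable_component_singleton) simp
    show "(\<lambda>s. f (\<lambda>_\<in>{0::nat}. s)) \<in> borel_measurable (distr (PiM {0::nat} (\<lambda>_. unit_interval)) unit_interval (\<lambda>x. x 0))"
      using measurable_compose[OF r fm] by simp
  qed
  also have "\<dots> = (\<integral>\<^sup>+ x. f x \<partial>PiM {0::nat} (\<lambda>_. unit_interval))"
  proof (rule nn_integral_cong)
    fix x assume "x \<in> space (PiM {0::nat} (\<lambda>_. unit_interval))"
    then have "(\<lambda>_\<in>{0::nat}. x 0) = x" by (auto simp: space_PiM PiE_def extensional_def fun_eq_iff)
    then show "f (\<lambda>_\<in>{0::nat}. x 0) = f x" by simp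
  qed
  finally show ?thesis unfolding u by (simp add: lessThan_Suc)
qed

context brownian begin

definition kernel_at :: "((nat \<Rightarrow> 'N) \<Rightarrow> (nat \<Rightarrow> real) \<Rightarrow> 'w \<Rightarrow> real) \<Rightarrow> 'N \<Rightarrow> real \<Rightarrow> 'w \<Rightarrow> real" where
  "kernel_at V k s \<omega> = V (\<lambda>_\<in>{..<1}. k) (\<lambda>_\<in>{..<1}. s) \<omega>"

definition deriv_inner :: "((nat \<Rightarrow> 'N) \<Rightarrow> (nat \<Rightarrow> real) \<Rightarrow> 'w \<Rightarrow> real) \<Rightarrow> ((nat \<Rightarrow> 'N) \<Rightarrow> (nat \<Rightarrow> real) \<Rightarrow> 'w \<Rightarrow> real) \<Rightarrow> 'w \<Rightarrow> real" where
  "deriv_inner V V' \<omega> = (\<Sum>k\<in>UNIV. LINT s|unit_interval. kernel_at V k s \<omega> * kernel_at V' k s \<omega>)"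

lemma malliavin_cov_deriv_inner:
  "malliavin_cov M W F \<omega> $ a $ b = deriv_inner (malliavin_deriv M W (\<lambda>\<omega>. F \<omega> $ a) 1) (malliavin_deriv M W (\<lambda>\<omega>. F \<omega> $ b) 1) \<omega>"
  by (simp add: malliavin_cov_def deriv_inner_def kernel_at_def malliavin_deriv1_def)

lemma kernel_at_joint_measurable:
  assumes "jointly_measurable M 1 V"
  shows "(\<lambda>p. kernel_at V k (snd p) (fst p)) \<in> borel_measurable (M \<Otimes>\<^sub>M unit_interval)"
proof -
  have "(\<lambda>s. \<lambda>_\<in>{..<1}. s) \<in> unit_interval \<rightarrow>\<^sub>M unit_cube 1"
    unfolding unit_cube_def by (rule measurable_restrict) simp
  then have "(\<lambda>p. (\<lambda>_\<in>{..<1}. snd p, fst p)) \<in> M \<Otimes>\<^sub>M unit_interval \<rightarrow>\<^sub>M unit_cube 1 \<Otimes>\<^sub>M M"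
    by (intro measurable_Pair measurable_compose[OF measurable_snd] measurable_fst)
  moreover have "(\<lambda>(s, \<omega>). V (\<lambda>_\<in>{..<1}. k) s \<omega>) \<in> borel_measurable (unit_cube 1 \<Otimes>\<^sub>M M)"
    using assms unfolding jointly_measurable_def by auto
  ultimately show ?thesis
    using measurable_compose[of "\<lambda>p. (\<lambda>_\<in>{..<1}. snd p, fst p)" "M \<Otimes>\<^sub>M unit_interval" "unit_cube 1 \<Otimes>\<^sub>M M"
        "\<lambda>(s, \<omega>). V (\<lambda>_\<in>{..<1}. k) s \<omega>" borel]
    by (simp add: kernel_at_def)
qed

lemma kernel_at_measurable:
  assumes "jointly_measurable M 1 V" "\<omega> \<in> space M"
  shows "(\<lambda>s. kernel_at V k s \<omega>) \<in> borel_measurable unit_interval"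
  using measurable_compose[OF measurable_Pair1'[OF assms(2)] kernel_at_joint_measurable[OF assms(1), of k]] by simp

lemma deriv_inner_measurable:
  assumes "jointly_measurable M 1 V" "jointly_measurable M 1 V'"
  shows "deriv_inner V V' \<in> borel_measurable M"
proof -
  interpret I: sigma_finite_measure unit_interval by (rule sigma_finite_unit_interval)
  have "(\<lambda>\<omega>. LINT s|unit_interval. kernel_at V k s \<omega> * kernel_at V' k s \<omega>) \<in> borel_measurable M" for k
  proof (rule I.borel_measurable_lebesgue_integral)
    note [measurable] = kernel_at_joint_measurable[OF assms(1), of k] kernel_at_joint_measurable[OF assms(2), of k]
    show "(\<lambda>(\<omega>, s). kernel_at V k s \<omega> * kernel_at V' k s \<omega>) \<in> borel_measurable (M \<Otimes>\<^sub>M unit_interval)"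
      unfolding case_prod_beta by measurable
  qed
  then show ?thesis unfolding deriv_inner_def[abs_def] by (intro borel_measurable_sum) auto
qed

lemma deriv_sq_1:
  assumes "jointly_measurable M 1 V" "\<omega> \<in> space M"
  shows "deriv_sq 1 V \<omega> = (\<Sum>k\<in>UNIV. \<integral>\<^sup>+ s. ennreal ((kernel_at V k s \<omega>)\<^sup>2) \<partial>unit_interval)"
  unfolding deriv_sq_def sum_PiE_singleton
proof (intro sum.cong refl)
  fix k :: 'N
  have "(\<lambda>_\<in>{..<1}. k) \<in> {..<1} \<rightarrow>\<^sub>E (UNIV :: 'N set)" by auto
  from jointly_measurable_section[OF assms(1) this assms(2)]
  have [measurable]: "(\<lambda>s. V (\<lambda>_\<in>{..<1}. k) s \<omega>) \<in> borel_measurable (unit_cube 1)" .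
  show "(\<integral>\<^sup>+ s. ennreal ((V (\<lambda>_\<in>{..<1}. k) s \<omega>)\<^sup>2) \<partial>unit_cube 1) = (\<integral>\<^sup>+ s. ennreal ((kernel_at V k s \<omega>)\<^sup>2) \<partial>unit_interval)"
    unfolding kernel_at_def by (rule nn_integral_unit_cube_1) measurable
qed

lemma kernel_at_product_integrable:
  assumes jm: "jointly_measurable M 1 V" "jointly_measurable M 1 V'" and \<omega>: "\<omega> \<in> space M"
    and fin: "deriv_sq 1 V \<omega> < \<infinity>" "deriv_sq 1 V' \<omega> < \<infinity>"
  shows "integrable unit_interval (\<lambda>s. kernel_at V k s \<omega> * kernel_at V' k s \<omega>)"
proof (rule integrableI_bounded)
  note [measurable] = kernel_at_measurable[OF jm(1) \<omega>, of k] kernel_at_measurable[OF jm(2) \<omega>, of k]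
  show "(\<lambda>s. kernel_at V k s \<omega> * kernel_at V' k s \<omega>) \<in> borel_measurable unit_interval" by measurable
  have k: "(\<integral>\<^sup>+ s. ennreal ((kernel_at V k s \<omega>)\<^sup>2) \<partial>unit_interval) < \<infinity>" if "jointly_measurable M 1 V" "deriv_sq 1 V \<omega> < \<infinity>" for V
  proof -
    have "(\<integral>\<^sup>+ s. ennreal ((kernel_at V k s \<omega>)\<^sup>2) \<partial>unit_interval) \<le> deriv_sq 1 V \<omega>"
      unfolding deriv_sq_1[OF that(1) \<omega>] by (intro member_le_sum) auto
    then show ?thesis using that(2) by (rule le_less_trans)
  qed
  have "(\<integral>\<^sup>+ s. ennreal (norm (kernel_at V k s \<omega> * kernel_at V' k s \<omega>)) \<partial>unit_interval)
     \<le> (\<integral>\<^sup>+ s. ennreal ((kernel_at V k s \<omega>)\<^sup>2) + ennreal ((kernel_at V' k s \<omega>)\<^sup>2) \<partial>unit_interval)"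
  proof (intro nn_integral_mono)
    fix s
    have "\<bar>a * b\<bar> \<le> a\<^sup>2 + b\<^sup>2" for a b :: real
    proof -
      have "0 \<le> (\<bar>a\<bar> - \<bar>b\<bar>)\<^sup>2" by simp
      then have "2 * \<bar>a * b\<bar> \<le> a\<^sup>2 + b\<^sup>2" by (simp add: power2_diff abs_mult)
      then show ?thesis using abs_ge_zero[of "a * b"] by linarith
    qed
    then show "ennreal (norm (kernel_at V k s \<omega> * kernel_at V' k s \<omega>)) \<le> ennreal ((kernel_at V k s \<omega>)\<^sup>2) + ennreal ((kernel_at V' k s \<omega>)\<^sup>2)"
      by (simp flip: ennreal_plus)
  qed
  also have "\<dots> = (\<integral>\<^sup>+ s. ennreal ((kernel_at V k s \<omega>)\<^sup>2) \<partial>unit_interval) + (\<integral>\<^sup>+ s. ennreal ((kernel_at V' k s \<omega>)\<^sup>2) \<partial>unit_interval)"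
    by (rule nn_integral_add) auto
  also have "\<dots> < \<infinity>" using k[OF jm(1) fin(1)] k[OF jm(2) fin(2)] by simp
  finally show "(\<integral>\<^sup>+ s. ennreal (norm (kernel_at V k s \<omega> * kernel_at V' k s \<omega>)) \<partial>unit_interval) < \<infinity>" .
qed

text \<open>Bilinearity and Young's inequality. The weight \<kappa> falls on the fixed kernels U and
  U', and the large factor falls on the differences, which will tend to 0.\<close>

lemma deriv_inner_perturbation:
  assumes jm: "jointly_measurable M 1 U" "jointly_measurable M 1 U'" "jointly_measurable M 1 V" "jointly_measurable M 1 V'"
    and \<omega>: "\<omega> \<in> space M" and \<kappa>: "\<kappa> > 0"
  shows "ennreal \<bar>deriv_inner U U' \<omega> - deriv_inner V V' \<omega>\<bar> \<le>
     ennreal (1 + 1 / \<kappa>) * (deriv_sq 1 (\<lambda>\<alpha> s \<omega>. U \<alpha> s \<omega> - V \<alpha> s \<omega>) \<omega> + deriv_sq 1 (\<lambda>\<alpha> s \<omega>. U' \<alpha> s \<omega> - V' \<alpha> s \<omega>) \<omega>)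
     + ennreal \<kappa> * (deriv_sq 1 U \<omega> + deriv_sq 1 U' \<omega>)" (is "_ \<le> ennreal (1 + 1 / \<kappa>) * (?d1 + ?d2) + ennreal \<kappa> * (?e1 + ?e2)")
proof (cases "?d1 < \<infinity> \<and> ?d2 < \<infinity> \<and> ?e1 < \<infinity> \<and> ?e2 < \<infinity>")
  \<comment> \<open>Squared norms may be infinite at exceptional points, where the integrals in
    \<open>deriv_inner\<close> mean nothing; the right-hand side is then infinite as well.\<close>
  case False
  have "1 + 1 / \<kappa> > 0" using \<kappa> by (simp add: add_pos_pos)
  then have E: "ennreal (1 + 1 / \<kappa>) * (?d1 + ?d2) + ennreal \<kappa> * (?e1 + ?e2) = \<top>"
    using False \<kappa> by (auto simp: ennreal_mult_eq_top_iff not_less top_unique)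
  show ?thesis unfolding E by (rule top_greatest)
next
  case True
  note jd = jointly_measurable_diff[OF jm(1,3)] jointly_measurable_diff[OF jm(2,4)]
  have kernel_at_diff: "kernel_at (\<lambda>\<alpha> s \<omega>. U \<alpha> s \<omega> - V \<alpha> s \<omega>) k s \<omega> = kernel_at U k s \<omega> - kernel_at V k s \<omega>" for U V k s
    by (simp add: kernel_at_def)
  have vfin: "deriv_sq 1 V \<omega> < \<infinity>" if "jointly_measurable M 1 U" "jointly_measurable M 1 V"
     "deriv_sq 1 U \<omega> < \<infinity>" "deriv_sq 1 (\<lambda>\<alpha> s \<omega>. U \<alpha> s \<omega> - V \<alpha> s \<omega>) \<omega> < \<infinity>" for U V
  proof -
    have "deriv_sq 1 (\<lambda>\<alpha> s \<omega>. U \<alpha> s \<omega> - (U \<alpha> s \<omega> - V \<alpha> s \<omega>)) \<omega>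
       \<le> 2 * deriv_sq 1 U \<omega> + 2 * deriv_sq 1 (\<lambda>\<alpha> s \<omega>. U \<alpha> s \<omega> - V \<alpha> s \<omega>) \<omega>"
      by (rule deriv_sq_diff_le[OF that(1) jointly_measurable_diff[OF that(1,2)] \<omega>])
    also have "\<dots> < \<infinity>" using that by (simp add: ennreal_mult_less_top)
    finally show ?thesis by simp
  qed
  have fin: "?e1 < \<infinity>" "?e2 < \<infinity>" "deriv_sq 1 V \<omega> < \<infinity>" "deriv_sq 1 V' \<omega> < \<infinity>"
    using True vfin[OF jm(1,3)] vfin[OF jm(2,4)] by auto
  note iU = kernel_at_product_integrable[OF jm(1,2) \<omega> fin(1,2)]
  note iV = kernel_at_product_integrable[OF jm(3,4) \<omega> fin(3,4)]
  let ?u = "\<lambda>k s. kernel_at U k s \<omega>" and ?u' = "\<lambda>k s. kernel_at U' k s \<omega>" and ?v = "\<lambda>k s. kernel_at V k s \<omega>" and ?v' = "\<lambda>k s. kernel_at V' k s \<omega>"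
  have each: "ennreal \<bar>(LINT s|unit_interval. ?u k s * ?u' k s) - (LINT s|unit_interval. ?v k s * ?v' k s)\<bar>
     \<le> ennreal (1 + 1 / \<kappa>) * ((\<integral>\<^sup>+ s. ennreal ((?u k s - ?v k s)\<^sup>2) \<partial>unit_interval) + (\<integral>\<^sup>+ s. ennreal ((?u' k s - ?v' k s)\<^sup>2) \<partial>unit_interval))
      + ennreal \<kappa> * ((\<integral>\<^sup>+ s. ennreal ((?u k s)\<^sup>2) \<partial>unit_interval) + (\<integral>\<^sup>+ s. ennreal ((?u' k s)\<^sup>2) \<partial>unit_interval))" for k
  proof -
    note [measurable] = jm[THEN kernel_at_measurable[OF _ \<omega>, of _ k]]
    have pw: "\<bar>a * a' - b * b'\<bar> \<le> (1 + 1 / \<kappa>) * ((a - b)\<^sup>2 + (a' - b')\<^sup>2) + \<kappa> * (a\<^sup>2 + a'\<^sup>2)" for a a' b b' :: real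
    proof -
      have young: "\<bar>x * y\<bar> \<le> 1 / \<kappa> * x\<^sup>2 + \<kappa> * y\<^sup>2" for x y :: real
      proof -
        have "0 \<le> (\<bar>x\<bar> - \<kappa> * \<bar>y\<bar>)\<^sup>2" by simp
        then have "2 * \<kappa> * \<bar>x * y\<bar> \<le> x\<^sup>2 + \<kappa>\<^sup>2 * y\<^sup>2" by (simp add: power2_diff abs_mult power_mult_distrib mult_ac)
        moreover have "0 \<le> \<kappa> * \<bar>x * y\<bar>" using \<kappa> by simp
        ultimately have "\<kappa> * \<bar>x * y\<bar> \<le> x\<^sup>2 + \<kappa>\<^sup>2 * y\<^sup>2" by linarith
        then show ?thesis using \<kappa> by (simp add: field_simps power2_eq_square)
      qed
      have one: "\<bar>x * y\<bar> \<le> x\<^sup>2 + y\<^sup>2" for x y :: real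
      proof -
        have "0 \<le> (\<bar>x\<bar> - \<bar>y\<bar>)\<^sup>2" by simp
        then have "2 * \<bar>x * y\<bar> \<le> x\<^sup>2 + y\<^sup>2" by (simp add: power2_diff abs_mult)
        then show ?thesis using abs_ge_zero[of "x * y"] by linarith
      qed
      \<comment> \<open>Expanded around a and a', so that no norm of the approximating kernels
        enters the bound.\<close>
      have "a * a' - b * b' = (a - b) * a' + (a' - b') * a - (a - b) * (a' - b')" by (simp add: algebra_simps)
      then have "\<bar>a * a' - b * b'\<bar> \<le> \<bar>(a - b) * a'\<bar> + \<bar>(a' - b') * a\<bar> + \<bar>(a - b) * (a' - b')\<bar>" by linarith
      also have "\<dots> \<le> (1 / \<kappa> * (a - b)\<^sup>2 + \<kappa> * a'\<^sup>2) + (1 / \<kappa> * (a' - b')\<^sup>2 + \<kappa> * a\<^sup>2) + ((a - b)\<^sup>2 + (a' - b')\<^sup>2)"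
        by (intro add_mono young one)
      finally show ?thesis by (simp add: algebra_simps)
    qed
    have "ennreal \<bar>(LINT s|unit_interval. ?u k s * ?u' k s) - (LINT s|unit_interval. ?v k s * ?v' k s)\<bar>
       = ennreal (norm (LINT s|unit_interval. ?u k s * ?u' k s - ?v k s * ?v' k s))"
      using iU iV by simp
    also have "\<dots> \<le> (\<integral>\<^sup>+ s. ennreal (norm (?u k s * ?u' k s - ?v k s * ?v' k s)) \<partial>unit_interval)"
      by (rule integral_norm_bound_ennreal) (intro Bochner_Integration.integrable_diff iU iV)
    also have "\<dots> \<le> (\<integral>\<^sup>+ s. ennreal (1 + 1 / \<kappa>) * (ennreal ((?u k s - ?v k s)\<^sup>2) + ennreal ((?u' k s - ?v' k s)\<^sup>2))
         + ennreal \<kappa> * (ennreal ((?u k s)\<^sup>2) + ennreal ((?u' k s)\<^sup>2)) \<partial>unit_interval)"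
      using pw \<kappa> by (intro nn_integral_mono) (simp flip: ennreal_plus ennreal_mult)
    also have "\<dots> = ennreal (1 + 1 / \<kappa>) * ((\<integral>\<^sup>+ s. ennreal ((?u k s - ?v k s)\<^sup>2) \<partial>unit_interval) + (\<integral>\<^sup>+ s. ennreal ((?u' k s - ?v' k s)\<^sup>2) \<partial>unit_interval))
      + ennreal \<kappa> * ((\<integral>\<^sup>+ s. ennreal ((?u k s)\<^sup>2) \<partial>unit_interval) + (\<integral>\<^sup>+ s. ennreal ((?u' k s)\<^sup>2) \<partial>unit_interval))"
      by (simp add: nn_integral_add nn_integral_cmult)
    finally show ?thesis .
  qed
  have "ennreal \<bar>deriv_inner U U' \<omega> - deriv_inner V V' \<omega>\<bar>
     \<le> ennreal (\<Sum>k\<in>UNIV. \<bar>(LINT s|unit_interval. ?u k s * ?u' k s) - (LINT s|unit_interval. ?v k s * ?v' k s)\<bar>)"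
    unfolding deriv_inner_def sum_subtractf[symmetric] by (intro ennreal_leI sum_abs)
  also have "\<dots> = (\<Sum>k\<in>UNIV. ennreal \<bar>(LINT s|unit_interval. ?u k s * ?u' k s) - (LINT s|unit_interval. ?v k s * ?v' k s)\<bar>)"
    by (rule sum_ennreal[symmetric]) simp
  also have "\<dots> \<le> ennreal (1 + 1 / \<kappa>) * (?d1 + ?d2) + ennreal \<kappa> * (?e1 + ?e2)"
    unfolding deriv_sq_1[OF jd(1) \<omega>] deriv_sq_1[OF jd(2) \<omega>] deriv_sq_1[OF jm(1) \<omega>] deriv_sq_1[OF jm(2) \<omega>] kernel_at_diff
      sum.distrib[symmetric] sum_distrib_left
    by (rule sum_mono) (rule each)
  finally show ?thesis .
qed

text \<open>Perturbation of the zero kernels with \<kappa> = 1: the coefficients 1 + 1/\<kappa> = 2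
  and \<kappa> = 1 add up to 3.\<close>

lemma deriv_inner_bound:
  assumes jm: "jointly_measurable M 1 U" "jointly_measurable M 1 U'" and \<omega>: "\<omega> \<in> space M"
  shows "ennreal \<bar>deriv_inner U U' \<omega>\<bar> \<le> 3 * (deriv_sq 1 U \<omega> + deriv_sq 1 U' \<omega>)"
proof -
  have "deriv_inner (\<lambda>\<alpha> s \<omega>. 0) (\<lambda>\<alpha> s \<omega>. 0) \<omega> = 0" by (simp add: deriv_inner_def kernel_at_def)
  moreover have "deriv_sq 1 (\<lambda>\<alpha> s \<omega>. U \<alpha> s \<omega> - 0) = deriv_sq 1 U" for U :: "(nat \<Rightarrow> 'N) \<Rightarrow> (nat \<Rightarrow> real) \<Rightarrow> 'w \<Rightarrow> real" by simp
  ultimately have "ennreal \<bar>deriv_inner U U' \<omega>\<bar> \<le> ennreal 2 * (deriv_sq 1 U \<omega> + deriv_sq 1 U' \<omega>) + 1 * (deriv_sq 1 U \<omega> + deriv_sq 1 U' \<omega>)"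
    using deriv_inner_perturbation[OF jm jointly_measurable_zero jointly_measurable_zero \<omega>, of 1] by simp
  also have "\<dots> = 3 * (deriv_sq 1 U \<omega> + deriv_sq 1 U' \<omega>)"
    by (subst distrib_right[symmetric]) simp
  finally show ?thesis .
qed

end

context brownian_grid begin

lemma integral_cell:
  fixes H :: "nat \<Rightarrow> real"
  shows "(LINT y|unit_interval. H (cell y)) = (\<Sum>l<n. (t (Suc l) - t l) * H l)"
proof -
  have "(LINT y|unit_interval. H (cell y)) = (LINT y|lborel. indicator {0..<1} y *\<^sub>R H (cell y))"
    by (rule integral_restrict_space) simp
  also have "\<dots> = (LINT y|lborel. (\<Sum>l<n. H l * indicator {t l..<t (Suc l)} y))"
  proof (rule Bochner_Integration.integral_cong[OF refl])
    fix y :: real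
    show "indicator {0..<1} y *\<^sub>R H (cell y) = (\<Sum>l<n. H l * indicator {t l..<t (Suc l)} y)"
    proof (cases "0 \<le> y \<and> y < 1")
      case True
      then obtain l where l: "l < n" "t l \<le> y" "y < t (Suc l)" using cell_exists by blast
      have "(\<Sum>l'<n. H l' * indicator {t l'..<t (Suc l')} y) = (\<Sum>l'<n. if l' = l then H l else 0)"
        using l cell_eq[OF l] cell_eq[of _ y] by (intro sum.cong refl) (auto simp: indicator_def)
      then show ?thesis using True l cell_eq[OF l] by simp
    next
      case False
      have "y \<notin> {t l..<t (Suc l)}" if "l < n" for l
        using False t_01[of l] t_01[of "Suc l"] that by auto
      then have "(\<Sum>l<n. H l * indicator {t l..<t (Suc l)} y) = 0" by (intro sum.neutral ballI) simp
      then show ?thesis using False by (auto simp: indicator_def)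
    qed
  qed
  also have "\<dots> = (\<Sum>l<n. (t (Suc l) - t l) * H l)"
  proof (subst Bochner_Integration.integral_sum)
    show "integrable lborel (\<lambda>y. H l * indicator {t l..<t (Suc l)} y)" for l
      by (intro integrable_mult_right integrable_real_indicator) 
         (simp, rule emeasure_bounded_finite, rule bounded_subset[OF bounded_closed_interval[of "t l" "t (Suc l)"]], auto)
    show "(\<Sum>l<n. LINT y|lborel. H l * indicator {t l..<t (Suc l)} y) = (\<Sum>l<n. (t (Suc l) - t l) * H l)"
      using t_less by (intro sum.cong refl) (auto simp: less_imp_le)
  qed
  finally show ?thesis .
qed

interpretation B: brownian M W by (rule brownian.intro) (rule bm)

text \<open>The kernels are constant on cells, so time integrals become sums weighted by the
  variances, the form in which \<open>cov\<close> is defined.\<close>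

lemma deriv_inner_cyl:
  assumes \<omega>: "\<And>i. W i 0 \<omega> = 0" and ts: "\<And>a. set (ts a) \<subseteq> t ` {..n}"
    and \<phi>: "\<And>a. smooth_poly_growth (length (ts a)) (\<phi> a)"
  shows "B.deriv_inner (cyl_deriv W (ts a) (\<phi> a) 1) (cyl_deriv W (ts b) (\<phi> b) 1) \<omega> = cov (\<lambda>a. lift (ts a) (\<phi> a)) (pt \<omega>) $ a $ b"
proof -
  have l: "B.kernel_at (cyl_deriv W (ts a) (\<phi> a) 1) k s \<omega> = partial (k, cell s) (lift (ts a) (\<phi> a)) (pt \<omega>)"
    if "s \<in> space unit_interval" for a k s
    using that
    by (simp add: B.kernel_at_def space_restrict_space cyl_deriv_lift[OF \<omega> ts _ smooth_poly_growth_smooth(2,1)[OF \<phi>]])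
  have "B.deriv_inner (cyl_deriv W (ts a) (\<phi> a) 1) (cyl_deriv W (ts b) (\<phi> b) 1) \<omega>
     = (\<Sum>k\<in>UNIV. LINT s|unit_interval. partial (k, cell s) (lift (ts a) (\<phi> a)) (pt \<omega>) * partial (k, cell s) (lift (ts b) (\<phi> b)) (pt \<omega>))"
    unfolding B.deriv_inner_def
  proof (intro sum.cong refl Bochner_Integration.integral_cong)
    fix k s assume s: "s \<in> space unit_interval"
    show "B.kernel_at (cyl_deriv W (ts a) (\<phi> a) 1) k s \<omega> * B.kernel_at (cyl_deriv W (ts b) (\<phi> b) 1) k s \<omega>
       = partial (k, cell s) (lift (ts a) (\<phi> a)) (pt \<omega>) * partial (k, cell s) (lift (ts b) (\<phi> b)) (pt \<omega>)"
      unfolding l[OF s] ..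
  qed
  also have "\<dots> = (\<Sum>k\<in>UNIV. \<Sum>l<n. (t (Suc l) - t l) * (partial (k, l) (lift (ts a) (\<phi> a)) (pt \<omega>) * partial (k, l) (lift (ts b) (\<phi> b)) (pt \<omega>)))"
    by (intro sum.cong refl) (rule integral_cell[of "\<lambda>l. partial (_, l) _ _ * partial (_, l) _ _"])
  also have "\<dots> = (\<Sum>c\<in>slots. len c * (partial c (lift (ts a) (\<phi> a)) (pt \<omega>) * partial c (lift (ts b) (\<phi> b)) (pt \<omega>)))"
    unfolding slots_def by (subst sum.cartesian_product) (simp add: len_def case_prod_beta)
  finally show ?thesis by (simp add: cov_def)
qed

end

section \<open>Integration by parts for Malliavin differentiable vectors\<close>

lemma vec_measurable:
  fixes g :: "'d::finite \<Rightarrow> 'w \<Rightarrow> real"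
  assumes "\<And>a. g a \<in> borel_measurable M" shows "(\<lambda>\<omega>. \<chi> a. g a \<omega>) \<in> borel_measurable M"
proof (subst borel_measurable_euclidean_space, rule ballI)
  fix b :: "real ^ 'd" assume "b \<in> Basis"
  then obtain i where b: "b = axis i 1" unfolding Basis_vec_def by auto
  show "(\<lambda>\<omega>. (\<chi> a. g a \<omega>) \<bullet> b) \<in> borel_measurable M" unfolding b using assms by (simp add: inner_axis)
qed

lemma matrix_measurable:
  fixes g :: "'d::finite \<Rightarrow> 'e::finite \<Rightarrow> 'w \<Rightarrow> real"
  assumes "\<And>a b. g a b \<in> borel_measurable M" shows "(\<lambda>\<omega>. \<chi> a b. g a b \<omega>) \<in> borel_measurable M"
proof (subst borel_measurable_euclidean_space, rule ballI)
  fix u :: "real ^ 'e ^ 'd" assume "u \<in> Basis"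
  then obtain i j where u: "\<And>A. A \<bullet> u = A $ i $ j" by (rule Basis_matrix_cases) blast
  show "(\<lambda>\<omega>. (\<chi> a b. g a b \<omega>) \<bullet> u) \<in> borel_measurable M" unfolding u using assms by simp
qed

lemma AE_convergent_subsequence:
  fixes r :: "nat \<Rightarrow> 'w \<Rightarrow> real"
  assumes [measurable]: "\<And>n. r n \<in> borel_measurable M" and "(\<lambda>n. \<integral>\<^sup>+ \<omega>. ennreal \<bar>r n \<omega>\<bar> \<partial>M) \<longlonglongrightarrow> 0"
  shows "\<exists>s :: nat \<Rightarrow> nat. strict_mono s \<and> (AE \<omega> in M. (\<lambda>n. r (s n) \<omega>) \<longlonglongrightarrow> 0)"
proof -
  have "\<forall>\<^sub>F n in sequentially. (\<integral>\<^sup>+ \<omega>. ennreal \<bar>r n \<omega>\<bar> \<partial>M) < 1" using assms(2) by (rule order_tendstoD) simp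
  \<comment> \<open>Finitely many terms may fail to be integrable; a shift by \<open>N\<close> drops
    them.\<close>
  then obtain N where N: "\<And>n. n \<ge> N \<Longrightarrow> (\<integral>\<^sup>+ \<omega>. ennreal \<bar>r n \<omega>\<bar> \<partial>M) < 1" by (auto simp: eventually_sequentially)
  have i: "integrable M (r (n + N))" for n
  proof (rule integrableI_bounded)
    have "(\<integral>\<^sup>+ \<omega>. ennreal (norm (r (n + N) \<omega>)) \<partial>M) < 1" using N[of "n + N"] by simp
    then show "(\<integral>\<^sup>+ \<omega>. ennreal (norm (r (n + N) \<omega>)) \<partial>M) < \<infinity>" by (rule less_trans) simp
  qed simp
  have "(\<lambda>n. \<integral>\<^sup>+ \<omega>. ennreal \<bar>r (n + N) \<omega>\<bar> \<partial>M) \<longlonglongrightarrow> 0" by (rule LIMSEQ_ignore_initial_segment[OF assms(2)])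
  then have "(\<lambda>n. ennreal (\<integral>\<omega>. norm (r (n + N) \<omega>) \<partial>M)) \<longlonglongrightarrow> 0"
    using nn_integral_eq_integral[OF integrable_norm[OF i]] by simp
  then have "(\<lambda>n. \<integral>\<omega>. norm (r (n + N) \<omega>) \<partial>M) \<longlonglongrightarrow> 0" by (subst (asm) ennreal_tendsto_0_iff) auto
  from tendsto_L1_AE_subseq[OF i this] obtain s where s: "strict_mono s" "AE \<omega> in M. (\<lambda>n. r (s n + N) \<omega>) \<longlonglongrightarrow> 0" by blast
  then show ?thesis by (intro exI[of _ "\<lambda>n. s n + N"]) (auto simp: strict_mono_def)
qed

text \<open>The fundamental theorem of calculus along the segment from Y to Y + h, combined with
  Fubini's theorem, turns a bound on directional derivatives at all translated points into one on
  the finite difference. The finite difference involves \<open>f\<close> alone, so it can be carried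
  to limits without its gradient.\<close>

lemma directional_average_bound:
  fixes Y :: "'w \<Rightarrow> 'a::euclidean_space"
  assumes "prob_space M" and Y [measurable]: "Y \<in> borel_measurable M" and g [measurable]: "g \<in> borel_measurable M"
    and g01: "\<And>\<omega>. 0 \<le> g \<omega> \<and> g \<omega> \<le> (1::real)"
    and f: "\<And>y. (f has_derivative (\<lambda>u. G y \<bullet> u)) (at y)" and G: "continuous_on UNIV G" "\<And>y. norm (G y) \<le> B"
    and b: "\<And>\<tau>. \<bar>LINT \<omega>|M. g \<omega> * (G (Y \<omega> + \<tau> *\<^sub>R h) \<bullet> h)\<bar> \<le> b"
  shows "\<bar>LINT \<omega>|M. g \<omega> * (f (Y \<omega> + h) - f (Y \<omega>))\<bar> \<le> b"
proof -
  interpret prob_space M by fact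
  interpret P: pair_sigma_finite lborel M ..
  have Gm [measurable]: "G \<in> borel_measurable borel" by (rule borel_measurable_continuous_onI[OF G(1)])
  let ?k = "\<lambda>\<tau> \<omega>. g \<omega> * (G (Y \<omega> + \<tau> *\<^sub>R h) \<bullet> h)"
  have FTC: "f (Y \<omega> + h) - f (Y \<omega>) = (LINT \<tau>|lborel. indicator {0..1} \<tau> * (G (Y \<omega> + \<tau> *\<^sub>R h) \<bullet> h))" for \<omega>
  proof -
    have "(LINT \<tau>|lborel. indicator {0..1} \<tau> *\<^sub>R (G (Y \<omega> + \<tau> *\<^sub>R h) \<bullet> h)) = f (Y \<omega> + 1 *\<^sub>R h) - f (Y \<omega> + 0 *\<^sub>R h)"
    proof (rule integral_FTC_atLeastAtMost)
      show "continuous_on {0..1} (\<lambda>\<tau>. G (Y \<omega> + \<tau> *\<^sub>R h) \<bullet> h)"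
        by (intro continuous_intros continuous_on_compose2[OF G(1)]) auto
      fix x :: real
      have "((\<lambda>\<tau>. Y \<omega> + \<tau> *\<^sub>R h) has_derivative (\<lambda>d. d *\<^sub>R h)) (at x)" by (auto intro!: derivative_eq_intros)
      from has_derivative_compose[OF this f]
      have "((\<lambda>\<tau>. f (Y \<omega> + \<tau> *\<^sub>R h)) has_vector_derivative G (Y \<omega> + x *\<^sub>R h) \<bullet> h) (at x)"
        unfolding has_vector_derivative_def by (rule has_derivative_eq_rhs) (auto simp: fun_eq_iff)
      then show "((\<lambda>\<tau>. f (Y \<omega> + \<tau> *\<^sub>R h)) has_vector_derivative G (Y \<omega> + x *\<^sub>R h) \<bullet> h) (at x within {0..1})"
        by (rule has_vector_derivative_at_within)
    qed simp
    then show ?thesis by simp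
  qed
  have B0: "0 \<le> B" using norm_ge_zero[of "G 0"] G(2)[of 0] by linarith
  have kb: "\<bar>?k \<tau> \<omega>\<bar> \<le> B * norm h" for \<tau> \<omega>
  proof -
    have "\<bar>G (Y \<omega> + \<tau> *\<^sub>R h) \<bullet> h\<bar> \<le> norm (G (Y \<omega> + \<tau> *\<^sub>R h)) * norm h" by (rule Cauchy_Schwarz_ineq2)
    also have "\<dots> \<le> B * norm h" by (intro mult_right_mono G(2)) simp
    finally have "\<bar>g \<omega>\<bar> * \<bar>G (Y \<omega> + \<tau> *\<^sub>R h) \<bullet> h\<bar> \<le> 1 * (B * norm h)"
      using g01[of \<omega>] B0 by (intro mult_mono) auto
    then show ?thesis by (simp add: abs_mult)
  qed
  have int: "integrable (lborel \<Otimes>\<^sub>M M) (\<lambda>(\<tau>, \<omega>). indicator {0..1} \<tau> * ?k \<tau> \<omega>)"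
  proof (rule integrableI_bounded)
    show "(\<lambda>(\<tau>, \<omega>). indicator {0..1} \<tau> * ?k \<tau> \<omega>) \<in> borel_measurable (lborel \<Otimes>\<^sub>M M)" by measurable
    have "(\<integral>\<^sup>+ p. ennreal (norm (case p of (\<tau>, \<omega>) \<Rightarrow> indicator {0..1} \<tau> * ?k \<tau> \<omega>)) \<partial>(lborel \<Otimes>\<^sub>M M))
       \<le> (\<integral>\<^sup>+ p. ennreal (B * norm h) * indicator {0..1::real} (fst p) \<partial>(lborel \<Otimes>\<^sub>M M))"
    proof (rule nn_integral_mono)
      fix p :: "real \<times> 'w"
      show "ennreal (norm (case p of (\<tau>, \<omega>) \<Rightarrow> indicator {0..1} \<tau> * ?k \<tau> \<omega>)) \<le> ennreal (B * norm h) * indicator {0..1::real} (fst p)"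
        using kb[of "snd p" "fst p"] by (cases "fst p \<in> {0..1}") (auto simp: case_prod_beta intro!: ennreal_leI)
    qed
    also have "\<dots> = (\<integral>\<^sup>+ \<tau>. (\<integral>\<^sup>+ \<omega>. ennreal (B * norm h) * indicator {0..1::real} \<tau> \<partial>M) \<partial>lborel)"
      by (subst nn_integral_fst[symmetric]) auto
    also have "\<dots> < \<infinity>" by (simp add: emeasure_space_1 nn_integral_cmult)
    finally show "(\<integral>\<^sup>+ p. ennreal (norm (case p of (\<tau>, \<omega>) \<Rightarrow> indicator {0..1} \<tau> * ?k \<tau> \<omega>)) \<partial>(lborel \<Otimes>\<^sub>M M)) < \<infinity>" .
  qed
  have "(LINT \<omega>|M. g \<omega> * (f (Y \<omega> + h) - f (Y \<omega>))) = (LINT \<omega>|M. (LINT \<tau>|lborel. indicator {0..1} \<tau> * ?k \<tau> \<omega>))"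
    unfolding FTC by (simp add: mult.left_commute flip: integral_mult_right_zero)
  also have "\<dots> = (LINT \<tau>|lborel. (LINT \<omega>|M. indicator {0..1} \<tau> * ?k \<tau> \<omega>))" using P.Fubini_integral[OF int] by simp
  also have "\<bar>\<dots>\<bar> \<le> (LINT \<tau>|lborel. \<bar>LINT \<omega>|M. indicator {0..1} \<tau> * ?k \<tau> \<omega>\<bar>)" by (rule integral_abs_bound)
  also have "\<dots> \<le> (LINT \<tau>|lborel. b * indicator {0..1::real} \<tau>)"
  proof (rule integral_mono)
    show "integrable lborel (\<lambda>\<tau>. \<bar>LINT \<omega>|M. indicator {0..1} \<tau> * ?k \<tau> \<omega>\<bar>)"
      using P.integrable_fst[OF int] by (rule integrable_abs)
    show "\<bar>LINT \<omega>|M. indicator {0..1} \<tau> * ?k \<tau> \<omega>\<bar> \<le> b * indicator {0..1::real} \<tau>" for \<tau> :: real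
      using b[of \<tau>] by (simp add: indicator_def)
  qed simp
  also have "\<dots> = b" by simp
  finally show ?thesis .
qed

context brownian begin

text \<open>The bound depends on the cylindrical functionals only through \<open>Q\<close>; the grid
  needed to prove it has disappeared. \<open>Q\<close> serves both orders, hence the term with 2
  CARD('d) Q.\<close>

lemma cylinder_estimate:
  fixes ts :: "'d::finite \<Rightarrow> real list" and f :: "real ^ 'd \<Rightarrow> real"
    and T :: "'d \<Rightarrow> 'd \<Rightarrow> real ^ 'd ^ 'd \<Rightarrow> real" and m :: "real ^ 'd ^ 'd \<Rightarrow> real" and h :: "real ^ 'd"
    and B B' Q :: real
  assumes cyl: "\<And>a. cylinder (ts a) (\<phi> a)"
    and Q: "\<And>a k. k \<in> {1, 2} \<Longrightarrow> (\<integral>\<^sup>+ \<omega>. deriv_sq k (cyl_deriv W (ts a) (\<phi> a) k) \<omega> \<partial>M) \<le> ennreal Q" "0 \<le> Q"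
    and f: "\<And>y. (f has_derivative (\<lambda>u. Gf y \<bullet> u)) (at y)" "continuous_on UNIV Gf"
      "\<And>y. \<bar>f y\<bar> \<le> 1" "\<And>y. norm (Gf y) \<le> B'"
    and T: "\<And>a b A. (T a b has_derivative (\<lambda>u. DT a b A \<bullet> u)) (at A)" "\<And>a b. continuous_on UNIV (DT a b)"
      "\<And>a b A. \<bar>T a b A\<bar> \<le> B" "\<And>a b A. norm (DT a b A) \<le> B" "\<And>a b A. norm A * norm (DT a b A) \<le> B"
    and inv: "\<And>A a e. (\<Sum>b\<in>UNIV. T a b A * A $ b $ e) = (if a = e then m A else 0)"
    and m: "continuous_on UNIV m"
  shows "\<bar>LINT \<omega>|M. m (\<chi> a b. deriv_inner (cyl_deriv W (ts a) (\<phi> a) 1) (cyl_deriv W (ts b) (\<phi> b) 1) \<omega>) * (Gf (\<chi> a. cyl_val W (ts a) (\<phi> a) \<omega>) \<bullet> h)\<bar>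
    \<le> B * (CARD('d) + 2 * CARD('d) ^ 3) * norm h * (CARD('d) + 2 * CARD('d) * Q)"
proof -
  have "finite (\<Union>a. set (ts a))" "(\<Union>a. set (ts a)) \<subseteq> {0..1}" using cyl by (auto simp: cylinder_def)
  then obtain t n where g: "brownian_grid M W t n" and S: "(\<Union>a. set (ts a)) \<subseteq> t ` {..n}" by (rule grid_for)
  interpret g: brownian_grid M W t n by fact
  have ts: "set (ts a) \<subseteq> t ` {..n}" for a using S by blast
  have \<phi>: "smooth_poly_growth (length (ts a)) (\<phi> a)" for a using cyl by (simp add: cylinder_def)
  define F where "F a = g.lift (ts a) (\<phi> a)" for a
  have sm: "smooth g.slots (F a)" for a unfolding F_def by (rule g.smooth_lift[OF smooth_poly_growth_smooth(1)[OF \<phi>]])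
  have D: "g.ev (g.Dsq k (F a)) \<le> Q" if "k \<in> {1, 2}" for a k
  proof -
    have "AE \<omega> in M. deriv_sq k (cyl_deriv W (ts a) (\<phi> a) k) \<omega> = ennreal (g.Dsq k (F a) (g.pt \<omega>))"
      using W0 by eventually_elim (simp add: F_def g.deriv_sq_cyl[OF _ ts \<phi>])
    from g.nn_integral_pt(1)[OF g.tempered_Dsq[OF sm] g.Dsq_nonneg this]
    have "ennreal (g.ev (g.Dsq k (F a))) \<le> ennreal Q" using Q(1)[OF that, of a] by simp
    then show ?thesis using Q(2) by (simp add: ennreal_le_iff)
  qed
  have "AE \<omega> in M. m (\<chi> a b. deriv_inner (cyl_deriv W (ts a) (\<phi> a) 1) (cyl_deriv W (ts b) (\<phi> b) 1) \<omega>) * (Gf (\<chi> a. cyl_val W (ts a) (\<phi> a) \<omega>) \<bullet> h)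
      = m (g.cov F (g.pt \<omega>)) * (Gf (\<chi> a. F a (g.pt \<omega>)) \<bullet> h)"
    using W0
  proof eventually_elim
    case (elim \<omega>)
    have "(\<chi> a b. deriv_inner (cyl_deriv W (ts a) (\<phi> a) 1) (cyl_deriv W (ts b) (\<phi> b) 1) \<omega>) = g.cov F (g.pt \<omega>)"
      unfolding F_def[abs_def] using g.deriv_inner_cyl[of \<omega> ts \<phi>] elim ts \<phi> by (simp add: vec_eq_iff)
    moreover have "(\<chi> a. cyl_val W (ts a) (\<phi> a) \<omega>) = (\<chi> a. F a (g.pt \<omega>))"
      unfolding F_def using g.cyl_val_lift[OF _ ts smooth_poly_growth_smooth(2)[OF \<phi>]] elim by (simp add: vec_eq_iff)
    ultimately show ?case by simp
  qed
  then have eq: "(LINT \<omega>|M. m (\<chi> a b. deriv_inner (cyl_deriv W (ts a) (\<phi> a) 1) (cyl_deriv W (ts b) (\<phi> b) 1) \<omega>) * (Gf (\<chi> a. cyl_val W (ts a) (\<phi> a) \<omega>) \<bullet> h))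
     = g.ev (\<lambda>x. m (g.cov F x) * (Gf (\<chi> a. F a x) \<bullet> h))"
  proof (intro integral_cong_AE)
    have [measurable]: "m \<in> borel_measurable borel" "Gf \<in> borel_measurable borel"
      using m f(2) by (auto intro: borel_measurable_continuous_onI)
    have [measurable]: "(\<lambda>\<omega>. \<chi> a b. deriv_inner (cyl_deriv W (ts a) (\<phi> a) 1) (cyl_deriv W (ts b) (\<phi> b) 1) \<omega>) \<in> borel_measurable M"
      by (intro matrix_measurable deriv_inner_measurable cyl_deriv_measurable cyl)
    have [measurable]: "(\<lambda>\<omega>. \<chi> a. cyl_val W (ts a) (\<phi> a) \<omega>) \<in> borel_measurable M"
      by (intro vec_measurable cyl_val_measurable cyl)
    show "(\<lambda>\<omega>. m (\<chi> a b. deriv_inner (cyl_deriv W (ts a) (\<phi> a) 1) (cyl_deriv W (ts b) (\<phi> b) 1) \<omega>) * (Gf (\<chi> a. cyl_val W (ts a) (\<phi> a) \<omega>) \<bullet> h)) \<in> borel_measurable M"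
      by measurable
    have pm: "(\<lambda>\<omega>. u (g.pt \<omega>)) \<in> borel_measurable M" if "tempered g.slots u" for u
      using g.pt_measurable borel_measurable_continuous_onI[OF tempered_cont[OF that]] by (rule measurable_compose)
    have [measurable]: "(\<lambda>\<omega>. \<chi> a. F a (g.pt \<omega>)) \<in> borel_measurable M"
      by (intro vec_measurable pm smooth_tempered sm)
    have [measurable]: "(\<lambda>\<omega>. g.cov F (g.pt \<omega>)) \<in> borel_measurable M"
      unfolding g.cov_def
      by (intro matrix_measurable borel_measurable_sum borel_measurable_times borel_measurable_const pm smooth_tempered smooth_partial sm)
    show "(\<lambda>\<omega>. m (g.cov F (g.pt \<omega>)) * (Gf (\<chi> a. F a (g.pt \<omega>)) \<bullet> h)) \<in> borel_measurable M"
      by measurable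
  qed
  have B0: "0 \<le> B" using T(3)[of undefined undefined undefined] by linarith
  have "(\<Sum>a\<in>UNIV. g.ev (g.Dsq 1 (F a)) + g.ev (g.Dsq 2 (F a))) \<le> (\<Sum>a\<in>(UNIV::'d set). Q + Q)"
    by (intro sum_mono add_mono D) auto
  then have "(\<Sum>a\<in>UNIV. g.ev (g.Dsq 1 (F a)) + g.ev (g.Dsq 2 (F a))) \<le> 2 * CARD('d) * Q" by simp
  then have "B * (CARD('d) + 2 * CARD('d) ^ 3) * norm h * (CARD('d) + (\<Sum>a\<in>UNIV. g.ev (g.Dsq 1 (F a)) + g.ev (g.Dsq 2 (F a))))
     \<le> B * (CARD('d) + 2 * CARD('d) ^ 3) * norm h * (CARD('d) + 2 * CARD('d) * Q)"
    using B0 by (intro mult_left_mono) auto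
  then show ?thesis unfolding eq
    using g.integration_by_parts_estimate[where F=F and h=h, OF sm f T inv] by linarith
qed

lemma deriv_inner_tendsto_L1:
  assumes jm: "jointly_measurable M 1 U" "jointly_measurable M 1 U'" "\<And>n. jointly_measurable M 1 (V n)" "\<And>n. jointly_measurable M 1 (V' n)"
    and conv: "(\<lambda>n. \<integral>\<^sup>+ \<omega>. deriv_sq 1 (\<lambda>\<alpha> s \<omega>. U \<alpha> s \<omega> - V n \<alpha> s \<omega>) \<omega> \<partial>M) \<longlonglongrightarrow> 0"
      "(\<lambda>n. \<integral>\<^sup>+ \<omega>. deriv_sq 1 (\<lambda>\<alpha> s \<omega>. U' \<alpha> s \<omega> - V' n \<alpha> s \<omega>) \<omega> \<partial>M) \<longlonglongrightarrow> 0"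
    and Q: "(\<integral>\<^sup>+ \<omega>. deriv_sq 1 U \<omega> \<partial>M) \<le> ennreal Q" "(\<integral>\<^sup>+ \<omega>. deriv_sq 1 U' \<omega> \<partial>M) \<le> ennreal Q" "0 \<le> Q"
  shows "(\<lambda>n. \<integral>\<^sup>+ \<omega>. ennreal \<bar>deriv_inner U U' \<omega> - deriv_inner (V n) (V' n) \<omega>\<bar> \<partial>M) \<longlonglongrightarrow> 0"
proof (rule order_tendstoI)
  fix e' :: ennreal assume "0 < e'"
  then obtain e where e: "e > 0" "ennreal (3 * e) < e'"
  proof (cases e')
    case (real r)
    then show ?thesis using \<open>0 < e'\<close> that[of "r / 6"] by (simp add: ennreal_less_iff)
  next
    case top then show ?thesis using that[of 1] by simp
  qed
  \<comment> \<open>Fixed first, against the energies of the limit kernels; the index n then has to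
    beat the constant 1 + 1/\<kappa>.\<close>
  define \<kappa> where "\<kappa> = e / (2 * Q + 1)"
  have \<kappa>: "\<kappa> > 0" "\<kappa> * (Q + Q) \<le> e" using e Q(3) by (auto simp: \<kappa>_def field_simps)
  define c where "c = 1 + 1 / \<kappa>"
  have c: "c > 0" using \<kappa> by (simp add: c_def add_pos_pos)
  note [measurable] = deriv_sq_measurable[OF jm(1)] deriv_sq_measurable[OF jm(2)]
    deriv_sq_measurable[OF jointly_measurable_diff[OF jm(1,3)]] deriv_sq_measurable[OF jointly_measurable_diff[OF jm(2,4)]]
  have "\<forall>\<^sub>F n in sequentially. (\<integral>\<^sup>+ \<omega>. deriv_sq 1 (\<lambda>\<alpha> s \<omega>. U \<alpha> s \<omega> - V n \<alpha> s \<omega>) \<omega> \<partial>M) < ennreal (e / c)"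
    using conv(1) by (rule order_tendstoD) (use e c in simp)
  moreover have "\<forall>\<^sub>F n in sequentially. (\<integral>\<^sup>+ \<omega>. deriv_sq 1 (\<lambda>\<alpha> s \<omega>. U' \<alpha> s \<omega> - V' n \<alpha> s \<omega>) \<omega> \<partial>M) < ennreal (e / c)"
    using conv(2) by (rule order_tendstoD) (use e c in simp)
  ultimately show "\<forall>\<^sub>F n in sequentially. (\<integral>\<^sup>+ \<omega>. ennreal \<bar>deriv_inner U U' \<omega> - deriv_inner (V n) (V' n) \<omega>\<bar> \<partial>M) < e'"
  proof eventually_elim
    case (elim n)
    let ?d = "\<lambda>\<omega>. deriv_sq 1 (\<lambda>\<alpha> s \<omega>. U \<alpha> s \<omega> - V n \<alpha> s \<omega>) \<omega>" and ?d' = "\<lambda>\<omega>. deriv_sq 1 (\<lambda>\<alpha> s \<omega>. U' \<alpha> s \<omega> - V' n \<alpha> s \<omega>) \<omega>"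
    have "(\<integral>\<^sup>+ \<omega>. ennreal \<bar>deriv_inner U U' \<omega> - deriv_inner (V n) (V' n) \<omega>\<bar> \<partial>M)
       \<le> (\<integral>\<^sup>+ \<omega>. ennreal c * (?d \<omega> + ?d' \<omega>) + ennreal \<kappa> * (deriv_sq 1 U \<omega> + deriv_sq 1 U' \<omega>) \<partial>M)"
      unfolding c_def by (intro nn_integral_mono deriv_inner_perturbation jm \<kappa>)
    also have "\<dots> = ennreal c * ((\<integral>\<^sup>+ \<omega>. ?d \<omega> \<partial>M) + (\<integral>\<^sup>+ \<omega>. ?d' \<omega> \<partial>M))
        + ennreal \<kappa> * ((\<integral>\<^sup>+ \<omega>. deriv_sq 1 U \<omega> \<partial>M) + (\<integral>\<^sup>+ \<omega>. deriv_sq 1 U' \<omega> \<partial>M))"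
      by (simp add: nn_integral_add nn_integral_cmult del: One_nat_def)
    also have "\<dots> \<le> ennreal c * (ennreal (e / c) + ennreal (e / c)) + ennreal \<kappa> * (ennreal Q + ennreal Q)"
      using elim Q by (intro add_mono mult_left_mono) (auto intro: less_imp_le)
    also have "\<dots> = ennreal (c * (e / c + e / c) + \<kappa> * (Q + Q))"
    proof -
      have "ennreal x * (ennreal y + ennreal y) + ennreal z * (ennreal w + ennreal w) = ennreal (x * (y + y) + z * (w + w))"
        if "0 \<le> x" "0 \<le> y" "0 \<le> z" "0 \<le> w" for x y z w using that by (simp add: ennreal_mult) (simp add: mult_2)
      from this[of c "e / c" \<kappa> Q] show ?thesis using c e \<kappa> Q(3) by simp
    qed
    also have "\<dots> \<le> ennreal (3 * e)"
    proof (rule ennreal_leI)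
      have "c * (e / c + e / c) = 2 * e" using c by (simp add: field_simps)
      then show "c * (e / c + e / c) + \<kappa> * (Q + Q) \<le> 3 * e" using \<kappa>(2) by linarith
    qed
    finally show ?case using e(2) by (rule le_less_trans)
  qed
qed simp

text \<open>The cylindrical estimate survives the limit because every factor under the expectation
  is bounded and continuous in the vector and its covariance matrix, both of which converge almost
  surely along a subsequence. The energies of the approximants are eventually at most 2 Q + 2,
  whence that expression in the bound.\<close>

lemma malliavin_estimate:
  fixes F :: "'w \<Rightarrow> real ^ 'd" and f :: "real ^ 'd \<Rightarrow> real"
    and T :: "'d \<Rightarrow> 'd \<Rightarrow> real ^ 'd ^ 'd \<Rightarrow> real" and m :: "real ^ 'd ^ 'd \<Rightarrow> real" and h :: "real ^ 'd"
    and B B' Q :: real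
  assumes F: "\<And>a. (\<lambda>\<omega>. F \<omega> $ a) \<in> malliavin_sobolev_inf M W 3"
    and Q: "\<And>a k. k \<in> {1, 2} \<Longrightarrow> (\<integral>\<^sup>+ \<omega>. deriv_sq k (malliavin_deriv M W (\<lambda>\<omega>. F \<omega> $ a) k) \<omega> \<partial>M) \<le> ennreal Q" "0 \<le> Q"
    and f: "\<And>y. (f has_derivative (\<lambda>u. Gf y \<bullet> u)) (at y)" "continuous_on UNIV Gf"
      "\<And>y. \<bar>f y\<bar> \<le> 1" "\<And>y. norm (Gf y) \<le> B'"
    and T: "\<And>a b A. (T a b has_derivative (\<lambda>u. DT a b A \<bullet> u)) (at A)" "\<And>a b. continuous_on UNIV (DT a b)"
      "\<And>a b A. \<bar>T a b A\<bar> \<le> B" "\<And>a b A. norm (DT a b A) \<le> B" "\<And>a b A. norm A * norm (DT a b A) \<le> B"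
    and inv: "\<And>A a e. (\<Sum>b\<in>UNIV. T a b A * A $ b $ e) = (if a = e then m A else 0)"
    and m: "continuous_on UNIV m" "\<And>A. 0 \<le> m A \<and> m A \<le> 1"
  shows "\<bar>LINT \<omega>|M. m (malliavin_cov M W F \<omega>) * (f (F \<omega> + h) - f (F \<omega>))\<bar>
    \<le> B * (CARD('d) + 2 * CARD('d) ^ 3) * norm h * (CARD('d) + 2 * CARD('d) * (2 * Q + 2))"
proof -
  define U where "U a = malliavin_deriv M W (\<lambda>\<omega>. F \<omega> $ a)" for a
  define approx where "approx a ts \<phi> \<longleftrightarrow> (\<forall>n. cylinder (ts n) (\<phi> n)) \<and> (\<lambda>\<omega>. F \<omega> $ a) \<in> borel_measurable M \<and>
    (\<lambda>n. \<integral>\<^sup>+ \<omega>. ennreal ((F \<omega> $ a - cyl_val W (ts n) (\<phi> n) \<omega>)\<^sup>2) \<partial>M) \<longlonglongrightarrow> 0 \<and>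
    (\<forall>k\<in>{1, 2}. jointly_measurable M k (U a k) \<and>
      (\<lambda>n. \<integral>\<^sup>+ \<omega>. deriv_sq k (\<lambda>\<alpha> s \<omega>. U a k \<alpha> s \<omega> - cyl_deriv W (ts n) (\<phi> n) k \<alpha> s \<omega>) \<omega> \<partial>M) \<longlonglongrightarrow> 0)"
    for a ts \<phi>
  have "\<exists>ts \<phi>. approx a ts \<phi>" for a
    by (rule malliavin_deriv_approximation[OF F[of a]]) (unfold approx_def U_def, blast)
  then obtain ts \<phi> where "\<And>a. approx a (ts a) (\<phi> a)" by metis
  note approx = this[unfolded approx_def]
  then have cyl: "\<And>a n. cylinder (ts a n) (\<phi> a n)" and Fm [measurable]: "\<And>a. (\<lambda>\<omega>. F \<omega> $ a) \<in> borel_measurable M"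
    and F0: "\<And>a. (\<lambda>n. \<integral>\<^sup>+ \<omega>. ennreal ((F \<omega> $ a - cyl_val W (ts a n) (\<phi> a n) \<omega>)\<^sup>2) \<partial>M) \<longlonglongrightarrow> 0"
    and jU: "\<And>a k. k \<in> {1, 2} \<Longrightarrow> jointly_measurable M k (U a k)"
    and FD: "\<And>a k. k \<in> {1, 2} \<Longrightarrow>
      (\<lambda>n. \<integral>\<^sup>+ \<omega>. deriv_sq k (\<lambda>\<alpha> s \<omega>. U a k \<alpha> s \<omega> - cyl_deriv W (ts a n) (\<phi> a n) k \<alpha> s \<omega>) \<omega> \<partial>M) \<longlonglongrightarrow> 0"
    by blast+
  define V where "V a n k = cyl_deriv W (ts a n) (\<phi> a n) k" for a n k
  define Y where "Y n \<omega> = (\<chi> a. cyl_val W (ts a n) (\<phi> a n) \<omega>)" for n \<omega>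
  define S where "S n \<omega> = (\<chi> a b. deriv_inner (V a n 1) (V b n 1) \<omega>)" for n \<omega>
  define \<sigma> where "\<sigma> \<omega> = malliavin_cov M W F \<omega>" for \<omega>
  define b where "b = B * (CARD('d) + 2 * CARD('d) ^ 3) * norm h * (CARD('d) + 2 * CARD('d) * (2 * Q + 2))"
  have jV: "jointly_measurable M k (V a n k)" for a n k
    unfolding V_def by (rule cyl_deriv_measurable[OF cyl])
  have \<sigma>_deriv_inner: "\<sigma> \<omega> = (\<chi> a b. deriv_inner (U a 1) (U b 1) \<omega>)" for \<omega>
    by (simp add: vec_eq_iff \<sigma>_def U_def malliavin_cov_deriv_inner)
  have [measurable]: "m \<in> borel_measurable borel" "f \<in> borel_measurable borel" "Gf \<in> borel_measurable borel"
    using m(1) f(2) has_derivative_continuous[OF f(1)]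
    by (auto intro!: borel_measurable_continuous_onI continuous_at_imp_continuous_on)
  have cyl_val_m [measurable]: "cyl_val W (ts a n) (\<phi> a n) \<in> borel_measurable M" for a n
    by (rule cyl_val_measurable[OF cyl])
  have [measurable]: "Y n \<in> borel_measurable M" for n unfolding Y_def[abs_def] by (intro vec_measurable cyl_val_m)
  have [measurable]: "S n \<in> borel_measurable M" for n unfolding S_def[abs_def] by (intro matrix_measurable deriv_inner_measurable jV)
  have [measurable]: "\<sigma> \<in> borel_measurable M" unfolding \<sigma>_deriv_inner[abs_def] by (intro matrix_measurable deriv_inner_measurable jU) auto
  have [measurable]: "F \<in> borel_measurable M" using vec_measurable[of "\<lambda>a \<omega>. F \<omega> $ a", OF Fm] by simp
  \<comment> \<open>Twice the energy of the limit plus twice the squared error, which is eventually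
    below 1 in mean.\<close>
  have "\<forall>\<^sub>F n in sequentially. \<forall>a. \<forall>k\<in>{1, 2}. (\<integral>\<^sup>+ \<omega>. deriv_sq k (V a n k) \<omega> \<partial>M) \<le> ennreal (2 * Q + 2)"
  proof (intro eventually_all_finite eventually_ball_finite ballI)
    fix a :: 'd and k :: nat assume k: "k \<in> {1, 2}"
    let ?d = "\<lambda>n. deriv_sq k (\<lambda>\<alpha> s \<omega>. U a k \<alpha> s \<omega> - V a n k \<alpha> s \<omega>)"
    have "\<forall>\<^sub>F n in sequentially. (\<integral>\<^sup>+ \<omega>. ?d n \<omega> \<partial>M) < 1"
      using FD[OF k, of a] unfolding V_def by (rule order_tendstoD) simp
    then show "\<forall>\<^sub>F n in sequentially. (\<integral>\<^sup>+ \<omega>. deriv_sq k (V a n k) \<omega> \<partial>M) \<le> ennreal (2 * Q + 2)"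
    proof eventually_elim
      case (elim n)
      note j = jointly_measurable_diff[OF jU[OF k] jV]
      have [measurable]: "deriv_sq k (U a k) \<in> borel_measurable M" "?d n \<in> borel_measurable M"
        by (intro deriv_sq_measurable jU k) (intro deriv_sq_measurable j)
      have "(\<integral>\<^sup>+ \<omega>. deriv_sq k (V a n k) \<omega> \<partial>M) \<le> (\<integral>\<^sup>+ \<omega>. 2 * deriv_sq k (U a k) \<omega> + 2 * ?d n \<omega> \<partial>M)"
      proof (rule nn_integral_mono)
        fix \<omega> assume "\<omega> \<in> space M"
        from deriv_sq_diff_le[OF jU[OF k, of a] j[of a a n] this]
        show "deriv_sq k (V a n k) \<omega> \<le> 2 * deriv_sq k (U a k) \<omega> + 2 * ?d n \<omega>" by simp
      qed
      also have "\<dots> = 2 * (\<integral>\<^sup>+ \<omega>. deriv_sq k (U a k) \<omega> \<partial>M) + 2 * (\<integral>\<^sup>+ \<omega>. ?d n \<omega> \<partial>M)"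
        by (simp add: nn_integral_add nn_integral_cmult)
      also have "\<dots> \<le> 2 * ennreal Q + 2 * 1"
        using elim Q(1)[OF k, of a] by (intro add_mono mult_left_mono) (auto simp: U_def)
      also have "\<dots> = ennreal (2 * Q + 2)" using Q(2) by (simp add: ennreal_mult)
      finally show ?case .
    qed
  qed auto
  then have bound: "\<forall>\<^sub>F n in sequentially. \<bar>LINT \<omega>|M. m (S n \<omega>) * (f (Y n \<omega> + h) - f (Y n \<omega>))\<bar> \<le> b"
  proof eventually_elim
    case (elim n)
    show ?case
    proof (rule directional_average_bound[where G=Gf and B=B'])
      \<comment> \<open>The translate of \<open>f\<close> by \<tau> h satisfies the same bounds as
        \<open>f\<close>, so the estimate is uniform in \<tau>.\<close>
      fix \<tau> :: real
      show "\<bar>LINT \<omega>|M. m (S n \<omega>) * (Gf (Y n \<omega> + \<tau> *\<^sub>R h) \<bullet> h)\<bar> \<le> b"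
        unfolding S_def Y_def V_def b_def
      proof (rule cylinder_estimate[where f="\<lambda>y. f (y + \<tau> *\<^sub>R h)" and Gf="\<lambda>y. Gf (y + \<tau> *\<^sub>R h)" and B'=B'
            and T=T and DT=DT and ts="\<lambda>a. ts a n" and \<phi>="\<lambda>a. \<phi> a n"])
        show "((\<lambda>y. f (y + \<tau> *\<^sub>R h)) has_derivative (\<lambda>u. Gf (y + \<tau> *\<^sub>R h) \<bullet> u)) (at y)" for y
        proof -
          have "((\<lambda>y. y + \<tau> *\<^sub>R h) has_derivative (\<lambda>u. u)) (at y)" by (auto intro!: derivative_eq_intros)
          from has_derivative_compose[OF this f(1)] show ?thesis .
        qed
        show "continuous_on UNIV (\<lambda>y. Gf (y + \<tau> *\<^sub>R h))"
          by (intro continuous_intros continuous_on_compose2[OF f(2)]) auto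
      qed (use cyl elim Q(2) f T inv m in \<open>auto simp: V_def\<close>)
    qed (use f m in \<open>auto intro: prob_space_axioms\<close>)
  qed
  \<comment> \<open>All errors, of the components and of the covariance entries, are gathered in one
    scalar, so that one subsequence serves them all.\<close>
  define r where "r n \<omega> = (\<Sum>a\<in>UNIV. (F \<omega> $ a - Y n \<omega> $ a)\<^sup>2) + (\<Sum>a\<in>UNIV. \<Sum>b\<in>UNIV. \<bar>\<sigma> \<omega> $ a $ b - S n \<omega> $ a $ b\<bar>)" for n \<omega>
  have ipm [measurable]: "deriv_inner (U a 1) (U b 1) \<in> borel_measurable M" "deriv_inner (V a n 1) (V b n 1) \<in> borel_measurable M" for a b n
    by (intro deriv_inner_measurable jU; simp) (intro deriv_inner_measurable jV)
  have r_eq: "r n = (\<lambda>\<omega>. (\<Sum>a\<in>UNIV. (F \<omega> $ a - cyl_val W (ts a n) (\<phi> a n) \<omega>)\<^sup>2)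
      + (\<Sum>a\<in>UNIV. \<Sum>b\<in>UNIV. \<bar>deriv_inner (U a 1) (U b 1) \<omega> - deriv_inner (V a n 1) (V b n 1) \<omega>\<bar>))" for n
    by (simp add: fun_eq_iff r_def Y_def S_def \<sigma>_deriv_inner)
  have rm: "r n \<in> borel_measurable M" for n
    unfolding r_eq by measurable
  have r0: "0 \<le> r n \<omega>" for n \<omega> unfolding r_def by (intro add_nonneg_nonneg sum_nonneg) auto
  have r_int: "(\<integral>\<^sup>+ \<omega>. ennreal \<bar>r n \<omega>\<bar> \<partial>M) = (\<Sum>a\<in>UNIV. \<integral>\<^sup>+ \<omega>. ennreal ((F \<omega> $ a - cyl_val W (ts a n) (\<phi> a n) \<omega>)\<^sup>2) \<partial>M)
      + (\<Sum>a\<in>UNIV. \<Sum>b\<in>UNIV. \<integral>\<^sup>+ \<omega>. ennreal \<bar>deriv_inner (U a 1) (U b 1) \<omega> - deriv_inner (V a n 1) (V b n 1) \<omega>\<bar> \<partial>M)" for n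
  proof -
    have "(\<integral>\<^sup>+ \<omega>. ennreal \<bar>r n \<omega>\<bar> \<partial>M) = (\<integral>\<^sup>+ \<omega>. (\<Sum>a\<in>UNIV. ennreal ((F \<omega> $ a - cyl_val W (ts a n) (\<phi> a n) \<omega>)\<^sup>2))
      + (\<Sum>a\<in>UNIV. \<Sum>b\<in>UNIV. ennreal \<bar>deriv_inner (U a 1) (U b 1) \<omega> - deriv_inner (V a n 1) (V b n 1) \<omega>\<bar>) \<partial>M)"
    proof (rule nn_integral_cong)
      fix \<omega>
      show "ennreal \<bar>r n \<omega>\<bar> = (\<Sum>a\<in>UNIV. ennreal ((F \<omega> $ a - cyl_val W (ts a n) (\<phi> a n) \<omega>)\<^sup>2))
        + (\<Sum>a\<in>UNIV. \<Sum>b\<in>UNIV. ennreal \<bar>deriv_inner (U a 1) (U b 1) \<omega> - deriv_inner (V a n 1) (V b n 1) \<omega>\<bar>)"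
        using r0[of n \<omega>] unfolding r_eq by (simp add: sum_nonneg ennreal_plus sum_ennreal)
    qed
    then show ?thesis by (simp add: nn_integral_add nn_integral_sum del: sum_ennreal One_nat_def)
  qed
  have "(\<lambda>n. \<integral>\<^sup>+ \<omega>. ennreal \<bar>deriv_inner (U a 1) (U b 1) \<omega> - deriv_inner (V a n 1) (V b n 1) \<omega>\<bar> \<partial>M) \<longlonglongrightarrow> 0" for a b
    using FD[of 1] Q(1)[of 1] Q(2) by (intro deriv_inner_tendsto_L1[where Q=Q] jU jV) (auto simp: V_def U_def)
  then have "(\<lambda>n. \<integral>\<^sup>+ \<omega>. ennreal \<bar>r n \<omega>\<bar> \<partial>M) \<longlonglongrightarrow> (\<Sum>a\<in>(UNIV::'d set). 0) + (\<Sum>a\<in>(UNIV::'d set). \<Sum>b\<in>(UNIV::'d set). 0)"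
    unfolding r_int by (intro tendsto_add tendsto_sum F0)
  then have "(\<lambda>n. \<integral>\<^sup>+ \<omega>. ennreal \<bar>r n \<omega>\<bar> \<partial>M) \<longlonglongrightarrow> 0" by simp
  from AE_convergent_subsequence[OF rm this] obtain s where s: "strict_mono s" and rs: "AE \<omega> in M. (\<lambda>n. r (s n) \<omega>) \<longlonglongrightarrow> 0"
    by blast
  have "(\<lambda>n. LINT \<omega>|M. m (S (s n) \<omega>) * (f (Y (s n) \<omega> + h) - f (Y (s n) \<omega>)))
     \<longlonglongrightarrow> (LINT \<omega>|M. m (\<sigma> \<omega>) * (f (F \<omega> + h) - f (F \<omega>)))"
  proof (rule integral_dominated_convergence[where w="\<lambda>_. 2"])
    show "AE \<omega> in M. (\<lambda>n. m (S (s n) \<omega>) * (f (Y (s n) \<omega> + h) - f (Y (s n) \<omega>))) \<longlonglongrightarrow> m (\<sigma> \<omega>) * (f (F \<omega> + h) - f (F \<omega>))"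
      using rs
    proof eventually_elim
      case (elim \<omega>)
      have Yl: "(\<lambda>n. Y (s n) \<omega>) \<longlonglongrightarrow> F \<omega>"
      proof (rule vec_tendstoI)
        fix a
        have "(F \<omega> $ a - Y n \<omega> $ a)\<^sup>2 \<le> r n \<omega>" for n
        proof -
          have "(F \<omega> $ a - Y n \<omega> $ a)\<^sup>2 \<le> (\<Sum>a\<in>UNIV. (F \<omega> $ a - Y n \<omega> $ a)\<^sup>2)"
            by (rule member_le_sum[of a UNIV "\<lambda>a. (F \<omega> $ a - Y n \<omega> $ a)\<^sup>2"]) auto
          then show ?thesis unfolding r_def by (rule order_trans) (simp add: sum_nonneg)
        qed
        then have "(\<lambda>n. (F \<omega> $ a - Y (s n) \<omega> $ a)\<^sup>2) \<longlonglongrightarrow> 0"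
          by (intro tendsto_sandwich[OF _ _ tendsto_const elim]) auto
        from tendsto_real_sqrt[OF this] have "(\<lambda>n. \<bar>F \<omega> $ a - Y (s n) \<omega> $ a\<bar>) \<longlonglongrightarrow> 0" by simp
        then have "(\<lambda>n. F \<omega> $ a - Y (s n) \<omega> $ a) \<longlonglongrightarrow> 0" by (rule tendsto_rabs_zero_cancel)
        from tendsto_diff[OF tendsto_const[of "F \<omega> $ a"] this] show "(\<lambda>n. Y (s n) \<omega> $ a) \<longlonglongrightarrow> F \<omega> $ a" by simp
      qed
      have Sl: "(\<lambda>n. S (s n) \<omega>) \<longlonglongrightarrow> \<sigma> \<omega>"
      proof (intro vec_tendstoI)
        fix a b
        have "\<bar>\<sigma> \<omega> $ a $ b - S n \<omega> $ a $ b\<bar> \<le> r n \<omega>" for n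
        proof -
          have "\<bar>\<sigma> \<omega> $ a $ b - S n \<omega> $ a $ b\<bar> \<le> (\<Sum>b\<in>UNIV. \<bar>\<sigma> \<omega> $ a $ b - S n \<omega> $ a $ b\<bar>)"
            by (rule member_le_sum[of b UNIV "\<lambda>b. \<bar>\<sigma> \<omega> $ a $ b - S n \<omega> $ a $ b\<bar>"]) auto
          also have "\<dots> \<le> (\<Sum>a\<in>UNIV. \<Sum>b\<in>UNIV. \<bar>\<sigma> \<omega> $ a $ b - S n \<omega> $ a $ b\<bar>)"
            by (rule member_le_sum[of a UNIV "\<lambda>a. \<Sum>b\<in>UNIV. \<bar>\<sigma> \<omega> $ a $ b - S n \<omega> $ a $ b\<bar>"]) (auto intro: sum_nonneg)
          finally show ?thesis unfolding r_def by (rule order_trans) (simp add: sum_nonneg)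
        qed
        then have "(\<lambda>n. \<bar>\<sigma> \<omega> $ a $ b - S (s n) \<omega> $ a $ b\<bar>) \<longlonglongrightarrow> 0"
          by (intro tendsto_sandwich[OF _ _ tendsto_const elim]) auto
        then have "(\<lambda>n. \<sigma> \<omega> $ a $ b - S (s n) \<omega> $ a $ b) \<longlonglongrightarrow> 0" by (rule tendsto_rabs_zero_cancel)
        from tendsto_diff[OF tendsto_const[of "\<sigma> \<omega> $ a $ b"] this] show "(\<lambda>n. S (s n) \<omega> $ a $ b) \<longlonglongrightarrow> \<sigma> \<omega> $ a $ b" by simp
      qed
      have fl: "isCont f y" for y using has_derivative_continuous[OF f(1)] by simp
      have ml: "isCont m A" for A using m(1) by (simp add: continuous_on_eq_continuous_at)
      show ?case
        by (intro tendsto_mult tendsto_diff isCont_tendsto_compose[OF fl] isCont_tendsto_compose[OF ml] tendsto_add Yl Sl tendsto_const)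
    qed
    show "AE \<omega> in M. norm (m (S (s n) \<omega>) * (f (Y (s n) \<omega> + h) - f (Y (s n) \<omega>))) \<le> 2" for n
    proof (rule AE_I2)
      fix \<omega>
      have "\<bar>m (S (s n) \<omega>)\<bar> * \<bar>f (Y (s n) \<omega> + h) - f (Y (s n) \<omega>)\<bar> \<le> 1 * 2"
        using m(2)[of "S (s n) \<omega>"] f(3)[of "Y (s n) \<omega> + h"] f(3)[of "Y (s n) \<omega>"] by (intro mult_mono) auto
      then show "norm (m (S (s n) \<omega>) * (f (Y (s n) \<omega> + h) - f (Y (s n) \<omega>))) \<le> 2" by (simp add: abs_mult)
    qed
  qed auto
  then have "(\<lambda>n. \<bar>LINT \<omega>|M. m (S (s n) \<omega>) * (f (Y (s n) \<omega> + h) - f (Y (s n) \<omega>))\<bar>)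
     \<longlonglongrightarrow> \<bar>LINT \<omega>|M. m (\<sigma> \<omega>) * (f (F \<omega> + h) - f (F \<omega>))\<bar>" by (rule tendsto_rabs)
  moreover have "\<forall>\<^sub>F n in sequentially. \<bar>LINT \<omega>|M. m (S (s n) \<omega>) * (f (Y (s n) \<omega> + h) - f (Y (s n) \<omega>))\<bar> \<le> b"
    by (rule eventually_subseq[OF s bound])
  ultimately have "\<bar>LINT \<omega>|M. m (\<sigma> \<omega>) * (f (F \<omega> + h) - f (F \<omega>))\<bar> \<le> b"
    by (rule tendsto_upperbound) simp
  then show ?thesis unfolding \<sigma>_def b_def .
qed

end

section \<open>Convergence in total variation\<close>

context brownian begin

text \<open>For exponent 2 the Sobolev norm is the root of a second moment, so its square bounds the
  energies of all components and orders.\<close>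

lemma malliavin_deriv_sq_bound:
  assumes "(SUP n. sobolev_norm M W 3 2 (Fs n)) < \<infinity>"
  obtains Q where "0 \<le> Q"
    "\<And>n a k. k \<in> {1, 2} \<Longrightarrow> (\<integral>\<^sup>+ \<omega>. deriv_sq k (malliavin_deriv M W (\<lambda>\<omega>. Fs n \<omega> $ a) k) \<omega> \<partial>M) \<le> ennreal Q"
proof -
  obtain R where R: "0 \<le> R" "(SUP n. sobolev_norm M W 3 2 (Fs n)) = ennreal R"
    using assms by (cases "SUP n. sobolev_norm M W 3 2 (Fs n)") auto
  show thesis
  proof (rule that[of "R * R"])
    fix n a k assume k: "k \<in> {1, 2::nat}"
    let ?J = "\<lambda>i. jet_sq 3 (\<lambda>\<omega>. Fs n \<omega> $ i) (malliavin_deriv M W (\<lambda>\<omega>. Fs n \<omega> $ i))"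
    have "(\<integral>\<^sup>+ \<omega>. deriv_sq k (malliavin_deriv M W (\<lambda>\<omega>. Fs n \<omega> $ a) k) \<omega> \<partial>M) \<le> (\<integral>\<^sup>+ \<omega>. (\<Sum>i\<in>UNIV. ?J i \<omega>) \<partial>M)"
    proof (rule nn_integral_mono)
      fix \<omega>
      have "deriv_sq k (malliavin_deriv M W (\<lambda>\<omega>. Fs n \<omega> $ a) k) \<omega> \<le> ?J a \<omega>" using k by (intro jet_sq_ge(2)) auto
      also have "\<dots> \<le> (\<Sum>i\<in>UNIV. ?J i \<omega>)" by (rule member_le_sum[of a UNIV "\<lambda>i. ?J i \<omega>"]) auto
      finally show "deriv_sq k (malliavin_deriv M W (\<lambda>\<omega>. Fs n \<omega> $ a) k) \<omega> \<le> (\<Sum>i\<in>UNIV. ?J i \<omega>)" .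
    qed
    also have "\<dots> = sobolev_norm M W 3 2 (Fs n) * sobolev_norm M W 3 2 (Fs n)"
      unfolding sobolev_norm_def Lp_norm_of_sq_def by (simp add: esqrt_mult_self)
    also have "\<dots> \<le> ennreal R * ennreal R"
      unfolding R(2)[symmetric] by (intro mult_mono SUP_upper) auto
    also have "\<dots> = ennreal (R * R)" using R(1) by (simp add: ennreal_mult)
    finally show "(\<integral>\<^sup>+ \<omega>. deriv_sq k (malliavin_deriv M W (\<lambda>\<omega>. Fs n \<omega> $ a) k) \<omega> \<partial>M) \<le> ennreal (R * R)" .
  qed simp
qed

lemma malliavin_cov_measurable:
  assumes "\<And>a. (\<lambda>\<omega>. F \<omega> $ a) \<in> malliavin_sobolev_inf M W 3"
  shows "malliavin_cov M W F \<in> borel_measurable M" "F \<in> borel_measurable M"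
    "jointly_measurable M 1 (malliavin_deriv M W (\<lambda>\<omega>. F \<omega> $ a) 1)"
proof -
  have j: "jointly_measurable M 1 (malliavin_deriv M W (\<lambda>\<omega>. F \<omega> $ a) 1)" for a
    by (rule malliavin_deriv_approximation[OF assms[of a]]) blast
  have "malliavin_cov M W F = (\<lambda>\<omega>. \<chi> a b. deriv_inner (malliavin_deriv M W (\<lambda>\<omega>. F \<omega> $ a) 1) (malliavin_deriv M W (\<lambda>\<omega>. F \<omega> $ b) 1) \<omega>)"
    by (simp add: fun_eq_iff vec_eq_iff malliavin_cov_deriv_inner)
  then show "malliavin_cov M W F \<in> borel_measurable M" by (simp only:) (intro matrix_measurable deriv_inner_measurable j)
  have "(\<lambda>\<omega>. F \<omega> $ a) \<in> borel_measurable M" for a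
    by (rule malliavin_deriv_approximation[OF assms[of a]]) blast
  from vec_measurable[of "\<lambda>a \<omega>. F \<omega> $ a", OF this] show "F \<in> borel_measurable M" by simp
  show "jointly_measurable M 1 (malliavin_deriv M W (\<lambda>\<omega>. F \<omega> $ a) 1)" by (rule j)
qed

text \<open>Markov's inequality: each of the CARD('d)^2 entries has absolute mean at most 3 (Q + Q)
  = 6 Q by \<open>deriv_inner_bound\<close>.\<close>

lemma malliavin_cov_norm_tail:
  fixes F :: "'w \<Rightarrow> real ^ 'd" and Q K :: real
  assumes F: "\<And>a. (\<lambda>\<omega>. F \<omega> $ a) \<in> malliavin_sobolev_inf M W 3"
    and Q: "\<And>a. (\<integral>\<^sup>+ \<omega>. deriv_sq 1 (malliavin_deriv M W (\<lambda>\<omega>. F \<omega> $ a) 1) \<omega> \<partial>M) \<le> ennreal Q" "0 \<le> Q" and K: "0 < K"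
  shows "prob {\<omega> \<in> space M. K \<le> norm (malliavin_cov M W F \<omega>)} \<le> CARD('d) ^ 2 * (6 * Q) / K"
proof -
  note m = malliavin_cov_measurable[OF F]
  note [measurable] = m(1) deriv_sq_measurable[OF m(3)]
  let ?U = "\<lambda>a. malliavin_deriv M W (\<lambda>\<omega>. F \<omega> $ a) 1"
  have [measurable]: "(\<lambda>\<omega>. deriv_inner (?U a) (?U b) \<omega>) \<in> borel_measurable M" for a b by (intro deriv_inner_measurable m(3))
  have e: "(\<integral>\<^sup>+ \<omega>. ennreal \<bar>deriv_inner (?U a) (?U b) \<omega>\<bar> \<partial>M) \<le> ennreal (6 * Q)" for a b
  proof -
    have "(\<integral>\<^sup>+ \<omega>. ennreal \<bar>deriv_inner (?U a) (?U b) \<omega>\<bar> \<partial>M) \<le> (\<integral>\<^sup>+ \<omega>. 3 * (deriv_sq 1 (?U a) \<omega> + deriv_sq 1 (?U b) \<omega>) \<partial>M)"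
      by (intro nn_integral_mono deriv_inner_bound m(3))
    also have "\<dots> = 3 * ((\<integral>\<^sup>+ \<omega>. deriv_sq 1 (?U a) \<omega> \<partial>M) + (\<integral>\<^sup>+ \<omega>. deriv_sq 1 (?U b) \<omega> \<partial>M))"
      by (simp add: nn_integral_add nn_integral_cmult del: One_nat_def)
    also have "\<dots> \<le> 3 * (ennreal Q + ennreal Q)" by (intro mult_left_mono add_mono Q(1)) simp
    also have "\<dots> = ennreal (3 * (Q + Q))" using Q(2) by (simp add: ennreal_mult flip: ennreal_plus)
    finally show ?thesis by simp
  qed
  have "(\<integral>\<^sup>+ \<omega>. ennreal (norm (malliavin_cov M W F \<omega>)) \<partial>M) \<le> (\<integral>\<^sup>+ \<omega>. (\<Sum>a\<in>UNIV. \<Sum>b\<in>UNIV. ennreal \<bar>deriv_inner (?U a) (?U b) \<omega>\<bar>) \<partial>M)"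
  proof (rule nn_integral_mono)
    fix \<omega>
    have "norm (malliavin_cov M W F \<omega>) \<le> (\<Sum>a\<in>UNIV. \<Sum>b\<in>UNIV. \<bar>deriv_inner (?U a) (?U b) \<omega>\<bar>)"
      using norm_matrix_le_sum[of "malliavin_cov M W F \<omega>"] by (simp only: malliavin_cov_deriv_inner)
    then have "ennreal (norm (malliavin_cov M W F \<omega>)) \<le> ennreal (\<Sum>a\<in>UNIV. \<Sum>b\<in>UNIV. \<bar>deriv_inner (?U a) (?U b) \<omega>\<bar>)" by (rule ennreal_leI)
    also have "\<dots> = (\<Sum>a\<in>UNIV. \<Sum>b\<in>UNIV. ennreal \<bar>deriv_inner (?U a) (?U b) \<omega>\<bar>)" by (simp add: sum_nonneg flip: sum_ennreal)
    finally show "ennreal (norm (malliavin_cov M W F \<omega>)) \<le> (\<Sum>a\<in>UNIV. \<Sum>b\<in>UNIV. ennreal \<bar>deriv_inner (?U a) (?U b) \<omega>\<bar>)" .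
  qed
  also have "\<dots> = (\<Sum>a\<in>UNIV. \<Sum>b\<in>UNIV. (\<integral>\<^sup>+ \<omega>. ennreal \<bar>deriv_inner (?U a) (?U b) \<omega>\<bar> \<partial>M))"
    by (simp add: nn_integral_sum del: sum_ennreal One_nat_def)
  also have "\<dots> \<le> (\<Sum>a\<in>(UNIV::'d set). \<Sum>b\<in>(UNIV::'d set). ennreal (6 * Q))" by (intro sum_mono e)
  also have "\<dots> = ennreal (CARD('d) ^ 2 * (6 * Q))"
    using Q(2) by (simp add: ennreal_mult power2_eq_square mult.assoc ennreal_of_nat_eq_real_of_nat)
  finally have "(\<integral>\<^sup>+ \<omega>. ennreal (norm (malliavin_cov M W F \<omega>)) \<partial>M) \<le> ennreal (CARD('d) ^ 2 * (6 * Q))" .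
  then have "ennreal (1 / K) * (\<integral>\<^sup>+ \<omega>. ennreal (norm (malliavin_cov M W F \<omega>)) * indicator (space M) \<omega> \<partial>M)
      \<le> ennreal (1 / K) * ennreal (CARD('d) ^ 2 * (6 * Q))"
    by (intro mult_left_mono) (auto cong: nn_integral_cong)
  moreover have "emeasure M {\<omega> \<in> space M. K \<le> norm (malliavin_cov M W F \<omega>)}
     \<le> emeasure M {\<omega> \<in> space M. 1 \<le> ennreal (1 / K) * ennreal (norm (malliavin_cov M W F \<omega>))}"
  proof (rule emeasure_mono)
    show "{\<omega> \<in> space M. K \<le> norm (malliavin_cov M W F \<omega>)} \<subseteq> {\<omega> \<in> space M. 1 \<le> ennreal (1 / K) * ennreal (norm (malliavin_cov M W F \<omega>))}"
    proof safe
      fix \<omega> assume "K \<le> norm (malliavin_cov M W F \<omega>)"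
      then have "1 \<le> 1 / K * norm (malliavin_cov M W F \<omega>)" using K by (simp add: field_simps)
      from ennreal_leI[OF this] show "1 \<le> ennreal (1 / K) * ennreal (norm (malliavin_cov M W F \<omega>))"
        using K by (simp add: ennreal_mult[symmetric] del: ennreal_1)
    qed
  qed measurable
  moreover have "emeasure M {\<omega> \<in> space M. 1 \<le> ennreal (1 / K) * ennreal (norm (malliavin_cov M W F \<omega>))}
     \<le> ennreal (1 / K) * (\<integral>\<^sup>+ \<omega>. ennreal (norm (malliavin_cov M W F \<omega>)) * indicator (space M) \<omega> \<partial>M)"
    using nn_integral_Markov_inequality[of "\<lambda>\<omega>. ennreal (norm (malliavin_cov M W F \<omega>))" "space M" M "ennreal (1 / K)"]
    by simp
  ultimately have "emeasure M {\<omega> \<in> space M. K \<le> norm (malliavin_cov M W F \<omega>)} \<le> ennreal (1 / K) * ennreal (CARD('d) ^ 2 * (6 * Q))"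
    by (meson order_trans)
  also have "\<dots> = ennreal (CARD('d) ^ 2 * (6 * Q) / K)" using K Q(2) by (simp flip: ennreal_mult)
  finally show ?thesis using K Q(2) by (simp add: emeasure_eq_measure ennreal_le_iff)
qed

lemma smoothing_estimate:
  fixes Fs :: "nat \<Rightarrow> 'w \<Rightarrow> real ^ 'd"
  assumes F: "\<And>n i. (\<lambda>\<omega>. Fs n \<omega> $ i) \<in> malliavin_sobolev_inf M W 3"
    and S: "(SUP n. sobolev_norm M W 3 2 (Fs n)) < \<infinity>"
    and det: "Limsup (at_right 0)
           (\<lambda>\<epsilon>. limsup (\<lambda>n. emeasure M {\<omega> \<in> space M. det (malliavin_cov M W (Fs n) \<omega>) < \<epsilon>})) = 0"
    and \<eta>: "\<eta> > 0"
  shows "\<exists>C. \<forall>\<^sub>F n in sequentially. \<forall>h f. test_function f \<longrightarrow>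
        \<bar>LINT \<omega>|M. f (Fs n \<omega> + h) - f (Fs n \<omega>)\<bar> \<le> \<eta> + C * norm h"
proof -
  obtain Q where Q: "0 \<le> Q"
    "\<And>n a k. k \<in> {1, 2} \<Longrightarrow> (\<integral>\<^sup>+ \<omega>. deriv_sq k (malliavin_deriv M W (\<lambda>\<omega>. Fs n \<omega> $ a) k) \<omega> \<partial>M) \<le> ennreal Q"
    using malliavin_deriv_sq_bound[OF S] by blast
  let ?\<sigma> = "\<lambda>n. malliavin_cov M W (Fs n)"
  have "\<forall>\<^sub>F \<epsilon> in at_right 0. limsup (\<lambda>n. emeasure M {\<omega> \<in> space M. det (?\<sigma> n \<omega>) < \<epsilon>}) < ennreal (\<eta> / 2)"
    by (rule Limsup_lessD) (use det \<eta> in simp)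
  moreover have "\<forall>\<^sub>F \<epsilon> in at_right (0::real). \<epsilon> > 0" by (rule eventually_at_right_less)
  ultimately have "\<forall>\<^sub>F \<epsilon> in at_right 0. limsup (\<lambda>n. emeasure M {\<omega> \<in> space M. det (?\<sigma> n \<omega>) < \<epsilon>}) < ennreal (\<eta> / 2) \<and> \<epsilon> > 0"
    by (rule eventually_conj)
  \<comment> \<open>One \<epsilon> is frozen at which the upper limit over n is already below
    \<eta>/2. The cut-off, and with it the constant C, depends on this \<epsilon> but not on
    n.\<close>
  from eventually_happens'[OF _ this]
  obtain \<epsilon> :: real where \<epsilon>: "limsup (\<lambda>n. emeasure M {\<omega> \<in> space M. det (?\<sigma> n \<omega>) < \<epsilon>}) < ennreal (\<eta> / 2)" "\<epsilon> > 0"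
    by auto
  have Pdet: "\<forall>\<^sub>F n in sequentially. emeasure M {\<omega> \<in> space M. det (?\<sigma> n \<omega>) < \<epsilon>} < ennreal (\<eta> / 2)"
    by (rule Limsup_lessD) (rule \<epsilon>)
  \<comment> \<open>Makes the tail of the covariance norm at most \<eta>/2; the added 1 keeps
    \<open>K\<close> positive when \<open>Q\<close> is 0.\<close>
  define K where "K = 2 * (CARD('d) ^ 2 * (6 * Q)) / \<eta> + 1"
  have q: "0 \<le> CARD('d) ^ 2 * (6 * Q)" using Q(1) by simp
  have K: "K > 0" "CARD('d) ^ 2 * (6 * Q) / K \<le> \<eta> / 2"
  proof -
    show "K > 0" unfolding K_def using q \<eta> by (intro add_nonneg_pos divide_nonneg_pos) auto
    moreover have "CARD('d) ^ 2 * (6 * Q) \<le> \<eta> / 2 * K" unfolding K_def using \<eta> by (simp add: algebra_simps)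
    ultimately show "CARD('d) ^ 2 * (6 * Q) / K \<le> \<eta> / 2" by (simp add: divide_le_eq)
  qed
  obtain T :: "'d \<Rightarrow> 'd \<Rightarrow> real ^ 'd ^ 'd \<Rightarrow> real" and DT B m where
    L: "(\<forall>a b A. (T a b has_derivative (\<lambda>u. DT a b A \<bullet> u)) (at A)) \<and> (\<forall>a b. continuous_on UNIV (DT a b)) \<and>
    (\<forall>a b A. \<bar>T a b A\<bar> \<le> B \<and> norm (DT a b A) \<le> B \<and> norm A * norm (DT a b A) \<le> B) \<and>
    (\<forall>A a e. (\<Sum>b\<in>UNIV. T a b A * A $ b $ e) = (if a = e then m A else 0)) \<and>
    continuous_on UNIV m \<and> (\<forall>A. 0 \<le> m A \<and> m A \<le> 1) \<and> (\<forall>A. det A \<ge> \<epsilon> \<and> norm A \<le> K \<longrightarrow> m A = 1)"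
    using localized_inverse[OF \<epsilon>(2) K(1), where 'd='d] by blast
  have T: "\<And>a b A. (T a b has_derivative (\<lambda>u. DT a b A \<bullet> u)) (at A)" "\<And>a b. continuous_on UNIV (DT a b)"
      "\<And>a b A. \<bar>T a b A\<bar> \<le> B" "\<And>a b A. norm (DT a b A) \<le> B" "\<And>a b A. norm A * norm (DT a b A) \<le> B"
    and inv: "\<And>A a e. (\<Sum>b\<in>UNIV. T a b A * A $ b $ e) = (if a = e then m A else 0)"
    and m: "continuous_on UNIV m" "\<And>A. 0 \<le> m A \<and> m A \<le> 1" and m1: "\<And>A. \<epsilon> \<le> det A \<Longrightarrow> norm A \<le> K \<Longrightarrow> m A = 1"
    using L by simp_all
  note [measurable] = malliavin_cov_measurable(1,2)[OF F]
  have [measurable]: "m \<in> borel_measurable borel" by (rule borel_measurable_continuous_onI[OF m(1)])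
  have [measurable]: "(det :: real ^ 'd ^ 'd \<Rightarrow> real) \<in> borel_measurable borel"
    by (intro borel_measurable_continuous_onI) (auto simp: det_def intro!: continuous_intros)
  show ?thesis
  proof (intro exI eventually_mono[OF Pdet] allI impI)
    fix n h and f :: "real ^ 'd \<Rightarrow> real"
    assume n: "emeasure M {\<omega> \<in> space M. det (?\<sigma> n \<omega>) < \<epsilon>} < ennreal (\<eta> / 2)" and f: "test_function f"
    obtain Gf B' where G: "continuous_on UNIV Gf" "\<And>y. (f has_derivative (\<lambda>u. Gf y \<bullet> u)) (at y)" "\<And>y. norm (Gf y) \<le> B'"
      "\<And>y. 0 \<le> f y" "\<And>y. f y \<le> 1" using test_functionE[OF f] by blast
    note [measurable] = test_function_measurable[OF f]
    let ?g = "\<lambda>\<omega>. f (Fs n \<omega> + h) - f (Fs n \<omega>)"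
    let ?D = "{\<omega> \<in> space M. det (?\<sigma> n \<omega>) < \<epsilon>}" and ?N = "{\<omega> \<in> space M. K \<le> norm (?\<sigma> n \<omega>)}"
    have gb: "\<bar>?g \<omega>\<bar> \<le> 1" for \<omega> using G(4,5)[of "Fs n \<omega> + h"] G(4,5)[of "Fs n \<omega>"] by linarith
    have est: "\<bar>LINT \<omega>|M. m (?\<sigma> n \<omega>) * ?g \<omega>\<bar>
       \<le> B * (CARD('d) + 2 * CARD('d) ^ 3) * norm h * (CARD('d) + 2 * CARD('d) * (2 * Q + 2))"
    proof (rule malliavin_estimate[OF F Q(2,1) G(2,1) _ G(3) T inv m])
      show "\<bar>f y\<bar> \<le> 1" for y using G(4,5)[of y] by simp
    qed
    have "\<bar>LINT \<omega>|M. m (?\<sigma> n \<omega>) * ?g \<omega>\<bar>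
       \<le> B * (CARD('d) + 2 * CARD('d) ^ 3) * (CARD('d) + 2 * CARD('d) * (2 * Q + 2)) * norm h"
      using est by (simp only: mult_ac)
    \<comment> \<open>The part removed by the cut-off: the integrand is at most 1 since
      \<open>f\<close> takes values between 0 and 1, and it vanishes unless the determinant is small
      or the norm is large.\<close>
    moreover have "\<bar>LINT \<omega>|M. (1 - m (?\<sigma> n \<omega>)) * ?g \<omega>\<bar> \<le> \<eta>"
    proof -
      have "\<bar>LINT \<omega>|M. (1 - m (?\<sigma> n \<omega>)) * ?g \<omega>\<bar> \<le> (LINT \<omega>|M. \<bar>(1 - m (?\<sigma> n \<omega>)) * ?g \<omega>\<bar>)" by (rule integral_abs_bound)
      also have "\<dots> \<le> (LINT \<omega>|M. indicator ?D \<omega> + indicator ?N \<omega>)"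
      proof (rule integral_mono)
        have le1: "\<bar>(1 - m (?\<sigma> n \<omega>)) * ?g \<omega>\<bar> \<le> 1 - m (?\<sigma> n \<omega>)" for \<omega>
          using mult_left_mono[OF gb[of \<omega>], of "1 - m (?\<sigma> n \<omega>)"] m(2)[of "?\<sigma> n \<omega>"] by (simp add: abs_mult)
        show "integrable M (\<lambda>\<omega>. \<bar>(1 - m (?\<sigma> n \<omega>)) * ?g \<omega>\<bar>)"
          by (rule integrable_const_bound[where B=1]) (use le1 m(2) in \<open>auto intro!: AE_I2 order_trans[OF le1]\<close>)
        show "integrable M (\<lambda>\<omega>. indicat_real ?D \<omega> + indicator ?N \<omega>)" by (intro Bochner_Integration.integrable_add integrable_real_indicator) (auto simp: emeasure_eq_measure)
        fix \<omega> assume \<omega>: "\<omega> \<in> space M"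
        show "\<bar>(1 - m (?\<sigma> n \<omega>)) * ?g \<omega>\<bar> \<le> indicator ?D \<omega> + indicator ?N \<omega>"
        proof (cases "\<omega> \<in> ?D \<or> \<omega> \<in> ?N")
          case True
          then have "1 \<le> indicat_real ?D \<omega> + indicator ?N \<omega>" by (auto simp: indicator_def)
          moreover have "1 - m (?\<sigma> n \<omega>) \<le> 1" using m(2)[of "?\<sigma> n \<omega>"] by simp
          ultimately show ?thesis using le1[of \<omega>] by linarith
        next
          case False
          then have "m (?\<sigma> n \<omega>) = 1" using \<omega> by (intro m1) auto
          then show ?thesis by simp
        qed
      qed
      also have "\<dots> = prob ?D + prob ?N" by (subst Bochner_Integration.integral_add) (auto simp: emeasure_eq_measure intro!: integrable_real_indicator)
      also have "\<dots> \<le> \<eta> / 2 + \<eta> / 2"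
      proof (rule add_mono)
        show "prob ?D \<le> \<eta> / 2" using n \<eta> by (simp add: emeasure_eq_measure ennreal_less_iff)
        have "prob ?N \<le> CARD('d) ^ 2 * (6 * Q) / K" by (rule malliavin_cov_norm_tail[OF F _ Q(1) K(1)]) (rule Q(2), simp)
        then show "prob ?N \<le> \<eta> / 2" using K(2) by linarith
      qed
      finally show ?thesis by simp
    qed
    moreover have "(LINT \<omega>|M. ?g \<omega>) = (LINT \<omega>|M. m (?\<sigma> n \<omega>) * ?g \<omega>) + (LINT \<omega>|M. (1 - m (?\<sigma> n \<omega>)) * ?g \<omega>)"
    proof -
      have "\<bar>a * ?g \<omega>\<bar> \<le> 1" if "0 \<le> a" "a \<le> 1" for a \<omega>
        using mult_mono[of a 1 "\<bar>?g \<omega>\<bar>" 1] gb[of \<omega>] that by (simp add: abs_mult)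
      then have i: "integrable M (\<lambda>\<omega>. m (?\<sigma> n \<omega>) * ?g \<omega>)" "integrable M (\<lambda>\<omega>. (1 - m (?\<sigma> n \<omega>)) * ?g \<omega>)"
        using m(2) by (auto intro!: integrable_const_bound[where B=1])
      show ?thesis by (subst Bochner_Integration.integral_add[OF i, symmetric]) (simp add: algebra_simps)
    qed
    ultimately show "\<bar>LINT \<omega>|M. ?g \<omega>\<bar>
       \<le> \<eta> + B * (CARD('d) + 2 * CARD('d) ^ 3) * (CARD('d) + 2 * CARD('d) * (2 * Q + 2)) * norm h"
      by linarith
  qed
qed

end

text \<open>The sign of p - q is an admissible test function and attains the L^1 distance. With test
  functions bounded by 1 in absolute value no factor 1/2 appears.\<close>

lemma density_L1_le_tv_dist:
  fixes F :: "'v \<Rightarrow> 'a::euclidean_space"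
  assumes M: "prob_space M" and M': "prob_space M'"
    and p: "has_density M' F p" and q: "has_density M G q"
  shows "(LINT x|lborel. \<bar>p x - q x\<bar>) \<le> tv_dist M' F M G"
proof -
  have [measurable]: "p \<in> borel_measurable borel" "q \<in> borel_measurable borel"
    and pq: "\<And>x. 0 \<le> p x" "\<And>x. 0 \<le> q x"
    and D: "distributed M' lborel F (\<lambda>x. ennreal (p x))" "distributed M lborel G (\<lambda>x. ennreal (q x))"
    using p q by (auto simp: has_density_def)
  have FG: "F \<in> borel_measurable M'" "G \<in> borel_measurable M"
    using D[THEN distributed_measurable] by simp_all
  define f where "f x = sgn (p x - q x)" for x
  have fm [measurable]: "f \<in> borel_measurable borel" unfolding f_def[abs_def] by measurable
  have fb: "\<bar>f x\<bar> \<le> 1" for x by (simp add: f_def abs_sgn_eq)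
  interpret M: prob_space M by fact
  interpret M': prob_space M' by fact
  have E: "(LINT x|lborel. p x * f x) = (LINT \<omega>|M'. f (F \<omega>))" "(LINT x|lborel. q x * f x) = (LINT \<omega>|M. f (G \<omega>))"
    by (rule distributed_integral[OF D(1)] distributed_integral[OF D(2)]; simp add: pq)+
  have i: "integrable lborel (\<lambda>x. p x * f x)" "integrable lborel (\<lambda>x. q x * f x)"
  proof -
    have "integrable M' (\<lambda>\<omega>. f (F \<omega>))" "integrable M (\<lambda>\<omega>. f (G \<omega>))"
      using fb measurable_compose[OF FG(1) fm] measurable_compose[OF FG(2) fm]
      by (auto intro!: M'.integrable_const_bound[where B=1] M.integrable_const_bound[where B=1])
    then show "integrable lborel (\<lambda>x. p x * f x)" "integrable lborel (\<lambda>x. q x * f x)"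
      using distributed_integrable[OF D(1), of f] distributed_integrable[OF D(2), of f] pq by auto
  qed
  have "(LINT x|lborel. \<bar>p x - q x\<bar>) = (LINT x|lborel. p x * f x - q x * f x)"
    by (intro Bochner_Integration.integral_cong refl) (auto simp: f_def sgn_if abs_if)
  also have "\<dots> = (LINT \<omega>|M'. f (F \<omega>)) - (LINT \<omega>|M. f (G \<omega>))"
    using i by (simp add: E)
  also have "\<dots> \<le> tv_dist M' F M G" using tv_dist_bounds(2)[OF M M' FG(2,1) fm fb] by linarith
  finally show ?thesis .
qed

theorem theorem2p15:
  fixes M :: "'w measure" and M' :: "'v measure"
    and W :: "'N::finite \<Rightarrow> real \<Rightarrow> 'w \<Rightarrow> real"
    and Fs :: "nat \<Rightarrow> 'w \<Rightarrow> real ^ 'd"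
    and F :: "'v \<Rightarrow> real ^ 'd"
  assumes "brownian_motion M W"
    and "\<And>n i. (\<lambda>\<omega>. Fs n \<omega> $ i) \<in> malliavin_sobolev_inf M W 3"
    and "\<And>p. p \<ge> 1 \<Longrightarrow> (SUP n. sobolev_norm M W 3 p (Fs n)) < \<infinity>"
    and "Limsup (at_right 0)
           (\<lambda>\<epsilon>. limsup (\<lambda>n. emeasure M {\<omega> \<in> space M. det (malliavin_cov M W (Fs n) \<omega>) < \<epsilon>})) = 0"
    and "prob_space M'" and "F \<in> borel_measurable M'" and "integrable M' F"
    and "tendsto_in_distribution M Fs M' F"
    and "(\<lambda>n. LINT \<omega>|M. Fs n \<omega>) \<longlonglongrightarrow> (LINT \<omega>|M'. F \<omega>)"
  shows "(\<lambda>n. tv_dist M' F M (Fs n)) \<longlonglongrightarrow> 0 \<and>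
    (\<forall>pF pFs. has_density M' F pF \<and> (\<forall>n. has_density M (Fs n) (pFs n)) \<longrightarrow>
       (\<lambda>n. LINT x|lborel. \<bar>pF x - pFs n x\<bar>) \<longlonglongrightarrow> 0)"
proof -
  interpret brownian M W by unfold_locales fact
  have tv: "(\<lambda>n. tv_dist M' F M (Fs n)) \<longlonglongrightarrow> 0"
  proof (rule tv_dist_tendsto_0[OF prob_space_axioms assms(5) malliavin_cov_measurable(2)[OF assms(2)] assms(6,8)])
    show "\<exists>C. \<forall>\<^sub>F n in sequentially. \<forall>h f. test_function f \<longrightarrow>
        \<bar>LINT \<omega>|M. f (Fs n \<omega> + h) - f (Fs n \<omega>)\<bar> \<le> \<eta> + C * norm h" if "\<eta> > 0" for \<eta>
      by (rule smoothing_estimate[OF assms(2) assms(3) assms(4) that]) simp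
  qed
  moreover have "(\<lambda>n. LINT x|lborel. \<bar>pF x - pFs n x\<bar>) \<longlonglongrightarrow> 0"
    if "has_density M' F pF" "\<And>n. has_density M (Fs n) (pFs n)" for pF pFs
    by (rule tendsto_sandwich[OF _ _ tendsto_const tv])
      (auto intro!: always_eventually density_L1_le_tv_dist[OF prob_space_axioms assms(5)] that)
  ultimately show ?thesis by blast
qed

end
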